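(* Fix $k\ge 3$ and $\lambda\in(0,1/2)$. Let $n\ge 1$ with $\gcd(n,(k-1)!)=1$, and let $m$ be an integer with $m/n\in(\lambda,1-\lambda)$. Choose a subset of $\mathbb{Z}/n\mathbb{Z}$ uniformly at random among all subsets of size $m$, and let $\mathbf{x}=(x_i)_{i\in\mathbb{Z}/n\mathbb{Z}}\in\{0,1\}^{\mathbb{Z}/n\mathbb{Z}}$ be its indicator vector. Let \[\mathrm{kAP}(\mathbf{x})=\sum_{a\in\mathbb{Z}/n\mathbb{Z}}\ \sum_{d=1}^{\lfloor n/2\rfloor}\ \prod_{i=0}^{k-1}x_{a+id},\] let $\mu_k=\mathbb{E}[\mathrm{kAP}(\mathbf{x})]$, let $\sigma_k$ be the standard deviation of $\mathrm{kAP}(\mathbf{x})$, and let $Z_k=(\mathrm{kAP}(\mathbf{x})-\mu_k)/\sigma_k$. Then for every $\varepsilon>0$, \[\sup_{z\in(\mathbb{Z}-\mu_k)/\sigma_k}\big|\sigma_k\,\mathbb{P}[Z_k=z]-\mathcal{N}(z)\big|\lesssim_{k,\lambda,\varepsilon}n^{\varepsilon-1/4},\qquad\sum_{z\in(\mathbb{Z}-\mu_k)/\sigma_k}\big|\mathbb{P}[Z_k=z]-\mathcal{N}(z)/\sigma_k\big|\lesssim_{k,\lambda,\varepsilon}n^{\varepsilon-1/4}.\]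
   Context: $\mathcal{N}(x)=\frac{1}{\sqrt{2\pi}}e^{-x^2/2}$ is the standard normal density. $f\lesssim_a g$ means $|f|\le Cg$ with $C$ depending only on the subscripted parameters. *)

theory Defs
  imports "HOL-Probability.Probability"
begin

text \<open>Z/nZ is represented by {0..<n}; addition is taken mod n.
  kAP of the indicator vector of a set A of residues.\<close>
definition kAP :: "nat \<Rightarrow> nat \<Rightarrow> nat set \<Rightarrow> real" where
  "kAP k n A = (\<Sum>a<n. \<Sum>d=1..n div 2. \<Prod>i<k. indicator A ((a + i * d) mod n))"

definition uniform_subset :: "nat \<Rightarrow> nat \<Rightarrow> nat set pmf" where
  "uniform_subset n m = pmf_of_set {A. A \<subseteq> {..<n} \<and> card A = m}"

end

theory Submission
  imports Defs "HOL-Real_Asymp.Real_Asymp"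
begin

text \<open>On a slice the progression count differs by a constant from a polynomial \<open>Y\<close> all of whose monomials
  in the centred bits have degree at least three; the lower degree parts are constant because every
  pair of residues lies in equally many progressions at any two given positions. Swapping two
  residues preserves the slice, and antisymmetrising over such swaps gives a Stein identity for \<open>Y\<close>
  whose coefficients concentrate, by variance bounds for independent bits that are transferred to
  the slice through hypercontractivity. It turns into a differential equation for the
  characteristic function of the normalised count, which is therefore close to the Gaussian one
  for frequencies \<open>|s| \<le> n^(1/50)\<close>. For larger frequencies, two applications of the
  Cauchy-Schwarz inequality leave only the interaction of two short, well separated blocks of
  residues, and the resulting product over one block is tiny. Fourier inversion gives a local limit
  theorem with error \<open>O(n^(-2/5))\<close>, and Chebyshev's inequality upgrades it to total variation.\<close>

section \<open>Independent bits\<close>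

text \<open>The fixed size of the set makes the bits dependent, and returning to independent bits
  has a price: the factor \<open>n + 1\<close> is the reciprocal of a lower bound for the
  probability that independent bits have the right sum. Far from the origin it is affordable. There
  the indicator of the slice is an average of characters \<open>cis (\<theta> * card A)\<close>, and
  the twisted characteristic functions are at most \<open>n powr (-3)\<close>. Near the origin all
  errors have relative size about \<open>n powr (-1/2)\<close>, which is why the loss has to be cut
  to a tiny power of \<open>n\<close>. The two ranges away from the origin need different
  mechanisms. As long as the angles stay small, a quadratic form in centred bits concentrates and
  forces decay. Near frequency \<open>pi\<close> no expansion is possible; what counts there is that
  a single raw bit can change a coefficient by exactly one unit. The exponent \<open>1/4\<close>
  comes out of a budget: with the window of \<open>n powr (13/100)\<close> standard deviations, the
  uniform error contributes \<open>n powr (-27/100)\<close> to the total variation and the tails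
  contribute \<open>n powr (-26/100)\<close>.\<close>

text \<open>A family of bits indexed by \<open>I\<close> is encoded as the subset of \<open>I\<close> on which the bits are one;
  \<open>bE p I\<close> is the expectation when the bits are independent with mean \<open>p\<close>.\<close>

definition wt :: "real \<Rightarrow> 'i set \<Rightarrow> 'i set \<Rightarrow> real" where
  "wt p I A = (\<Prod>i\<in>I. if i \<in> A then p else 1 - p)"

definition bE :: "real \<Rightarrow> 'i set \<Rightarrow> ('i set \<Rightarrow> 'a::real_vector) \<Rightarrow> 'a" where
  "bE p I f = (\<Sum>A\<in>Pow I. wt p I A *\<^sub>R f A)"

lemma wt_nonneg: "0 \<le> p \<Longrightarrow> p \<le> 1 \<Longrightarrow> 0 \<le> wt p I A"
  by (auto simp: wt_def intro!: prod_nonneg)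

lemma bE_empty [simp]: "bE p {} f = f {}"
  by (simp add: bE_def wt_def)

text \<open>The weight is a product over the coordinates, so conditioning on one bit gives a
  two-term average. The inductions below use this recursion instead of the explicit sum over
  subsets.\<close>

lemma bE_insert:
  assumes "finite I" "x \<notin> I"
  shows "bE p (insert x I) f = (1 - p) *\<^sub>R bE p I f + p *\<^sub>R bE p I (\<lambda>A. f (insert x A))"
proof -
  have w1: "wt p (insert x I) A = (1 - p) * wt p I A" if "A \<in> Pow I" for A
    using assms that by (auto simp: wt_def)
  have w2: "wt p (insert x I) (insert x A) = p * wt p I A" if "A \<in> Pow I" for A
  proof -
    have "(\<Prod>i\<in>I. if i \<in> insert x A then p else 1 - p) = (\<Prod>i\<in>I. if i \<in> A then p else 1 - p)"
      using assms by (intro prod.cong) auto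
    then show ?thesis using assms by (simp add: wt_def)
  qed
  have "bE p (insert x I) f = (\<Sum>A\<in>Pow I. wt p (insert x I) A *\<^sub>R f A)
      + (\<Sum>A\<in>insert x ` Pow I. wt p (insert x I) A *\<^sub>R f A)"
    unfolding bE_def Pow_insert using assms by (intro sum.union_disjoint) auto
  also have "(\<Sum>A\<in>insert x ` Pow I. wt p (insert x I) A *\<^sub>R f A)
      = (\<Sum>A\<in>Pow I. wt p (insert x I) (insert x A) *\<^sub>R f (insert x A))"
    using assms by (intro sum.reindex_cong[of "insert x"]) (auto simp: inj_on_def)
  finally show ?thesis
    by (simp add: w1 w2 bE_def scaleR_sum_right)
qed

lemma bE_cong: "(\<And>A. A \<subseteq> I \<Longrightarrow> f A = g A) \<Longrightarrow> bE p I f = bE p I g"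
  by (auto simp: bE_def intro!: sum.cong)

text \<open>Fubini for disjoint blocks of independent bits.\<close>

lemma bE_Un:
  assumes "finite I" "finite J" "I \<inter> J = {}"
  shows "bE p (I \<union> J) f = bE p I (\<lambda>A. bE p J (\<lambda>B. f (A \<union> B)))"
  using assms(1,3)
proof (induction I arbitrary: f rule: finite_induct)
  case empty
  then show ?case by simp
next
  case (insert x I)
  then show ?case using assms(2)
    by (simp add: bE_insert)
qed

lemma bE_add: "bE p I (\<lambda>A. f A + g A) = bE p I f + bE p I g"
  by (simp add: bE_def scaleR_add_right sum.distrib)

lemma bE_diff: "bE p I (\<lambda>A. f A - g A) = bE p I f - bE p I g"
  by (simp add: bE_def scaleR_diff_right sum_subtractf)

lemma bE_cmult: "bE p I (\<lambda>A. c * f A) = c * bE p I f" for f :: "'i set \<Rightarrow> 'a::real_algebra"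
  by (simp add: bE_def sum_distrib_left)

lemma bE_multc: "bE p I (\<lambda>A. f A * c) = bE p I f * c" for f :: "'i set \<Rightarrow> 'a::real_algebra"
  by (simp add: bE_def sum_distrib_right)

lemma bE_divide: "bE p I (\<lambda>A. f A / c) = bE p I f / c" for f :: "'i set \<Rightarrow> real"
  using bE_multc[of p I f "inverse c"] by (simp add: divide_inverse)

lemma bE_sum: "bE p I (\<lambda>A. \<Sum>j\<in>J. f j A) = (\<Sum>j\<in>J. bE p I (f j))"
  by (simp add: bE_def scaleR_sum_right sum.swap[of _ J])

lemma bE_const [simp]: "finite I \<Longrightarrow> bE p I (\<lambda>A. c) = c"
  by (induction I rule: finite_induct) (auto simp: bE_insert simp flip: scaleR_add_left)

lemma bE_mono:
  fixes f g :: "'i set \<Rightarrow> real"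
  assumes "0 \<le> p" "p \<le> 1" "\<And>A. A \<subseteq> I \<Longrightarrow> f A \<le> g A"
  shows "bE p I f \<le> bE p I g"
  unfolding bE_def using assms wt_nonneg[OF assms(1,2)]
  by (intro sum_mono) (auto intro!: mult_left_mono)

lemma bE_nonneg:
  fixes f :: "'i set \<Rightarrow> real"
  assumes "0 \<le> p" "p \<le> 1" "\<And>A. A \<subseteq> I \<Longrightarrow> 0 \<le> f A"
  shows "0 \<le> bE p I f"
  unfolding bE_def using assms wt_nonneg[OF assms(1,2)] by (intro sum_nonneg) (auto intro!: mult_nonneg_nonneg)

lemma bE_norm:
  fixes f :: "'i set \<Rightarrow> 'a::real_normed_vector"
  assumes "0 \<le> p" "p \<le> 1"
  shows "norm (bE p I f) \<le> bE p I (\<lambda>A. norm (f A))"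
proof -
  have "norm (bE p I f) \<le> (\<Sum>A\<in>Pow I. norm (wt p I A *\<^sub>R f A))"
    unfolding bE_def by (rule norm_sum)
  also have "\<dots> = bE p I (\<lambda>A. norm (f A))"
    by (auto simp: bE_def wt_nonneg[OF assms] intro!: sum.cong)
  finally show ?thesis .
qed

lemma bE_le_const:
  fixes f :: "'i set \<Rightarrow> real"
  assumes "finite I" "0 \<le> p" "p \<le> 1" "\<And>A. A \<subseteq> I \<Longrightarrow> f A \<le> c"
  shows "bE p I f \<le> c"
  using bE_mono[OF assms(2,3), of I f "\<lambda>_. c"] assms by auto

lemma bE_abs_le:
  fixes f :: "'i set \<Rightarrow> real"
  assumes "finite I" "0 \<le> p" "p \<le> 1" "\<And>A. A \<subseteq> I \<Longrightarrow> \<bar>f A\<bar> \<le> c"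
  shows "\<bar>bE p I f\<bar> \<le> c"
  using bE_norm[OF assms(2,3), of I f] bE_le_const[OF assms(1-3), of "\<lambda>A. \<bar>f A\<bar>" c] assms(4) by auto

lemma bE_Cauchy_Schwarz:
  fixes f g :: "'i set \<Rightarrow> real"
  assumes "0 \<le> p" "p \<le> 1"
  shows "(bE p I (\<lambda>A. f A * g A))\<^sup>2 \<le> bE p I (\<lambda>A. (f A)\<^sup>2) * bE p I (\<lambda>A. (g A)\<^sup>2)"
proof -
  let ?w = "\<lambda>A. sqrt (wt p I A)"
  have "(\<Sum>A\<in>Pow I. (?w A * f A) * (?w A * g A))\<^sup>2
      \<le> (\<Sum>A\<in>Pow I. (?w A * f A)\<^sup>2) * (\<Sum>A\<in>Pow I. (?w A * g A)\<^sup>2)"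
    by (rule Cauchy_Schwarz_ineq_sum)
  moreover have "(?w A * f A) * (?w A * g A) = wt p I A * (f A * g A)" for A
  proof -
    have "(?w A * f A) * (?w A * g A) = (?w A * ?w A) * (f A * g A)" by (simp only: mult_ac)
    then show ?thesis using wt_nonneg[OF assms, of I A] by simp
  qed
  ultimately show ?thesis
    using wt_nonneg[OF assms, of I] by (simp add: bE_def power_mult_distrib)
qed

lemma bE_norm_square:
  fixes f :: "'i set \<Rightarrow> 'a::real_normed_vector"
  assumes "finite I" "0 \<le> p" "p \<le> 1"
  shows "(norm (bE p I f))\<^sup>2 \<le> bE p I (\<lambda>A. (norm (f A))\<^sup>2)"
proof -
  have "(norm (bE p I f))\<^sup>2 \<le> (bE p I (\<lambda>A. 1 * norm (f A)))\<^sup>2"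
    using bE_norm[OF assms(2,3), of I f] by (intro power_mono) auto
  also have "\<dots> \<le> bE p I (\<lambda>A. 1\<^sup>2) * bE p I (\<lambda>A. (norm (f A))\<^sup>2)"
    by (rule bE_Cauchy_Schwarz[OF assms(2,3)])
  finally show ?thesis using assms by simp
qed

text \<open>The quantifier ranges over all sets \<open>A\<close>, not over the subsets of an index
  set, so the notion composes without any reference to \<open>I\<close> or to finiteness.\<close>

definition dep :: "('i set \<Rightarrow> 'a) \<Rightarrow> 'i set \<Rightarrow> bool" where
  "dep f B \<longleftrightarrow> (\<forall>A. f A = f (A \<inter> B))"

lemma depD: "dep f B \<Longrightarrow> A \<inter> B = A' \<inter> B \<Longrightarrow> f A = f A'"
  by (metis dep_def)

lemma dep_const [simp]: "dep (\<lambda>A. c) B"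
  by (simp add: dep_def)

lemma dep_comp2: "dep f B \<Longrightarrow> dep g B' \<Longrightarrow> dep (\<lambda>A. h (f A) (g A)) (B \<union> B')"
  unfolding dep_def by (metis Int_assoc Int_commute Un_Int_eq(1) Un_Int_eq(2))

lemma dep_comp: "dep f B \<Longrightarrow> dep (\<lambda>A. h (f A)) B"
  unfolding dep_def by metis

lemma dep_mult: "dep f B \<Longrightarrow> dep g B' \<Longrightarrow> dep (\<lambda>A. f A * g A) (B \<union> B')"
  by (rule dep_comp2)

lemma dep_prod:
  assumes "\<And>j. j \<in> J \<Longrightarrow> dep (f j) (B j)"
  shows "dep (\<lambda>A. \<Prod>j\<in>J. f j A) (\<Union>j\<in>J. B j)"
  unfolding dep_def
proof (intro allI prod.cong refl)
  fix A j assume "j \<in> J"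
  then show "f j A = f j (A \<inter> (\<Union>j\<in>J. B j))"
    by (intro depD[OF assms]) auto
qed

text \<open>Once \<open>I\<close> is split into \<open>I \<inter> B\<close> and
  \<open>I - B\<close>, the function \<open>f\<close> sees only the first block and \<open>g\<close>
  only the second.\<close>

lemma bE_indep:
  fixes f g :: "'i set \<Rightarrow> 'a::real_algebra"
  assumes "finite I" "dep f B" "dep g B'" "B \<inter> B' \<inter> I = {}"
  shows "bE p I (\<lambda>A. f A * g A) = bE p I f * bE p I g"
proof -
  have I: "I = (I \<inter> B) \<union> (I - B)" by auto
  have E: "bE p I h = bE p (I \<inter> B) (\<lambda>A. bE p (I - B) (\<lambda>C. h (A \<union> C)))" for h :: "'i set \<Rightarrow> 'a"
    by (subst I, rule bE_Un) (use assms in auto)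
  have f: "f (A \<union> C) = f A" if "C \<subseteq> I - B" for A C
    using that by (intro depD[OF assms(2)]) auto
  have g: "g (A \<union> C) = g C" if "A \<subseteq> I \<inter> B" for A C
    using that assms(4) by (intro depD[OF assms(3)]) auto
  have "bE p I (\<lambda>A. f A * g A) = bE p (I \<inter> B) (\<lambda>A. bE p (I - B) (\<lambda>C. f A * g C))"
    unfolding E by (intro bE_cong) (simp add: f g)
  also have "\<dots> = bE p (I \<inter> B) f * bE p (I - B) g"
    by (simp add: bE_cmult bE_multc)
  also have "bE p (I \<inter> B) f = bE p I f"
  proof -
    have "bE p I f = bE p (I \<inter> B) (\<lambda>A. bE p (I - B) (\<lambda>C. f A))"
      unfolding E by (intro bE_cong) (simp add: f)
    then show ?thesis using assms(1) by simp
  qed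
  also have "bE p (I - B) g = bE p I g"
  proof -
    have "bE p I g = bE p (I \<inter> B) (\<lambda>A. bE p (I - B) g)"
      unfolding E by (intro bE_cong) (simp add: g)
    then show ?thesis using assms(1) by simp
  qed
  finally show ?thesis .
qed

lemma bE_indep_prod:
  fixes f :: "'j \<Rightarrow> 'i set \<Rightarrow> 'a::{real_algebra_1,comm_ring_1}"
  assumes "finite I" "finite J" "\<And>j. j \<in> J \<Longrightarrow> dep (f j) (B j)"
    "\<And>j j'. j \<in> J \<Longrightarrow> j' \<in> J \<Longrightarrow> j \<noteq> j' \<Longrightarrow> B j \<inter> B j' = {}"
  shows "bE p I (\<lambda>A. \<Prod>j\<in>J. f j A) = (\<Prod>j\<in>J. bE p I (f j))"
  using assms(2,3,4)
proof (induction J rule: finite_induct)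
  case empty
  then show ?case using assms(1) by simp
next
  case (insert x J)
  have "bE p I (\<lambda>A. f x A * (\<Prod>j\<in>J. f j A)) = bE p I (f x) * bE p I (\<lambda>A. \<Prod>j\<in>J. f j A)"
    using insert.hyps insert.prems(2)
    by (intro bE_indep[OF assms(1) insert.prems(1) dep_prod[OF insert.prems(1)]]) blast+
  then show ?case using insert by simp
qed

lemma bE_dep:
  assumes "finite I" "dep f B"
  shows "bE p I f = bE p (I \<inter> B) f"
proof -
  have "bE p I f = bE p ((I \<inter> B) \<union> (I - B)) f" by (simp add: Int_Diff_Un)
  also have "\<dots> = bE p (I \<inter> B) (\<lambda>A. bE p (I - B) (\<lambda>C. f (A \<union> C)))"
    using assms(1) by (intro bE_Un) auto
  also have "\<dots> = bE p (I \<inter> B) (\<lambda>A. bE p (I - B) (\<lambda>C. f A))"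
    by (intro bE_cong depD[OF assms(2)]) auto
  finally show ?thesis using assms(1) by simp
qed

text \<open>Relabelling of bits, needed when a second copy of a block is stored at shifted
  indices.\<close>

lemma bE_image:
  assumes "finite I" "inj_on g I"
  shows "bE p (g ` I) f = bE p I (\<lambda>A. f (g ` A))"
  using assms
proof (induction I arbitrary: f rule: finite_induct)
  case (insert x I)
  then have "g x \<notin> g ` I" by auto
  with insert show ?case by (simp add: bE_insert)
qed simp

text \<open>No single outcome is likely; this later bounds the probability that two independent
  copies of a block coincide.\<close>

lemma wt_le_power:
  assumes "0 \<le> p" "p \<le> 1" "p \<le> c" "1 - p \<le> c"
  shows "wt p I A \<le> c ^ card I"
proof -
  have "wt p I A \<le> (\<Prod>i\<in>I. c)"
    unfolding wt_def using assms by (intro prod_mono) auto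
  then show ?thesis by simp
qed

section \<open>Hypercontractivity for multilinear polynomials\<close>

text \<open>Polynomials of degree at most \<open>D\<close> in the bits, the indicator of
  \<open>T \<subseteq> A\<close> being the monomial over \<open>T\<close>. The inductive form avoids
  a choice of coefficients and makes the closure properties inductions.\<close>

inductive dg :: "nat \<Rightarrow> ('i set \<Rightarrow> real) \<Rightarrow> bool" where
  dg_mono: "finite T \<Longrightarrow> card T \<le> D \<Longrightarrow> dg D (\<lambda>A. if T \<subseteq> A then 1 else 0)"
| dg_add: "dg D f \<Longrightarrow> dg D g \<Longrightarrow> dg D (\<lambda>A. f A + g A)"
| dg_scale: "dg D f \<Longrightarrow> dg D (\<lambda>A. c * f A)"

lemma dg_const: "dg D (\<lambda>A. c)"
  using dg_scale[OF dg_mono[of "{}" D], of c] by simp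

lemma dg_le: "dg D f \<Longrightarrow> D \<le> E \<Longrightarrow> dg E f"
  by (induction rule: dg.induct) (auto intro: dg.intros)

lemma dg_sum: "(\<And>j. j \<in> J \<Longrightarrow> dg D (f j)) \<Longrightarrow> dg D (\<lambda>A. \<Sum>j\<in>J. f j A)"
  by (induction J rule: infinite_finite_induct) (auto intro: dg_const dg_add)

lemma dg_diff: "dg D f \<Longrightarrow> dg D g \<Longrightarrow> dg D (\<lambda>A. f A - g A)"
  using dg_add[of D f "\<lambda>A. (-1) * g A"] dg_scale[of D g "-1"] by simp

text \<open>Bits are idempotent, so the product of the monomials over \<open>T\<close> and
  \<open>T'\<close> is the monomial over their union, and degrees at most add.\<close>

lemma dg_mult: "dg D f \<Longrightarrow> dg E g \<Longrightarrow> dg (D + E) (\<lambda>A. f A * g A)"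
proof (induction arbitrary: rule: dg.induct)
  case (dg_mono T D)
  from dg_mono(3) show ?case
  proof (induction rule: dg.induct)
    case (dg_mono T' E)
    have "(\<lambda>A. (if T \<subseteq> A then 1 else 0) * (if T' \<subseteq> A then 1 else 0::real)) = (\<lambda>A. if T \<union> T' \<subseteq> A then 1 else 0)"
      by auto
    then show ?case
      using dg.dg_mono[of "T \<union> T'" "D + E"] card_Un_le[of T T'] \<open>finite T\<close> \<open>card T \<le> D\<close> dg_mono by auto
  next
    case (dg_add E f g)
    then show ?case using dg.dg_add by (fastforce simp: distrib_left)
  next
    case (dg_scale E f c)
    then show ?case using dg.dg_scale[OF dg_scale.IH, of c] by (simp add: mult_ac)
  qed
next
  case (dg_add D f g)
  then show ?case using dg.dg_add by (fastforce simp: distrib_right)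
next
  case (dg_scale D f c)
  then show ?case using dg.dg_scale[of _ _ c] by (simp add: mult_ac)
qed

lemma dg_power: "dg D f \<Longrightarrow> dg (D * j) (\<lambda>A. f A ^ j)"
proof (induction j)
  case 0
  then show ?case by (simp add: dg_const)
next
  case (Suc j)
  then show ?case using dg_mult[of D f "D * j"] by simp
qed

lemma dg_prod:
  assumes "finite J" "\<And>j. j \<in> J \<Longrightarrow> dg 1 (f j)"
  shows "dg (card J) (\<lambda>A. \<Prod>j\<in>J. f j A)"
  using assms
proof (induction J rule: finite_induct)
  case empty
  then show ?case by (simp add: dg_const)
next
  case (insert x J)
  then show ?case using dg_mult[of 1 "f x" "card J"] by simp
qed

text \<open>In the bit at \<open>x\<close> a multilinear polynomial is affine, and its slope
  \<open>h\<close> has lower degree. The clause for \<open>D = 0\<close> records that the slope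
  vanishes there, which the truncated \<open>D - 1\<close> cannot express.\<close>

lemma dg_split:
  assumes "dg D f"
  shows "\<exists>g h. dg D g \<and> dg (D - 1) h \<and> (D = 0 \<longrightarrow> h = (\<lambda>_. 0)) \<and>
    (\<forall>A. x \<notin> A \<longrightarrow> f A = g A \<and> f (insert x A) = g A + h A)"
  using assms
proof (induction rule: dg.induct)
  case (dg_mono T D)
  show ?case
  proof (cases "x \<in> T")
    case True
    then have "card T > 0" using dg_mono by (auto simp: card_gt_0_iff)
    then have "card (T - {x}) \<le> D - 1" "D \<noteq> 0" using dg_mono True by (auto simp: card_Diff_singleton)
    then show ?thesis using dg_mono True
      by (intro exI[of _ "\<lambda>_. 0"] exI[of _ "\<lambda>A. if T - {x} \<subseteq> A then 1 else 0"])
        (auto intro: dg.dg_mono dg_const)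
  next
    case False
    then show ?thesis using dg_mono
      by (intro exI[of _ "\<lambda>_. 0"] exI[of _ "\<lambda>A. if T \<subseteq> A then 1 else 0"])
        (auto intro: dg.dg_mono dg_const)
  qed
next
  case (dg_add D f1 f2)
  then obtain g1 h1 g2 h2 where
    "dg D g1" "dg (D-1) h1" "D = 0 \<longrightarrow> h1 = (\<lambda>_. 0)" "\<And>A. x \<notin> A \<Longrightarrow> f1 A = g1 A \<and> f1 (insert x A) = g1 A + h1 A"
    "dg D g2" "dg (D-1) h2" "D = 0 \<longrightarrow> h2 = (\<lambda>_. 0)" "\<And>A. x \<notin> A \<Longrightarrow> f2 A = g2 A \<and> f2 (insert x A) = g2 A + h2 A"
    by blast
  then show ?case
    by (intro exI[of _ "\<lambda>A. g1 A + g2 A"] exI[of _ "\<lambda>A. h1 A + h2 A"]) (auto intro: dg.dg_add)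
next
  case (dg_scale D f c)
  then obtain g h where
    "dg D g" "dg (D-1) h" "D = 0 \<longrightarrow> h = (\<lambda>_. 0)" "\<And>A. x \<notin> A \<Longrightarrow> f A = g A \<and> f (insert x A) = g A + h A"
    by blast
  then show ?case
    by (intro exI[of _ "\<lambda>A. c * g A"] exI[of _ "\<lambda>A. c * h A"]) (auto intro: dg.dg_scale simp: algebra_simps)
qed

text \<open>The origin of the conditions on \<open>\<kappa>\<close>: the right side minus the left
  is \<open>2 * s^2 * q * a * b * \<kappa> * (\<kappa> - 4) + s^2 * q * b^2 * (\<kappa>^2 * q -
  3)\<close>.\<close>

lemma hypercontractive_real:
  fixes a b q s \<kappa> :: real
  assumes "0 < q" "\<kappa> \<ge> 4" "\<kappa>\<^sup>2 * q \<ge> 3" "0 \<le> a" "0 \<le> b" "0 \<le> s"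
  shows "(s * \<kappa>)\<^sup>2 * a\<^sup>2 + 8 * q * (s * \<kappa>) * s * a * b + 3 * q * s\<^sup>2 * b\<^sup>2 \<le> (s * \<kappa>)\<^sup>2 * (a + q * b)\<^sup>2"
proof -
  have "(s * \<kappa>)\<^sup>2 * (a + q * b)\<^sup>2 - ((s * \<kappa>)\<^sup>2 * a\<^sup>2 + 8 * q * (s * \<kappa>) * s * a * b + 3 * q * s\<^sup>2 * b\<^sup>2)
     = 2 * s\<^sup>2 * q * a * b * \<kappa> * (\<kappa> - 4) + s\<^sup>2 * q * b\<^sup>2 * (\<kappa>\<^sup>2 * q - 3)"
    by (simp add: power2_eq_square algebra_simps)
  moreover have "0 \<le> 2 * s\<^sup>2 * q * a * b * \<kappa> * (\<kappa> - 4)"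
    using assms by (intro mult_nonneg_nonneg) auto
  moreover have "0 \<le> s\<^sup>2 * q * b\<^sup>2 * (\<kappa>\<^sup>2 * q - 3)"
    using assms by (intro mult_nonneg_nonneg) auto
  ultimately show ?thesis by linarith
qed

text \<open>A centred bit takes the values \<open>- p\<close> and \<open>1 - p\<close>. The cubic
  term of the expanded fourth moment is shared between the quadratic and the quartic one by the
  arithmetic-geometric mean inequality, which raises their coefficients from \<open>6\<close> and
  \<open>1\<close> to \<open>8\<close> and \<open>3\<close>.\<close>

lemma hypercontractive_step:
  fixes A B p :: real
  assumes "0 \<le> p" "p \<le> 1" and q: "q = p * (1 - p)"
  shows "(1 - p) * (A - p * B)^4 + p * (A + (1 - p) * B)^4 \<le> A^4 + 8 * q * (A\<^sup>2 * B\<^sup>2) + 3 * q * B^4"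
proof -
  have "(1 - p) * (A - p * B)^4 + p * (A + (1 - p) * B)^4
     = A^4 + 6 * q * (A\<^sup>2 * B\<^sup>2) + 4 * q * (1 - 2 * p) * (A * B^3) + q * (1 - 3 * q) * B^4"
    unfolding q by (simp add: power2_eq_square power3_eq_cube power4_eq_xxxx algebra_simps)
  moreover have "4 * q * (1 - 2 * p) * (A * B^3) \<le> 2 * q * (A\<^sup>2 * B\<^sup>2 + B^4)"
  proof -
    have "q \<ge> 0" using assms by auto
    have "2 * ((1 - 2 * p) * (A * B^3)) \<le> A\<^sup>2 * B\<^sup>2 + B^4"
    proof -
      have "\<bar>1 - 2 * p\<bar> \<le> 1" using assms by auto
      then have "\<bar>(1 - 2 * p) * (A * B^3)\<bar> \<le> 1 * \<bar>A * B^3\<bar>"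
        unfolding abs_mult[of "1 - 2 * p"] by (intro mult_right_mono) auto
      moreover have "2 * (\<bar>A * B\<bar> * B\<^sup>2) \<le> (A * B)\<^sup>2 + (B\<^sup>2)\<^sup>2"
        using sum_squares_bound[of "\<bar>A * B\<bar>" "B\<^sup>2"] by (simp add: mult_ac)
      moreover have "\<bar>A * B^3\<bar> = \<bar>A * B\<bar> * B\<^sup>2"
        by (simp add: abs_mult power3_eq_cube power2_eq_square mult_ac)
      ultimately show ?thesis by (simp add: power_mult_distrib)
    qed
    then show ?thesis using mult_left_mono[OF _ \<open>q \<ge> 0\<close>, of _ _] by (fastforce simp: algebra_simps)
  qed
  moreover have "q * (1 - 3 * q) * B^4 \<le> q * B^4"
  proof (intro mult_right_mono)
    have "q \<ge> 0" using assms by auto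
    then have "q * (1 - 3 * q) \<le> q * 1" by (intro mult_left_mono) auto
    then show "q * (1 - 3 * q) \<le> q" by simp
  qed auto
  ultimately show ?thesis by (simp add: algebra_simps)
qed

text \<open>Bonami's inequality between the second and fourth moments, for biased bits, by induction
  on the coordinates. The constant \<open>\<kappa>\<close> has to grow as \<open>p\<close>
  approaches \<open>0\<close> or \<open>1\<close>.\<close>

lemma hypercontractive:
  assumes "finite I" "dg D f" "0 < p" "p < 1" "\<kappa> \<ge> 4" "\<kappa>\<^sup>2 * (p * (1 - p)) \<ge> 3"
  shows "bE p I (\<lambda>A. f A ^ 4) \<le> \<kappa> ^ (2 * D) * (bE p I (\<lambda>A. (f A)\<^sup>2))\<^sup>2"
  using assms(1,2)
proof (induction I arbitrary: D f rule: finite_induct)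
  case empty
  have "1 * f {} ^ 4 \<le> \<kappa> ^ (2 * D) * f {} ^ 4"
    using assms(5) by (intro mult_right_mono) auto
  then show ?case by (simp flip: power_mult)
next
  case (insert x I)
  define q where "q = p * (1 - p)"
  have q: "0 < q" using assms by (auto simp: q_def)
  obtain g h where gh: "dg D g" "dg (D - 1) h" "D = 0 \<longrightarrow> h = (\<lambda>_. 0)"
     "\<And>A. x \<notin> A \<Longrightarrow> f A = g A \<and> f (insert x A) = g A + h A"
    using dg_split[OF insert.prems, of x] by blast
  \<comment> \<open>Recentring: \<open>f\<close> equals \<open>F\<close> plus \<open>h\<close> times
    the centred bit at \<open>x\<close>, so first-order cross terms vanish in expectation.\<close>
  define F where "F A = g A + p * h A" for A
  have h': "dg D h" using dg_le[OF gh(2)] by simp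
  have F: "dg D F" unfolding F_def by (intro dg_add gh dg_scale h')
  have f1: "f A = F A - p * h A" "f (insert x A) = F A + (1 - p) * h A" if "A \<subseteq> I" for A
    using gh(4)[of A] that insert.hyps by (auto simp: F_def algebra_simps)
  define a b where "a = bE p I (\<lambda>A. (F A)\<^sup>2)" and "b = bE p I (\<lambda>A. (h A)\<^sup>2)"
  have ab: "a \<ge> 0" "b \<ge> 0" using assms by (auto simp: a_def b_def intro!: bE_nonneg)
  have E2: "bE p (insert x I) (\<lambda>A. (f A)\<^sup>2) = a + q * b"
  proof -
    have "bE p (insert x I) (\<lambda>A. (f A)\<^sup>2)
      = (1 - p) * bE p I (\<lambda>A. (F A - p * h A)\<^sup>2) + p * bE p I (\<lambda>A. (F A + (1 - p) * h A)\<^sup>2)"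
      using insert.hyps by (simp add: bE_insert f1 cong: bE_cong)
    also have "\<dots> = bE p I (\<lambda>A. (1 - p) * (F A - p * h A)\<^sup>2 + p * (F A + (1 - p) * h A)\<^sup>2)"
      by (simp add: bE_add bE_cmult)
    also have "\<dots> = bE p I (\<lambda>A. (F A)\<^sup>2 + q * (h A)\<^sup>2)"
      by (intro bE_cong) (simp add: q_def power2_eq_square algebra_simps)
    finally show ?thesis by (simp add: bE_add bE_cmult a_def b_def)
  qed
  have "bE p (insert x I) (\<lambda>A. f A ^ 4)
      = (1 - p) * bE p I (\<lambda>A. (F A - p * h A)^4) + p * bE p I (\<lambda>A. (F A + (1 - p) * h A)^4)"
    using insert.hyps by (simp add: bE_insert f1 cong: bE_cong)
  also have "\<dots> = bE p I (\<lambda>A. (1 - p) * (F A - p * h A)^4 + p * (F A + (1 - p) * h A)^4)"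
    by (simp add: bE_add bE_cmult)
  also have "\<dots> \<le> bE p I (\<lambda>A. F A ^ 4 + 8 * q * ((F A)\<^sup>2 * (h A)\<^sup>2) + 3 * q * h A ^ 4)"
    using assms by (intro bE_mono hypercontractive_step) (auto simp: q_def)
  also have "\<dots> = bE p I (\<lambda>A. F A ^ 4) + 8 * q * bE p I (\<lambda>A. (F A)\<^sup>2 * (h A)\<^sup>2) + 3 * q * bE p I (\<lambda>A. h A ^ 4)"
    by (simp add: bE_add bE_cmult)
  finally have main: "bE p (insert x I) (\<lambda>A. f A ^ 4) \<le> \<dots>" .
  have IHF: "bE p I (\<lambda>A. F A ^ 4) \<le> \<kappa> ^ (2 * D) * a\<^sup>2"
    using insert.IH[OF F] by (simp add: a_def)
  show ?case
  proof (cases "D = 0")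
    case True
    then have "h = (\<lambda>_. 0)" using gh by simp
    then show ?thesis using main IHF insert.hyps unfolding E2 b_def by simp
  next
    case False
    define s where "s = \<kappa> ^ (D - 1)"
    have s: "\<kappa> ^ D = s * \<kappa>" "s \<ge> 0" using False assms(5)
      by (auto simp: s_def power_Suc2[symmetric] simp del: power_Suc)
    have k2: "\<kappa> ^ (2 * D) = (s * \<kappa>)\<^sup>2" "\<kappa> ^ (2 * (D - 1)) = s\<^sup>2"
      using s(1) by (simp_all add: s_def power_even_eq)
    have IHh: "bE p I (\<lambda>A. h A ^ 4) \<le> s\<^sup>2 * b\<^sup>2"
      using insert.IH[OF gh(2)] by (simp only: b_def k2(2))
    \<comment> \<open>The mixed moment is at most the geometric mean of two fourth moments, to which
      the induction hypothesis applies in degrees \<open>D\<close> and \<open>D - 1\<close>.\<close>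
    have c1: "(bE p I (\<lambda>A. (F A)\<^sup>2 * (h A)\<^sup>2))\<^sup>2 \<le> bE p I (\<lambda>A. F A ^ 4) * bE p I (\<lambda>A. h A ^ 4)"
      using bE_Cauchy_Schwarz[of p I "\<lambda>A. (F A)\<^sup>2" "\<lambda>A. (h A)\<^sup>2"] assms(3,4) by (simp flip: power_mult)
    have c2: "bE p I (\<lambda>A. F A ^ 4) * bE p I (\<lambda>A. h A ^ 4) \<le> ((s * \<kappa>)\<^sup>2 * a\<^sup>2) * (s\<^sup>2 * b\<^sup>2)"
      using IHF[unfolded k2(1)] IHh assms(3,4) by (intro mult_mono) (auto intro!: bE_nonneg)
    have c3: "((s * \<kappa>)\<^sup>2 * a\<^sup>2) * (s\<^sup>2 * b\<^sup>2) = ((s * \<kappa>) * s * a * b)\<^sup>2"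
      by (simp only: power_mult_distrib mult_ac)
    have "0 \<le> (s * \<kappa>) * s * a * b"
      using ab s(2) assms(5) by (intro mult_nonneg_nonneg) auto
    then have IHc: "bE p I (\<lambda>A. (F A)\<^sup>2 * (h A)\<^sup>2) \<le> (s * \<kappa>) * s * a * b"
      using c1 c2 unfolding c3 by (meson order_trans power2_le_imp_le)
    have "bE p (insert x I) (\<lambda>A. f A ^ 4) \<le> (s * \<kappa>)\<^sup>2 * a\<^sup>2 + 8 * q * ((s * \<kappa>) * s * a * b) + 3 * q * (s\<^sup>2 * b\<^sup>2)"
      using main IHF[unfolded k2(1)] mult_left_mono[OF IHc, of "8 * q"] mult_left_mono[OF IHh, of "3 * q"] q
      by linarith
    also have "\<dots> \<le> (s * \<kappa>)\<^sup>2 * (a + q * b)\<^sup>2"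
      using hypercontractive_real[OF q assms(5) _ ab s(2)] assms(6) by (simp add: q_def mult_ac)
    finally show ?thesis by (simp only: E2 k2(1))
  qed
qed

text \<open>The fourth-moment inequality is applied to \<open>f ^ 2 ^ j\<close>, of degree
  \<open>D * 2 ^ j\<close>. With \<open>N = 2 ^ j\<close> the exponents of \<open>\<kappa>\<close>
  add up to \<open>2 * D * N * N\<close>, which is enlarged to
  \<open>2 * D * N * (2 * N - 1)\<close> to keep the pattern of the statement.\<close>

lemma hypercontractive_power:
  assumes "finite I" "dg D f" "0 < p" "p < 1" "\<kappa> \<ge> 4" "\<kappa>\<^sup>2 * (p * (1 - p)) \<ge> 3"
  shows "bE p I (\<lambda>A. f A ^ (2 ^ Suc j)) \<le> \<kappa> ^ (D * 2 ^ j * (2 ^ j - 1)) * (bE p I (\<lambda>A. (f A)\<^sup>2)) ^ (2 ^ j)"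
proof (induction j)
  case 0
  then show ?case by simp
next
  case (Suc j)
  define N :: nat where "N = 2 ^ j"
  have N: "N \<ge> 1" by (simp add: N_def)
  have "bE p I (\<lambda>A. f A ^ (2 ^ Suc (Suc j))) = bE p I (\<lambda>A. (f A ^ N) ^ 4)"
    by (simp add: N_def flip: power_mult) (simp add: mult.commute)
  also have "\<dots> \<le> \<kappa> ^ (2 * (D * N)) * (bE p I (\<lambda>A. (f A ^ N)\<^sup>2))\<^sup>2"
    by (intro hypercontractive assms dg_power)
  also have "(\<lambda>A. (f A ^ N)\<^sup>2) = (\<lambda>A. f A ^ 2 ^ Suc j)"
    by (simp add: N_def mult.commute flip: power_mult)
  also have "(bE p I (\<lambda>A. f A ^ 2 ^ Suc j))\<^sup>2 \<le> (\<kappa> ^ (D * N * (N - 1)) * (bE p I (\<lambda>A. (f A)\<^sup>2)) ^ N)\<^sup>2"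
    using Suc.IH assms by (intro power_mono bE_nonneg) (auto simp: N_def)
  also have "\<kappa> ^ (2 * (D * N)) * \<dots> = \<kappa> ^ (D * (2 * N) * N) * (bE p I (\<lambda>A. (f A)\<^sup>2)) ^ (2 * N)"
  proof -
    have "2 * (D * N) + (D * N * (N - 1)) * 2 = D * (2 * N) * N"
      using N by (simp add: algebra_simps diff_mult_distrib2)
    then show ?thesis
      by (simp add: power_mult_distrib power_mult[symmetric] mult.commute[of N 2] power_add[symmetric] mult.assoc[symmetric])
  qed
  also have "\<dots> \<le> \<kappa> ^ (D * (2 * N) * (2 * N - 1)) * (bE p I (\<lambda>A. (f A)\<^sup>2)) ^ (2 * N)"
    using assms N by (intro mult_right_mono power_increasing mult_le_mono zero_le_power[OF bE_nonneg]) auto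
  finally show ?case using assms by (simp add: N_def mult_left_mono)
qed

section \<open>Averages over a slice\<close>

definition slc :: "nat \<Rightarrow> nat \<Rightarrow> nat set set" where
  "slc n m = {A. A \<subseteq> {..<n} \<and> card A = m}"

definition sE :: "nat \<Rightarrow> nat \<Rightarrow> (nat set \<Rightarrow> 'a::real_vector) \<Rightarrow> 'a" where
  "sE n m f = (1 / real (card (slc n m))) *\<^sub>R (\<Sum>A\<in>slc n m. f A)"

lemma finite_slc [simp]: "finite (slc n m)"
  by (rule finite_subset[of _ "Pow {..<n}"]) (auto simp: slc_def)

lemma card_slc: "card (slc n m) = n choose m"
  using n_subsets[of "{..<n}" m] by (simp add: slc_def)

lemma sE_add: "sE n m (\<lambda>A. f A + g A) = sE n m f + sE n m g"
  by (simp add: sE_def sum.distrib scaleR_add_right)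

lemma sE_diff: "sE n m (\<lambda>A. f A - g A) = sE n m f - sE n m g"
  by (simp add: sE_def sum_subtractf scaleR_diff_right)

lemma sE_sum: "sE n m (\<lambda>A. \<Sum>j\<in>J. f j A) = (\<Sum>j\<in>J. sE n m (f j))"
  by (simp add: sE_def scaleR_sum_right sum.swap[of _ J])

lemma sE_scale: "sE n m (\<lambda>A. c *\<^sub>R f A) = c *\<^sub>R sE n m f"
  by (simp add: sE_def scaleR_sum_right)

lemma sE_cmult: "sE n m (\<lambda>A. c * f A) = c * sE n m f" for f :: "_ \<Rightarrow> 'a::real_algebra"
  by (simp add: sE_def sum_distrib_left[symmetric])

lemma sE_multc: "sE n m (\<lambda>A. f A * c) = sE n m f * c" for f :: "_ \<Rightarrow> 'a::real_algebra"
  by (simp add: sE_def sum_distrib_right[symmetric])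

lemma sE_cong: "(\<And>A. A \<in> slc n m \<Longrightarrow> f A = g A) \<Longrightarrow> sE n m f = sE n m g"
  by (simp add: sE_def cong: sum.cong)

lemma sE_const: "m \<le> n \<Longrightarrow> sE n m (\<lambda>A. c) = c"
  by (simp add: sE_def card_slc sum_constant_scaleR del: sum_constant)

lemma sE_mono:
  fixes f g :: "nat set \<Rightarrow> real"
  shows "(\<And>A. A \<in> slc n m \<Longrightarrow> f A \<le> g A) \<Longrightarrow> sE n m f \<le> sE n m g"
  by (auto simp: sE_def intro!: divide_right_mono sum_mono)

lemma sE_nonneg:
  fixes f :: "nat set \<Rightarrow> real"
  shows "(\<And>A. A \<in> slc n m \<Longrightarrow> 0 \<le> f A) \<Longrightarrow> 0 \<le> sE n m f"
  by (auto simp: sE_def intro!: divide_nonneg_nonneg sum_nonneg)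

lemma sE_norm:
  fixes f :: "nat set \<Rightarrow> 'a::real_normed_vector"
  shows "norm (sE n m f) \<le> sE n m (\<lambda>A. norm (f A))"
  by (auto simp: sE_def intro!: divide_right_mono norm_sum)

lemma sE_of_real: "sE n m (\<lambda>A. complex_of_real (f A)) = of_real (sE n m f)"
  by (simp add: sE_def scaleR_conv_of_real)

lemma sE_Cauchy_Schwarz:
  fixes f g :: "nat set \<Rightarrow> real"
  shows "(sE n m (\<lambda>A. f A * g A))\<^sup>2 \<le> sE n m (\<lambda>A. (f A)\<^sup>2) * sE n m (\<lambda>A. (g A)\<^sup>2)"
proof -
  have "(\<Sum>A\<in>slc n m. f A * g A)\<^sup>2 \<le> (\<Sum>A\<in>slc n m. (f A)\<^sup>2) * (\<Sum>A\<in>slc n m. (g A)\<^sup>2)"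
    by (rule Cauchy_Schwarz_ineq_sum)
  then show ?thesis
    by (simp add: sE_def power_divide power2_eq_square divide_right_mono)
qed

lemma sE_square_le:
  fixes f :: "nat set \<Rightarrow> real"
  assumes "m \<le> n"
  shows "(sE n m f)\<^sup>2 \<le> sE n m (\<lambda>A. (f A)\<^sup>2)"
  using sE_Cauchy_Schwarz[of n m f "\<lambda>_. 1"] assms by (simp add: sE_const)

lemma sE_abs_le_sqrt:
  fixes f :: "nat set \<Rightarrow> real"
  assumes "m \<le> n"
  shows "sE n m (\<lambda>A. \<bar>f A\<bar>) \<le> sqrt (sE n m (\<lambda>A. (f A)\<^sup>2))"
  using sE_square_le[OF assms, of "\<lambda>A. \<bar>f A\<bar>"] by (intro real_le_rsqrt) simp

text \<open>Jensen's inequality for powers of two, by iterated squaring.\<close>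

lemma sE_power_le:
  fixes f :: "nat set \<Rightarrow> real"
  assumes "m \<le> n" "\<And>A. A \<in> slc n m \<Longrightarrow> 0 \<le> f A"
  shows "(sE n m f) ^ (2 ^ j) \<le> sE n m (\<lambda>A. f A ^ (2 ^ j))"
proof (induction j)
  case (Suc j)
  have "(sE n m f) ^ (2 ^ Suc j) = ((sE n m f) ^ (2 ^ j))\<^sup>2"
    by (simp add: mult.commute flip: power_mult)
  also have "\<dots> \<le> (sE n m (\<lambda>A. f A ^ (2 ^ j)))\<^sup>2"
    using Suc sE_nonneg[of n m f] assms by (intro power_mono) auto
  also have "\<dots> \<le> sE n m (\<lambda>A. (f A ^ (2 ^ j))\<^sup>2)"
    by (rule sE_square_le[OF assms(1)])
  finally show ?case by (simp add: mult.commute flip: power_mult)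
qed simp

text \<open>Exchangeability: swapping two residues permutes the slice. This is the symmetry behind
  the Stein identity.\<close>

lemma sE_swap:
  assumes "u < n" "v < n"
  shows "sE n m (\<lambda>A. f (Transposition.transpose u v ` A)) = sE n m f"
proof -
  let ?t = "\<lambda>A. Transposition.transpose u v ` A"
  have inv: "?t (?t A) = A" for A by (simp add: image_image)
  have mem: "?t A \<in> slc n m" if "A \<in> slc n m" for A
  proof -
    have "Transposition.transpose u v x < n" if "x < n" for x
      using that assms by (auto simp: Transposition.transpose_def)
    then show ?thesis using that
      by (auto simp: slc_def card_image[OF inj_on_subset[OF inj_transpose]])
  qed
  have "(\<Sum>A\<in>slc n m. f (?t A)) = (\<Sum>A\<in>slc n m. f A)"
    by (rule sum.reindex_bij_witness[where i="?t" and j="?t"]) (use inv mem in auto)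
  then show ?thesis by (simp add: sE_def)
qed

section \<open>Comparison of the slice with independent bits\<close>

lemma wt_slc:
  assumes "A \<subseteq> I" "finite I"
  shows "wt p I A = p ^ card A * (1 - p) ^ (card I - card A)"
proof -
  have "wt p I A = (\<Prod>i\<in>A. if i \<in> A then p else 1 - p) * (\<Prod>i\<in>I - A. if i \<in> A then p else 1 - p)"
    unfolding wt_def using prod.subset_diff[OF assms, of "\<lambda>i. if i \<in> A then p else 1 - p"]
    by (simp add: mult.commute)
  also have "(\<Prod>i\<in>I - A. if i \<in> A then p else 1 - p) = (\<Prod>i\<in>I - A. 1 - p)"
    by (intro prod.cong) auto
  finally show ?thesis
    using assms by (simp add: card_Diff_subset finite_subset)
qed

text \<open>The binomial point probability at \<open>j\<close> with success probability
  \<open>m / n\<close>, so that the mean is the integer \<open>m\<close>.\<close>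

definition binp :: "nat \<Rightarrow> nat \<Rightarrow> nat \<Rightarrow> real" where
  "binp n m j = real (n choose j) * (real m / real n) ^ j * (1 - real m / real n) ^ (n - j)"

lemma binp_Suc:
  assumes "j < n" "m \<le> n"
  shows "(real j + 1) * (real n - real m) * binp n m (Suc j) = (real n - real j) * real m * binp n m j"
proof -
  have c: "(real j + 1) * real (n choose Suc j) = (real n - real j) * real (n choose j)"
  proof -
    have "Suc j * (n choose Suc j) = (n - j) * (n choose j)"
      using binomial_absorption[of j n] binomial_absorb_comp[of n j] by simp
    then have "real (Suc j * (n choose Suc j)) = real ((n - j) * (n choose j))" by simp
    then have "real (Suc j) * real (n choose Suc j) = real (n - j) * real (n choose j)" by (simp only: of_nat_mult)
    then show ?thesis using assms by (simp only: of_nat_diff[OF less_imp_le] of_nat_Suc add.commute)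
  qed
  define p where "p = real m / real n"
  have n: "real n > 0" using assms by auto
  have p: "real m = real n * p" using n by (simp add: p_def)
  have e: "n - j = Suc (n - Suc j)" using assms by auto
  have "(real j + 1) * (real n - real m) * binp n m (Suc j)
     = ((real j + 1) * real (n choose Suc j)) * (real n * p) * p ^ j * (1 - p) ^ (n - j)"
    unfolding binp_def p_def[symmetric] p e by (simp add: algebra_simps)
  also have "\<dots> = (real n - real j) * real m * binp n m j"
    unfolding c binp_def p_def[symmetric] p by (simp add: algebra_simps)
  finally show ?thesis .
qed

text \<open>Consecutive probabilities increase up to \<open>m\<close> and decrease from there on;
  both comparisons are read off the recurrence with denominators cleared.\<close>

lemma binp_le_mode:
  assumes "0 < m" "m < n" "j \<le> n"
  shows "binp n m j \<le> binp n m m"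
proof -
  have nn: "binp n m i \<ge> 0" for i
    using assms unfolding binp_def by (intro mult_nonneg_nonneg zero_le_power) auto
  have e1: "real ((i + 1) * (n - m)) = (real i + 1) * (real n - real m)" for i
  proof -
    have "real (n - m) = real n - real m" "real (i + 1) = real i + 1" using assms by auto
    then show ?thesis by (simp only: of_nat_mult)
  qed
  have e2: "real ((n - i) * m) = (real n - real i) * real m" if "i < n" for i
    using that by (simp add: of_nat_diff)
  have up: "binp n m i \<le> binp n m (Suc i)" if "i < m" for i
  proof -
    have le: "(i + 1) * (n - m) \<le> (n - i) * m"
    proof -
      have "real ((i + 1) * (n - m)) \<le> real ((n - i) * m)"
      proof -
        have "(real i + 1) * real n \<le> real m * real n"
          using that by (intro mult_right_mono) auto
        then have "(real i + 1) * (real n - real m) \<le> (real n - real i) * real m"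
          by (simp add: algebra_simps)
        moreover have "real (i + 1) = real i + 1" "real (n - m) = real n - real m" "real (n - i) = real n - real i"
          using assms that by auto
        ultimately show ?thesis by (simp only: of_nat_mult)
      qed
      then show ?thesis by linarith
    qed
    have "real ((i + 1) * (n - m)) * binp n m i \<le> real ((n - i) * m) * binp n m i"
      using le nn by (intro mult_right_mono) (simp_all only: of_nat_le_iff)
    also have "\<dots> = real ((i + 1) * (n - m)) * binp n m (Suc i)"
      using binp_Suc[of i n m] that assms unfolding e1 by (subst e2) auto
    finally have "real ((i + 1) * (n - m)) * binp n m i \<le> real ((i + 1) * (n - m)) * binp n m (Suc i)" .
    moreover have "0 < real ((i + 1) * (n - m))" using assms unfolding e1 by (intro mult_pos_pos) auto
    ultimately show ?thesis by (simp only: mult_le_cancel_left_pos)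
  qed
  have dn: "binp n m (Suc i) \<le> binp n m i" if "i < n" "m \<le> i" for i
  proof -
    have "real ((n - i) * m) \<le> real ((i + 1) * (n - m))"
    proof -
      have "real m * (real n + 1) \<le> (real i + 1) * real n"
      proof -
        have "real m * real n \<le> real i * real n" using that by (intro mult_right_mono) auto
        then show ?thesis using assms(2) by (simp only: distrib_left distrib_right mult_1 mult_1_right)
      qed
      then have "(real n - real i) * real m \<le> (real i + 1) * (real n - real m)"
        by (simp add: algebra_simps)
      moreover have "real (i + 1) = real i + 1" "real (n - m) = real n - real m" "real (n - i) = real n - real i"
        using assms that by auto
      ultimately show ?thesis by (simp only: of_nat_mult)
    qed
    have "real ((i + 1) * (n - m)) * binp n m (Suc i) = real ((n - i) * m) * binp n m i"
      using binp_Suc[of i n m] that assms unfolding e1 by (subst e2) auto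
    also have "\<dots> \<le> real ((i + 1) * (n - m)) * binp n m i"
      using \<open>real ((n - i) * m) \<le> _\<close> nn by (intro mult_right_mono) auto
    finally have "real ((i + 1) * (n - m)) * binp n m (Suc i) \<le> real ((i + 1) * (n - m)) * binp n m i" .
    moreover have "0 < real ((i + 1) * (n - m))" using assms unfolding e1 by (intro mult_pos_pos) auto
    ultimately show ?thesis by (simp only: mult_le_cancel_left_pos)
  qed
  show ?thesis
  proof (cases "j \<le> m")
    case True
    then show ?thesis
    proof (induction j rule: inc_induct)
      case (step i)
      then show ?case using up[of i] by linarith
    qed simp
  next
    case False
    have "j \<le> n \<Longrightarrow> binp n m j \<le> binp n m m" if "m \<le> j" for j
      using that
    proof (induction j rule: dec_induct)
      case (step i)
      then show ?case using dn[of i] by linarith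
    qed simp
    then show ?thesis using False assms by simp
  qed
qed

text \<open>The \<open>n + 1\<close> probabilities sum to one and the largest is at
  \<open>m\<close>. Every factor \<open>n + 1\<close> below originates here.\<close>

lemma binp_mode_ge:
  assumes "0 < m" "m < n"
  shows "1 / (real n + 1) \<le> binp n m m"
proof -
  have "1 = (real m / real n + (1 - real m / real n)) ^ n" by simp
  also have "\<dots> = (\<Sum>j\<le>n. binp n m j)"
    unfolding binomial_ring binp_def by simp
  also have "\<dots> \<le> (\<Sum>j\<le>n. binp n m m)"
    using assms by (intro sum_mono binp_le_mode) auto
  finally show ?thesis by (simp add: field_simps)
qed

text \<open>The weight depends only on the size of the set, so independent bits conditioned on their
  sum are uniform on the slice.\<close>

lemma bE_slice:
  fixes f :: "nat set \<Rightarrow> 'a::real_vector"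
  assumes "0 < m" "m < n"
  shows "bE (real m / real n) {..<n} (\<lambda>A. if card A = m then f A else 0) = binp n m m *\<^sub>R sE n m f"
proof -
  let ?p = "real m / real n"
  have "bE ?p {..<n} (\<lambda>A. if card A = m then f A else 0) = (\<Sum>A\<in>Pow {..<n}. if card A = m then wt ?p {..<n} A *\<^sub>R f A else 0)"
    unfolding bE_def by (intro sum.cong) auto
  also have "\<dots> = (\<Sum>A\<in>slc n m. wt ?p {..<n} A *\<^sub>R f A)"
    by (subst sum.inter_filter[symmetric]) (auto simp: slc_def intro!: sum.cong)
  also have "\<dots> = (\<Sum>A\<in>slc n m. (?p ^ m * (1 - ?p) ^ (n - m)) *\<^sub>R f A)"
    by (intro sum.cong) (auto simp: slc_def wt_slc)
  also have "\<dots> = binp n m m *\<^sub>R sE n m f"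
    using assms by (simp add: sE_def binp_def card_slc scaleR_sum_right)
  finally show ?thesis .
qed

lemma sE_le_bE:
  fixes f :: "nat set \<Rightarrow> real"
  assumes "0 < m" "m < n" "\<And>A. A \<subseteq> {..<n} \<Longrightarrow> 0 \<le> f A"
  shows "sE n m f \<le> (real n + 1) * bE (real m / real n) {..<n} f"
proof -
  have nn: "0 \<le> sE n m f" using assms by (intro sE_nonneg) (auto simp: slc_def)
  have "sE n m f = (real n + 1) * (1 / (real n + 1) * sE n m f)" by simp
  also have "\<dots> \<le> (real n + 1) * (binp n m m * sE n m f)"
    using binp_mode_ge[OF assms(1,2)] nn by (intro mult_left_mono mult_right_mono) auto
  also have "\<dots> = (real n + 1) * bE (real m / real n) {..<n} (\<lambda>A. if card A = m then f A else 0)"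
    using bE_slice[OF assms(1,2), of f] by simp
  also have "\<dots> \<le> (real n + 1) * bE (real m / real n) {..<n} f"
    using assms by (intro mult_left_mono bE_mono) auto
  finally show ?thesis .
qed

text \<open>Orthogonality of the characters modulo \<open>N\<close>.\<close>

lemma roots_of_unity_sum:
  assumes "c < N" "m < N"
  shows "(\<Sum>l<N. cis (2 * pi * real l * (real c - real m) / real N)) = (if c = m then of_nat N else 0)"
proof -
  define z where "z = cis (2 * pi * real c / real N) / cis (2 * pi * real m / real N)"
  have N: "N > 0" using assms by auto
  have z: "z = cis (2 * pi * (real c - real m) / real N)"
    by (simp add: z_def cis_divide diff_divide_distrib right_diff_distrib)
  have zl: "cis (2 * pi * real l * (real c - real m) / real N) = z ^ l" for l
  proof -
    have "cis (real l * (2 * pi * (real c - real m) / real N)) = z ^ l"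
      unfolding z by (rule Complex.DeMoivre[symmetric])
    moreover have "real l * (2 * pi * (real c - real m) / real N) = 2 * pi * real l * (real c - real m) / real N"
      by simp
    ultimately show ?thesis by (simp only:)
  qed
  have zN: "z ^ N = 1"
    using N by (simp add: z_def power_divide Complex.DeMoivre)
  have "z = 1 \<longleftrightarrow> c = m"
  proof -
    have "z = 1 \<longleftrightarrow> cis (2 * pi * real c / real N) = cis (2 * pi * real m / real N)"
      by (simp add: z_def)
    also have "\<dots> \<longleftrightarrow> c = m"
      using bij_betw_imp_inj_on[OF Complex.bij_betw_roots_unity[OF N]] assms
      by (auto simp: inj_on_def)
    finally show ?thesis .
  qed
  then show ?thesis unfolding zl sum_gp_strict using zN by auto
qed

text \<open>The condition \<open>card A = m\<close> is an average of characters modulo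
  \<open>n + 1\<close>, a modulus that separates the possible sizes \<open>0\<close> to
  \<open>n\<close>. The averaging costs nothing; the factor is the reciprocal of the bound for the
  probability of the slice.\<close>

lemma sE_le_twisted_bE:
  fixes f :: "nat set \<Rightarrow> complex"
  assumes "0 < m" "m < n" "\<And>\<theta>. norm (bE (real m / real n) {..<n} (\<lambda>A. f A * cis (\<theta> * real (card A)))) \<le> B"
  shows "norm (sE n m f) \<le> (real n + 1) * B"
proof -
  let ?p = "real m / real n"
  let ?th = "\<lambda>l. 2 * pi * real l / real (n + 1)"
  let ?g = "\<lambda>l A. f A * cis (?th l * real (card A))"
  have card: "card A < n + 1" if "A \<subseteq> {..<n}" for A
    using card_mono[OF _ that] by simp
  have "bE ?p {..<n} (\<lambda>A. if card A = m then f A else 0)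
     = bE ?p {..<n} (\<lambda>A. (1 / of_nat (n + 1)) * (\<Sum>l<n + 1. cis (- (?th l * real m)) * ?g l A))"
  proof (rule bE_cong)
    fix A :: "nat set" assume A: "A \<subseteq> {..<n}"
    have "(\<Sum>l<n + 1. cis (- (?th l * real m)) * ?g l A)
       = f A * (\<Sum>l<n + 1. cis (2 * pi * real l * (real (card A) - real m) / real (n + 1)))"
      unfolding sum_distrib_left
    proof (intro sum.cong refl)
      fix l
      have "cis (- (?th l * real m)) * cis (?th l * real (card A))
        = cis (2 * pi * real l * (real (card A) - real m) / real (n + 1))"
      proof -
        have "- (2 * pi * l' / D * m') + 2 * pi * l' / D * c' = 2 * pi * l' * (c' - m') / D" for l' c' m' D :: real
          by (cases "D = 0") (auto simp: field_simps)
        then show ?thesis unfolding cis_mult by (rule arg_cong[of _ _ cis])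
      qed
      then show "cis (- (?th l * real m)) * ?g l A
        = f A * cis (2 * pi * real l * (real (card A) - real m) / real (n + 1))"
        by (simp only: mult_ac)
    qed
    also have "\<dots> = (if card A = m then of_nat (n + 1) * f A else 0)"
      using roots_of_unity_sum[OF card[OF A], of m] assms(2) by simp
    finally show "(if card A = m then f A else 0)
      = (1 / of_nat (n + 1)) * (\<Sum>l<n + 1. cis (- (?th l * real m)) * ?g l A)"
      by (simp del: of_nat_Suc of_nat_add)
  qed
  also have "\<dots> = (1 / of_nat (n + 1)) * (\<Sum>l<n + 1. cis (- (?th l * real m)) * bE ?p {..<n} (?g l))"
    by (simp only: bE_cmult bE_sum)
  finally have "norm (bE ?p {..<n} (\<lambda>A. if card A = m then f A else 0))
     = (1 / real (n + 1)) * norm (\<Sum>l<n + 1. cis (- (?th l * real m)) * bE ?p {..<n} (?g l))"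
    by (simp add: norm_mult norm_divide del: of_nat_Suc of_nat_add)
  also have "\<dots> \<le> (1 / real (n + 1)) * (\<Sum>l<n + 1. norm (cis (- (?th l * real m)) * bE ?p {..<n} (?g l)))"
    by (intro mult_left_mono norm_sum) auto
  also have "\<dots> \<le> (1 / real (n + 1)) * (\<Sum>l<n + 1. B)"
    by (intro mult_left_mono sum_mono) (simp_all only: norm_mult norm_cis mult_1 assms(3), simp)
  also have "\<dots> = B" by simp
  finally have "binp n m m * norm (sE n m f) \<le> B"
    using bE_slice[OF assms(1,2), of f] binp_mode_ge[OF assms(1,2)]
    by (smt (verit) norm_scaleR divide_nonneg_nonneg of_nat_0_le_iff)
  moreover have "1 / (real n + 1) * norm (sE n m f) \<le> binp n m m * norm (sE n m f)"
    using binp_mode_ge[OF assms(1,2)] by (intro mult_right_mono) auto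
  ultimately have "norm (sE n m f) / (real n + 1) \<le> B" by simp
  then show ?thesis by (simp add: pos_divide_le_eq mult.commute)
qed

lemma powr_inverse_power:
  assumes "(K::real) > 0"
  shows "(K powr (1 / 2 ^ j)) ^ 2 ^ j = K"
proof -
  have "(K powr (1 / 2 ^ j)) ^ 2 ^ j = (K powr (1 / 2 ^ j)) powr real (2 ^ j)"
    using assms by (intro powr_realpow[symmetric]) auto
  then show ?thesis using assms by (simp add: powr_powr)
qed

text \<open>Passing from the slice to independent bits costs a factor \<^term>\<open>n + 1\<close>; applying this to a
  high power and using hypercontractivity reduces the loss to \<^term>\<open>n powr (1 / 2 ^ j)\<close>.\<close>

lemma sE_square_le_bE:
  assumes "0 < m" "m < n" "dg D f" "\<kappa> \<ge> 4" "\<kappa>\<^sup>2 * (real m / real n * (1 - real m / real n)) \<ge> 3"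
  shows "sE n m (\<lambda>A. (f A)\<^sup>2)
    \<le> ((real n + 1) * \<kappa> ^ (D * 2 ^ j * (2 ^ j - 1))) powr (1 / 2 ^ j) * bE (real m / real n) {..<n} (\<lambda>A. (f A)\<^sup>2)"
proof -
  let ?p = "real m / real n"
  let ?N = "2 ^ j :: nat"
  let ?b = "bE ?p {..<n} (\<lambda>A. (f A)\<^sup>2)" and ?s = "sE n m (\<lambda>A. (f A)\<^sup>2)"
  let ?K = "(real n + 1) * \<kappa> ^ (D * 2 ^ j * (2 ^ j - 1))"
  have p: "0 < ?p" "?p < 1" using assms by auto
  have b: "?b \<ge> 0" using p by (intro bE_nonneg) auto
  have s: "?s \<ge> 0" by (intro sE_nonneg) auto
  have K: "?K > 0" using assms by (intro mult_pos_pos) auto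
  have "?s ^ ?N \<le> sE n m (\<lambda>A. ((f A)\<^sup>2) ^ ?N)"
    using assms by (intro sE_power_le) auto
  also have "\<dots> \<le> (real n + 1) * bE ?p {..<n} (\<lambda>A. ((f A)\<^sup>2) ^ ?N)"
    using assms by (intro sE_le_bE) auto
  also have "bE ?p {..<n} (\<lambda>A. ((f A)\<^sup>2) ^ ?N) = bE ?p {..<n} (\<lambda>A. f A ^ 2 ^ Suc j)"
    by (simp flip: power_mult)
  also have "\<dots> \<le> \<kappa> ^ (D * 2 ^ j * (2 ^ j - 1)) * ?b ^ ?N"
    using assms p by (intro hypercontractive_power) auto
  finally have "?s ^ ?N \<le> ?K * ?b ^ ?N" by (simp add: mult_left_mono mult_ac)
  also have "\<dots> = (?K powr (1 / 2 ^ j) * ?b) ^ ?N"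
  proof -
    have "(?K powr (1 / 2 ^ j)) ^ ?N = ?K"
      by (rule powr_inverse_power[OF K])
    then show ?thesis by (simp only: power_mult_distrib)
  qed
  finally have "?s ^ ?N \<le> (?K powr (1 / 2 ^ j) * ?b) ^ ?N" .
  moreover have "0 \<le> ?K powr (1 / 2 ^ j) * ?b" using b by (intro mult_nonneg_nonneg) simp_all
  moreover have "0 < ?N" by simp
  ultimately show ?thesis using s by (simp only: power_mono_iff)
qed

section \<open>Variances of sums of products of bits\<close>

text \<open>Only pairs with overlapping sets of bits have a covariance. Centring doubles the bound
  \<open>M\<close>, whence \<open>4 * M^2\<close>.\<close>

lemma variance_sum_le:
  fixes f :: "'j \<Rightarrow> 'i set \<Rightarrow> real"
  assumes "finite I" "0 \<le> p" "p \<le> 1" "finite J" "0 \<le> M"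
    and dep: "\<And>j. j \<in> J \<Longrightarrow> dep (f j) (B j)"
    and bd: "\<And>j A. j \<in> J \<Longrightarrow> \<bar>f j A\<bar> \<le> M"
    and ct: "\<And>j. j \<in> J \<Longrightarrow> card {j' \<in> J. B j \<inter> B j' \<noteq> {}} \<le> N"
  shows "bE p I (\<lambda>A. ((\<Sum>j\<in>J. f j A) - bE p I (\<lambda>A. \<Sum>j\<in>J. f j A))\<^sup>2) \<le> 4 * M\<^sup>2 * real (card J) * real N"
proof -
  define g where "g j A = f j A - bE p I (f j)" for j A
  have gE: "bE p I (g j) = 0" for j
    unfolding g_def using assms(1) by (simp add: bE_diff)
  have gb: "\<bar>g j A\<bar> \<le> 2 * M" if "j \<in> J" for j A
    using bd[OF that, of A] bE_abs_le[OF assms(1-3), of "f j" M, OF bd[OF that]] unfolding g_def by linarith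
  have gd: "dep (g j) (B j)" if "j \<in> J" for j
    unfolding g_def by (rule dep_comp[OF dep[OF that]])
  have pair: "bE p I (\<lambda>A. g j A * g j' A) \<le> (if B j \<inter> B j' \<noteq> {} then 4 * M\<^sup>2 else 0)"
    if "j \<in> J" "j' \<in> J" for j j'
  proof (cases "B j \<inter> B j' = {}")
    case True
    then have "bE p I (\<lambda>A. g j A * g j' A) = bE p I (g j) * bE p I (g j')"
      by (intro bE_indep[OF assms(1) gd gd]) (use that in auto)
    then show ?thesis using True gE by simp
  next
    case False
    have "g j A * g j' A \<le> (2 * M) * (2 * M)" for A
    proof -
      have "g j A * g j' A \<le> \<bar>g j A\<bar> * \<bar>g j' A\<bar>" by (simp flip: abs_mult)
      also have "\<dots> \<le> (2 * M) * (2 * M)"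
        using gb[OF that(1)] gb[OF that(2)] assms(5) by (intro mult_mono) auto
      finally show ?thesis .
    qed
    then have "bE p I (\<lambda>A. g j A * g j' A) \<le> (2 * M) * (2 * M)"
      by (intro bE_le_const assms) auto
    then show ?thesis using False by (simp add: power2_eq_square)
  qed
  have "(\<Sum>j\<in>J. f j A) - bE p I (\<lambda>A. \<Sum>j\<in>J. f j A) = (\<Sum>j\<in>J. g j A)" for A
    by (simp add: bE_sum g_def sum_subtractf)
  then have "bE p I (\<lambda>A. ((\<Sum>j\<in>J. f j A) - bE p I (\<lambda>A. \<Sum>j\<in>J. f j A))\<^sup>2)
     = bE p I (\<lambda>A. \<Sum>j\<in>J. \<Sum>j'\<in>J. g j A * g j' A)"
    by (simp add: power2_eq_square sum_product)
  also have "\<dots> = (\<Sum>j\<in>J. \<Sum>j'\<in>J. bE p I (\<lambda>A. g j A * g j' A))"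
    by (simp add: bE_sum)
  also have "\<dots> \<le> (\<Sum>j\<in>J. \<Sum>j'\<in>J. if B j \<inter> B j' \<noteq> {} then 4 * M\<^sup>2 else 0)"
    using pair by (intro sum_mono) auto
  also have "\<dots> = (\<Sum>j\<in>J. 4 * M\<^sup>2 * real (card {j' \<in> J. B j \<inter> B j' \<noteq> {}}))"
    using assms(4) by (intro sum.cong refl) (simp add: sum.If_cases Int_def mult.commute)
  also have "\<dots> \<le> (\<Sum>j\<in>J. 4 * M\<^sup>2 * real N)"
    using ct by (intro sum_mono mult_left_mono) auto
  also have "\<dots> = 4 * M\<^sup>2 * real (card J) * real N" by simp
  finally show ?thesis .
qed

text \<open>The factors \<open>z i\<close> are the centred bits or, once the bits of a block have been doubled, the
  differences of the two copies of a bit.\<close>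

locale indep_family =
  fixes p :: real and I :: "'b set" and Pt :: "'a set" and z :: "'a \<Rightarrow> 'b set \<Rightarrow> real" and b :: "'a \<Rightarrow> 'b set"
  assumes fin_I: "finite I" and p0: "0 \<le> p" and p1: "p \<le> 1"
    and z_dep: "\<And>i. i \<in> Pt \<Longrightarrow> dep (z i) (b i)"
    and b_disj: "\<And>i j. i \<in> Pt \<Longrightarrow> j \<in> Pt \<Longrightarrow> i \<noteq> j \<Longrightarrow> b i \<inter> b j = {}"
    and z_le: "\<And>i A. \<bar>z i A\<bar> \<le> 1"
    and z_mean: "\<And>i. i \<in> Pt \<Longrightarrow> bE p I (z i) = 0"
begin

definition zm :: "'a set \<Rightarrow> 'b set \<Rightarrow> real" where "zm T A = (\<Prod>i\<in>T. z i A)"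

lemma zm_le: "\<bar>zm T A\<bar> \<le> 1"
  unfolding zm_def abs_prod by (rule prod_le_1) (use z_le in auto)

lemma dep_zm: "T \<subseteq> Pt \<Longrightarrow> dep (zm T) (\<Union>i\<in>T. b i)"
  unfolding zm_def by (rule dep_prod) (use z_dep in auto)

text \<open>The factor \<open>z w\<close> occurs nowhere else in the product, so it splits off and
  has mean zero. The orthogonality relations below are instances of this.\<close>

lemma mean_zm_zero:
  assumes "finite T" "T \<subseteq> Pt" "w \<in> T" "dep h (\<Union>i\<in>W. b i)" "W \<subseteq> Pt" "w \<notin> W"
  shows "bE p I (\<lambda>A. h A * zm T A) = 0"
proof -
  have d: "b w \<inter> (\<Union>i\<in>W. b i) = {}" "b w \<inter> (\<Union>i\<in>T - {w}. b i) = {}"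
    using assms b_disj[of w] by blast+
  have "zm T A = z w A * zm (T - {w}) A" for A
    unfolding zm_def using assms by (simp add: prod.remove)
  then have "bE p I (\<lambda>A. h A * zm T A) = bE p I (\<lambda>A. z w A * (h A * zm (T - {w}) A))"
    by (simp add: mult_ac)
  also have "\<dots> = bE p I (z w) * bE p I (\<lambda>A. h A * zm (T - {w}) A)"
    using assms d by (intro bE_indep[OF fin_I z_dep dep_mult[OF assms(4) dep_zm]]) auto
  finally show ?thesis using z_mean assms by auto
qed

text \<open>Near-orthogonality: the product of the terms at \<open>j\<close> and \<open>j'\<close>
  has mean zero as soon as some point of \<open>Z j'\<close> lies outside \<open>Z j\<close> and
  \<open>W j\<close>. The coefficient \<open>h j'\<close> may depend on the points of
  \<open>W j'\<close>; keeping these apart from \<open>Z j'\<close> ensures that the lone point is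
  not seen by its own coefficient.\<close>

lemma square_sum_le:
  assumes "finite J" "0 \<le> M"
    and Z: "\<And>j. j \<in> J \<Longrightarrow> finite (Z j) \<and> Z j \<subseteq> Pt"
    and W: "\<And>j. j \<in> J \<Longrightarrow> W j \<subseteq> Pt \<and> W j \<inter> Z j = {}"
    and h: "\<And>j. j \<in> J \<Longrightarrow> dep (h j) (\<Union>i\<in>W j. b i)"
    and hb: "\<And>j A. j \<in> J \<Longrightarrow> \<bar>h j A\<bar> \<le> M"
    and ct: "\<And>j. j \<in> J \<Longrightarrow> card {j' \<in> J. Z j' \<subseteq> Z j \<union> W j} \<le> N"
  shows "bE p I (\<lambda>A. (\<Sum>j\<in>J. h j A * zm (Z j) A)\<^sup>2) \<le> M\<^sup>2 * real (card J) * real N"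
proof -
  define f where "f j A = h j A * zm (Z j) A" for j A
  have fb: "\<bar>f j A\<bar> \<le> M" if "j \<in> J" for j A
    using mult_mono[OF hb[OF that, of A] zm_le[of "Z j" A]] assms(2) by (simp add: f_def abs_mult)
  have pair: "bE p I (\<lambda>A. f j A * f j' A) \<le> (if Z j' \<subseteq> Z j \<union> W j then M\<^sup>2 else 0)"
    if j: "j \<in> J" "j' \<in> J" for j j'
  proof (cases "Z j' \<subseteq> Z j \<union> W j")
    case False
    then obtain w where w: "w \<in> Z j'" "w \<notin> Z j \<union> W j" by auto
    have "dep (\<lambda>A. h j' A * f j A) (\<Union>i\<in>W j' \<union> (W j \<union> Z j). b i)"
      unfolding f_def UN_Un using Z h j by (intro dep_mult dep_zm) auto
    then have "bE p I (\<lambda>A. (h j' A * f j A) * zm (Z j') A) = 0"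
      using w Z[OF j(1)] Z[OF j(2)] W[OF j(1)] W[OF j(2)] by (intro mean_zm_zero[of _ w _ "W j' \<union> (W j \<union> Z j)"]) auto
    then show ?thesis using False by (simp add: f_def mult_ac)
  next
    case True
    have "f j A * f j' A \<le> M * M" for A
    proof -
      have "f j A * f j' A \<le> \<bar>f j A\<bar> * \<bar>f j' A\<bar>" by (simp flip: abs_mult)
      also have "\<dots> \<le> M * M"
        using fb[OF j(1)] fb[OF j(2)] assms(2) by (intro mult_mono) auto
      finally show ?thesis .
    qed
    then have "bE p I (\<lambda>A. f j A * f j' A) \<le> M * M"
      by (intro bE_le_const fin_I p0 p1) auto
    then show ?thesis using True by (simp add: power2_eq_square)
  qed
  have "bE p I (\<lambda>A. (\<Sum>j\<in>J. f j A)\<^sup>2) = (\<Sum>j\<in>J. \<Sum>j'\<in>J. bE p I (\<lambda>A. f j A * f j' A))"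
    by (simp add: power2_eq_square sum_product bE_sum)
  also have "\<dots> \<le> (\<Sum>j\<in>J. \<Sum>j'\<in>J. if Z j' \<subseteq> Z j \<union> W j then M\<^sup>2 else 0)"
    using pair by (intro sum_mono) auto
  also have "\<dots> = (\<Sum>j\<in>J. M\<^sup>2 * real (card {j' \<in> J. Z j' \<subseteq> Z j \<union> W j}))"
    using assms(1) by (intro sum.cong refl) (simp add: sum.If_cases Int_def mult.commute)
  also have "\<dots> \<le> (\<Sum>j\<in>J. M\<^sup>2 * real N)"
    using ct by (intro sum_mono mult_left_mono) auto
  finally show ?thesis by (simp add: f_def mult_ac)
qed

end

definition ind :: "nat \<Rightarrow> nat set \<Rightarrow> real" where "ind i A = (if i \<in> A then 1 else 0)"

text \<open>One notation for both kinds of monomials: \<open>s = 0\<close> gives products of raw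
  bits, \<open>s = p\<close> products of centred bits.\<close>

definition mon :: "real \<Rightarrow> nat set \<Rightarrow> nat set \<Rightarrow> real" where "mon s T A = (\<Prod>i\<in>T. ind i A - s)"

lemma bE_ind: "finite I \<Longrightarrow> i \<in> I \<Longrightarrow> bE p I (ind i) = p"
proof -
  assume "finite I" "i \<in> I"
  then have "bE p I (ind i) = bE p {i} (ind i)"
    by (subst bE_dep[of I "ind i" "{i}"]) (auto simp: dep_def ind_def)
  also have "\<dots> = p" using bE_insert[of "{}" i p "ind i"] by (simp add: ind_def)
  finally show ?thesis .
qed

lemma dg_ind: "dg 1 (\<lambda>A. ind i A - s)"
proof -
  have "ind i = (\<lambda>A. if {i} \<subseteq> A then 1 else 0)" by (auto simp: ind_def)
  then show ?thesis using dg_diff[OF dg_mono[of "{i}" 1] dg_const[of 1 s]] by simp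
qed

lemma dg_mon: "finite T \<Longrightarrow> card T \<le> D \<Longrightarrow> dg D (mon s T)"
proof -
  assume T: "finite T" "card T \<le> D"
  have "mon s T = (\<lambda>A. \<Prod>i\<in>T. ind i A - s)" by (auto simp: mon_def)
  then show ?thesis using dg_le[OF dg_prod[of T "\<lambda>i A. ind i A - s"] T(2)] dg_ind T(1) by simp
qed

lemma mon_abs_le: "0 \<le> s \<Longrightarrow> s \<le> 1 \<Longrightarrow> \<bar>mon s T A\<bar> \<le> 1"
  unfolding mon_def abs_prod by (rule prod_le_1) (auto simp: ind_def)

lemma bits_family:
  assumes "0 \<le> p" "p \<le> 1"
  shows "indep_family p {..<n} {..<n} (\<lambda>i A. ind i A - p) (\<lambda>i. {i})"
proof
  show "bE p {..<n} (\<lambda>A. ind i A - p) = 0" if "i \<in> {..<n}" for i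
    using that bE_ind[of "{..<n}" i p] by (simp add: bE_diff)
qed (use assms in \<open>auto simp: dep_def ind_def\<close>)

lemma bits_zm: "0 \<le> p \<Longrightarrow> p \<le> 1 \<Longrightarrow> indep_family.zm (\<lambda>i A. ind i A - p) = mon p"
  by (intro ext) (simp add: indep_family.zm_def[OF bits_family] mon_def)

section \<open>Progressions and flags\<close>

text \<open>The \<open>k\<close>-term progressions modulo \<open>n\<close> enter the argument only through the fact that any two of their
  positions determine them: every ordered pair of distinct residues occurs exactly once at any two
  given positions.\<close>

locale progressions =
  fixes n k :: nat and AP :: "'a set" and e :: "nat \<Rightarrow> 'a \<Rightarrow> nat"
  assumes fin_AP: "finite AP" and k3: "3 \<le> k"
    and pair_bij: "\<And>i j. i < k \<Longrightarrow> j < k \<Longrightarrow> i \<noteq> j \<Longrightarrow>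
      bij_betw (\<lambda>a. (e i a, e j a)) AP {(w, w'). w < n \<and> w' < n \<and> w \<noteq> w'}"
begin

lemma e_pair: "a \<in> AP \<Longrightarrow> i < k \<Longrightarrow> j < k \<Longrightarrow> i \<noteq> j \<Longrightarrow> e i a < n \<and> e j a < n \<and> e i a \<noteq> e j a"
  using bij_betwE[OF pair_bij, of i j] by fastforce

lemma ex_other: "\<exists>j<k. j \<noteq> i"
  using k3 by (intro exI[of _ "if i = 0 then 1 else 0"]) auto

lemma e_less: "a \<in> AP \<Longrightarrow> i < k \<Longrightarrow> e i a < n"
  using e_pair ex_other by blast

lemma e_inj: "a \<in> AP \<Longrightarrow> inj_on (\<lambda>j. e j a) {..<k}"
  using e_pair by (fastforce simp: inj_on_def)

lemma e_det: "a \<in> AP \<Longrightarrow> a' \<in> AP \<Longrightarrow> i < k \<Longrightarrow> j < k \<Longrightarrow> i \<noteq> j \<Longrightarrow> e i a = e i a' \<Longrightarrow> e j a = e j a' \<Longrightarrow> a = a'"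
  using bij_betw_imp_inj_on[OF pair_bij, of i j] by (auto simp: inj_on_def)

lemma e_ex: "i < k \<Longrightarrow> j < k \<Longrightarrow> i \<noteq> j \<Longrightarrow> w < n \<Longrightarrow> w' < n \<Longrightarrow> w \<noteq> w' \<Longrightarrow> \<exists>a\<in>AP. e i a = w \<and> e j a = w'"
proof -
  assume "i < k" "j < k" "i \<noteq> j" and w: "w < n" "w' < n" "w \<noteq> w'"
  then have "(\<lambda>a. (e i a, e j a)) ` AP = {(w, w'). w < n \<and> w' < n \<and> w \<noteq> w'}"
    using bij_betw_imp_surj_on[OF pair_bij, of i j] by simp
  then have "(w, w') \<in> (\<lambda>a. (e i a, e j a)) ` AP" using w by simp
  then show ?thesis by auto
qed

section \<open>Incidence counts for points and progressions\<close>

definition pts :: "'a \<Rightarrow> nat set" where "pts a = (\<lambda>j. e j a) ` {..<k}"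

lemma finite_pts [simp]: "finite (pts a)" by (simp add: pts_def)

lemma pts_less: "a \<in> AP \<Longrightarrow> pts a \<subseteq> {..<n}"
  by (auto simp: pts_def e_less)

lemma card_pts_le: "card (pts a) \<le> k"
  unfolding pts_def using card_image_le[of "{..<k}" "\<lambda>j. e j a"] by simp

lemma card_AP_pos: "i < k \<Longrightarrow> card {a \<in> AP. e i a = w} \<le> n"
proof -
  assume i: "i < k"
  obtain j where j: "j < k" "j \<noteq> i" using ex_other by blast
  have "inj_on (\<lambda>a. e j a) {a \<in> AP. e i a = w}"
    using e_det[of _ _ i j] i j by (auto simp: inj_on_def)
  moreover have "(\<lambda>a. e j a) ` {a \<in> AP. e i a = w} \<subseteq> {..<n}" using e_less j by auto
  ultimately show ?thesis by (metis card_inj_on_le card_lessThan finite_lessThan)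
qed

lemma card_AP_le: "card AP \<le> n\<^sup>2"
proof -
  have "card AP = card {(w, w'). w < n \<and> w' < n \<and> w \<noteq> w'}"
    using k3 by (intro bij_betw_same_card[OF pair_bij[of 0 1]]) auto
  also have "\<dots> \<le> card ({..<n} \<times> {..<n})" by (intro card_mono) auto
  finally show ?thesis by (simp add: power2_eq_square)
qed

lemma card_AP_point: "card {a \<in> AP. w \<in> pts a} \<le> k * n"
proof -
  have "{a \<in> AP. w \<in> pts a} = (\<Union>i\<in>{..<k}. {a \<in> AP. e i a = w})" by (auto simp: pts_def)
  then have "card {a \<in> AP. w \<in> pts a} \<le> (\<Sum>i<k. card {a \<in> AP. e i a = w})"
    by (simp add: card_UN_le)
  also have "\<dots> \<le> (\<Sum>i<k. n)" using card_AP_pos by (intro sum_mono) auto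
  finally show ?thesis by simp
qed

text \<open>Two distinct points at two given positions determine the progression, and there are
  \<open>k^2\<close> ordered pairs of positions; one position cannot hold two distinct
  points.\<close>

lemma card_AP_two_points: "w \<noteq> w' \<Longrightarrow> card {a \<in> AP. w \<in> pts a \<and> w' \<in> pts a} \<le> k\<^sup>2"
proof -
  assume ne: "w \<noteq> w'"
  have "{a \<in> AP. w \<in> pts a \<and> w' \<in> pts a} = (\<Union>(i,j)\<in>{..<k} \<times> {..<k}. {a \<in> AP. e i a = w \<and> e j a = w'})"
    by (auto simp: pts_def)
  then have "card {a \<in> AP. w \<in> pts a \<and> w' \<in> pts a}
      \<le> (\<Sum>x\<in>{..<k} \<times> {..<k}. card (case x of (i,j) \<Rightarrow> {a \<in> AP. e i a = w \<and> e j a = w'}))"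
    using card_UN_le[of "{..<k} \<times> {..<k}" "\<lambda>x. case x of (i,j) \<Rightarrow> {a \<in> AP. e i a = w \<and> e j a = w'}"] by simp
  also have "\<dots> \<le> (\<Sum>x\<in>{..<k} \<times> {..<k}. 1)"
  proof (intro sum_mono)
    fix x assume "x \<in> {..<k} \<times> {..<k}"
    then obtain i j where x: "x = (i, j)" "i < k" "j < k" by auto
    have "card {a \<in> AP. e i a = w \<and> e j a = w'} \<le> 1"
    proof (cases "i = j")
      case True
      then have "{a \<in> AP. e i a = w \<and> e j a = w'} = {}" using ne by auto
      then show ?thesis by (metis card.empty zero_le)
    next
      case False
      have "a = a'" if "a \<in> {a \<in> AP. e i a = w \<and> e j a = w'}" "a' \<in> {a \<in> AP. e i a = w \<and> e j a = w'}" for a a'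
        using e_det[of a a' i j] that x False by auto
      then show ?thesis using card_le_Suc0_iff_eq[of "{a \<in> AP. e i a = w \<and> e j a = w'}"] fin_AP by auto
    qed
    then show "card (case x of (i,j) \<Rightarrow> {a \<in> AP. e i a = w \<and> e j a = w'}) \<le> 1" using x by simp
  qed
  finally show ?thesis by (simp add: power2_eq_square)
qed

text \<open>A flag \<open>(a, S, i)\<close> is a monomial of \<open>YY\<close> below, given by a progression \<open>a\<close> and a set \<open>S\<close> of positions,
  with a distinguished position \<open>i\<close>; its base \<open>fb\<close> is the point at \<open>i\<close> and \<open>fT\<close> collects the other points.\<close>

definition flags :: "('a \<times> nat set \<times> nat) set" where
  "flags = {(a, S, i). a \<in> AP \<and> S \<subseteq> {..<k} \<and> 3 \<le> card S \<and> i \<in> S}"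

definition fb :: "'a \<times> nat set \<times> nat \<Rightarrow> nat" where "fb t = (case t of (a, S, i) \<Rightarrow> e i a)"

definition fT :: "'a \<times> nat set \<times> nat \<Rightarrow> nat set" where
  "fT t = (case t of (a, S, i) \<Rightarrow> (\<lambda>j. e j a) ` (S - {i}))"

text \<open>A common constant for all counts: \<open>2 ^ k * k\<close> bounds the choices of
  \<open>S\<close> and \<open>i\<close> over one progression, and \<open>k^2\<close> counts the
  positions of two prescribed points.\<close>

definition KK :: nat where "KK = 2 ^ k * k ^ 3"

lemma card_flags_over:
  assumes "finite Q"
  shows "finite {t \<in> flags. fst t \<in> Q}" "card {t \<in> flags. fst t \<in> Q} \<le> 2 ^ k * k * card Q"
proof -
  have sub: "{t \<in> flags. fst t \<in> Q} \<subseteq> Q \<times> Pow {..<k} \<times> {..<k}"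
    by (auto simp: flags_def)
  moreover have "finite (Q \<times> Pow {..<k} \<times> {..<k})" using assms by simp
  ultimately show "finite {t \<in> flags. fst t \<in> Q}" by (rule finite_subset)
  have "card {t \<in> flags. fst t \<in> Q} \<le> card (Q \<times> Pow {..<k} \<times> {..<k})"
    using sub assms by (intro card_mono) auto
  then show "card {t \<in> flags. fst t \<in> Q} \<le> 2 ^ k * k * card Q"
    by (simp add: card_cartesian_product card_Pow mult_ac)
qed

lemma fst_flags: "t \<in> flags \<Longrightarrow> fst t \<in> AP" by (auto simp: flags_def)

lemma finite_flags [simp]: "finite flags"
proof -
  have "flags = {t \<in> flags. fst t \<in> AP}" using fst_flags by auto
  then show ?thesis using card_flags_over(1)[OF fin_AP] by simp
qed

lemma card_flags: "card flags \<le> KK * n\<^sup>2"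
proof -
  have "flags = {t \<in> flags. fst t \<in> AP}" using fst_flags by auto
  then have "card flags \<le> 2 ^ k * k * card AP" using card_flags_over(2)[OF fin_AP] by simp
  also have "\<dots> \<le> KK * n\<^sup>2"
  proof -
    have "k \<le> k ^ 3" using k3 by (simp add: self_le_power)
    then show ?thesis unfolding KK_def using card_AP_le by (intro mult_le_mono) auto
  qed
  finally show ?thesis .
qed

lemma card_flags_point: "card {t \<in> flags. w \<in> pts (fst t)} \<le> KK * n"
proof -
  have "{t \<in> flags. w \<in> pts (fst t)} = {t \<in> flags. fst t \<in> {a \<in> AP. w \<in> pts a}}"
    using fst_flags by auto
  then have "card {t \<in> flags. w \<in> pts (fst t)} \<le> 2 ^ k * k * card {a \<in> AP. w \<in> pts a}"
    using card_flags_over(2)[of "{a \<in> AP. w \<in> pts a}"] fin_AP by simp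
  also have "\<dots> \<le> 2 ^ k * k * (k * n)" by (intro mult_le_mono card_AP_point order_refl)
  also have "\<dots> \<le> KK * n" unfolding KK_def power3_eq_cube using k3 by simp
  finally show ?thesis .
qed

lemma card_flags_two_points: "w \<noteq> w' \<Longrightarrow> card {t \<in> flags. w \<in> pts (fst t) \<and> w' \<in> pts (fst t)} \<le> KK"
proof -
  assume ne: "w \<noteq> w'"
  have "{t \<in> flags. w \<in> pts (fst t) \<and> w' \<in> pts (fst t)} = {t \<in> flags. fst t \<in> {a \<in> AP. w \<in> pts a \<and> w' \<in> pts a}}"
    using fst_flags by auto
  then have "card {t \<in> flags. w \<in> pts (fst t) \<and> w' \<in> pts (fst t)} \<le> 2 ^ k * k * card {a \<in> AP. w \<in> pts a \<and> w' \<in> pts a}"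
    using card_flags_over(2)[of "{a \<in> AP. w \<in> pts a \<and> w' \<in> pts a}"] fin_AP by simp
  also have "\<dots> \<le> 2 ^ k * k * k\<^sup>2" by (intro mult_le_mono card_AP_two_points ne order_refl)
  also have "\<dots> = KK" by (simp add: KK_def power3_eq_cube power2_eq_square)
  finally show ?thesis .
qed

lemma flag_pts: "t \<in> flags \<Longrightarrow> insert (fb t) (fT t) \<subseteq> pts (fst t)"
  by (auto simp: flags_def fb_def fT_def pts_def)

lemma flag_less: "t \<in> flags \<Longrightarrow> fb t < n \<and> fT t \<subseteq> {..<n}"
  using flag_pts pts_less fst_flags by blast

lemma flag_notin: "t \<in> flags \<Longrightarrow> fb t \<notin> fT t"
proof -
  assume "t \<in> flags"
  then obtain a S i where t: "t = (a, S, i)" "a \<in> AP" "S \<subseteq> {..<k}" "i \<in> S" by (auto simp: flags_def)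
  then show ?thesis using inj_onD[OF e_inj[of a]] by (fastforce simp: fb_def fT_def)
qed

lemma finite_fT [simp]: "t \<in> flags \<Longrightarrow> finite (fT t)"
  using flag_less finite_subset by blast

lemma card_fT: "t \<in> flags \<Longrightarrow> 2 \<le> card (fT t) \<and> card (fT t) < k"
proof -
  assume "t \<in> flags"
  then obtain a S i where t: "t = (a, S, i)" "a \<in> AP" "S \<subseteq> {..<k}" "3 \<le> card S" "i \<in> S" by (auto simp: flags_def)
  have fS: "finite S" using t finite_subset by blast
  have "card (fT t) = card (S - {i})" unfolding t fT_def prod.case
    by (intro card_image inj_on_subset[OF e_inj[OF t(2)]]) (use t in auto)
  also have "\<dots> = card S - 1" using t by (simp add: card_Diff_singleton)
  finally show ?thesis using t card_mono[OF finite_lessThan t(3)] by auto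
qed

lemma fT_two: "t \<in> flags \<Longrightarrow> \<exists>w\<in>fT t. \<exists>w'\<in>fT t. w \<noteq> w'"
proof -
  assume t: "t \<in> flags"
  then have "\<not> card (fT t) \<le> Suc 0" using card_fT[OF t] by simp
  then show ?thesis using card_le_Suc0_iff_eq[OF finite_fT[OF t]] by blast
qed

lemma fT_other: "t \<in> flags \<Longrightarrow> \<exists>w\<in>fT t. w \<noteq> v"
  using fT_two by metis

text \<open>As \<open>card S\<close> is at least three, \<open>fT t\<close> contains two distinct
  points, and these leave at most \<open>KK\<close> flags. This is how the absence of terms of
  degree one and two enters the counts.\<close>

lemma card_flags_within:
  assumes "finite Q"
  shows "card {t \<in> flags. fT t \<subseteq> Q} \<le> KK * (card Q)\<^sup>2"
proof -
  let ?F = "\<lambda>x. {t \<in> flags. fst x \<noteq> snd x \<and> fst x \<in> pts (fst t) \<and> snd x \<in> pts (fst t)}"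
  have "{t \<in> flags. fT t \<subseteq> Q} \<subseteq> (\<Union>x\<in>Q \<times> Q. ?F x)"
  proof
    fix t assume t: "t \<in> {t \<in> flags. fT t \<subseteq> Q}"
    then obtain w w' where "w \<in> fT t" "w' \<in> fT t" "w \<noteq> w'" using fT_two by blast
    moreover have "fT t \<subseteq> pts (fst t)" using flag_pts t by auto
    ultimately show "t \<in> (\<Union>x\<in>Q \<times> Q. ?F x)" using t by (intro UN_I[of "(w, w')"]) auto
  qed
  then have "card {t \<in> flags. fT t \<subseteq> Q} \<le> card (\<Union>x\<in>Q \<times> Q. ?F x)"
    using assms by (intro card_mono) auto
  also have "\<dots> \<le> (\<Sum>x\<in>Q \<times> Q. card (?F x))" using assms by (intro card_UN_le) auto
  also have "\<dots> \<le> (\<Sum>x\<in>Q \<times> Q. KK)"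
  proof (intro sum_mono)
    fix x show "card (?F x) \<le> KK"
      using card_flags_two_points[of "fst x" "snd x"] by (cases "fst x = snd x") auto
  qed
  finally show ?thesis by (simp add: power2_eq_square card_cartesian_product mult_ac)
qed

text \<open>Every progression occurs in \<open>AP\<close> together with its reversal, whence the factor one half. \<open>YY\<close> is the part of
  degree at least three of the expansion of \<open>XX\<close> in the centred bits.\<close>

definition XX :: "nat set \<Rightarrow> real" where "XX A = (\<Sum>a\<in>AP. mon 0 (pts a) A) / 2"

definition shapes :: "nat set set" where "shapes = {S. S \<subseteq> {..<k} \<and> 3 \<le> card S}"

definition YY :: "real \<Rightarrow> nat set \<Rightarrow> real" where
  "YY p A = (\<Sum>a\<in>AP. \<Sum>S\<in>shapes. p ^ (k - card S) / 2 * mon p ((\<lambda>j. e j a) ` S) A)"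

lemma finite_shapes [simp]: "finite shapes"
  by (rule finite_subset[of _ "Pow {..<k}"]) (auto simp: shapes_def)

lemma mon_image: "a \<in> AP \<Longrightarrow> S \<subseteq> {..<k} \<Longrightarrow> mon s ((\<lambda>j. e j a) ` S) A = (\<Prod>j\<in>S. ind (e j a) A - s)"
  unfolding mon_def by (subst prod.reindex[OF inj_on_subset[OF e_inj]]) auto

lemma mon_expand:
  assumes "a \<in> AP"
  shows "mon 0 (pts a) A = (\<Sum>S\<in>Pow {..<k}. p ^ (k - card S) * mon p ((\<lambda>j. e j a) ` S) A)"
proof -
  have "mon 0 (pts a) A = (\<Prod>j<k. (ind (e j a) A - p) + p)"
    unfolding pts_def using mon_image[OF assms, of "{..<k}" 0 A] by simp
  also have "\<dots> = (\<Sum>S\<in>Pow {..<k}. (\<Prod>j\<in>S. ind (e j a) A - p) * (\<Prod>j\<in>{..<k} - S. p))"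
    by (rule prod_add) simp
  also have "\<dots> = (\<Sum>S\<in>Pow {..<k}. p ^ (k - card S) * mon p ((\<lambda>j. e j a) ` S) A)"
  proof (intro sum.cong refl)
    fix S assume "S \<in> Pow {..<k}"
    moreover from this have "card ({..<k} - S) = k - card S"
      by (subst card_Diff_subset) (auto intro: finite_subset)
    ultimately show "(\<Prod>j\<in>S. ind (e j a) A - p) * (\<Prod>j\<in>{..<k} - S. p) = p ^ (k - card S) * mon p ((\<lambda>j. e j a) ` S) A"
      using mon_image[OF assms, of S p A] by simp
  qed
  finally show ?thesis .
qed

lemma sum_ind_slice: "A \<in> slc n m \<Longrightarrow> 0 < n \<Longrightarrow> p = real m / real n \<Longrightarrow> (\<Sum>i<n. ind i A - p) = 0"
proof -
  assume A: "A \<in> slc n m" "0 < n" "p = real m / real n"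
  have "(\<Sum>i<n. ind i A) = real (card ({..<n} \<inter> A))"
    unfolding ind_def by (simp add: sum.If_cases)
  also have "{..<n} \<inter> A = A" using A by (auto simp: slc_def)
  finally show ?thesis using A by (simp add: sum_subtractf slc_def)
qed

text \<open>On a slice the components of degree at most two are constant.\<close>

lemma XX_eq_YY:
  assumes "0 < n" "m \<le> n" "p = real m / real n"
  shows "\<exists>c. \<forall>A\<in>slc n m. XX A = YY p A + c"
proof -
  have low: "\<exists>c. \<forall>A\<in>slc n m. (\<Sum>a\<in>AP. mon p ((\<lambda>j. e j a) ` S) A) = c"
    if S: "S \<subseteq> {..<k}" "\<not> 3 \<le> card S" for S
  proof -
    have fS: "finite S" using S finite_subset by blast
    let ?D = "{(w, w'). w < n \<and> w' < n \<and> w \<noteq> w'}"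
    have D: "?D = (SIGMA w:{..<n}. {..<n} - {w})" by auto
    consider "card S = 0" | "card S = 1" | "card S = 2" using S by linarith
    then show ?thesis
    proof cases
      case 1
      then have "S = {}" using fS by simp
      then show ?thesis by (intro exI[of _ "real (card AP)"]) (simp add: mon_def)
    next
      case 2
      then obtain i where i: "S = {i}" by (auto simp: card_1_singleton_iff)
      obtain j where j: "j < k" "j \<noteq> i" using ex_other by blast
      \<comment> \<open>All residues occur equally often at position \<open>i\<close>, so this is a
        multiple of the sum of the centred bits, which vanishes on the slice.\<close>
      have "(\<Sum>a\<in>AP. mon p ((\<lambda>j. e j a) ` S) A) = 0" if A: "A \<in> slc n m" for A
      proof -
        have "(\<Sum>a\<in>AP. mon p ((\<lambda>j. e j a) ` S) A) = (\<Sum>a\<in>AP. (\<lambda>(w,w'). ind w A - p) (e i a, e j a))"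
          by (simp add: i mon_def)
        also have "\<dots> = (\<Sum>(w,w')\<in>?D. ind w A - p)"
          using S i j by (intro sum.reindex_bij_betw pair_bij) auto
        also have "\<dots> = (\<Sum>w<n. \<Sum>w'\<in>{..<n} - {w}. ind w A - p)"
          unfolding D by (subst sum.Sigma) auto
        also have "\<dots> = (\<Sum>w<n. (real n - 1) * (ind w A - p))"
          using assms(1) by (intro sum.cong) (auto simp: card_Diff_singleton of_nat_diff)
        also have "\<dots> = 0" using sum_ind_slice[OF A assms(1,3)] by (simp flip: sum_distrib_left)
        finally show ?thesis .
      qed
      then show ?thesis by blast
    next
      case 3
      then obtain i j where ij: "S = {i, j}" "i \<noteq> j" by (auto simp: card_2_iff)
      have "(\<Sum>a\<in>AP. mon p ((\<lambda>j. e j a) ` S) A) = - (real m * (1 - p)\<^sup>2 + (real n - real m) * p\<^sup>2)" if A: "A \<in> slc n m" for A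
      proof -
        have ijk: "i < k" "j < k" using S ij by auto
        have "(\<Sum>a\<in>AP. mon p ((\<lambda>j. e j a) ` S) A) = (\<Sum>a\<in>AP. (\<lambda>(w,w'). (ind w A - p) * (ind w' A - p)) (e i a, e j a))"
        proof (intro sum.cong refl)
          fix a assume "a \<in> AP"
          then have "e i a \<noteq> e j a" using e_pair ij ijk by blast
          then show "mon p ((\<lambda>j. e j a) ` S) A = (\<lambda>(w,w'). (ind w A - p) * (ind w' A - p)) (e i a, e j a)"
            by (simp add: ij mon_def)
        qed
        also have "\<dots> = (\<Sum>(w,w')\<in>?D. (ind w A - p) * (ind w' A - p))"
          using ijk ij by (intro sum.reindex_bij_betw pair_bij) auto
        also have "\<dots> = (\<Sum>w<n. \<Sum>w'\<in>{..<n} - {w}. (ind w A - p) * (ind w' A - p))"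
          unfolding D by (subst sum.Sigma) auto
        \<comment> \<open>The sum over all \<open>w'\<close> vanishes on the slice, so leaving out
          \<open>w' = w\<close> leaves minus the diagonal term.\<close>
        also have "\<dots> = (\<Sum>w<n. - (ind w A - p)\<^sup>2)"
        proof (intro sum.cong refl)
          fix w assume w: "w \<in> {..<n}"
          have "(\<Sum>w'\<in>{..<n} - {w}. (ind w A - p) * (ind w' A - p))
             = (ind w A - p) * ((\<Sum>w'<n. ind w' A - p) - (ind w A - p))"
            using w by (simp add: sum_diff1 flip: sum_distrib_left)
          then show "(\<Sum>w'\<in>{..<n} - {w}. (ind w A - p) * (ind w' A - p)) = - (ind w A - p)\<^sup>2"
            using sum_ind_slice[OF A assms(1,3)] by (simp add: power2_eq_square algebra_simps)
        qed
        also have "\<dots> = - (\<Sum>w<n. if w \<in> A then (1 - p)\<^sup>2 else p\<^sup>2)"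
          by (subst sum_negf, intro arg_cong[of _ _ uminus] sum.cong) (auto simp: ind_def)
        also have "(\<Sum>w<n. if w \<in> A then (1 - p)\<^sup>2 else p\<^sup>2) = real m * (1 - p)\<^sup>2 + (real n - real m) * p\<^sup>2"
        proof -
          have "{..<n} \<inter> A = A" "{..<n} \<inter> - A = {..<n} - A" using A by (auto simp: slc_def)
          moreover have "card ({..<n} - A) = n - m"
            using A by (subst card_Diff_subset) (auto simp: slc_def intro: finite_subset)
          moreover have "card A = m" using A by (simp add: slc_def)
          ultimately show ?thesis using assms(2) by (simp add: sum.If_cases of_nat_diff)
        qed
        finally show ?thesis .
      qed
      then show ?thesis by blast
    qed
  qed
  define L where "L = {S. S \<subseteq> {..<k} \<and> \<not> 3 \<le> card S}"
  have "\<forall>S. \<exists>c. S \<in> L \<longrightarrow> (\<forall>A\<in>slc n m. (\<Sum>a\<in>AP. mon p ((\<lambda>j. e j a) ` S) A) = c)"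
    using low unfolding L_def by blast
  then obtain c where c: "\<And>S A. S \<in> L \<Longrightarrow> A \<in> slc n m \<Longrightarrow> (\<Sum>a\<in>AP. mon p ((\<lambda>j. e j a) ` S) A) = c S"
    by metis
  have P: "Pow {..<k} = shapes \<union> L" "shapes \<inter> L = {}" "finite L"
    by (auto simp: shapes_def L_def intro: finite_subset[of _ "Pow {..<k}"])
  have "XX A = YY p A + (\<Sum>S\<in>L. p ^ (k - card S) / 2 * c S)" if A: "A \<in> slc n m" for A
  proof -
    have "XX A = (\<Sum>a\<in>AP. \<Sum>S\<in>Pow {..<k}. p ^ (k - card S) / 2 * mon p ((\<lambda>j. e j a) ` S) A)"
      unfolding XX_def sum_divide_distrib
      by (intro sum.cong refl) (simp add: mon_expand[of _ _ p] sum_divide_distrib)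
    also have "\<dots> = YY p A + (\<Sum>a\<in>AP. \<Sum>S\<in>L. p ^ (k - card S) / 2 * mon p ((\<lambda>j. e j a) ` S) A)"
      unfolding P(1) YY_def using P by (subst sum.union_disjoint) (auto simp: sum.distrib)
    also have "(\<Sum>a\<in>AP. \<Sum>S\<in>L. p ^ (k - card S) / 2 * mon p ((\<lambda>j. e j a) ` S) A)
       = (\<Sum>S\<in>L. p ^ (k - card S) / 2 * c S)"
      by (subst sum.swap, intro sum.cong refl) (simp only: c[OF _ A] sum_distrib_left[symmetric])
    finally show ?thesis .
  qed
  then show ?thesis by blast
qed

end

section \<open>A Stein identity on the slice\<close>

lemma ind_swap: "ind i (Transposition.transpose u v ` A) = ind (Transposition.transpose u v i) A"
proof -
  have "i \<in> Transposition.transpose u v ` A \<longleftrightarrow> Transposition.transpose u v i \<in> A"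
    by (metis image_iff transpose_involutory)
  then show ?thesis by (simp add: ind_def)
qed

lemma mon_swap: "mon s T (Transposition.transpose u v ` A) = mon s (Transposition.transpose u v ` T) A"
  unfolding mon_def ind_swap by (simp add: prod.reindex[OF inj_on_subset[OF inj_transpose]])

lemma transpose_image_both:
  assumes "u \<in> T \<longleftrightarrow> v \<in> T"
  shows "Transposition.transpose u v ` T = T"
proof -
  have sub: "Transposition.transpose u v ` T \<subseteq> T"
    using assms by (auto simp: Transposition.transpose_def)
  moreover have "T = Transposition.transpose u v ` (Transposition.transpose u v ` T)"
    by (simp add: image_image)
  ultimately show ?thesis by (metis image_mono subset_antisym)
qed

lemma mon_swap_diff:
  assumes "finite T" "u \<in> T" "v \<notin> T"
  shows "mon s (Transposition.transpose u v ` T) A - mon s T A = (ind v A - ind u A) * mon s (T - {u}) A"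
proof -
  have "Transposition.transpose u v ` T = insert v (T - {u})"
    using assms by (auto simp: Transposition.transpose_def image_iff)
  moreover have "T = insert u (T - {u})" using assms by auto
  ultimately have "mon s (Transposition.transpose u v ` T) A = (ind v A - s) * mon s (T - {u}) A"
    "mon s T A = (ind u A - s) * mon s (T - {u}) A"
    using assms unfolding mon_def by (simp_all add: prod.remove[of T u])
  then show ?thesis by (simp add: algebra_simps)
qed

locale slice_progressions = progressions n k AP e for n k :: nat and AP :: "'a set" and e +
  fixes m :: nat
  assumes m_pos: "0 < m" and m_less: "m < n"
begin

definition p :: real where "p = real m / real n"

lemma n_pos: "0 < n" using m_pos m_less by simp
lemma p_pos: "0 < p" and p_less: "p < 1" using m_pos m_less by (auto simp: p_def)
lemma p_bounds [simp]: "0 \<le> p" "p \<le> 1" using p_pos p_less by auto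

definition cf :: "'a \<times> nat set \<times> nat \<Rightarrow> real" where
  "cf t = (case t of (a, S, i) \<Rightarrow> p ^ (k - card S) / 2)"

text \<open>A monomial with position set \<open>S\<close> carries \<open>card S\<close> flags.\<close>

definition cg :: "'a \<times> nat set \<times> nat \<Rightarrow> real" where
  "cg t = (case t of (a, S, i) \<Rightarrow> p ^ (k - card S) / 2 / real (card S))"

lemma cf_bounds: "0 \<le> cf t" "cf t \<le> 1"
proof -
  obtain a S i where t: "t = (a, S, i)" by (cases t) auto
  have "p ^ (k - card S) \<le> 1" by (simp add: power_le_one)
  then show "0 \<le> cf t" "cf t \<le> 1" by (auto simp: cf_def t)
qed

lemma cg_bounds: "t \<in> flags \<Longrightarrow> 0 \<le> cg t \<and> cg t \<le> 1"
proof -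
  assume "t \<in> flags"
  then obtain a S i where t: "t = (a, S, i)" "3 \<le> card S" by (auto simp: flags_def)
  have "p ^ (k - card S) / 2 / real (card S) \<le> p ^ (k - card S) / 2"
  proof -
    have "1 * p ^ (k - card S) \<le> real (card S) * p ^ (k - card S)"
      using t by (intro mult_right_mono) auto
    then show ?thesis using t by (simp add: divide_le_eq mult_ac)
  qed
  then show ?thesis using cf_bounds[of t] t by (auto simp: cf_def cg_def)
qed

lemma sum_flags: "(\<Sum>t\<in>flags. f t) = (\<Sum>a\<in>AP. \<Sum>S\<in>shapes. \<Sum>i\<in>S. f (a, S, i))"
proof -
  have fS: "finite S" if "S \<in> shapes" for S using that by (auto simp: shapes_def intro: finite_subset)
  have "flags = (SIGMA a:AP. SIGMA S:shapes. S)" by (auto simp: flags_def shapes_def)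
  moreover have "(\<Sum>S\<in>shapes. \<Sum>i\<in>S. f (a, S, i)) = (\<Sum>y\<in>(SIGMA S:shapes. S). f (a, y))" for a
    using fS by (subst sum.Sigma) (auto simp: split_def)
  ultimately show ?thesis by (simp add: sum.cartesian_product)
qed

text \<open>Euler's identity: a monomial is recovered from its derivatives by summing over its
  points and dividing by the degree, and \<open>cg\<close> contains this division.\<close>

lemma YY_flags: "YY p A = (\<Sum>t\<in>flags. cg t * (ind (fb t) A - p) * mon p (fT t) A)"
proof -
  have eq: "(\<Sum>i\<in>S. cg (a, S, i) * (ind (fb (a, S, i)) A - p) * mon p (fT (a, S, i)) A)
     = p ^ (k - card S) / 2 * mon p ((\<lambda>j. e j a) ` S) A" if "a \<in> AP" "S \<in> shapes" for a S
  proof -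
    have S: "S \<subseteq> {..<k}" "finite S" "card S > 0"
      using that by (auto simp: shapes_def intro: finite_subset)
    have "(\<Sum>i\<in>S. cg (a, S, i) * (ind (fb (a, S, i)) A - p) * mon p (fT (a, S, i)) A)
      = (\<Sum>i\<in>S. p ^ (k - card S) / 2 / real (card S) * mon p ((\<lambda>j. e j a) ` S) A)"
    proof (intro sum.cong refl)
      fix i assume i: "i \<in> S"
      have "mon p ((\<lambda>j. e j a) ` S) A = (ind (e i a) A - p) * mon p ((\<lambda>j. e j a) ` (S - {i})) A"
        using mon_image[OF that(1) S(1), of p A] mon_image[OF that(1), of "S - {i}" p A] S i
        by (simp add: prod.remove subset_iff)
      then show "cg (a, S, i) * (ind (fb (a, S, i)) A - p) * mon p (fT (a, S, i)) A
         = p ^ (k - card S) / 2 / real (card S) * mon p ((\<lambda>j. e j a) ` S) A"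
        by (simp add: cg_def fb_def fT_def)
    qed
    then show ?thesis using S by (auto simp: card_gt_0_iff)
  qed
  show ?thesis unfolding sum_flags YY_def by (intro sum.cong refl) (rule eq[symmetric]; assumption)
qed

text \<open>For \<open>u \<noteq> v\<close> this is the discrete derivative of \<open>YY p\<close>
  in the bit at \<open>u\<close>, restricted to monomials that avoid \<open>v\<close>.\<close>

definition PP :: "nat \<Rightarrow> nat \<Rightarrow> nat set \<Rightarrow> real" where
  "PP u v A = (\<Sum>t\<in>{t \<in> flags. fb t = u \<and> v \<notin> fT t}. cf t * mon p (fT t) A)"

text \<open>The same restricted derivative as \<open>PP\<close>, with each monomial weighted by the
  reciprocal of its degree.\<close>

definition DD :: "nat \<Rightarrow> nat \<Rightarrow> nat set \<Rightarrow> real" where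
  "DD u v A = (\<Sum>t\<in>{t \<in> flags. fb t = u \<and> v \<notin> fT t}. cg t * mon p (fT t) A)"

text \<open>A residue sits at no more than one position of a progression, so summing over flags with
  base \<open>u\<close> amounts to summing over monomials that contain \<open>u\<close>.\<close>

lemma PP_shapes:
  assumes "u \<noteq> v"
  shows "PP u v A = (\<Sum>a\<in>AP. \<Sum>S\<in>shapes. if u \<in> (\<lambda>j. e j a) ` S \<and> v \<notin> (\<lambda>j. e j a) ` S
    then p ^ (k - card S) / 2 * mon p ((\<lambda>j. e j a) ` S - {u}) A else 0)"
proof -
  have "PP u v A = (\<Sum>t\<in>flags. if fb t = u \<and> v \<notin> fT t then cf t * mon p (fT t) A else 0)"
    unfolding PP_def by (subst sum.inter_filter) auto
  also have "\<dots> = (\<Sum>a\<in>AP. \<Sum>S\<in>shapes. \<Sum>i\<in>S. if e i a = u \<and> v \<notin> (\<lambda>j. e j a) ` (S - {i})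
      then p ^ (k - card S) / 2 * mon p ((\<lambda>j. e j a) ` (S - {i})) A else 0)"
    unfolding sum_flags by (simp only: fb_def fT_def cf_def prod.case)
  also have "\<dots> = (\<Sum>a\<in>AP. \<Sum>S\<in>shapes. if u \<in> (\<lambda>j. e j a) ` S \<and> v \<notin> (\<lambda>j. e j a) ` S
    then p ^ (k - card S) / 2 * mon p ((\<lambda>j. e j a) ` S - {u}) A else 0)"
  proof (intro sum.cong refl)
    fix a S assume aS: "a \<in> AP" "S \<in> shapes"
    then have S: "S \<subseteq> {..<k}" "finite S" by (auto simp: shapes_def intro: finite_subset)
    have inj: "inj_on (\<lambda>j. e j a) S" using inj_on_subset[OF e_inj[OF aS(1)] S(1)] .
    let ?g = "\<lambda>i. if e i a = u \<and> v \<notin> (\<lambda>j. e j a) ` (S - {i})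
      then p ^ (k - card S) / 2 * mon p ((\<lambda>j. e j a) ` (S - {i})) A else 0"
    let ?r = "if u \<in> (\<lambda>j. e j a) ` S \<and> v \<notin> (\<lambda>j. e j a) ` S
      then p ^ (k - card S) / 2 * mon p ((\<lambda>j. e j a) ` S - {u}) A else 0"
    show "(\<Sum>i\<in>S. ?g i) = ?r"
    proof (cases "u \<in> (\<lambda>j. e j a) ` S")
      case False
      then have "?g i = 0" if "i \<in> S" for i using that by auto
      then have "(\<Sum>i\<in>S. ?g i) = 0" by (intro sum.neutral) blast
      then show ?thesis using False by simp
    next
      case True
      then obtain i0 where i0: "i0 \<in> S" "e i0 a = u" by auto
      have im: "(\<lambda>j. e j a) ` (S - {i0}) = (\<lambda>j. e j a) ` S - {u}"
        using i0 inj by (auto simp: inj_on_def)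
      have "?g i = (if i = i0 then ?r else 0)" if "i \<in> S" for i
      proof (cases "i = i0")
        case True
        then show ?thesis using i0 im assms \<open>u \<in> _ ` S\<close> by auto
      next
        case False
        then have "e i a \<noteq> u" using i0 that inj by (auto simp: inj_on_def)
        then show ?thesis using False by simp
      qed
      then have "(\<Sum>i\<in>S. ?g i) = (\<Sum>i\<in>S. if i = i0 then ?r else 0)" by (intro sum.cong) blast+
      then show ?thesis using i0 S by simp
    qed
  qed
  finally show ?thesis .
qed

text \<open>Only monomials containing exactly one of \<open>u\<close> and \<open>v\<close> are moved
  by the swap; exchanging that point multiplies the derivative by the difference of the two
  bits.\<close>

lemma YY_swap:
  assumes "u \<noteq> v"
  shows "YY p (Transposition.transpose u v ` A) - YY p A = (ind v A - ind u A) * (PP u v A - PP v u A)"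
proof -
  have "YY p (Transposition.transpose u v ` A) - YY p A
    = (\<Sum>a\<in>AP. \<Sum>S\<in>shapes. p ^ (k - card S) / 2 *
       (mon p (Transposition.transpose u v ` ((\<lambda>j. e j a) ` S)) A - mon p ((\<lambda>j. e j a) ` S) A))"
    unfolding YY_def mon_swap by (simp add: sum_subtractf right_diff_distrib)
  also have "\<dots> = (\<Sum>a\<in>AP. \<Sum>S\<in>shapes. (ind v A - ind u A) *
     ((if u \<in> (\<lambda>j. e j a) ` S \<and> v \<notin> (\<lambda>j. e j a) ` S
        then p ^ (k - card S) / 2 * mon p ((\<lambda>j. e j a) ` S - {u}) A else 0)
    - (if v \<in> (\<lambda>j. e j a) ` S \<and> u \<notin> (\<lambda>j. e j a) ` S
        then p ^ (k - card S) / 2 * mon p ((\<lambda>j. e j a) ` S - {v}) A else 0)))"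
  proof (intro sum.cong refl)
    fix a S assume aS: "a \<in> AP" "S \<in> shapes"
    let ?T = "(\<lambda>j. e j a) ` S"
    have fT: "finite ?T" using aS by (auto simp: shapes_def intro: finite_subset)
    consider "u \<in> ?T \<longleftrightarrow> v \<in> ?T" | "u \<in> ?T" "v \<notin> ?T" | "v \<in> ?T" "u \<notin> ?T" by blast
    then show "p ^ (k - card S) / 2 * (mon p (Transposition.transpose u v ` ?T) A - mon p ?T A)
      = (ind v A - ind u A) *
     ((if u \<in> ?T \<and> v \<notin> ?T then p ^ (k - card S) / 2 * mon p (?T - {u}) A else 0)
    - (if v \<in> ?T \<and> u \<notin> ?T then p ^ (k - card S) / 2 * mon p (?T - {v}) A else 0))"
    proof cases
      case 1
      then show ?thesis using transpose_image_both[of u ?T v] by auto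
    next
      case 2
      then show ?thesis using mon_swap_diff[OF fT 2, of p A] by simp
    next
      case 3
      have "mon p (Transposition.transpose u v ` ?T) A - mon p ?T A = (ind u A - ind v A) * mon p (?T - {v}) A"
        using mon_swap_diff[OF fT 3, of p A] by (simp only: transpose_commute)
      moreover have "c * ((x - y) * w) = (y - x) * (0 - c * w)" for c x y w :: real
        by (simp add: algebra_simps)
      ultimately show ?thesis using 3 by (simp only: if_True if_False simp_thms)
    qed
  qed
  also have "\<dots> = (ind v A - ind u A) * (PP u v A - PP v u A)"
    using assms by (simp add: PP_shapes sum_subtractf sum_distrib_left[symmetric])
  finally show ?thesis .
qed

text \<open>The flags in \<open>DD u v\<close> avoid \<open>v\<close> by definition and
  \<open>u\<close> because a base is not among the other points. For this invariance the terms with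
  \<open>v\<close> in \<open>fT t\<close> have to be set aside.\<close>

lemma DD_swap:
  assumes "u < n" "v < n"
  shows "DD u v (Transposition.transpose u v ` A) = DD u v A"
  unfolding DD_def mon_swap
proof (intro sum.cong refl)
  fix t assume t: "t \<in> {t \<in> flags. fb t = u \<and> v \<notin> fT t}"
  then have "u \<notin> fT t" "v \<notin> fT t" using flag_notin[of t] by auto
  then show "cg t * mon p (Transposition.transpose u v ` fT t) A = cg t * mon p (fT t) A"
    using transpose_image_both[of u "fT t" v] by simp
qed

definition Xi :: "nat set \<Rightarrow> real" where
  "Xi A = (\<Sum>t\<in>flags. \<Sum>v\<in>fT t. cg t * (ind (fb t) A - ind v A) * mon p (fT t) A) / real n"

text \<open>The Stein kernel: the swap term of the identity for the choice \<open>f = YY p\<close>,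
  before averaging. It plays the role of a random variance.\<close>

definition Gam :: "nat set \<Rightarrow> real" where
  "Gam A = (\<Sum>u<n. \<Sum>v<n. (ind u A - ind v A)\<^sup>2 * DD u v A * (PP u v A - PP v u A)) / (2 * real n)"

lemma slice_center:
  assumes "A \<in> slc n m"
  shows "real n * (ind u A - p) = (\<Sum>v<n. ind u A - ind v A)"
  using sum_ind_slice[OF assms n_pos p_def] n_pos by (simp add: sum_subtractf algebra_simps)

text \<open>On the slice \<open>n * (x u - p)\<close> is the sum of \<open>x u - x v\<close> over all \<open>v\<close>. The terms with \<open>v\<close> among the points of
  the flag make up \<open>Xi\<close>; all others are antisymmetrised under the swap of \<open>u\<close> and \<open>v\<close>.\<close>

lemma stein_identity:
  fixes f :: "nat set \<Rightarrow> complex"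
  shows "sE n m (\<lambda>A. YY p A * f A) = sE n m (\<lambda>A. Xi A * f A)
    + (\<Sum>u<n. \<Sum>v<n. sE n m (\<lambda>A. complex_of_real ((ind u A - ind v A) * DD u v A) * (f A - f (Transposition.transpose u v ` A)))) / (2 * of_nat n)"
proof -
  define T where "T u v A = complex_of_real ((ind u A - ind v A) * DD u v A) * f A" for u v A
  have YY: "of_nat n * (YY p A * f A) = of_nat n * (Xi A * f A) + (\<Sum>u<n. \<Sum>v<n. T u v A)"
    if A: "A \<in> slc n m" for A
  proof -
    have "real n * YY p A = (\<Sum>t\<in>flags. cg t * (real n * (ind (fb t) A - p)) * mon p (fT t) A)"
      unfolding YY_flags sum_distrib_left by (simp add: mult_ac)
    also have "\<dots> = (\<Sum>t\<in>flags. \<Sum>v<n. cg t * (ind (fb t) A - ind v A) * mon p (fT t) A)"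
      unfolding slice_center[OF A] by (simp add: sum_distrib_left sum_distrib_right)
    also have "\<dots> = (\<Sum>t\<in>flags. (\<Sum>v\<in>fT t. cg t * (ind (fb t) A - ind v A) * mon p (fT t) A)
        + (\<Sum>v<n. if v \<notin> fT t then cg t * (ind (fb t) A - ind v A) * mon p (fT t) A else 0))"
    proof (intro sum.cong refl)
      fix t assume t: "t \<in> flags"
      have U: "{..<n} = fT t \<union> ({..<n} - fT t)" using flag_less[OF t] by auto
      have "(\<Sum>v<n. if v \<notin> fT t then cg t * (ind (fb t) A - ind v A) * mon p (fT t) A else 0)
         = (\<Sum>v\<in>{..<n} - fT t. cg t * (ind (fb t) A - ind v A) * mon p (fT t) A)"
        by (subst sum.inter_filter[symmetric]) (auto intro!: sum.cong)
      then show "(\<Sum>v<n. cg t * (ind (fb t) A - ind v A) * mon p (fT t) A) =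
        (\<Sum>v\<in>fT t. cg t * (ind (fb t) A - ind v A) * mon p (fT t) A)
        + (\<Sum>v<n. if v \<notin> fT t then cg t * (ind (fb t) A - ind v A) * mon p (fT t) A else 0)"
        using t by (subst U, subst sum.union_disjoint) auto
    qed
    also have "\<dots> = real n * Xi A + (\<Sum>t\<in>flags. \<Sum>v<n. if v \<notin> fT t then cg t * (ind (fb t) A - ind v A) * mon p (fT t) A else 0)"
      using n_pos by (simp add: sum.distrib Xi_def)
    also have "(\<Sum>t\<in>flags. \<Sum>v<n. if v \<notin> fT t then cg t * (ind (fb t) A - ind v A) * mon p (fT t) A else 0)
       = (\<Sum>u<n. \<Sum>v<n. (ind u A - ind v A) * DD u v A)"
    proof -
      have "(\<Sum>u<n. \<Sum>v<n. (ind u A - ind v A) * DD u v A)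
        = (\<Sum>u<n. \<Sum>v<n. \<Sum>t\<in>flags. if fb t = u \<and> v \<notin> fT t then cg t * (ind u A - ind v A) * mon p (fT t) A else 0)"
        unfolding DD_def sum_distrib_left by (subst sum.inter_filter) (auto simp: mult_ac intro!: sum.cong)
      also have "\<dots> = (\<Sum>t\<in>flags. \<Sum>u<n. \<Sum>v<n. if fb t = u \<and> v \<notin> fT t then cg t * (ind u A - ind v A) * mon p (fT t) A else 0)"
      proof -
        have "(\<Sum>u<n. \<Sum>v<n. \<Sum>t\<in>flags. g u v t) = (\<Sum>t\<in>flags. \<Sum>u<n. \<Sum>v<n. g u v t)" for g :: "nat \<Rightarrow> nat \<Rightarrow> _ \<Rightarrow> real"
          by (simp only: sum.swap[of _ flags "{..<n}"])
        then show ?thesis .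
      qed
      also have "\<dots> = (\<Sum>t\<in>flags. \<Sum>u<n. if u = fb t then (\<Sum>v<n. if v \<notin> fT t then cg t * (ind (fb t) A - ind v A) * mon p (fT t) A else 0) else 0)"
        by (intro sum.cong refl) (auto intro!: sum.neutral)
      also have "\<dots> = (\<Sum>t\<in>flags. \<Sum>v<n. if v \<notin> fT t then cg t * (ind (fb t) A - ind v A) * mon p (fT t) A else 0)"
      proof (rule sum.cong[OF refl])
        fix t assume "t \<in> flags"
        then have "fb t < n" using flag_less by blast
        then show "(\<Sum>u<n. if u = fb t then (\<Sum>v<n. if v \<notin> fT t then cg t * (ind (fb t) A - ind v A) * mon p (fT t) A else 0) else 0)
          = (\<Sum>v<n. if v \<notin> fT t then cg t * (ind (fb t) A - ind v A) * mon p (fT t) A else 0)"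
          by (simp only: sum.delta finite_lessThan lessThan_iff if_True)
      qed
      finally show ?thesis by simp
    qed
    finally have "complex_of_real (real n * YY p A) = complex_of_real (real n * Xi A + (\<Sum>u<n. \<Sum>v<n. (ind u A - ind v A) * DD u v A))"
      by (rule arg_cong)
    then have "complex_of_real (real n * YY p A) * f A = complex_of_real (real n * Xi A + (\<Sum>u<n. \<Sum>v<n. (ind u A - ind v A) * DD u v A)) * f A"
      by simp
    then have "(of_nat n * YY p A) * f A = (of_nat n * Xi A) * f A + complex_of_real (\<Sum>u<n. \<Sum>v<n. (ind u A - ind v A) * DD u v A) * f A"
      by (simp only: of_real_add distrib_right of_real_mult of_real_of_nat_eq)
    moreover have "complex_of_real (\<Sum>u<n. \<Sum>v<n. (ind u A - ind v A) * DD u v A) * f A = (\<Sum>u<n. \<Sum>v<n. T u v A)"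
      unfolding T_def by (simp only: of_real_sum sum_distrib_right)
    ultimately show ?thesis by (simp only: mult.assoc of_real_mult of_real_of_nat_eq)
  qed
  \<comment> \<open>The swap preserves the average and \<open>DD u v\<close>, and it changes the
    sign of \<open>ind u A - ind v A\<close>; averaging a term with its swapped version gives the
    difference of \<open>f\<close> and the factor one half.\<close>
  have sw: "sE n m (T u v) = sE n m (\<lambda>A. complex_of_real ((ind u A - ind v A) * DD u v A) * (f A - f (Transposition.transpose u v ` A))) / 2"
    if "u < n" "v < n" for u v
  proof -
    have "sE n m (\<lambda>A. complex_of_real ((ind u A - ind v A) * DD u v A) * f (Transposition.transpose u v ` A))
       = sE n m (\<lambda>A. - T u v (Transposition.transpose u v ` A))"
      by (intro sE_cong) (simp add: T_def ind_swap DD_swap[OF that] algebra_simps)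
    also have "\<dots> = - sE n m (T u v)"
      using sE_scale[of n m "-1" "\<lambda>A. T u v (Transposition.transpose u v ` A)"] sE_swap[OF that, of m "T u v"] by simp
    finally have "sE n m (\<lambda>A. complex_of_real ((ind u A - ind v A) * DD u v A) * (f A - f (Transposition.transpose u v ` A)))
      = sE n m (T u v) - (- sE n m (T u v))"
      unfolding right_diff_distrib[of "complex_of_real _"] sE_diff T_def by simp
    then show ?thesis by simp
  qed
  have "of_nat n * sE n m (\<lambda>A. YY p A * f A) = of_nat n * sE n m (\<lambda>A. Xi A * f A) + (\<Sum>u<n. \<Sum>v<n. sE n m (T u v))"
    unfolding sE_cmult[symmetric] sE_sum[symmetric] sE_add[symmetric] using YY by (intro sE_cong)
  also have "(\<Sum>u<n. \<Sum>v<n. sE n m (T u v))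
    = (\<Sum>u<n. \<Sum>v<n. sE n m (\<lambda>A. complex_of_real ((ind u A - ind v A) * DD u v A) * (f A - f (Transposition.transpose u v ` A)))) / 2"
    unfolding sum_divide_distrib using sw by (intro sum.cong refl) auto
  finally show ?thesis using n_pos by (simp add: field_simps)
qed

lemma stein_square: "sE n m (\<lambda>A. (YY p A)\<^sup>2) = sE n m (\<lambda>A. Xi A * YY p A) + sE n m Gam"
proof -
  have "complex_of_real (sE n m (\<lambda>A. (YY p A)\<^sup>2)) = sE n m (\<lambda>A. YY p A * complex_of_real (YY p A))"
    by (simp add: sE_of_real[symmetric] power2_eq_square)
  also have "\<dots> = sE n m (\<lambda>A. Xi A * complex_of_real (YY p A)) + (\<Sum>u<n. \<Sum>v<n. sE n m (\<lambda>A. complex_of_real ((ind u A - ind v A) * DD u v A) *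
      (complex_of_real (YY p A) - complex_of_real (YY p (Transposition.transpose u v ` A))))) / (2 * of_nat n)"
    by (rule stein_identity)
  also have "(\<Sum>u<n. \<Sum>v<n. sE n m (\<lambda>A. complex_of_real ((ind u A - ind v A) * DD u v A) *
      (complex_of_real (YY p A) - complex_of_real (YY p (Transposition.transpose u v ` A)))))
     = (\<Sum>u<n. \<Sum>v<n. sE n m (\<lambda>A. complex_of_real ((ind u A - ind v A)\<^sup>2 * DD u v A * (PP u v A - PP v u A))))"
  proof (intro sum.cong refl sE_cong)
    fix u v A
    show "complex_of_real ((ind u A - ind v A) * DD u v A) *
      (complex_of_real (YY p A) - complex_of_real (YY p (Transposition.transpose u v ` A)))
      = complex_of_real ((ind u A - ind v A)\<^sup>2 * DD u v A * (PP u v A - PP v u A))"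
    proof (cases "u = v")
      case False
      then have "YY p A - YY p (Transposition.transpose u v ` A) = (ind u A - ind v A) * (PP u v A - PP v u A)"
        using YY_swap[of u v A] by (simp add: algebra_simps)
      then show ?thesis by (simp add: power2_eq_square mult_ac flip: of_real_diff of_real_mult)
    qed simp
  qed
  also have "(\<Sum>u<n. \<Sum>v<n. sE n m (\<lambda>A. complex_of_real ((ind u A - ind v A)\<^sup>2 * DD u v A * (PP u v A - PP v u A)))) / (2 * of_nat n)
     = complex_of_real (sE n m Gam)"
  proof -
    have "Gam = (\<lambda>A. (1 / (2 * real n)) * (\<Sum>u<n. \<Sum>v<n. (ind u A - ind v A)\<^sup>2 * DD u v A * (PP u v A - PP v u A)))"
      by (auto simp: Gam_def)
    then have "sE n m Gam = (\<Sum>u<n. \<Sum>v<n. sE n m (\<lambda>A. (ind u A - ind v A)\<^sup>2 * DD u v A * (PP u v A - PP v u A))) / (2 * real n)"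
      by (simp only: sE_cmult sE_sum) simp
    then show ?thesis by (simp only: sE_of_real) simp
  qed
  also have "sE n m (\<lambda>A. Xi A * complex_of_real (YY p A)) = complex_of_real (sE n m (\<lambda>A. Xi A * YY p A))"
    by (simp flip: sE_of_real)
  finally show ?thesis by (metis of_real_add of_real_eq_iff)
qed

text \<open>For the constant function \<open>1\<close> all swap differences vanish.\<close>

lemma stein_mean: "sE n m (YY p) = sE n m Xi"
proof -
  have "complex_of_real (sE n m (YY p)) = complex_of_real (sE n m Xi)"
    using stein_identity[of "\<lambda>_. 1"] by (simp add: sE_of_real sE_def)
  then show ?thesis by simp
qed

lemma cis_taylor: "norm (1 - cis x + \<i> * of_real x) \<le> x\<^sup>2 / 2"
proof -
  have "norm (exp (\<i> * of_real x) - (\<Sum>j\<le>1. (\<i> * of_real x) ^ j / fact j)) \<le> \<bar>x\<bar> ^ Suc 1 / fact (Suc 1)"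
    using iexp_approx1[of x 1] by simp
  then have "norm (cis x - (1 + \<i> * of_real x)) \<le> x\<^sup>2 / 2"
    by (simp add: cis_conv_exp power2_eq_square)
  moreover have "1 - cis x + \<i> * of_real x = - (cis x - (1 + \<i> * of_real x))" by simp
  ultimately show ?thesis by (simp only: norm_minus_cancel)
qed

text \<open>A swap multiplies \<open>cis (s * YY p A)\<close> by a phase with increment
  \<open>s * dl u v A\<close>. Its linear term produces \<open>Gam\<close>; the quadratic Taylor
  remainder leaves an error of third order in the derivatives.\<close>

lemma stein_cis:
  defines "dl \<equiv> \<lambda>u v A. (ind v A - ind u A) * (PP u v A - PP v u A)"
  shows "norm (sE n m (\<lambda>A. YY p A * cis (s * YY p A)) - sE n m (\<lambda>A. Xi A * cis (s * YY p A))
     - \<i> * s * sE n m (\<lambda>A. Gam A * cis (s * YY p A)))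
    \<le> s\<^sup>2 / (4 * real n) * (\<Sum>u<n. \<Sum>v<n. sE n m (\<lambda>A. \<bar>DD u v A\<bar> * (dl u v A)\<^sup>2))"
proof -
  let ?t = "\<lambda>u v A. Transposition.transpose u v ` A"
  let ?f = "\<lambda>A. cis (s * YY p A)"
  define G where "G u v A = (ind u A - ind v A)\<^sup>2 * DD u v A * (PP u v A - PP v u A)" for u v A
  define R where "R u v A = complex_of_real ((ind u A - ind v A) * DD u v A) * ((?f A - ?f (?t u v A)))
     - \<i> * s * (complex_of_real (G u v A) * ?f A)" for u v A
  have R: "norm (R u v A) \<le> s\<^sup>2 / 2 * (\<bar>DD u v A\<bar> * (dl u v A)\<^sup>2)" for u v A
  proof (cases "u = v")
    case True
    then show ?thesis by (simp add: R_def G_def)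
  next
    case False
    have Y: "YY p (?t u v A) = YY p A + dl u v A"
      using YY_swap[OF False, of A] by (simp add: dl_def)
    have G: "G u v A = - ((ind u A - ind v A) * DD u v A * dl u v A)"
      by (simp add: G_def dl_def power2_eq_square algebra_simps)
    have "R u v A = complex_of_real ((ind u A - ind v A) * DD u v A) * ?f A * (1 - cis (s * dl u v A) + \<i> * of_real (s * dl u v A))"
      unfolding R_def Y G by (simp add: distrib_left cis_mult[symmetric] algebra_simps)
    then have "norm (R u v A) = \<bar>ind u A - ind v A\<bar> * \<bar>DD u v A\<bar> * norm (1 - cis (s * dl u v A) + \<i> * of_real (s * dl u v A))"
      by (simp only: norm_mult norm_of_real abs_mult norm_cis mult_1_right)
    also have "\<dots> \<le> 1 * \<bar>DD u v A\<bar> * ((s * dl u v A)\<^sup>2 / 2)"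
      by (intro mult_mono cis_taylor) (auto simp: ind_def)
    finally show ?thesis by (simp add: power_mult_distrib mult_ac)
  qed
  have Gm: "sE n m (\<lambda>A. Gam A * ?f A) = (\<Sum>u<n. \<Sum>v<n. sE n m (\<lambda>A. G u v A * ?f A)) / (2 * of_nat n)"
  proof -
    have "Gam A * ?f A = (1 / (2 * of_nat n)) * (\<Sum>u<n. \<Sum>v<n. complex_of_real (G u v A) * ?f A)" for A
      by (simp add: Gam_def G_def sum_distrib_right)
    then show ?thesis by (simp only: sE_cmult sE_sum) simp
  qed
  have "sE n m (\<lambda>A. YY p A * ?f A) - sE n m (\<lambda>A. Xi A * ?f A) - \<i> * s * sE n m (\<lambda>A. Gam A * ?f A)
     = (\<Sum>u<n. \<Sum>v<n. sE n m (R u v)) / (2 * of_nat n)"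
    unfolding stein_identity[of ?f] Gm R_def sE_diff sE_cmult[of _ _ "\<i> * s"]
    by (simp add: sum_subtractf diff_divide_distrib sum_distrib_left)
  then have "norm (sE n m (\<lambda>A. YY p A * ?f A) - sE n m (\<lambda>A. Xi A * ?f A) - \<i> * s * sE n m (\<lambda>A. Gam A * ?f A))
     = norm (\<Sum>u<n. \<Sum>v<n. sE n m (R u v)) / (2 * real n)"
    by (simp add: norm_divide norm_mult)
  also have "\<dots> \<le> (\<Sum>u<n. \<Sum>v<n. s\<^sup>2 / 2 * sE n m (\<lambda>A. \<bar>DD u v A\<bar> * (dl u v A)\<^sup>2)) / (2 * real n)"
  proof (intro divide_right_mono sum_norm_le)
    fix u v
    have "norm (sE n m (R u v)) \<le> sE n m (\<lambda>A. norm (R u v A))" by (rule sE_norm)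
    also have "\<dots> \<le> sE n m (\<lambda>A. s\<^sup>2 / 2 * (\<bar>DD u v A\<bar> * (dl u v A)\<^sup>2))" by (intro sE_mono R)
    finally show "norm (sE n m (R u v)) \<le> s\<^sup>2 / 2 * sE n m (\<lambda>A. \<bar>DD u v A\<bar> * (dl u v A)\<^sup>2)"
      by (simp only: sE_cmult)
  qed simp
  also have "\<dots> = s\<^sup>2 / (4 * real n) * (\<Sum>u<n. \<Sum>v<n. sE n m (\<lambda>A. \<bar>DD u v A\<bar> * (dl u v A)\<^sup>2))"
    by (simp only: sum_distrib_left[symmetric]) (simp add: field_simps)
  finally show ?thesis .
qed

end

section \<open>Concentration of the Stein coefficients\<close>

lemma card_Sigma_le:
  assumes "finite A" "card A \<le> a" "\<And>x. x \<in> A \<Longrightarrow> finite (B x) \<and> card (B x) \<le> b"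
  shows "card (Sigma A B) \<le> a * b"
proof -
  have "card (Sigma A B) = (\<Sum>x\<in>A. card (B x))" using assms by (intro card_SigmaI) auto
  also have "\<dots> \<le> (\<Sum>x\<in>A. b)" using assms by (intro sum_mono) auto
  also have "\<dots> \<le> a * b" using assms by simp
  finally show ?thesis .
qed

lemma card_triples_le:
  assumes "S \<subseteq> (SIGMA x:A. SIGMA y:B x. C x y)" "finite A" "card A \<le> a"
    "\<And>x. x \<in> A \<Longrightarrow> finite (B x) \<and> card (B x) \<le> b"
    "\<And>x y. x \<in> A \<Longrightarrow> y \<in> B x \<Longrightarrow> finite (C x y) \<and> card (C x y) \<le> c"
  shows "card S \<le> a * (b * c)"
proof -
  have in1: "finite (SIGMA y:B x. C x y) \<and> card (SIGMA y:B x. C x y) \<le> b * c" if "x \<in> A" for x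
    using that assms by (intro conjI card_Sigma_le finite_SigmaI) auto
  have "finite (SIGMA x:A. SIGMA y:B x. C x y)"
    by (rule finite_SigmaI[OF assms(2)]) (use in1 in blast)
  then have "card S \<le> card (SIGMA x:A. SIGMA y:B x. C x y)"
    using assms(1) by (rule card_mono)
  also have "\<dots> \<le> a * (b * c)" using assms(2,3) in1 by (intro card_Sigma_le) auto
  finally show ?thesis .
qed

lemma card_triples_swap_le:
  assumes "\<And>x y z. (x, y, z) \<in> S \<Longrightarrow> y \<in> A \<and> x \<in> B y \<and> z \<in> C y x" "finite A" "card A \<le> a"
    "\<And>y. y \<in> A \<Longrightarrow> finite (B y) \<and> card (B y) \<le> b"
    "\<And>y x. y \<in> A \<Longrightarrow> x \<in> B y \<Longrightarrow> finite (C y x) \<and> card (C y x) \<le> c"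
  shows "card S \<le> a * (b * c)"
proof -
  let ?S = "(\<lambda>(x, y, z). (y, x, z)) ` S"
  have "card S = card ?S" by (intro card_image[symmetric]) (auto simp: inj_on_def)
  also have "\<dots> \<le> a * (b * c)"
    using assms by (intro card_triples_le[of ?S A B C]) auto
  finally show ?thesis .
qed

lemma card_Collect_point_le:
  assumes "finite L" "finite Q" "card Q \<le> q" "\<And>w. card {x \<in> L. w \<in> B x} \<le> N"
  shows "card {x \<in> L. Q \<inter> B x \<noteq> {}} \<le> q * N"
proof -
  have "{x \<in> L. Q \<inter> B x \<noteq> {}} = (\<Union>w\<in>Q. {x \<in> L. w \<in> B x})" by auto
  then have "card {x \<in> L. Q \<inter> B x \<noteq> {}} \<le> (\<Sum>w\<in>Q. card {x \<in> L. w \<in> B x})"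
    using assms card_UN_le[of Q "\<lambda>w. {x \<in> L. w \<in> B x}"] by simp
  also have "\<dots> \<le> (\<Sum>w\<in>Q. N)" using assms by (intro sum_mono) auto
  also have "\<dots> \<le> q * N" using assms by simp
  finally show ?thesis .
qed

lemma sum_restrict_triples:
  assumes "finite F" "J \<subseteq> F \<times> F \<times> {..<n::nat}"
  shows "(\<Sum>t\<in>F. \<Sum>t'\<in>F. \<Sum>v<n. if (t, t', v) \<in> J then g (t, t', v) else 0) = (\<Sum>x\<in>J. g x :: real)"
proof -
  have "(\<Sum>t\<in>F. \<Sum>t'\<in>F. \<Sum>v<n. if (t, t', v) \<in> J then g (t, t', v) else 0)
     = (\<Sum>x\<in>F \<times> F \<times> {..<n}. if x \<in> J then g x else 0)"
    by (simp add: sum.cartesian_product split_def cong: if_cong)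
  also have "\<dots> = sum g ((F \<times> F \<times> {..<n}) \<inter> J)"
    using assms(1) by (intro sum.inter_restrict[symmetric]) auto
  also have "(F \<times> F \<times> {..<n}) \<inter> J = J" using assms(2) by auto
  finally show ?thesis .
qed

context slice_progressions
begin

interpretation B: indep_family p "{..<n}" "{..<n}" "\<lambda>i A. ind i A - p" "\<lambda>i. {i}"
  rewrites "indep_family.zm (\<lambda>i A. ind i A - p) = mon p"
  by (rule bits_family) (simp_all add: bits_zm)

lemma card_flags_base: "card {t \<in> flags. fb t = u} \<le> KK * n"
proof -
  have "card {t \<in> flags. fb t = u} \<le> card {t \<in> flags. u \<in> pts (fst t)}"
    using flag_pts by (intro card_mono) auto
  then show ?thesis using card_flags_point[of u] by linarith
qed

lemma card_flags_same: "t \<in> flags \<Longrightarrow> card {t' \<in> flags. fT t' \<subseteq> fT t} \<le> KK * k\<^sup>2"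
proof -
  assume t: "t \<in> flags"
  have "card {t' \<in> flags. fT t' \<subseteq> fT t} \<le> KK * (card (fT t))\<^sup>2"
    using t by (intro card_flags_within) auto
  also have "\<dots> \<le> KK * k\<^sup>2" using card_fT[OF t] by (intro mult_le_mono2 power_mono) auto
  finally show ?thesis .
qed

text \<open>At most \<open>KK * n\<close> flags have the base \<open>u\<close>, and each of their
  monomials correlates with boundedly many others. Hence derivatives have size about the square root
  of \<open>n\<close>, not \<open>n\<close>.\<close>

lemma flag_sum_square:
  assumes "\<And>t. t \<in> flags \<Longrightarrow> \<bar>c t\<bar> \<le> 1" "J \<subseteq> {t \<in> flags. fb t = u}"
  shows "bE p {..<n} (\<lambda>A. (\<Sum>t\<in>J. c t * mon p (fT t) A)\<^sup>2) \<le> real (KK\<^sup>2 * k\<^sup>2) * real n"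
proof -
  have fJ: "finite J" using assms(2) by (rule finite_subset) auto
  have "bE p {..<n} (\<lambda>A. (\<Sum>t\<in>J. c t * mon p (fT t) A)\<^sup>2) \<le> 1\<^sup>2 * real (card J) * real (KK * k\<^sup>2)"
  proof (rule B.square_sum_le[where W = "\<lambda>_. {}"])
    fix t assume t: "t \<in> J"
    then have tf: "t \<in> flags" using assms(2) by auto
    show "finite (fT t) \<and> fT t \<subseteq> {..<n}" using flag_less[OF tf] tf by auto
    have "card {j' \<in> J. fT j' \<subseteq> fT t \<union> {}} \<le> card {t' \<in> flags. fT t' \<subseteq> fT t}"
      using assms(2) by (intro card_mono) auto
    then show "card {j' \<in> J. fT j' \<subseteq> fT t \<union> {}} \<le> KK * k\<^sup>2" using card_flags_same[OF tf] by linarith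
  qed (use fJ assms in \<open>auto simp: subset_iff\<close>)
  also have "\<dots> \<le> 1\<^sup>2 * real (KK * n) * real (KK * k\<^sup>2)"
  proof (intro mult_right_mono mult_left_mono)
    have "card J \<le> card {t \<in> flags. fb t = u}" using assms(2) by (intro card_mono) auto
    then show "real (card J) \<le> real (KK * n)" using card_flags_base[of u] by (simp del: of_nat_mult)
  qed auto
  finally show ?thesis by (simp add: power2_eq_square mult_ac)
qed

lemma PP_square: "bE p {..<n} (\<lambda>A. (PP u v A)\<^sup>2) \<le> real (KK\<^sup>2 * k\<^sup>2) * real n"
  unfolding PP_def using cf_bounds by (intro flag_sum_square[of _ _ u]) auto

lemma DD_square: "bE p {..<n} (\<lambda>A. (DD u v A)\<^sup>2) \<le> real (KK\<^sup>2 * k\<^sup>2) * real n"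
  unfolding DD_def using cg_bounds by (intro flag_sum_square[of _ _ u]) (auto simp: abs_le_iff intro: order_trans)

text \<open>Each summand has mean zero: \<open>fT t\<close> has a point other than \<open>v\<close>,
  and its centred bit occurs alone. The second moment is therefore a variance, of
  \<open>O(n^2)\<close> summands each sharing a bit with \<open>O(n)\<close> others; the division by
  \<open>n\<close> in \<open>Xi\<close> leaves \<open>O(n)\<close>.\<close>

lemma Xi_square: "bE p {..<n} (\<lambda>A. (Xi A)\<^sup>2) \<le> real (4 * k ^ 3 * KK\<^sup>2) * real n"
proof -
  define J where "J = (SIGMA t:flags. fT t)"
  define f where "f x A = cg (fst x) * (ind (fb (fst x)) A - ind (snd x) A) * mon p (fT (fst x)) A" for x A
  have fJ: "finite J" by (simp add: J_def)
  have Xi: "Xi A = (\<Sum>x\<in>J. f x A) / real n" for A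
    unfolding Xi_def J_def f_def by (subst sum.Sigma) (auto simp: split_def)
  have cJ: "card J \<le> KK * n\<^sup>2 * k"
    unfolding J_def using card_fT by (intro card_Sigma_le card_flags) (auto intro: less_imp_le)
  have zero: "bE p {..<n} (f x) = 0" if x: "x \<in> J" for x
  proof -
    obtain t v where tv: "x = (t, v)" "t \<in> flags" "v \<in> fT t" using x by (auto simp: J_def)
    obtain w where w: "w \<in> fT t" "w \<noteq> v" using fT_other[OF tv(2)] by blast
    have "f x = (\<lambda>A. (cg t * (ind (fb t) A - ind v A)) * mon p (fT t) A)" by (auto simp: f_def tv)
    moreover have "dep (\<lambda>A. cg t * (ind (fb t) A - ind v A)) (\<Union>i\<in>{fb t, v}. {i})"
      by (auto simp: dep_def ind_def)
    moreover have "fb t < n" "fT t \<subseteq> {..<n}" "fb t \<notin> fT t" using flag_less[OF tv(2)] flag_notin[OF tv(2)] by auto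
    ultimately show ?thesis using w tv
      by (simp only:) (intro B.mean_zm_zero[of _ w _ "{fb t, v}"], auto)
  qed
  have "bE p {..<n} (\<lambda>A. ((\<Sum>x\<in>J. f x A) - bE p {..<n} (\<lambda>A. \<Sum>x\<in>J. f x A))\<^sup>2)
     \<le> 4 * 1\<^sup>2 * real (card J) * real (k * (k * (KK * n)))"
  proof (rule variance_sum_le[where B = "\<lambda>x. insert (fb (fst x)) (fT (fst x))"])
    fix x assume x: "x \<in> J"
    then obtain t v where tv: "x = (t, v)" "t \<in> flags" "v \<in> fT t" by (auto simp: J_def)
    have "dep (\<lambda>A. (cg t * (ind (fb t) A - ind v A)) * mon p (fT t) A) ({fb t, v} \<union> (\<Union>i\<in>fT t. {i}))"
      using flag_less[OF tv(2)] by (intro dep_mult B.dep_zm) (auto simp: dep_def ind_def)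
    moreover have "{fb t, v} \<union> (\<Union>i\<in>fT t. {i}) = insert (fb (fst x)) (fT (fst x))" using tv by auto
    ultimately show "dep (f x) (insert (fb (fst x)) (fT (fst x)))" by (simp add: f_def[abs_def] tv)
    show "\<bar>f x A\<bar> \<le> 1" for A
    proof -
      have "\<bar>cg t\<bar> * \<bar>ind (fb t) A - ind v A\<bar> * \<bar>mon p (fT t) A\<bar> \<le> 1 * 1 * 1"
        using cg_bounds[OF tv(2)] mon_abs_le[of p "fT t" A] by (intro mult_mono) (auto simp: ind_def)
      then show ?thesis by (simp add: f_def tv abs_mult)
    qed
    show "card {x' \<in> J. insert (fb (fst x)) (fT (fst x)) \<inter> insert (fb (fst x')) (fT (fst x')) \<noteq> {}} \<le> k * (k * (KK * n))"
    proof (rule card_Collect_point_le[OF fJ])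
      show "finite (insert (fb (fst x)) (fT (fst x)))" using tv by simp
      have "insert (fb t) (fT t) \<subseteq> pts (fst t)" using flag_pts[OF tv(2)] .
      then show "card (insert (fb (fst x)) (fT (fst x))) \<le> k"
        using card_mono[OF finite_pts, of "insert (fb t) (fT t)" "fst t"] card_pts_le[of "fst t"] tv by auto
      fix w
      have "{x \<in> J. w \<in> insert (fb (fst x)) (fT (fst x))} \<subseteq> (SIGMA t:{t \<in> flags. w \<in> pts (fst t)}. fT t)"
        using flag_pts by (fastforce simp: J_def)
      then have "card {x \<in> J. w \<in> insert (fb (fst x)) (fT (fst x))} \<le> card (SIGMA t:{t \<in> flags. w \<in> pts (fst t)}. fT t)"
        by (intro card_mono) auto
      also have "\<dots> \<le> (KK * n) * k"
        using card_fT card_flags_point by (intro card_Sigma_le) (auto intro: less_imp_le)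
      finally show "card {x \<in> J. w \<in> insert (fb (fst x)) (fT (fst x))} \<le> k * (KK * n)" by (simp add: mult_ac)
    qed
  qed (use fJ in auto)
  then have "bE p {..<n} (\<lambda>A. (\<Sum>x\<in>J. f x A)\<^sup>2) \<le> 4 * real (card J) * real (k * (k * (KK * n)))"
    using zero by (simp add: bE_sum)
  also have "\<dots> \<le> 4 * real (KK * n\<^sup>2 * k) * real (k * (k * (KK * n)))"
  proof (intro mult_right_mono mult_left_mono)
    show "real (card J) \<le> real (KK * n\<^sup>2 * k)" using cJ by (simp only: of_nat_le_iff)
  qed auto
  finally have "bE p {..<n} (\<lambda>A. (\<Sum>x\<in>J. f x A)\<^sup>2) \<le> real (4 * k ^ 3 * KK\<^sup>2) * real n * (real n)\<^sup>2"
    by (simp add: power2_eq_square power3_eq_cube mult_ac)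
  then show ?thesis using n_pos by (simp add: Xi power_divide bE_divide divide_le_eq)
qed

section \<open>Expansion of the Stein kernel into pairs of flags\<close>

definition Ja :: "(('a \<times> nat set \<times> nat) \<times> ('a \<times> nat set \<times> nat) \<times> nat) set" where
  "Ja = {(t, t', v). t \<in> flags \<and> t' \<in> flags \<and> v < n \<and> fb t' = fb t \<and> v \<noteq> fb t \<and> v \<notin> fT t \<and> v \<notin> fT t'}"

text \<open>\<open>Ja\<close> indexes the products \<open>DD u v * PP u v\<close> and
  \<open>Jb\<close> the products \<open>DD u v * PP v u\<close>, with \<open>u = fb t\<close> in
  both. In \<open>Ja\<close> the two flags share the base and \<open>v\<close> is free; in
  \<open>Jb\<close> the residue \<open>v\<close> is the base of \<open>t'\<close>. The diagonal
  \<open>u = v\<close> drops out because its factor is the square of a zero difference.\<close>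

definition Jb :: "(('a \<times> nat set \<times> nat) \<times> ('a \<times> nat set \<times> nat) \<times> nat) set" where
  "Jb = {(t, t', v). t \<in> flags \<and> t' \<in> flags \<and> v < n \<and> fb t' = v \<and> v \<noteq> fb t \<and> v \<notin> fT t \<and> fb t \<notin> fT t'}"

definition trm :: "('a \<times> nat set \<times> nat) \<times> ('a \<times> nat set \<times> nat) \<times> nat \<Rightarrow> nat set \<Rightarrow> real" where
  "trm x A = (case x of (t, t', v) \<Rightarrow> cg t * cf t' * (ind (fb t) A - ind v A)\<^sup>2 * (mon p (fT t) A * mon p (fT t') A))"

lemma DD_if: "DD u v A = (\<Sum>t\<in>flags. if fb t = u \<and> v \<notin> fT t then cg t * mon p (fT t) A else 0)"
  unfolding DD_def by (subst sum.inter_filter) auto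

lemma PP_if: "PP u v A = (\<Sum>t\<in>flags. if fb t = u \<and> v \<notin> fT t then cf t * mon p (fT t) A else 0)"
  unfolding PP_def by (subst sum.inter_filter) auto

lemma sum_delta_base:
  assumes "t \<in> flags" "\<And>u. u \<noteq> fb t \<Longrightarrow> g u = 0"
  shows "(\<Sum>u<n. g u) = (g (fb t) :: real)"
proof -
  have "(\<Sum>u<n. g u) = (\<Sum>u<n. if u = fb t then g (fb t) else 0)"
    using assms(2) by (intro sum.cong) auto
  then show ?thesis using flag_less[OF assms(1)] by simp
qed

lemma sum_swap4:
  "(\<Sum>u<n. \<Sum>v<n. \<Sum>t\<in>F. \<Sum>t'\<in>F. g u v t t') = (\<Sum>t\<in>F. \<Sum>t'\<in>F. \<Sum>v<n. \<Sum>u<n. g u v t t' :: real)"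
proof -
  have "(\<Sum>u<n. \<Sum>v<n. \<Sum>t\<in>F. \<Sum>t'\<in>F. g u v t t') = (\<Sum>v<n. \<Sum>u<n. \<Sum>t\<in>F. \<Sum>t'\<in>F. g u v t t')"
    by (rule sum.swap)
  then show ?thesis by (simp only: sum.swap[of _ F "{..<n}"])
qed

lemma Gam_eq: "Gam A = ((\<Sum>x\<in>Ja. trm x A) - (\<Sum>x\<in>Jb. trm x A)) / (2 * real n)"
proof -
  let ?y = "\<lambda>u v. (ind u A - ind v A)\<^sup>2"
  have a: "(\<Sum>u<n. \<Sum>v<n. ?y u v * DD u v A * PP u v A) = (\<Sum>x\<in>Ja. trm x A)"
  proof -
    have "(\<Sum>u<n. \<Sum>v<n. ?y u v * DD u v A * PP u v A)
      = (\<Sum>u<n. \<Sum>v<n. \<Sum>t\<in>flags. \<Sum>t'\<in>flags. ?y u v * ((if fb t = u \<and> v \<notin> fT t then cg t * mon p (fT t) A else 0)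
         * (if fb t' = u \<and> v \<notin> fT t' then cf t' * mon p (fT t') A else 0)))"
      unfolding DD_if PP_if mult.assoc sum_product by (simp only: sum_distrib_left)
    also have "\<dots> = (\<Sum>t\<in>flags. \<Sum>t'\<in>flags. \<Sum>v<n. \<Sum>u<n. ?y u v * ((if fb t = u \<and> v \<notin> fT t then cg t * mon p (fT t) A else 0)
         * (if fb t' = u \<and> v \<notin> fT t' then cf t' * mon p (fT t') A else 0)))"
      by (rule sum_swap4)
    also have "\<dots> = (\<Sum>t\<in>flags. \<Sum>t'\<in>flags. \<Sum>v<n. if (t, t', v) \<in> Ja then trm (t, t', v) A else 0)"
    proof (intro sum.cong[OF refl])
      fix t t' v assume t: "t \<in> flags" "t' \<in> flags" "v \<in> {..<n}"
      show "(\<Sum>u<n. ?y u v * ((if fb t = u \<and> v \<notin> fT t then cg t * mon p (fT t) A else 0)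
         * (if fb t' = u \<and> v \<notin> fT t' then cf t' * mon p (fT t') A else 0)))
        = (if (t, t', v) \<in> Ja then trm (t, t', v) A else 0)"
        using t by (subst sum_delta_base[OF t(1)]) (auto simp: Ja_def trm_def)
    qed
    also have "\<dots> = (\<Sum>x\<in>Ja. trm x A)"
      by (rule sum_restrict_triples) (auto simp: Ja_def)
    finally show ?thesis .
  qed
  have b: "(\<Sum>u<n. \<Sum>v<n. ?y u v * DD u v A * PP v u A) = (\<Sum>x\<in>Jb. trm x A)"
  proof -
    have "(\<Sum>u<n. \<Sum>v<n. ?y u v * DD u v A * PP v u A)
      = (\<Sum>u<n. \<Sum>v<n. \<Sum>t\<in>flags. \<Sum>t'\<in>flags. ?y u v * ((if fb t = u \<and> v \<notin> fT t then cg t * mon p (fT t) A else 0)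
         * (if fb t' = v \<and> u \<notin> fT t' then cf t' * mon p (fT t') A else 0)))"
      unfolding DD_if PP_if mult.assoc sum_product by (simp only: sum_distrib_left)
    also have "\<dots> = (\<Sum>t\<in>flags. \<Sum>t'\<in>flags. \<Sum>v<n. \<Sum>u<n. ?y u v * ((if fb t = u \<and> v \<notin> fT t then cg t * mon p (fT t) A else 0)
         * (if fb t' = v \<and> u \<notin> fT t' then cf t' * mon p (fT t') A else 0)))"
      by (rule sum_swap4)
    also have "\<dots> = (\<Sum>t\<in>flags. \<Sum>t'\<in>flags. \<Sum>v<n. if (t, t', v) \<in> Jb then trm (t, t', v) A else 0)"
    proof (intro sum.cong[OF refl])
      fix t t' v assume t: "t \<in> flags" "t' \<in> flags" "v \<in> {..<n}"
      show "(\<Sum>u<n. ?y u v * ((if fb t = u \<and> v \<notin> fT t then cg t * mon p (fT t) A else 0)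
         * (if fb t' = v \<and> u \<notin> fT t' then cf t' * mon p (fT t') A else 0)))
        = (if (t, t', v) \<in> Jb then trm (t, t', v) A else 0)"
        using t by (subst sum_delta_base[OF t(1)]) (auto simp: Jb_def trm_def)
    qed
    also have "\<dots> = (\<Sum>x\<in>Jb. trm x A)"
      by (rule sum_restrict_triples) (auto simp: Jb_def)
    finally show ?thesis .
  qed
  have "(\<Sum>u<n. \<Sum>v<n. ?y u v * DD u v A * (PP u v A - PP v u A))
    = (\<Sum>u<n. \<Sum>v<n. ?y u v * DD u v A * PP u v A) - (\<Sum>u<n. \<Sum>v<n. ?y u v * DD u v A * PP v u A)"
    by (simp only: right_diff_distrib sum_subtractf)
  then show ?thesis unfolding Gam_def a b by simp
qed

definition supp :: "('a \<times> nat set \<times> nat) \<times> ('a \<times> nat set \<times> nat) \<times> nat \<Rightarrow> nat set" where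
  "supp x = (case x of (t, t', v) \<Rightarrow> {fb t, v} \<union> (fT t \<union> fT t'))"

text \<open>Separates terms that may have a mean from those that cannot: disjoint nonempty sets of
  points leave lone centred bits.\<close>

definition linked :: "('a \<times> nat set \<times> nat) \<times> ('a \<times> nat set \<times> nat) \<times> nat \<Rightarrow> bool" where
  "linked x = (case x of (t, t', v) \<Rightarrow> fT t \<inter> fT t' \<noteq> {})"

text \<open>Linked terms are few and are treated by counting overlaps: \<open>O(n^3)\<close> terms,
  each meeting \<open>O(n^2)\<close> others. Unlinked terms are numerous but nearly orthogonal:
  \<open>O(n^4)\<close> terms, each correlated with \<open>O(n)\<close> others. Both products are
  \<open>O(n^5)\<close>.\<close>

lemma part_variance:
  assumes J: "J \<subseteq> flags \<times> flags \<times> {..<n}"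
    and adm: "\<And>t t' v. (t, t', v) \<in> J \<Longrightarrow> v \<noteq> fb t \<and> v \<notin> fT t \<and> v \<notin> fT t' \<and> fb t \<notin> fT t'"
    and c1: "card J \<le> KK\<^sup>2 * n ^ 4"
    and c2: "\<And>Q. finite Q \<Longrightarrow> card Q \<le> 3 * k \<Longrightarrow> card {(s, s', v) \<in> J. fT s \<subseteq> Q \<and> fT s' \<subseteq> Q} \<le> 81 * KK\<^sup>2 * k ^ 4 * n"
    and c3: "card {x \<in> J. linked x} \<le> k * KK\<^sup>2 * n ^ 3"
    and c4: "\<And>w. card {x \<in> {x \<in> J. linked x}. w \<in> supp x} \<le> 3 * k * KK\<^sup>2 * n\<^sup>2"
  shows "bE p {..<n} (\<lambda>A. ((\<Sum>x\<in>J. trm x A) - bE p {..<n} (\<lambda>A. \<Sum>x\<in>{x \<in> J. linked x}. trm x A))\<^sup>2)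
     \<le> 234 * real (k ^ 4 * KK ^ 4) * real n ^ 5"
proof -
  let ?E = "bE p {..<n}"
  let ?L = "{x \<in> J. linked x}" and ?U = "{x \<in> J. \<not> linked x}"
  have fJ: "finite J" using J by (rule finite_subset) auto
  have cc: "\<bar>cg t * cf t' * (ind (fb t) A - ind v A)\<^sup>2\<bar> \<le> 1" if "t \<in> flags" for t t' v A
  proof -
    have "\<bar>cg t\<bar> * \<bar>cf t'\<bar> * \<bar>(ind (fb t) A - ind v A)\<^sup>2\<bar> \<le> 1 * 1 * 1"
      using cg_bounds[OF that] cf_bounds[of t'] by (intro mult_mono) (auto simp: ind_def)
    then show ?thesis by (simp add: abs_mult)
  qed
  have tb: "\<bar>trm x A\<bar> \<le> 1" if "x \<in> J" for x A
  proof -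
    obtain t t' v where x0: "x = (t, t', v)" by (cases x) auto
    then have x: "x = (t, t', v)" "t \<in> flags" using that J by blast+
    have "\<bar>cg t * cf t' * (ind (fb t) A - ind v A)\<^sup>2\<bar> * (\<bar>mon p (fT t) A\<bar> * \<bar>mon p (fT t') A\<bar>) \<le> 1 * (1 * 1)"
      using cc[OF x(2)] by (intro mult_mono mon_abs_le) auto
    then show ?thesis by (simp add: x trm_def abs_mult)
  qed
  have hd: "dep (\<lambda>A. cg t * cf t' * (ind (fb t) A - ind v A)\<^sup>2) (\<Union>i\<in>{fb t, v}. {i})" for t t' v
    by (auto simp: dep_def ind_def)
  have VL: "?E (\<lambda>A. ((\<Sum>x\<in>?L. trm x A) - ?E (\<lambda>A. \<Sum>x\<in>?L. trm x A))\<^sup>2)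
     \<le> 4 * 1\<^sup>2 * real (card ?L) * real (3 * k * (3 * k * KK\<^sup>2 * n\<^sup>2))"
  proof (rule variance_sum_le[where B = supp])
    fix x assume x: "x \<in> ?L"
    then obtain t t' v where tv: "x = (t, t', v)" "t \<in> flags" "t' \<in> flags" "v < n" using J by auto
    have "dep (\<lambda>A. cg t * cf t' * (ind (fb t) A - ind v A)\<^sup>2 * (mon p (fT t) A * mon p (fT t') A))
       ((\<Union>i\<in>{fb t, v}. {i}) \<union> ((\<Union>i\<in>fT t. {i}) \<union> (\<Union>i\<in>fT t'. {i})))"
      using flag_less[OF tv(2)] flag_less[OF tv(3)] by (intro dep_mult B.dep_zm hd) auto
    then show "dep (trm x) (supp x)" by (simp add: trm_def[abs_def] supp_def tv insert_commute)
    show "\<bar>trm x A\<bar> \<le> 1" for A using tb x by simp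
    show "card {x' \<in> ?L. supp x \<inter> supp x' \<noteq> {}} \<le> 3 * k * (3 * k * KK\<^sup>2 * n\<^sup>2)"
    proof (rule card_Collect_point_le[OF _ _ _ c4])
      show "finite (supp x)" using tv by (simp add: supp_def)
      have "card (supp x) \<le> card {fb t, v} + (card (fT t) + card (fT t'))"
        unfolding supp_def tv prod.case by (intro order_trans[OF card_Un_le] add_mono card_Un_le order_refl)
      also have "\<dots> \<le> 2 + ((k - 1) + (k - 1))"
        using card_fT[OF tv(2)] card_fT[OF tv(3)] by (intro add_mono) (auto simp: card_insert_if)
      also have "\<dots> \<le> 3 * k" using k3 by auto
      finally show "card (supp x) \<le> 3 * k" .
    qed (use fJ in auto)
  qed (use fJ in auto)
  have VU: "?E (\<lambda>A. (\<Sum>x\<in>?U. trm x A)\<^sup>2) \<le> real (KK\<^sup>2 * n ^ 4) * real (81 * KK\<^sup>2 * k ^ 4 * n)"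
  proof -
    \<comment> \<open>The two disjoint centred products merge into one monomial over
      \<open>Z\<close>, while the squared difference of bits is a coefficient reading only
      \<open>fb t\<close> and \<open>v\<close>, which \<open>adm\<close> keeps outside
      \<open>Z\<close>.\<close>
    define h where "h = (\<lambda>(t, t', v) A. cg t * cf t' * (ind (fb t) A - ind v A)\<^sup>2)"
    define Z where "Z = (\<lambda>(t, t', v::nat). fT t \<union> fT t')"
    have "?E (\<lambda>A. (\<Sum>x\<in>?U. h x A * mon p (Z x) A)\<^sup>2) \<le> 1\<^sup>2 * real (card ?U) * real (81 * KK\<^sup>2 * k ^ 4 * n)"
    proof (rule B.square_sum_le[where W = "\<lambda>(t, t', v). {fb t, v}"])
      fix x assume x: "x \<in> ?U"
      then obtain t t' v where tv: "x = (t, t', v)" "t \<in> flags" "t' \<in> flags" "v < n" using J by auto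
      have ad: "v \<noteq> fb t \<and> v \<notin> fT t \<and> v \<notin> fT t' \<and> fb t \<notin> fT t'" using adm[of t t' v] x tv by simp
      show "finite (Z x) \<and> Z x \<subseteq> {..<n}" using flag_less[OF tv(2)] flag_less[OF tv(3)] tv by (auto simp: Z_def)
      show "(case x of (t, t', v) \<Rightarrow> {fb t, v}) \<subseteq> {..<n} \<and> (case x of (t, t', v) \<Rightarrow> {fb t, v}) \<inter> Z x = {}"
        using ad flag_less[OF tv(2)] flag_notin[OF tv(2)] tv by (auto simp: Z_def)
      show "dep (h x) (\<Union>i\<in>case x of (t, t', v) \<Rightarrow> {fb t, v}. {i})"
        using hd[of t t' v] by (simp add: h_def tv)
      show "\<bar>h x A\<bar> \<le> 1" for A using cc[OF tv(2)] by (simp add: h_def tv)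
      let ?Q = "Z x \<union> (case x of (t, t', v) \<Rightarrow> {fb t, v})"
      have "card ?Q \<le> (card (fT t) + card (fT t')) + card {fb t, v}"
        unfolding Z_def tv prod.case by (intro order_trans[OF card_Un_le] add_mono card_Un_le order_refl)
      also have "\<dots> \<le> ((k - 1) + (k - 1)) + 2"
        using card_fT[OF tv(2)] card_fT[OF tv(3)] by (intro add_mono) (auto simp: card_insert_if)
      also have "\<dots> \<le> 3 * k" using k3 by auto
      finally have "card {(s, s', v) \<in> J. fT s \<subseteq> ?Q \<and> fT s' \<subseteq> ?Q} \<le> 81 * KK\<^sup>2 * k ^ 4 * n"
        using tv by (intro c2) (auto simp: Z_def)
      moreover have "card {x' \<in> ?U. Z x' \<subseteq> ?Q} \<le> card {(s, s', v) \<in> J. fT s \<subseteq> ?Q \<and> fT s' \<subseteq> ?Q}"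
        using fJ by (intro card_mono finite_subset[OF _ fJ]) (auto simp: Z_def)
      ultimately show "card {x' \<in> ?U. Z x' \<subseteq> ?Q} \<le> 81 * KK\<^sup>2 * k ^ 4 * n" by linarith
    qed (use fJ in auto)
    moreover have hm: "h x A * mon p (Z x) A = trm x A" if "x \<in> ?U" for x A
    proof -
      obtain t t' v where tv0: "x = (t, t', v)" by (cases x) auto
      then have tv: "x = (t, t', v)" "t \<in> flags" "t' \<in> flags" using that J by blast+
      have "mon p (fT t \<union> fT t') A = mon p (fT t) A * mon p (fT t') A"
        unfolding mon_def using that tv by (intro prod.union_disjoint) (auto simp: linked_def)
      then show ?thesis by (simp add: h_def Z_def trm_def tv)
    qed
    moreover have "(\<Sum>x\<in>?U. h x A * mon p (Z x) A) = (\<Sum>x\<in>?U. trm x A)" for A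
      by (intro sum.cong refl hm)
    ultimately have "?E (\<lambda>A. (\<Sum>x\<in>?U. trm x A)\<^sup>2) \<le> real (card ?U) * real (81 * KK\<^sup>2 * k ^ 4 * n)"
      by (simp only: power_one mult_1)
    also have "\<dots> \<le> real (KK\<^sup>2 * n ^ 4) * real (81 * KK\<^sup>2 * k ^ 4 * n)"
    proof (intro mult_right_mono)
      have "card ?U \<le> card J" using fJ by (intro card_mono) auto
      then show "real (card ?U) \<le> real (KK\<^sup>2 * n ^ 4)" using c1 by (simp only: of_nat_le_iff)
    qed simp
    finally show ?thesis .
  qed
  let ?g = "?E (\<lambda>A. \<Sum>x\<in>?L. trm x A)"
  have split: "(\<Sum>x\<in>J. trm x A) = (\<Sum>x\<in>?L. trm x A) + (\<Sum>x\<in>?U. trm x A)" for A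
  proof -
    have "J = ?L \<union> ?U" by auto
    then have "(\<Sum>x\<in>J. trm x A) = (\<Sum>x\<in>?L \<union> ?U. trm x A)" by simp
    also have "\<dots> = (\<Sum>x\<in>?L. trm x A) + (\<Sum>x\<in>?U. trm x A)" using fJ by (intro sum.union_disjoint) auto
    finally show ?thesis .
  qed
  have "((\<Sum>x\<in>J. trm x A) - ?g)\<^sup>2 \<le> 2 * ((\<Sum>x\<in>?L. trm x A) - ?g)\<^sup>2 + 2 * (\<Sum>x\<in>?U. trm x A)\<^sup>2" for A
  proof -
    have "(a + b - g)\<^sup>2 \<le> 2 * (a - g)\<^sup>2 + 2 * b\<^sup>2" for a b g :: real
      using zero_le_power2[of "a - g - b"] by (simp add: power2_eq_square algebra_simps)
    then show ?thesis unfolding split .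
  qed
  then have "?E (\<lambda>A. ((\<Sum>x\<in>J. trm x A) - ?g)\<^sup>2)
     \<le> ?E (\<lambda>A. 2 * ((\<Sum>x\<in>?L. trm x A) - ?g)\<^sup>2 + 2 * (\<Sum>x\<in>?U. trm x A)\<^sup>2)"
    by (intro bE_mono) auto
  also have "\<dots> = 2 * ?E (\<lambda>A. ((\<Sum>x\<in>?L. trm x A) - ?g)\<^sup>2) + 2 * ?E (\<lambda>A. (\<Sum>x\<in>?U. trm x A)\<^sup>2)"
    by (simp only: bE_add bE_cmult)
  also have "\<dots> \<le> 2 * (4 * real (k * KK\<^sup>2 * n ^ 3) * real (3 * k * (3 * k * KK\<^sup>2 * n\<^sup>2)))
      + 2 * (real (KK\<^sup>2 * n ^ 4) * real (81 * KK\<^sup>2 * k ^ 4 * n))"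
  proof (intro add_mono mult_left_mono VU order_trans[OF VL])
    show "4 * 1\<^sup>2 * real (card ?L) * real (3 * k * (3 * k * KK\<^sup>2 * n\<^sup>2))
      \<le> 4 * real (k * KK\<^sup>2 * n ^ 3) * real (3 * k * (3 * k * KK\<^sup>2 * n\<^sup>2))"
      unfolding power_one mult_1_right
    proof (intro mult_right_mono mult_left_mono)
      show "real (card ?L) \<le> real (k * KK\<^sup>2 * n ^ 3)" using c3 by (simp only: of_nat_le_iff)
    qed auto
  qed auto
  also have "\<dots> = real (72 * k ^ 3 * KK ^ 4 * n ^ 5 + 162 * k ^ 4 * KK ^ 4 * n ^ 5)"
    by (simp add: power2_eq_square power3_eq_cube power4_eq_xxxx numeral_eq_Suc algebra_simps)
  \<comment> \<open>Here \<open>234\<close> is \<open>72 + 162\<close>, after \<open>k ^ 3\<close>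
    has been enlarged to \<open>k ^ 4\<close>.\<close>
  also have "\<dots> \<le> real (234 * (k ^ 4 * KK ^ 4) * n ^ 5)"
  proof -
    have "k ^ 3 \<le> k ^ 4" using k3 by (intro power_increasing) auto
    then have "72 * k ^ 3 * KK ^ 4 * n ^ 5 \<le> 72 * k ^ 4 * KK ^ 4 * n ^ 5" by (intro mult_le_mono) auto
    then show ?thesis unfolding of_nat_le_iff by (simp add: mult_ac)
  qed
  finally show ?thesis by simp
qed

end

context slice_progressions
begin

interpretation B: indep_family p "{..<n}" "{..<n}" "\<lambda>i A. ind i A - p" "\<lambda>i. {i}"
  rewrites "indep_family.zm (\<lambda>i A. ind i A - p) = mon p"
  by (rule bits_family) (simp_all add: bits_zm)

lemma card_fT_le: "t \<in> flags \<Longrightarrow> card (fT t) \<le> k"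
  using card_fT less_imp_le by blast

text \<open>Such a flag contains two prescribed distinct points, the base and a common further
  point, so the count does not grow with \<open>n\<close>.\<close>

lemma card_same_base_linked:
  "t \<in> flags \<Longrightarrow> card {t' \<in> flags. fb t' = fb t \<and> fT t \<inter> fT t' \<noteq> {}} \<le> k * KK"
proof -
  assume t: "t \<in> flags"
  have "card {t' \<in> {t' \<in> flags. fb t' = fb t}. fT t \<inter> fT t' \<noteq> {}} \<le> k * KK"
  proof (rule card_Collect_point_le)
    fix w
    show "card {x \<in> {t' \<in> flags. fb t' = fb t}. w \<in> fT x} \<le> KK"
    proof (cases "w = fb t")
      case True
      then have "{x \<in> {t' \<in> flags. fb t' = fb t}. w \<in> fT x} = {}" using flag_notin by fastforce
      then show ?thesis by (metis card.empty zero_le)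
    next
      case False
      have "card {x \<in> {t' \<in> flags. fb t' = fb t}. w \<in> fT x} \<le> card {x \<in> flags. w \<in> pts (fst x) \<and> fb t \<in> pts (fst x)}"
        using flag_pts by (intro card_mono) fastforce+
      then show ?thesis using card_flags_two_points[OF False] by linarith
    qed
  qed (use t card_fT_le in auto)
  then show ?thesis by (simp add: conj_assoc)
qed

text \<open>Without a common base only one point is prescribed, and the count becomes linear in
  \<open>n\<close>.\<close>

lemma card_linked: "t \<in> flags \<Longrightarrow> card {t' \<in> flags. fT t \<inter> fT t' \<noteq> {}} \<le> k * (KK * n)"
proof -
  assume t: "t \<in> flags"
  show ?thesis
  proof (rule card_Collect_point_le)
    fix w
    have "card {x \<in> flags. w \<in> fT x} \<le> card {x \<in> flags. w \<in> pts (fst x)}"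
      using flag_pts by (intro card_mono) fastforce+
    then show "card {x \<in> flags. w \<in> fT x} \<le> KK * n" using card_flags_point[of w] by linarith
  qed (use t card_fT_le in auto)
qed

lemma card_within_3k: "finite Q \<Longrightarrow> card Q \<le> 3 * k \<Longrightarrow> card {t \<in> flags. fT t \<subseteq> Q} \<le> 9 * k\<^sup>2 * KK"
proof -
  assume Q: "finite Q" "card Q \<le> 3 * k"
  have "card {t \<in> flags. fT t \<subseteq> Q} \<le> KK * (card Q)\<^sup>2" by (rule card_flags_within[OF Q(1)])
  also have "\<dots> \<le> KK * (3 * k)\<^sup>2" using Q by (intro mult_le_mono2 power_mono) auto
  finally show ?thesis by (simp add: power2_eq_square mult_ac)
qed

text \<open>Orders of magnitude: \<open>n^2\<close> flags \<open>t\<close>, then \<open>n\<close>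
  flags \<open>t'\<close> with the same base, then \<open>n\<close> residues \<open>v\<close>. Being
  linked cuts the choices of \<open>t'\<close> to a constant.\<close>

lemma Ja_variance: "bE p {..<n} (\<lambda>A. ((\<Sum>x\<in>Ja. trm x A) - bE p {..<n} (\<lambda>A. \<Sum>x\<in>{x \<in> Ja. linked x}. trm x A))\<^sup>2)
     \<le> 234 * real (k ^ 4 * KK ^ 4) * real n ^ 5"
proof (rule part_variance)
  show sub: "Ja \<subseteq> flags \<times> flags \<times> {..<n}" by (auto simp: Ja_def)
  show "v \<noteq> fb t \<and> v \<notin> fT t \<and> v \<notin> fT t' \<and> fb t \<notin> fT t'" if "(t, t', v) \<in> Ja" for t t' v
    using that flag_notin[of t'] by (auto simp: Ja_def)
  have "card Ja \<le> KK * n\<^sup>2 * (KK * n * n)"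
    by (rule card_triples_le[where A = flags and B = "\<lambda>t. {t' \<in> flags. fb t' = fb t}" and C = "\<lambda>_ _. {..<n}"])
      (auto simp: Ja_def card_flags card_flags_base)
  then show "card Ja \<le> KK\<^sup>2 * n ^ 4" by (simp add: power2_eq_square power4_eq_xxxx mult_ac)
  show "card {(s, s', v) \<in> Ja. fT s \<subseteq> Q \<and> fT s' \<subseteq> Q} \<le> 81 * KK\<^sup>2 * k ^ 4 * n" if "finite Q" "card Q \<le> 3 * k" for Q
  proof -
    have "card {(s, s', v) \<in> Ja. fT s \<subseteq> Q \<and> fT s' \<subseteq> Q} \<le> 9 * k\<^sup>2 * KK * (9 * k\<^sup>2 * KK * n)"
      by (rule card_triples_le[where A = "{t \<in> flags. fT t \<subseteq> Q}" and B = "\<lambda>t. {t \<in> flags. fT t \<subseteq> Q}" and C = "\<lambda>_ _. {..<n}"])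
        (use card_within_3k[OF that] in \<open>auto simp: Ja_def\<close>)
    then show ?thesis by (simp add: power2_eq_square power4_eq_xxxx mult_ac)
  qed
  have "card {x \<in> Ja. linked x} \<le> KK * n\<^sup>2 * (k * KK * n)"
    by (rule card_triples_le[where A = flags and B = "\<lambda>t. {t' \<in> flags. fb t' = fb t \<and> fT t \<inter> fT t' \<noteq> {}}" and C = "\<lambda>_ _. {..<n}"])
      (auto simp: Ja_def card_flags card_same_base_linked linked_def)
  then show "card {x \<in> Ja. linked x} \<le> k * KK\<^sup>2 * n ^ 3" by (simp add: power2_eq_square power3_eq_cube mult_ac)
  fix w
  let ?L = "{x \<in> Ja. linked x}"
  let ?S1 = "{x \<in> ?L. w \<in> pts (fst (fst x))}" and ?S2 = "{x \<in> ?L. w \<in> pts (fst (fst (snd x)))}" and ?S3 = "{x \<in> ?L. snd (snd x) = w}"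
  have fJ: "finite Ja" using sub by (rule finite_subset) auto
  have "card ?S1 \<le> KK * n * (k * KK * n)"
    by (rule card_triples_le[where A = "{t \<in> flags. w \<in> pts (fst t)}" and B = "\<lambda>t. {t' \<in> flags. fb t' = fb t \<and> fT t \<inter> fT t' \<noteq> {}}" and C = "\<lambda>_ _. {..<n}"])
      (auto simp: Ja_def card_flags_point card_same_base_linked linked_def)
  moreover have "card ?S2 \<le> KK * n * (k * KK * n)"
    by (rule card_triples_swap_le[where A = "{t \<in> flags. w \<in> pts (fst t)}" and B = "\<lambda>t. {t' \<in> flags. fb t' = fb t \<and> fT t \<inter> fT t' \<noteq> {}}" and C = "\<lambda>_ _. {..<n}"])
      (auto simp: Ja_def card_flags_point card_same_base_linked linked_def Int_commute)
  moreover have "card ?S3 \<le> KK * n\<^sup>2 * (k * KK * 1)"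
    by (rule card_triples_le[where A = flags and B = "\<lambda>t. {t' \<in> flags. fb t' = fb t \<and> fT t \<inter> fT t' \<noteq> {}}" and C = "\<lambda>_ _. {w}"])
      (auto simp: Ja_def card_flags card_same_base_linked linked_def)
  moreover have "card {x \<in> ?L. w \<in> supp x} \<le> card (?S1 \<union> ?S2 \<union> ?S3)"
  proof (rule card_mono)
    show "{x \<in> ?L. w \<in> supp x} \<subseteq> ?S1 \<union> ?S2 \<union> ?S3"
    proof
      fix x assume x: "x \<in> {x \<in> ?L. w \<in> supp x}"
      obtain t t' v where tv: "x = (t, t', v)" by (cases x) auto
      have "t \<in> flags" "t' \<in> flags" using x sub tv by auto
      then show "x \<in> ?S1 \<union> ?S2 \<union> ?S3" using x tv flag_pts[of t] flag_pts[of t'] by (auto simp: supp_def)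
    qed
  qed (use fJ in auto)
  moreover have "card (?S1 \<union> ?S2 \<union> ?S3) \<le> card ?S1 + card ?S2 + card ?S3"
    by (meson add_mono card_Un_le order_refl order_trans)
  ultimately show "card {x \<in> ?L. w \<in> supp x} \<le> 3 * k * KK\<^sup>2 * n\<^sup>2" by (simp add: power2_eq_square mult_ac)
qed

text \<open>Here \<open>t\<close> and \<open>t'\<close> range over \<open>n^2\<close> flags each and
  \<open>v\<close> is determined by \<open>t'\<close>. Being linked cuts the choices of
  \<open>t'\<close> from \<open>n^2\<close> to \<open>n\<close>.\<close>

lemma Jb_variance: "bE p {..<n} (\<lambda>A. ((\<Sum>x\<in>Jb. trm x A) - bE p {..<n} (\<lambda>A. \<Sum>x\<in>{x \<in> Jb. linked x}. trm x A))\<^sup>2)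
     \<le> 234 * real (k ^ 4 * KK ^ 4) * real n ^ 5"
proof (rule part_variance)
  show sub: "Jb \<subseteq> flags \<times> flags \<times> {..<n}" by (auto simp: Jb_def)
  show "v \<noteq> fb t \<and> v \<notin> fT t \<and> v \<notin> fT t' \<and> fb t \<notin> fT t'" if "(t, t', v) \<in> Jb" for t t' v
    using that flag_notin[of t'] by (auto simp: Jb_def)
  have "card Jb \<le> KK * n\<^sup>2 * (KK * n\<^sup>2 * 1)"
    by (rule card_triples_le[where A = flags and B = "\<lambda>t. flags" and C = "\<lambda>_ t'. {fb t'}"])
      (auto simp: Jb_def card_flags)
  then show "card Jb \<le> KK\<^sup>2 * n ^ 4" by (simp add: power2_eq_square power4_eq_xxxx mult_ac)
  show "card {(s, s', v) \<in> Jb. fT s \<subseteq> Q \<and> fT s' \<subseteq> Q} \<le> 81 * KK\<^sup>2 * k ^ 4 * n" if "finite Q" "card Q \<le> 3 * k" for Q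
  proof -
    have "card {(s, s', v) \<in> Jb. fT s \<subseteq> Q \<and> fT s' \<subseteq> Q} \<le> 9 * k\<^sup>2 * KK * (9 * k\<^sup>2 * KK * 1)"
      by (rule card_triples_le[where A = "{t \<in> flags. fT t \<subseteq> Q}" and B = "\<lambda>t. {t \<in> flags. fT t \<subseteq> Q}" and C = "\<lambda>_ t'. {fb t'}"])
        (use card_within_3k[OF that] in \<open>auto simp: Jb_def\<close>)
    also have "\<dots> \<le> 9 * k\<^sup>2 * KK * (9 * k\<^sup>2 * KK * n)" using n_pos by (intro mult_le_mono) auto
    finally show ?thesis by (simp add: power2_eq_square power4_eq_xxxx mult_ac)
  qed
  have "card {x \<in> Jb. linked x} \<le> KK * n\<^sup>2 * (k * (KK * n) * 1)"
    by (rule card_triples_le[where A = flags and B = "\<lambda>t. {t' \<in> flags. fT t \<inter> fT t' \<noteq> {}}" and C = "\<lambda>_ t'. {fb t'}"])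
      (auto simp: Jb_def card_flags card_linked linked_def)
  then show "card {x \<in> Jb. linked x} \<le> k * KK\<^sup>2 * n ^ 3" by (simp add: power2_eq_square power3_eq_cube mult_ac)
  fix w
  let ?L = "{x \<in> Jb. linked x}"
  let ?S1 = "{x \<in> ?L. w \<in> pts (fst (fst x))}" and ?S2 = "{x \<in> ?L. w \<in> pts (fst (fst (snd x)))}"
  have fJ: "finite Jb" using sub by (rule finite_subset) auto
  have "card ?S1 \<le> KK * n * (k * (KK * n) * 1)"
    by (rule card_triples_le[where A = "{t \<in> flags. w \<in> pts (fst t)}" and B = "\<lambda>t. {t' \<in> flags. fT t \<inter> fT t' \<noteq> {}}" and C = "\<lambda>_ t'. {fb t'}"])
      (auto simp: Jb_def card_flags_point card_linked linked_def)
  moreover have "card ?S2 \<le> KK * n * (k * (KK * n) * 1)"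
    by (rule card_triples_swap_le[where A = "{t \<in> flags. w \<in> pts (fst t)}" and B = "\<lambda>t. {t' \<in> flags. fT t \<inter> fT t' \<noteq> {}}" and C = "\<lambda>t' _. {fb t'}"])
      (auto simp: Jb_def card_flags_point card_linked linked_def Int_commute)
  moreover have "card {x \<in> ?L. w \<in> supp x} \<le> card (?S1 \<union> ?S2)"
  proof (rule card_mono)
    show "{x \<in> ?L. w \<in> supp x} \<subseteq> ?S1 \<union> ?S2"
    proof
      fix x assume x: "x \<in> {x \<in> ?L. w \<in> supp x}"
      obtain t t' v where tv: "x = (t, t', v)" by (cases x) auto
      have "t \<in> flags" "t' \<in> flags" "v = fb t'" using x tv by (auto simp: Jb_def)
      then show "x \<in> ?S1 \<union> ?S2" using x tv flag_pts[of t] flag_pts[of t'] by (auto simp: supp_def)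
    qed
  qed (use fJ in auto)
  moreover have "card (?S1 \<union> ?S2) \<le> card ?S1 + card ?S2" by (rule card_Un_le)
  ultimately have "card {x \<in> ?L. w \<in> supp x} \<le> 2 * (k * KK\<^sup>2 * n\<^sup>2)" by (simp add: power2_eq_square mult_ac)
  then show "card {x \<in> ?L. w \<in> supp x} \<le> 3 * k * KK\<^sup>2 * n\<^sup>2" by simp
qed

section \<open>The mean of the Stein kernel\<close>

definition ga :: real where "ga = bE p {..<n} (\<lambda>A. \<Sum>x\<in>{x \<in> Ja. linked x}. trm x A)"
definition gb :: real where "gb = bE p {..<n} (\<lambda>A. \<Sum>x\<in>{x \<in> Jb. linked x}. trm x A)"
text \<open>The unlinked terms have mean zero, so this is the mean of \<open>Gam\<close> under
  independent bits.\<close>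

definition gamma :: real where "gamma = (ga - gb) / (2 * real n)"

text \<open>Against a mean \<open>gamma\<close> of order \<open>n^2\<close> this is a relative
  fluctuation of order \<open>n powr (-1/2)\<close>, the concentration on which the Gaussian
  approximation rests.\<close>

lemma Gam_variance: "bE p {..<n} (\<lambda>A. (Gam A - gamma)\<^sup>2) \<le> 234 * real (k ^ 4 * KK ^ 4) * real n ^ 3"
proof -
  let ?C = "234 * real (k ^ 4 * KK ^ 4) * real n ^ 5"
  let ?a = "\<lambda>A. (\<Sum>x\<in>Ja. trm x A) - ga" and ?b = "\<lambda>A. (\<Sum>x\<in>Jb. trm x A) - gb"
  have "(Gam A - gamma)\<^sup>2 \<le> (1 / (2 * (real n)\<^sup>2)) * ((?a A)\<^sup>2 + (?b A)\<^sup>2)" for A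
  proof -
    have "Gam A - gamma = (?a A - ?b A) / (2 * real n)"
      unfolding Gam_eq gamma_def by (simp add: diff_divide_distrib)
    then have "(Gam A - gamma)\<^sup>2 = (?a A - ?b A)\<^sup>2 / (4 * (real n)\<^sup>2)" by (simp add: power_divide power_mult_distrib)
    also have "\<dots> \<le> (2 * ((?a A)\<^sup>2 + (?b A)\<^sup>2)) / (4 * (real n)\<^sup>2)"
    proof (intro divide_right_mono)
      have "(x - y)\<^sup>2 \<le> 2 * (x\<^sup>2 + y\<^sup>2)" for x y :: real
        using zero_le_power2[of "x + y"] by (simp add: power2_eq_square algebra_simps)
      then show "(?a A - ?b A)\<^sup>2 \<le> 2 * ((?a A)\<^sup>2 + (?b A)\<^sup>2)" .
    qed simp
    also have "\<dots> = (1 / (2 * (real n)\<^sup>2)) * ((?a A)\<^sup>2 + (?b A)\<^sup>2)"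
    proof -
      have "2 * X / (4 * Y) = 1 / (2 * Y) * X" for X Y :: real by simp
      then show ?thesis .
    qed
    finally show ?thesis .
  qed
  then have "bE p {..<n} (\<lambda>A. (Gam A - gamma)\<^sup>2) \<le> bE p {..<n} (\<lambda>A. (1 / (2 * (real n)\<^sup>2)) * ((?a A)\<^sup>2 + (?b A)\<^sup>2))"
    by (intro bE_mono) auto
  also have "\<dots> = (1 / (2 * (real n)\<^sup>2)) * (bE p {..<n} (\<lambda>A. (?a A)\<^sup>2) + bE p {..<n} (\<lambda>A. (?b A)\<^sup>2))"
    by (simp only: bE_cmult bE_add)
  also have "\<dots> \<le> (1 / (2 * (real n)\<^sup>2)) * (?C + ?C)"
    using Ja_variance Jb_variance unfolding ga_def gb_def by (intro mult_left_mono add_mono) auto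
  also have "\<dots> = 234 * real (k ^ 4 * KK ^ 4) * real n ^ 3"
  proof -
    have "real n ^ 5 = real n ^ 3 * (real n)\<^sup>2" by (simp flip: power_add)
    moreover have "1 / (2 * M) * (c * (x * M) + c * (x * M)) = c * x" if "M \<noteq> 0" for M c x :: real
      using that by simp
    moreover have "(real n)\<^sup>2 \<noteq> 0" using n_pos by simp
    ultimately show ?thesis by (simp only:)
  qed
  finally show ?thesis .
qed

lemma trm_bound: "t \<in> flags \<Longrightarrow> \<bar>trm (t, t', v) A\<bar> \<le> 1"
proof -
  assume t: "t \<in> flags"
  have "\<bar>cg t\<bar> * \<bar>cf t'\<bar> * \<bar>(ind (fb t) A - ind v A)\<^sup>2\<bar> * (\<bar>mon p (fT t) A\<bar> * \<bar>mon p (fT t') A\<bar>) \<le> 1 * 1 * 1 * (1 * 1)"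
    using cg_bounds[OF t] cf_bounds[of t'] by (intro mult_mono mon_abs_le) (auto simp: ind_def)
  then show ?thesis by (simp add: trm_def abs_mult)
qed

text \<open>A point in the symmetric difference of the two sets contributes a lone centred bit,
  since \<open>fb t\<close> and \<open>v\<close> lie in neither set.\<close>

lemma trm_mean_zero:
  assumes "t \<in> flags" "t' \<in> flags" "v < n" "fT t \<noteq> fT t'"
    "v \<notin> fT t" "v \<notin> fT t'" "fb t \<notin> fT t'"
  shows "bE p {..<n} (trm (t, t', v)) = 0"
proof -
  note fl = flag_less[OF assms(1)] flag_less[OF assms(2)] flag_notin[OF assms(1)]
  have hd: "dep (\<lambda>A. cg t * cf t' * (ind (fb t) A - ind v A)\<^sup>2) (\<Union>i\<in>{fb t, v}. {i})"
    by (auto simp: dep_def ind_def)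
  consider w where "w \<in> fT t" "w \<notin> fT t'" | w where "w \<in> fT t'" "w \<notin> fT t" using assms(4) by blast
  then show ?thesis
  proof cases
    case 1
    have "dep (\<lambda>A. cg t * cf t' * (ind (fb t) A - ind v A)\<^sup>2 * mon p (fT t') A) (\<Union>i\<in>{fb t, v} \<union> fT t'. {i})"
      unfolding UN_Un using fl by (intro dep_mult hd B.dep_zm) auto
    then have "bE p {..<n} (\<lambda>A. (cg t * cf t' * (ind (fb t) A - ind v A)\<^sup>2 * mon p (fT t') A) * mon p (fT t) A) = 0"
      using assms fl 1 by (intro B.mean_zm_zero[of _ w _ "{fb t, v} \<union> fT t'"]) auto
    then show ?thesis by (simp add: trm_def[abs_def] mult_ac)
  next
    case 2
    have "dep (\<lambda>A. cg t * cf t' * (ind (fb t) A - ind v A)\<^sup>2 * mon p (fT t) A) (\<Union>i\<in>{fb t, v} \<union> fT t. {i})"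
      unfolding UN_Un using fl by (intro dep_mult hd B.dep_zm) auto
    then have "bE p {..<n} (\<lambda>A. (cg t * cf t' * (ind (fb t) A - ind v A)\<^sup>2 * mon p (fT t) A) * mon p (fT t') A) = 0"
      using assms fl 2 by (intro B.mean_zm_zero[of _ w _ "{fb t, v} \<union> fT t"]) auto
    then show ?thesis by (simp add: trm_def[abs_def] mult_ac)
  qed
qed

text \<open>Only triples with \<open>fT t = fT t'\<close> have a mean. Given \<open>t\<close> they
  leave boundedly many \<open>t'\<close>, and \<open>v\<close> is the base of \<open>t'\<close>, so
  there are \<open>O(n^2)\<close> of them, one power of \<open>n\<close> below the main term
  \<open>ga\<close>.\<close>

lemma gb_bound: "\<bar>gb\<bar> \<le> real (KK\<^sup>2 * k\<^sup>2) * (real n)\<^sup>2"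
proof -
  let ?L = "{x \<in> Jb. linked x}" and ?E = "{(t, t', v) \<in> Jb. fT t' \<subseteq> fT t}"
  have sub: "Jb \<subseteq> flags \<times> flags \<times> {..<n}" by (auto simp: Jb_def)
  have fJ: "finite Jb" using sub by (rule finite_subset) auto
  have "\<bar>gb\<bar> \<le> (\<Sum>x\<in>?L. \<bar>bE p {..<n} (trm x)\<bar>)"
    unfolding gb_def bE_sum by (rule sum_abs)
  also have "\<dots> \<le> (\<Sum>x\<in>?L. if x \<in> ?E then 1 else 0)"
  proof (rule sum_mono)
    fix x assume x: "x \<in> ?L"
    obtain t t' v where tv: "x = (t, t', v)" by (cases x) auto
    have mem: "t \<in> flags" "t' \<in> flags" "v < n" "fb t' = v" "v \<notin> fT t" "fb t \<notin> fT t'"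
      using x tv by (auto simp: Jb_def)
    show "\<bar>bE p {..<n} (trm x)\<bar> \<le> (if x \<in> ?E then 1 else 0)"
    proof (cases "fT t = fT t'")
      case True
      then have "x \<in> ?E" using x tv by auto
      moreover have "\<bar>bE p {..<n} (trm x)\<bar> \<le> 1"
        unfolding tv using trm_bound[OF mem(1)] by (intro bE_abs_le) auto
      ultimately show ?thesis by simp
    next
      case False
      have "v \<notin> fT t'" using flag_notin[OF mem(2)] mem by auto
      then have "bE p {..<n} (trm x) = 0" unfolding tv by (intro trm_mean_zero mem False)
      then show ?thesis by simp
    qed
  qed
  also have "\<dots> = real (card (?L \<inter> ?E))" using fJ by (simp add: sum.If_cases Int_def)
  also have "\<dots> \<le> real (card ?E)"
  proof -
    have "finite ?E" using fJ by (rule rev_finite_subset) auto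
    then show ?thesis by (simp add: card_mono)
  qed
  also have "\<dots> \<le> real (KK * n\<^sup>2 * (KK * k\<^sup>2 * 1))"
  proof -
    have "card ?E \<le> KK * n\<^sup>2 * (KK * k\<^sup>2 * 1)"
      by (rule card_triples_le[where A = flags and B = "\<lambda>t. {t' \<in> flags. fT t' \<subseteq> fT t}" and C = "\<lambda>_ t'. {fb t'}"])
        (auto simp: Jb_def card_flags card_flags_same)
    then show ?thesis by (simp only: of_nat_le_iff)
  qed
  finally show ?thesis by (simp add: power2_eq_square mult_ac)
qed

lemma ga_upper: "ga \<le> real (k * KK\<^sup>2) * real n ^ 3"
proof -
  have "card {x \<in> Ja. linked x} \<le> KK * n\<^sup>2 * (k * KK * n)"
    by (rule card_triples_le[where A = flags and B = "\<lambda>t. {t' \<in> flags. fb t' = fb t \<and> fT t \<inter> fT t' \<noteq> {}}" and C = "\<lambda>_ _. {..<n}"])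
      (auto simp: Ja_def card_flags card_same_base_linked linked_def)
  then have c: "real (card {x \<in> Ja. linked x}) \<le> real (KK * n\<^sup>2 * (k * KK * n))" by (simp only: of_nat_le_iff)
  have "ga \<le> (\<Sum>x\<in>{x \<in> Ja. linked x}. 1)"
    unfolding ga_def bE_sum
  proof (intro sum_mono bE_le_const)
    fix x A assume "x \<in> {x \<in> Ja. linked x}"
    then obtain t t' v where tv: "x = (t, t', v)" "t \<in> flags" by (auto simp: Ja_def)
    then show "trm x A \<le> 1" using trm_bound[OF tv(2), of t' v A] by auto
  qed auto
  then show ?thesis using c by (simp add: power2_eq_square power3_eq_cube mult_ac)
qed

lemma bE_ind_diff_square:
  assumes "u < n" "v < n" "u \<noteq> v"
  shows "bE p {..<n} (\<lambda>A. (ind u A - ind v A)\<^sup>2) = 2 * (p * (1 - p))"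
proof -
  have "(\<lambda>A. (ind u A - ind v A)\<^sup>2) = (\<lambda>A. ind u A + ind v A - 2 * (ind u A * ind v A))"
    by (auto simp: ind_def)
  moreover have "bE p {..<n} (\<lambda>A. ind u A * ind v A) = bE p {..<n} (ind u) * bE p {..<n} (ind v)"
    using assms(3) by (intro bE_indep[where B = "{u}" and B' = "{v}"]) (auto simp: dep_def ind_def)
  ultimately have "bE p {..<n} (\<lambda>A. (ind u A - ind v A)\<^sup>2) = bE p {..<n} (ind u) + bE p {..<n} (ind v) - 2 * (bE p {..<n} (ind u) * bE p {..<n} (ind v))"
    by (simp only: bE_diff bE_add bE_cmult)
  then show ?thesis using assms by (simp add: bE_ind algebra_simps)
qed

text \<open>A centred bit is never smaller than \<open>lam\<close> in absolute value.\<close>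

lemma mon_square_ge:
  assumes "0 < lam" "lam \<le> p" "lam \<le> 1 - p" "finite T" "card T \<le> k"
  shows "lam ^ (2 * k) \<le> (mon p T A)\<^sup>2"
proof -
  have lam1: "lam \<le> 1" using assms p_less by linarith
  have "lam ^ k \<le> lam ^ card T" using assms lam1 by (intro power_decreasing) auto
  also have "\<dots> = (\<Prod>i\<in>T. lam)" by simp
  also have "\<dots> \<le> (\<Prod>i\<in>T. \<bar>ind i A - p\<bar>)" using assms by (intro prod_mono) (auto simp: ind_def)
  also have "\<dots> = \<bar>mon p T A\<bar>" by (simp add: mon_def abs_prod)
  finally have "(lam ^ k)\<^sup>2 \<le> \<bar>mon p T A\<bar>\<^sup>2" using assms by (intro power_mono) auto
  then show ?thesis by (simp add: power_mult[symmetric] mult.commute)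
qed

lemma card_AP: "card AP = n * (n - 1)"
proof -
  have "card AP = card {(w, w'). w < n \<and> w' < n \<and> w \<noteq> w'}"
    using k3 by (intro bij_betw_same_card[OF pair_bij[of 0 1]]) auto
  also have "{(w, w'). w < n \<and> w' < n \<and> w \<noteq> w'} = (SIGMA w:{..<n}. {..<n} - {w})" by auto
  also have "card \<dots> = (\<Sum>w<n. n - 1)" by (subst card_SigmaI) auto
  finally show ?thesis by simp
qed

text \<open>No linked term has a negative mean: with equal point sets the term is a product of
  squares with nonnegative weights, otherwise the mean is zero. It is therefore enough to count an
  explicit diagonal family.\<close>

lemma ga_lower:
  assumes lam: "0 < lam" "lam \<le> p" "lam \<le> 1 - p"
  shows "lam ^ (2 * k) * lam\<^sup>2 / (2 * real k) * (real n * (real n - 1) * (real n - real k)) \<le> ga"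
proof -
  let ?L = "{x \<in> Ja. linked x}"
  have fJ: "finite Ja" by (rule finite_subset[of _ "flags \<times> flags \<times> {..<n}"]) (auto simp: Ja_def)
  \<comment> \<open>The flag with all \<open>k\<close> positions and base at position
    \<open>0\<close>; its weights \<open>1 / (2 * k)\<close> and \<open>1 / 2\<close> contain no
    power of \<open>p\<close>.\<close>
  define g where "g a = (a :: 'a, {..<k}, 0 :: nat)" for a
  define S where "S = (\<lambda>(a, v). (g a, g a, v)) ` (SIGMA a:AP. {..<n} - pts a)"
  have gf: "g a \<in> flags" "fb (g a) = e 0 a" "fT (g a) \<subseteq> pts a" "fb (g a) \<in> pts a" if "a \<in> AP" for a
  proof -
    show f: "g a \<in> flags" using that k3 by (auto simp: g_def flags_def)
    show "fb (g a) = e 0 a" by (simp add: g_def fb_def)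
    show "fT (g a) \<subseteq> pts a" "fb (g a) \<in> pts a" using flag_pts[OF f] by (auto simp: g_def)
  qed
  have SL: "S \<subseteq> ?L"
  proof
    fix x assume "x \<in> S"
    then obtain a v where x: "x = (g a, g a, v)" "a \<in> AP" "v < n" "v \<notin> pts a" by (auto simp: S_def)
    then show "x \<in> ?L" using gf[OF x(2)] fT_two[OF gf(1)[OF x(2)]] by (auto simp: Ja_def linked_def)
  qed
  have pos: "0 \<le> bE p {..<n} (trm x)" if x: "x \<in> ?L" for x
  proof -
    obtain t t' v where tv: "x = (t, t', v)" by (cases x) auto
    have mem: "t \<in> flags" "t' \<in> flags" "v < n" "fb t' = fb t" "v \<notin> fT t" "v \<notin> fT t'"
      using x tv by (auto simp: Ja_def)
    show ?thesis
    proof (cases "fT t = fT t'")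
      case True
      then have "0 \<le> trm x A" for A
        using cg_bounds[OF mem(1)] cf_bounds[of t'] by (simp add: trm_def tv)
      then show ?thesis by (intro bE_nonneg) auto
    next
      case False
      then show ?thesis unfolding tv
        using flag_notin[OF mem(2)] mem by (subst trm_mean_zero) auto
    qed
  qed
  have low: "lam ^ (2 * k) * lam\<^sup>2 / (2 * real k) \<le> bE p {..<n} (trm x)" if x: "x \<in> S" for x
  proof -
    obtain a v where av: "x = (g a, g a, v)" "a \<in> AP" "v < n" "v \<notin> pts a" using x by (auto simp: S_def)
    have ne: "e 0 a \<noteq> v" using av(4) k3 by (auto simp: pts_def)
    have "lam\<^sup>2 \<le> p * (1 - p)" using lam by (simp add: power2_eq_square mult_mono)
    then have "lam ^ (2 * k) * lam\<^sup>2 / (2 * real k) \<le> lam ^ (2 * k) * (p * (1 - p)) / (2 * real k)"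
      using lam by (intro divide_right_mono mult_left_mono) auto
    also have "\<dots> = lam ^ (2 * k) / (4 * real k) * bE p {..<n} (\<lambda>A. (ind (e 0 a) A - ind v A)\<^sup>2)"
      using e_less[OF av(2), of 0] k3 av(3) ne by (subst bE_ind_diff_square) auto
    also have "\<dots> = bE p {..<n} (\<lambda>A. lam ^ (2 * k) / (4 * real k) * (ind (e 0 a) A - ind v A)\<^sup>2)"
      by (simp only: bE_cmult)
    also have "\<dots> \<le> bE p {..<n} (trm x)"
    proof (intro bE_mono)
      fix A
      have "lam ^ (2 * k) * (ind (e 0 a) A - ind v A)\<^sup>2 \<le> (mon p (fT (g a)) A)\<^sup>2 * (ind (e 0 a) A - ind v A)\<^sup>2"
        using lam card_fT_le[OF gf(1)[OF av(2)]] gf(1)[OF av(2)]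
        by (intro mult_right_mono mon_square_ge) auto
      then have "lam ^ (2 * k) * (ind (e 0 a) A - ind v A)\<^sup>2 / (4 * real k)
         \<le> (mon p (fT (g a)) A)\<^sup>2 * (ind (e 0 a) A - ind v A)\<^sup>2 / (4 * real k)"
        by (intro divide_right_mono) auto
      also have "\<dots> = trm x A"
      proof -
        have "cg (g a) = 1 / (2 * real k)" "cf (g a) = 1 / 2" by (simp_all add: g_def cg_def cf_def)
        then show ?thesis by (simp only: trm_def av prod.case gf(2)[OF av(2)]) (simp add: power2_eq_square)
      qed
      finally show "lam ^ (2 * k) / (4 * real k) * (ind (e 0 a) A - ind v A)\<^sup>2 \<le> trm x A" by simp
    qed auto
    finally show ?thesis .
  qed
  have cS: "real n * (real n - 1) * (real n - real k) \<le> real (card S)"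
  proof -
    have "card S = card (SIGMA a:AP. {..<n} - pts a)"
      unfolding S_def by (intro card_image) (auto simp: inj_on_def g_def)
    also have "\<dots> = (\<Sum>a\<in>AP. card ({..<n} - pts a))" using fin_AP by (intro card_SigmaI) auto
    also have "real \<dots> \<ge> (\<Sum>a\<in>AP. real n - real k)"
      unfolding of_nat_sum
    proof (intro sum_mono)
      fix a assume "a \<in> AP"
      then have "card ({..<n} - pts a) = n - card (pts a)" using pts_less by (subst card_Diff_subset) auto
      then show "real n - real k \<le> real (card ({..<n} - pts a))" using card_pts_le[of a] by linarith
    qed
    also have "(\<Sum>a\<in>AP. real n - real k) = real (card AP) * (real n - real k)" by simp
    also have "real (card AP) = real n * (real n - 1)" using n_pos by (simp add: card_AP of_nat_diff)
    finally show ?thesis by simp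
  qed
  have "lam ^ (2 * k) * lam\<^sup>2 / (2 * real k) * (real n * (real n - 1) * (real n - real k))
      \<le> lam ^ (2 * k) * lam\<^sup>2 / (2 * real k) * real (card S)"
    using lam by (intro mult_left_mono cS) auto
  also have "\<dots> = (\<Sum>x\<in>S. lam ^ (2 * k) * lam\<^sup>2 / (2 * real k))" by simp
  also have "\<dots> \<le> (\<Sum>x\<in>S. bE p {..<n} (trm x))" using low by (intro sum_mono)
  also have "\<dots> \<le> (\<Sum>x\<in>?L. bE p {..<n} (trm x))" using SL fJ pos by (intro sum_mono2) auto
  also have "\<dots> = ga" by (simp add: ga_def bE_sum)
  finally show ?thesis .
qed

end

text \<open>The exponent \<open>2 ^ 6\<close> reduces the loss in passing from independent bits to the slice to \<open>n powr (1 / 64)\<close>.\<close>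

definition kap :: "real \<Rightarrow> real" where "kap lam = 4 + 2 / lam"

definition hc :: "real \<Rightarrow> nat \<Rightarrow> real" where "hc lam D = 2 * kap lam ^ (D * 2 ^ 6 * (2 ^ 6 - 1))"

locale lam_progressions = slice_progressions n k AP e m for n k :: nat and AP :: "'a set" and e m +
  fixes lam :: real
  assumes lam_pos: "0 < lam" and lam_le: "lam \<le> real m / real n" and lam_ge: "real m / real n \<le> 1 - lam"
begin

lemma lam_p: "lam \<le> p" "lam \<le> 1 - p" using lam_le lam_ge by (auto simp: p_def)

lemma kap_ge: "4 \<le> kap lam" using lam_pos by (simp add: kap_def)

text \<open>The summand \<open>2 / lam\<close> in \<open>kap lam\<close> is chosen for this
  condition, since \<open>p * (1 - p)\<close> is at least \<open>lam^2\<close>; the summand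
  \<open>4\<close> serves the other condition of the hypercontractive inequality.\<close>

lemma kap_square: "3 \<le> (kap lam)\<^sup>2 * (p * (1 - p))"
proof -
  have "3 \<le> (2 / lam)\<^sup>2 * (lam * lam)" using lam_pos by (simp add: power2_eq_square)
  also have "\<dots> \<le> (kap lam)\<^sup>2 * (p * (1 - p))"
    using lam_pos lam_p by (intro mult_mono power_mono) (auto simp: kap_def)
  finally show ?thesis .
qed

lemma hc_nonneg: "0 \<le> hc lam D" using kap_ge by (simp add: hc_def)

text \<open>The transfer with \<open>j = 6\<close>. The constant \<open>2 * K\<close> is at least
  one and hence at least its 64th root, so that the remaining loss is a pure power of
  \<open>n\<close>.\<close>

lemma sE_square:
  assumes "dg D f"
  shows "sE n m (\<lambda>A. (f A)\<^sup>2) \<le> hc lam D * real n powr (1 / 64) * bE p {..<n} (\<lambda>A. (f A)\<^sup>2)"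
proof -
  define K where "K = kap lam ^ (D * 2 ^ 6 * (2 ^ 6 - 1))"
  have K: "1 \<le> K" unfolding K_def using kap_ge by (intro one_le_power) auto
  have N: "real n \<ge> 1" using n_pos by auto
  have e: "(1::real) / 2 ^ 6 = 1 / 64" by simp
  have "sE n m (\<lambda>A. (f A)\<^sup>2) \<le> ((real n + 1) * K) powr (1 / 64) * bE p {..<n} (\<lambda>A. (f A)\<^sup>2)"
    using sE_square_le_bE[OF m_pos m_less assms kap_ge, of 6] kap_square unfolding p_def[symmetric] K_def[symmetric] e by blast
  also have "\<dots> \<le> (hc lam D * real n powr (1 / 64)) * bE p {..<n} (\<lambda>A. (f A)\<^sup>2)"
  proof (intro mult_right_mono bE_nonneg)
    have "(real n + 1) * K \<le> (2 * real n) * K" using N K by (intro mult_right_mono) auto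
    then have "((real n + 1) * K) powr (1 / 64) \<le> ((2 * K) * real n) powr (1 / 64)"
      using K N by (intro powr_mono2) (auto simp: mult_ac)
    also have "\<dots> = (2 * K) powr (1 / 64) * real n powr (1 / 64)"
      using K by (subst powr_mult) auto
    also have "\<dots> \<le> (2 * K) powr 1 * real n powr (1 / 64)"
      using K by (intro mult_right_mono powr_mono) auto
    also have "(2 * K) powr 1 = hc lam D" using K by (simp add: hc_def K_def)
    finally show "((real n + 1) * K) powr (1 / 64) \<le> hc lam D * real n powr (1 / 64)" .
  qed auto
  finally show ?thesis .
qed

lemma dg_flag: "t \<in> flags \<Longrightarrow> dg k (\<lambda>A. c * mon p (fT t) A)"
  using dg_scale[OF dg_mon[of "fT t" k p], of c] card_fT_le by simp

lemma dg_PP: "dg k (PP u v)"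
  unfolding PP_def[abs_def] by (intro dg_sum dg_flag) auto

lemma dg_DD: "dg k (DD u v)"
  unfolding DD_def[abs_def] by (intro dg_sum dg_flag) auto

lemma dg_ind_diff: "dg 1 (\<lambda>A. ind u A - ind v A)"
  using dg_diff[OF dg_ind[of u 0] dg_ind[of v 0]] by simp

lemma dg_Xi: "dg (k + 1) Xi"
proof -
  have "dg (k + 1) (\<lambda>A. cg t * (ind (fb t) A - ind v A) * mon p (fT t) A)" if "t \<in> flags" for t v
    using dg_mult[OF dg_flag[OF that, of "cg t"] dg_ind_diff[of "fb t" v]] by (simp add: mult_ac)
  then have "dg (k + 1) (\<lambda>A. (1 / real n) * (\<Sum>t\<in>flags. \<Sum>v\<in>fT t. cg t * (ind (fb t) A - ind v A) * mon p (fT t) A))"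
    by (intro dg_scale dg_sum) auto
  then show ?thesis by (simp add: Xi_def[abs_def])
qed

lemma dg_Gam: "dg (2 * k + 2) (\<lambda>A. Gam A - g)"
proof -
  have "dg (1 + 1 + k + k) (\<lambda>A. (ind u A - ind v A) * (ind u A - ind v A) * DD u v A * (PP u v A - PP v u A))" for u v
    by (intro dg_mult dg_ind_diff dg_DD dg_diff dg_PP)
  then have "dg (2 * k + 2) (\<lambda>A. (ind u A - ind v A)\<^sup>2 * DD u v A * (PP u v A - PP v u A))" for u v
    by (simp add: power2_eq_square mult_2)
  then have "dg (2 * k + 2) (\<lambda>A. (1 / (2 * real n)) * (\<Sum>u<n. \<Sum>v<n. (ind u A - ind v A)\<^sup>2 * DD u v A * (PP u v A - PP v u A)))"
    by (intro dg_scale dg_sum)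
  then have "dg (2 * k + 2) Gam" by (simp add: Gam_def[abs_def])
  then show ?thesis by (intro dg_diff dg_const)
qed

lemma Xi_slice: "sE n m (\<lambda>A. (Xi A)\<^sup>2) \<le> hc lam (k + 1) * real (4 * k ^ 3 * KK\<^sup>2) * real n powr (65 / 64)"
proof -
  have "sE n m (\<lambda>A. (Xi A)\<^sup>2) \<le> hc lam (k + 1) * real n powr (1 / 64) * bE p {..<n} (\<lambda>A. (Xi A)\<^sup>2)"
    by (rule sE_square[OF dg_Xi])
  also have "\<dots> \<le> hc lam (k + 1) * real n powr (1 / 64) * (real (4 * k ^ 3 * KK\<^sup>2) * real n)"
    using hc_nonneg by (intro mult_left_mono Xi_square) auto
  also have "real n powr (65 / 64) = real n powr (1 / 64) * real n"
    using n_pos powr_add[of "real n" "1 / 64" 1] by simp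
  then have "hc lam (k + 1) * real n powr (1 / 64) * (real (4 * k ^ 3 * KK\<^sup>2) * real n)
     = hc lam (k + 1) * real (4 * k ^ 3 * KK\<^sup>2) * real n powr (65 / 64)" by simp
  finally show ?thesis .
qed

lemma Gam_slice: "sE n m (\<lambda>A. (Gam A - gamma)\<^sup>2) \<le> hc lam (2 * k + 2) * (234 * real (k ^ 4 * KK ^ 4)) * real n powr (193 / 64)"
proof -
  have "sE n m (\<lambda>A. (Gam A - gamma)\<^sup>2) \<le> hc lam (2 * k + 2) * real n powr (1 / 64) * bE p {..<n} (\<lambda>A. (Gam A - gamma)\<^sup>2)"
    by (rule sE_square[OF dg_Gam])
  also have "\<dots> \<le> hc lam (2 * k + 2) * real n powr (1 / 64) * (234 * real (k ^ 4 * KK ^ 4) * real n ^ 3)"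
    using hc_nonneg by (intro mult_left_mono Gam_variance) auto
  also have "real n powr (193 / 64) = real n powr (1 / 64) * real n ^ 3"
    using n_pos powr_add[of "real n" "1 / 64" 3] by (simp add: powr_numeral)
  then have "hc lam (2 * k + 2) * real n powr (1 / 64) * (234 * real (k ^ 4 * KK ^ 4) * real n ^ 3)
     = hc lam (2 * k + 2) * (234 * real (k ^ 4 * KK ^ 4)) * real n powr (193 / 64)" by simp
  finally show ?thesis .
qed

definition c_third :: real where
  "c_third = sqrt (hc lam k * real (KK\<^sup>2 * k\<^sup>2)) * sqrt (hc lam (2 * k) * kap lam ^ (2 * k) * (real (KK\<^sup>2 * k\<^sup>2))\<^sup>2)"

text \<open>By Cauchy-Schwarz the mixed moment is controlled by the second moment of
  \<open>DD\<close> and the fourth moment of \<open>PP\<close>, the latter through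
  hypercontractivity. The exponent \<open>97/64\<close> is \<open>3/2\<close> plus the loss of
  \<open>1/64\<close>.\<close>

lemma DD_PP_slice: "sE n m (\<lambda>A. \<bar>DD u v A\<bar> * (PP u' v' A)\<^sup>2) \<le> c_third * real n powr (97 / 64)"
proof -
  let ?a = "hc lam k * real (KK\<^sup>2 * k\<^sup>2)" and ?b = "hc lam (2 * k) * kap lam ^ (2 * k) * (real (KK\<^sup>2 * k\<^sup>2))\<^sup>2"
  have D: "sE n m (\<lambda>A. (DD u v A)\<^sup>2) \<le> ?a * real n powr (65 / 64)"
  proof -
    have "sE n m (\<lambda>A. (DD u v A)\<^sup>2) \<le> hc lam k * real n powr (1 / 64) * bE p {..<n} (\<lambda>A. (DD u v A)\<^sup>2)"
      by (rule sE_square[OF dg_DD])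
    also have "\<dots> \<le> hc lam k * real n powr (1 / 64) * (real (KK\<^sup>2 * k\<^sup>2) * real n)"
      using hc_nonneg by (intro mult_left_mono DD_square) auto
    also have "\<dots> = ?a * (real n powr (1 / 64) * real n)" by simp
    also have "real n powr (1 / 64) * real n = real n powr (65 / 64)"
      using n_pos powr_add[of "real n" "1 / 64" 1] by simp
    finally show ?thesis .
  qed
  have P: "sE n m (\<lambda>A. ((PP u' v' A)\<^sup>2)\<^sup>2) \<le> ?b * real n powr (129 / 64)"
  proof -
    have d: "dg (2 * k) (\<lambda>A. (PP u' v' A)\<^sup>2)"
      using dg_power[OF dg_PP[of u' v'], of 2] by (simp add: mult.commute)
    have "sE n m (\<lambda>A. ((PP u' v' A)\<^sup>2)\<^sup>2) \<le> hc lam (2 * k) * real n powr (1 / 64) * bE p {..<n} (\<lambda>A. ((PP u' v' A)\<^sup>2)\<^sup>2)"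
      by (rule sE_square[OF d])
    also have "bE p {..<n} (\<lambda>A. ((PP u' v' A)\<^sup>2)\<^sup>2) = bE p {..<n} (\<lambda>A. PP u' v' A ^ 4)" by simp
    also have "hc lam (2 * k) * real n powr (1 / 64) * \<dots>
      \<le> hc lam (2 * k) * real n powr (1 / 64) * (kap lam ^ (2 * k) * (real (KK\<^sup>2 * k\<^sup>2) * real n)\<^sup>2)"
    proof (intro mult_left_mono)
      have "bE p {..<n} (\<lambda>A. PP u' v' A ^ 4) \<le> kap lam ^ (2 * k) * (bE p {..<n} (\<lambda>A. (PP u' v' A)\<^sup>2))\<^sup>2"
        using p_pos p_less by (intro hypercontractive dg_PP kap_ge kap_square) auto
      also have "\<dots> \<le> kap lam ^ (2 * k) * (real (KK\<^sup>2 * k\<^sup>2) * real n)\<^sup>2"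
        using kap_ge by (intro mult_left_mono power_mono PP_square bE_nonneg) auto
      finally show "bE p {..<n} (\<lambda>A. PP u' v' A ^ 4) \<le> kap lam ^ (2 * k) * (real (KK\<^sup>2 * k\<^sup>2) * real n)\<^sup>2" .
    qed (use hc_nonneg in auto)
    also have "\<dots> = ?b * (real n powr (1 / 64) * (real n)\<^sup>2)" by (simp add: power_mult_distrib)
    also have "real n powr (1 / 64) * (real n)\<^sup>2 = real n powr (129 / 64)"
      using n_pos powr_add[of "real n" "1 / 64" 2] by (simp add: powr_numeral)
    finally show ?thesis .
  qed
  have "(sE n m (\<lambda>A. \<bar>DD u v A\<bar> * (PP u' v' A)\<^sup>2))\<^sup>2 \<le> sE n m (\<lambda>A. (DD u v A)\<^sup>2) * sE n m (\<lambda>A. ((PP u' v' A)\<^sup>2)\<^sup>2)"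
    using sE_Cauchy_Schwarz[of n m "\<lambda>A. \<bar>DD u v A\<bar>" "\<lambda>A. (PP u' v' A)\<^sup>2"] by simp
  also have "\<dots> \<le> (?a * real n powr (65 / 64)) * (?b * real n powr (129 / 64))"
    using hc_nonneg by (intro mult_mono D P sE_nonneg) auto
  finally have "sE n m (\<lambda>A. \<bar>DD u v A\<bar> * (PP u' v' A)\<^sup>2) \<le> sqrt ((?a * real n powr (65 / 64)) * (?b * real n powr (129 / 64)))"
    by (rule real_le_rsqrt)
  also have "\<dots> = c_third * sqrt (real n powr (65 / 64) * real n powr (129 / 64))"
    by (simp add: c_third_def real_sqrt_mult)
  also have "sqrt (real n powr (65 / 64) * real n powr (129 / 64)) = real n powr (97 / 64)"
  proof -
    have "real n powr (65 / 64) * real n powr (129 / 64) = (real n powr (97 / 64))\<^sup>2"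
      by (simp add: power2_eq_square powr_add[symmetric])
    then show ?thesis by simp
  qed
  finally show ?thesis .
qed

lemma third_moment:
  "(\<Sum>u<n. \<Sum>v<n. sE n m (\<lambda>A. \<bar>DD u v A\<bar> * ((ind v A - ind u A) * (PP u v A - PP v u A))\<^sup>2)) \<le> 4 * c_third * real n powr (225 / 64)"
proof -
  have one: "sE n m (\<lambda>A. \<bar>DD u v A\<bar> * ((ind v A - ind u A) * (PP u v A - PP v u A))\<^sup>2) \<le> 4 * c_third * real n powr (97 / 64)" for u v
  proof -
    have "sE n m (\<lambda>A. \<bar>DD u v A\<bar> * ((ind v A - ind u A) * (PP u v A - PP v u A))\<^sup>2)
       \<le> sE n m (\<lambda>A. 2 * (\<bar>DD u v A\<bar> * (PP u v A)\<^sup>2) + 2 * (\<bar>DD u v A\<bar> * (PP v u A)\<^sup>2))"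
    proof (rule sE_mono)
      fix A
      have "(ind v A - ind u A)\<^sup>2 * (PP u v A - PP v u A)\<^sup>2 \<le> 1 * (PP u v A - PP v u A)\<^sup>2"
        by (intro mult_right_mono) (auto simp: ind_def)
      also have "\<dots> \<le> 2 * (PP u v A)\<^sup>2 + 2 * (PP v u A)\<^sup>2"
        using zero_le_power2[of "PP u v A + PP v u A"] by (simp add: power2_eq_square algebra_simps)
      finally have "((ind v A - ind u A) * (PP u v A - PP v u A))\<^sup>2 \<le> 2 * (PP u v A)\<^sup>2 + 2 * (PP v u A)\<^sup>2"
        by (simp add: power_mult_distrib)
      then have "\<bar>DD u v A\<bar> * ((ind v A - ind u A) * (PP u v A - PP v u A))\<^sup>2 \<le> \<bar>DD u v A\<bar> * (2 * (PP u v A)\<^sup>2 + 2 * (PP v u A)\<^sup>2)"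
        by (intro mult_left_mono) auto
      then show "\<bar>DD u v A\<bar> * ((ind v A - ind u A) * (PP u v A - PP v u A))\<^sup>2
        \<le> 2 * (\<bar>DD u v A\<bar> * (PP u v A)\<^sup>2) + 2 * (\<bar>DD u v A\<bar> * (PP v u A)\<^sup>2)"
        by (simp add: algebra_simps)
    qed
    also have "\<dots> = 2 * sE n m (\<lambda>A. \<bar>DD u v A\<bar> * (PP u v A)\<^sup>2) + 2 * sE n m (\<lambda>A. \<bar>DD u v A\<bar> * (PP v u A)\<^sup>2)"
      by (simp only: sE_add sE_cmult)
    also have "\<dots> \<le> 2 * (c_third * real n powr (97 / 64)) + 2 * (c_third * real n powr (97 / 64))"
      by (intro add_mono mult_left_mono DD_PP_slice) auto
    finally show ?thesis by simp
  qed
  have "(\<Sum>u<n. \<Sum>v<n. sE n m (\<lambda>A. \<bar>DD u v A\<bar> * ((ind v A - ind u A) * (PP u v A - PP v u A))\<^sup>2))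
     \<le> (\<Sum>u<n. \<Sum>v<n. 4 * c_third * real n powr (97 / 64))"
    by (intro sum_mono one)
  also have "\<dots> = 4 * c_third * (real n powr (97 / 64) * (real n)\<^sup>2)" by (simp add: power2_eq_square)
  also have "real n powr (97 / 64) * (real n)\<^sup>2 = real n powr (225 / 64)"
    using n_pos powr_add[of "real n" "97 / 64" 2] by (simp add: powr_numeral)
  finally show ?thesis .
qed

definition g_low :: real where "g_low = lam ^ (2 * k) * lam\<^sup>2 / (2 * real k)"

lemma g_low_pos: "0 < g_low" using lam_pos k3 by (simp add: g_low_def)

text \<open>The threshold makes \<open>(n - 1) * (n - k)\<close> at least \<open>9/16 * n^2\<close>
  and \<open>gb\<close> at most \<open>g_low / 4 * n^3\<close>. The difference
  \<open>ga - gb\<close> still exceeds \<open>g_low / 4 * n^3\<close>, and dividing by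
  \<open>2 * n\<close> gives the claim.\<close>

lemma gamma_lower:
  assumes "real n \<ge> 4 * real k + 4 * real (KK\<^sup>2 * k\<^sup>2) / g_low"
  shows "g_low / 8 * (real n)\<^sup>2 \<le> gamma"
proof -
  let ?N = "real n" and ?B = "real (KK\<^sup>2 * k\<^sup>2)"
  have N: "?N > 0" "?N \<ge> 1" using n_pos by auto
  have B: "4 * ?B / g_low \<le> ?N" "4 * real k \<le> ?N" using assms g_low_pos
    by (auto intro: order_trans[OF _ assms] divide_nonneg_pos)
  have B': "4 * ?B \<le> g_low * ?N" using B(1) g_low_pos by (simp add: divide_le_eq mult.commute)
  have "(?N - 1) * (?N - real k) \<ge> (3/4 * ?N) * (3/4 * ?N)"
    using B(2) k3 by (intro mult_mono) auto
  then have "g_low * (?N * ((3/4 * ?N) * (3/4 * ?N))) \<le> g_low * (?N * ((?N - 1) * (?N - real k)))"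
    using g_low_pos N by (intro mult_left_mono) auto
  also have "\<dots> \<le> ga"
    using ga_lower[OF lam_pos lam_p] by (simp add: g_low_def mult.assoc)
  finally have a: "9/16 * g_low * (?N\<^sup>2 * ?N) \<le> ga" by (simp add: power2_eq_square algebra_simps)
  have "gb \<le> ?B * ?N\<^sup>2" using gb_bound by linarith
  also have "\<dots> \<le> (g_low * ?N / 4) * ?N\<^sup>2" using B' by (intro mult_right_mono) auto
  finally have b: "gb \<le> 1/4 * g_low * (?N\<^sup>2 * ?N)" by (simp add: mult_ac)
  have "0 \<le> g_low * (?N\<^sup>2 * ?N)" using g_low_pos N by auto
  then have "g_low / 4 * (?N\<^sup>2 * ?N) \<le> ga - gb" using a b by (simp add: algebra_simps)
  then show ?thesis unfolding gamma_def using N by (simp add: le_divide_eq algebra_simps)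
qed

lemma gamma_upper: "gamma \<le> real (k\<^sup>2 * KK\<^sup>2) * (real n)\<^sup>2"
proof -
  let ?N = "real n"
  have N: "?N \<ge> 1" using n_pos by auto
  have "ga \<le> real (k\<^sup>2 * KK\<^sup>2) * ?N ^ 3"
    using k3 by (intro order_trans[OF ga_upper] mult_right_mono) (auto simp: power2_eq_square simp flip: of_nat_mult)
  moreover have "- gb \<le> real (k\<^sup>2 * KK\<^sup>2) * ?N ^ 3"
  proof -
    have "?N\<^sup>2 \<le> ?N ^ 3" using N by (intro power_increasing) auto
    then have "real (KK\<^sup>2 * k\<^sup>2) * ?N\<^sup>2 \<le> real (KK\<^sup>2 * k\<^sup>2) * ?N ^ 3" by (intro mult_left_mono) auto
    then show ?thesis using gb_bound by (simp add: mult.commute)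
  qed
  ultimately have "ga - gb \<le> 2 * (real (k\<^sup>2 * KK\<^sup>2) * ?N ^ 3)" by linarith
  then have "gamma \<le> 2 * (real (k\<^sup>2 * KK\<^sup>2) * ?N ^ 3) / (2 * ?N)"
    unfolding gamma_def using N by (intro divide_right_mono) auto
  also have "\<dots> = real (k\<^sup>2 * KK\<^sup>2) * ?N\<^sup>2" using N by (simp add: power2_eq_square power3_eq_cube)
  finally show ?thesis .
qed

end

section \<open>The characteristic function near the origin\<close>

text \<open>The integrating factor \<open>exp (x^2 / 2)\<close> turns the hypothesis into a bound on
  a derivative. Along the segment from \<open>0\<close> to \<open>s\<close> the factor is largest at
  \<open>s\<close>, where it is divided out again, so there is no exponential loss.\<close>

lemma gaussian_ode:
  fixes f f' :: "real \<Rightarrow> complex"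
  assumes der: "\<And>x. (f has_derivative (\<lambda>h. h *\<^sub>R f' x)) (at x)" and f0: "f 0 = 1"
    and bd: "\<And>x. \<bar>x\<bar> \<le> \<bar>s\<bar> \<Longrightarrow> norm (f' x + x *\<^sub>R f x) \<le> E"
  shows "norm (f s - of_real (exp (- s\<^sup>2 / 2))) \<le> \<bar>s\<bar> * E"
proof -
  define g where "g x = exp (x\<^sup>2 / 2) *\<^sub>R f x" for x :: real
  let ?S = "closed_segment 0 s"
  have S: "\<bar>x\<bar> \<le> \<bar>s\<bar>" if "x \<in> ?S" for x
    using that by (auto simp: closed_segment_eq_real_ivl split: if_splits)
  have E: "0 \<le> E" using order_trans[OF norm_ge_zero bd[of 0]] by simp
  have dg: "(g has_derivative (\<lambda>h. h *\<^sub>R (exp (x\<^sup>2 / 2) *\<^sub>R (f' x + x *\<^sub>R f x)))) (at x within ?S)" for x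
  proof -
    have "((\<lambda>x::real. exp (x\<^sup>2 / 2)) has_derivative (\<lambda>h. h * (x * exp (x\<^sup>2 / 2)))) (at x)"
      by (auto intro!: derivative_eq_intros)
    from has_derivative_scaleR[OF this der[of x]]
    have "(g has_derivative (\<lambda>h. exp (x\<^sup>2 / 2) *\<^sub>R (h *\<^sub>R f' x) + (h * (x * exp (x\<^sup>2 / 2))) *\<^sub>R f x)) (at x)"
      by (simp add: g_def[abs_def])
    moreover have "exp (x\<^sup>2 / 2) *\<^sub>R (h *\<^sub>R f' x) + (h * (x * exp (x\<^sup>2 / 2))) *\<^sub>R f x
       = h *\<^sub>R (exp (x\<^sup>2 / 2) *\<^sub>R (f' x + x *\<^sub>R f x))" for h
      by (simp add: scaleR_add_right mult_ac)
    ultimately show ?thesis by (simp add: has_derivative_at_withinI)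
  qed
  have "norm (g s - g 0) \<le> (exp (s\<^sup>2 / 2) * E) * norm (s - 0)"
  proof (rule differentiable_bound[OF _ dg])
    fix x assume x: "x \<in> ?S"
    show "onorm (\<lambda>h. h *\<^sub>R (exp (x\<^sup>2 / 2) *\<^sub>R (f' x + x *\<^sub>R f x))) \<le> exp (s\<^sup>2 / 2) * E"
    proof (rule onorm_le)
      fix h :: real
      have "x\<^sup>2 \<le> s\<^sup>2" using S[OF x] by (simp add: abs_le_square_iff)
      then have "exp (x\<^sup>2 / 2) * norm (f' x + x *\<^sub>R f x) \<le> exp (s\<^sup>2 / 2) * E"
        using bd[OF S[OF x]] E by (intro mult_mono) auto
      then show "norm (h *\<^sub>R (exp (x\<^sup>2 / 2) *\<^sub>R (f' x + x *\<^sub>R f x))) \<le> exp (s\<^sup>2 / 2) * E * norm h"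
        using mult_right_mono[of "exp (x\<^sup>2 / 2) * norm (f' x + x *\<^sub>R f x)" "exp (s\<^sup>2 / 2) * E" "\<bar>h\<bar>"] by (simp add: abs_mult mult_ac)
    qed
  qed auto
  moreover have "g 0 = 1" by (simp add: g_def f0)
  moreover have "f s - of_real (exp (- s\<^sup>2 / 2)) = exp (- s\<^sup>2 / 2) *\<^sub>R (g s - 1)"
  proof -
    have "exp (- s\<^sup>2 / 2) * exp (s\<^sup>2 / 2) = 1" by (simp flip: exp_add)
    then have "exp (- s\<^sup>2 / 2) *\<^sub>R g s = f s" unfolding g_def scaleR_scaleR by simp
    then show ?thesis by (simp only: scaleR_diff_right) (simp add: scaleR_conv_of_real)
  qed
  ultimately have "norm (f s - of_real (exp (- s\<^sup>2 / 2))) \<le> exp (- s\<^sup>2 / 2) * ((exp (s\<^sup>2 / 2) * E) * \<bar>s\<bar>)"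
    by (simp add: mult_left_mono)
  also have "\<dots> = (exp (- s\<^sup>2 / 2) * exp (s\<^sup>2 / 2)) * (\<bar>s\<bar> * E)" by (simp only: mult_ac)
  also have "\<dots> = \<bar>s\<bar> * E" by (simp flip: exp_add)
  finally show ?thesis .
qed

text \<open>The main cancellation: \<open>\<i> * \<i> * s * g / w^2\<close> compensates
  \<open>s * y\<close> up to the deviations of \<open>g\<close> from \<open>ga * y\<close> and of
  \<open>w^2\<close> from \<open>ga\<close>. In the application \<open>w\<close> is the standard
  deviation and \<open>ga\<close> stands for \<open>gamma\<close>.\<close>

lemma ode_algebra:
  fixes c R x g y w s mu ga :: complex
  assumes "w \<noteq> 0"
  shows "\<i> * c / w * ((R + x + \<i> * (s / w) * g) - mu * y) + s * (c * y)
    = \<i> * c / w * ((x - mu * y) + R) - (s / w\<^sup>2) * c * (g - ga * y) + (s * (w\<^sup>2 - ga) / w\<^sup>2) * c * y"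
proof -
  have "\<i> * c / w * (\<i> * (s / w) * g) = - ((s / w\<^sup>2) * c * g)"
  proof -
    have "\<i> * c / w * (\<i> * (s / w) * g) = (\<i> * \<i>) * (c * s * g / (w * w))"
      by (simp only: times_divide_eq_left times_divide_eq_right divide_divide_eq_left mult_ac)
    then show ?thesis by (simp add: power2_eq_square mult_ac)
  qed
  moreover have "s * (w\<^sup>2 - ga) / w\<^sup>2 = s - s / w\<^sup>2 * ga"
    using assms by (simp add: right_diff_distrib diff_divide_distrib)
  moreover have "\<i> * c / w * ((R + x + \<i> * (s / w) * g) - mu * y)
     = \<i> * c / w * ((x - mu * y) + R) + \<i> * c / w * (\<i> * (s / w) * g)" by (simp only: distrib_left[symmetric]) (simp add: algebra_simps)
  ultimately show ?thesis by (simp only:) (simp add: algebra_simps add_divide_distrib diff_divide_distrib)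
qed

context lam_progressions
begin

definition mu :: real where "mu = sE n m (YY p)"
definition s2 :: real where "s2 = sE n m (\<lambda>A. (YY p A - mu)\<^sup>2)"
definition sg :: real where "sg = sqrt s2"
definition ZZ :: "nat set \<Rightarrow> real" where "ZZ A = (YY p A - mu) / sg"
definition phi :: "real \<Rightarrow> complex" where "phi s = sE n m (\<lambda>A. cis (s * ZZ A))"

definition cXi :: real where "cXi = sqrt (hc lam (k + 1) * real (4 * k ^ 3 * KK\<^sup>2))"
definition cGam :: real where "cGam = sqrt (hc lam (2 * k + 2) * (234 * real (k ^ 4 * KK ^ 4)))"
definition cS :: real where "cS = sqrt (2 * real (k\<^sup>2 * KK\<^sup>2) + cXi\<^sup>2 + 2 * cGam)"
definition cD :: real where "cD = cXi * cS + cGam"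
text \<open>Half of the lower bound \<open>g_low / 8\<close> for \<open>gamma / n^2\<close> is given
  up to absorb the distance between \<open>s2\<close> and \<open>gamma\<close>.\<close>

definition cL :: real where "cL = sqrt (g_low / 16)"

lemma m_le_n: "m \<le> n" using m_less by simp

lemma consts_nonneg: "0 \<le> cXi" "0 \<le> cGam" "0 \<le> cS" "0 \<le> cD" "0 < cL" "0 \<le> c_third"
  using hc_nonneg kap_ge g_low_pos by (auto simp: cXi_def cGam_def cS_def cD_def cL_def c_third_def)

lemma Xi_L2: "sqrt (sE n m (\<lambda>A. (Xi A)\<^sup>2)) \<le> cXi * real n powr (65 / 128)"
proof -
  have "sqrt (sE n m (\<lambda>A. (Xi A)\<^sup>2)) \<le> sqrt (hc lam (k + 1) * real (4 * k ^ 3 * KK\<^sup>2) * (real n powr (65 / 128))\<^sup>2)"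
    using Xi_slice by (intro real_sqrt_le_mono) (simp add: power2_eq_square powr_add[symmetric])
  then show ?thesis by (simp add: cXi_def real_sqrt_mult)
qed

lemma Gam_L2: "sqrt (sE n m (\<lambda>A. (Gam A - gamma)\<^sup>2)) \<le> cGam * real n powr (193 / 128)"
proof -
  have "sqrt (sE n m (\<lambda>A. (Gam A - gamma)\<^sup>2)) \<le> sqrt (hc lam (2 * k + 2) * (234 * real (k ^ 4 * KK ^ 4)) * (real n powr (193 / 128))\<^sup>2)"
    using Gam_slice by (intro real_sqrt_le_mono) (simp add: power2_eq_square powr_add[symmetric])
  then show ?thesis by (simp add: cGam_def real_sqrt_mult)
qed

lemma s2_nonneg: "0 \<le> s2" unfolding s2_def by (intro sE_nonneg) auto

text \<open>Taking \<open>f = YY p\<close> in the Stein identity expresses \<open>s2\<close> as the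
  mean of \<open>Xi * (YY p - mu)\<close> plus the mean of \<open>Gam\<close>; Cauchy-Schwarz bounds
  the first and the deviation of the second.\<close>

lemma s2_near_gamma: "\<bar>s2 - gamma\<bar> \<le> cXi * real n powr (65 / 128) * sg + cGam * real n powr (193 / 128)"
proof -
  have e1: "s2 = sE n m (\<lambda>A. (YY p A)\<^sup>2) - mu\<^sup>2"
  proof -
    have "s2 = sE n m (\<lambda>A. ((YY p A)\<^sup>2 - (2 * mu) * YY p A) + mu\<^sup>2)"
      unfolding s2_def by (intro sE_cong) (simp add: power2_eq_square algebra_simps)
    also have "\<dots> = sE n m (\<lambda>A. (YY p A)\<^sup>2) - (2 * mu) * mu + mu\<^sup>2"
      by (simp only: sE_add sE_diff sE_cmult sE_const[OF m_le_n] mu_def)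
    finally show ?thesis by (simp add: power2_eq_square)
  qed
  have e2: "sE n m (\<lambda>A. Xi A * (YY p A - mu)) = sE n m (\<lambda>A. Xi A * YY p A) - mu\<^sup>2"
    by (simp only: right_diff_distrib sE_diff sE_multc stein_mean[symmetric] mu_def[symmetric] power2_eq_square)
  have e3: "sE n m (\<lambda>A. Gam A - gamma) = sE n m Gam - gamma"
    by (simp add: sE_diff sE_const[OF m_le_n])
  have eq: "s2 - gamma = sE n m (\<lambda>A. Xi A * (YY p A - mu)) + sE n m (\<lambda>A. Gam A - gamma)"
    unfolding e1 e2 e3 stein_square by simp
  have "(sE n m (\<lambda>A. Xi A * (YY p A - mu)))\<^sup>2 \<le> sE n m (\<lambda>A. (Xi A)\<^sup>2) * s2"
    unfolding s2_def by (rule sE_Cauchy_Schwarz)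
  then have "\<bar>sE n m (\<lambda>A. Xi A * (YY p A - mu))\<bar> \<le> sqrt (sE n m (\<lambda>A. (Xi A)\<^sup>2) * s2)"
    by (intro real_le_rsqrt) simp
  then have b1: "\<bar>sE n m (\<lambda>A. Xi A * (YY p A - mu))\<bar> \<le> sqrt (sE n m (\<lambda>A. (Xi A)\<^sup>2)) * sg"
    by (simp add: real_sqrt_mult sg_def)
  have b2: "sqrt (sE n m (\<lambda>A. (Xi A)\<^sup>2)) * sg \<le> cXi * real n powr (65 / 128) * sg"
    by (rule mult_right_mono[OF Xi_L2]) (simp add: sg_def s2_nonneg)
  have "(sE n m (\<lambda>A. Gam A - gamma))\<^sup>2 \<le> sE n m (\<lambda>A. (Gam A - gamma)\<^sup>2)"
    by (rule sE_square_le[OF m_le_n])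
  then have b3: "\<bar>sE n m (\<lambda>A. Gam A - gamma)\<bar> \<le> sqrt (sE n m (\<lambda>A. (Gam A - gamma)\<^sup>2))"
    by (intro real_le_rsqrt) simp
  show ?thesis using eq b1 b2 b3 Gam_L2 by linarith
qed

lemma n_ge_1: "1 \<le> real n" using n_pos by auto

text \<open>The bound for \<open>s2\<close> itself contains \<open>sg\<close>. The
  arithmetic-geometric mean inequality moves half of \<open>s2\<close> to the left side and closes
  the circle.\<close>

lemma sg_upper: "sg \<le> cS * real n"
proof -
  let ?N = "real n" and ?x = "cXi * real n powr (65 / 128)"
  have sg: "0 \<le> sg" "sg\<^sup>2 = s2" using s2_nonneg by (auto simp: sg_def)
  have "?x * sg \<le> ?x\<^sup>2 / 2 + s2 / 2"
    using zero_le_power2[of "?x - sg"] sg(2) by (simp add: power2_eq_square algebra_simps)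
  moreover have "?x\<^sup>2 \<le> cXi\<^sup>2 * ?N\<^sup>2"
  proof -
    have "?N powr (65 / 128) \<le> ?N powr 1" using n_ge_1 by (intro powr_mono) auto
    then show ?thesis unfolding power_mult_distrib using n_ge_1 by (intro mult_left_mono power_mono) auto
  qed
  moreover have "cGam * ?N powr (193 / 128) \<le> cGam * ?N\<^sup>2"
  proof -
    have "?N powr (193 / 128) \<le> ?N powr 2" using n_ge_1 by (intro powr_mono) auto
    then show ?thesis using n_ge_1 consts_nonneg by (intro mult_left_mono) (auto simp: powr_numeral)
  qed
  ultimately have "s2 \<le> 2 * gamma + cXi\<^sup>2 * ?N\<^sup>2 + 2 * (cGam * ?N\<^sup>2)" using s2_near_gamma by linarith
  also have "\<dots> \<le> 2 * (real (k\<^sup>2 * KK\<^sup>2) * ?N\<^sup>2) + cXi\<^sup>2 * ?N\<^sup>2 + 2 * (cGam * ?N\<^sup>2)"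
    using gamma_upper by simp
  also have "\<dots> = (2 * real (k\<^sup>2 * KK\<^sup>2) + cXi\<^sup>2 + 2 * cGam) * ?N\<^sup>2" by (simp add: algebra_simps)
  finally have "sg \<le> sqrt ((2 * real (k\<^sup>2 * KK\<^sup>2) + cXi\<^sup>2 + 2 * cGam) * ?N\<^sup>2)"
    unfolding sg_def by (rule real_sqrt_le_mono)
  then show ?thesis by (simp add: cS_def real_sqrt_mult)
qed

lemma s2_near_gamma': "\<bar>s2 - gamma\<bar> \<le> cD * real n powr (193 / 128)"
proof -
  have "cXi * real n powr (65 / 128) * sg \<le> cXi * real n powr (65 / 128) * (cS * real n)"
    using sg_upper consts_nonneg by (intro mult_left_mono) auto
  also have "\<dots> = cXi * cS * (real n powr (65 / 128) * real n)" by simp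
  also have "real n powr (65 / 128) * real n = real n powr (193 / 128)"
    using n_pos powr_add[of "real n" "65 / 128" 1] by simp
  finally show ?thesis using s2_near_gamma by (simp add: cD_def algebra_simps)
qed

lemma sg_lower:
  assumes "real n \<ge> 4 * real k + 4 * real (KK\<^sup>2 * k\<^sup>2) / g_low"
    and "cD * real n powr (193 / 128) \<le> g_low / 16 * (real n)\<^sup>2"
  shows "cL * real n \<le> sg"
proof -
  have "g_low / 16 * (real n)\<^sup>2 \<le> s2"
    using gamma_lower[OF assms(1)] s2_near_gamma' assms(2) by linarith
  then have "sqrt (g_low / 16 * (real n)\<^sup>2) \<le> sg" unfolding sg_def by (rule real_sqrt_le_mono)
  moreover have "sqrt (g_low / 16 * (real n)\<^sup>2) = cL * real n"
    unfolding cL_def by (subst real_sqrt_mult) simp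
  ultimately show ?thesis by simp
qed

lemma phi_derivative: "(phi has_derivative (\<lambda>h. h *\<^sub>R sE n m (\<lambda>A. \<i> * (of_real (ZZ A) * cis (x * ZZ A))))) (at x)"
proof -
  have "(phi has_derivative (\<lambda>h. (1 / real (card (slc n m))) *\<^sub>R (\<Sum>A\<in>slc n m. (h * ZZ A) *\<^sub>R (\<i> * cis (x * ZZ A))))) (at x)"
    unfolding phi_def[abs_def] sE_def
    by (intro has_derivative_scaleR_right has_derivative_sum has_derivative_cis has_derivative_mult_left has_derivative_ident)
  moreover have "(1 / real (card (slc n m))) *\<^sub>R (\<Sum>A\<in>slc n m. (h * ZZ A) *\<^sub>R (\<i> * cis (x * ZZ A)))
     = h *\<^sub>R sE n m (\<lambda>A. \<i> * (of_real (ZZ A) * cis (x * ZZ A)))" for h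
    by (simp add: sE_def scaleR_sum_right scaleR_conv_of_real sum_distrib_left mult_ac)
  ultimately show ?thesis by simp
qed

text \<open>The Stein identity for \<open>cis\<close> is read as an approximate equation
  \<open>phi' = - s * phi\<close>: the term with \<open>Gam\<close> supplies the right side. The
  three errors stem from \<open>Xi\<close>, from the deviations of \<open>Gam\<close> and
  \<open>s2\<close> from \<open>gamma\<close>, and from the Taylor remainder.\<close>

lemma phi_ode:
  assumes sg0: "0 < sg"
  shows "norm (sE n m (\<lambda>A. \<i> * (of_real (ZZ A) * cis (s * ZZ A))) + s *\<^sub>R phi s)
    \<le> cXi * real n powr (65 / 128) / sg + \<bar>s\<bar> * (cGam + cD) * real n powr (193 / 128) / sg\<^sup>2
      + s\<^sup>2 * c_third * real n powr (161 / 64) / sg ^ 3"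
proof -
  define t where "t = s / sg"
  define f where "f A = cis (t * YY p A)" for A
  define c where "c = cis (- (t * mu))"
  define R where "R = sE n m (\<lambda>A. YY p A * f A) - sE n m (\<lambda>A. Xi A * f A) - \<i> * t * sE n m (\<lambda>A. Gam A * f A)"
  have nc: "norm c = 1" "norm (f A) = 1" for A by (auto simp: c_def f_def)
  have Rb: "norm R \<le> t\<^sup>2 * c_third * real n powr (161 / 64)"
  proof -
    have "norm R \<le> t\<^sup>2 / (4 * real n) * (\<Sum>u<n. \<Sum>v<n. sE n m (\<lambda>A. \<bar>DD u v A\<bar> * ((ind v A - ind u A) * (PP u v A - PP v u A))\<^sup>2))"
      unfolding R_def f_def by (rule stein_cis)
    also have "\<dots> \<le> t\<^sup>2 / (4 * real n) * (4 * c_third * real n powr (225 / 64))"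
      by (intro mult_left_mono third_moment) auto
    also have "\<dots> = t\<^sup>2 * c_third * (real n powr (225 / 64) / real n)" by simp
    also have "real n powr (225 / 64) / real n = real n powr (161 / 64)"
      using n_pos powr_diff[of "real n" "225 / 64" 1] by simp
    finally show ?thesis .
  qed
  have ZZ: "cis (s * ZZ A) = c * f A" for A
    unfolding c_def f_def cis_mult using sg0 by (simp add: ZZ_def t_def field_simps)
  have phi: "phi s = c * sE n m f" by (simp add: phi_def ZZ sE_cmult)
  have i1: "sE n m (\<lambda>A. complex_of_real (Xi A - mu) * f A) = sE n m (\<lambda>A. Xi A * f A) - mu * sE n m f"
    by (simp only: of_real_diff left_diff_distrib sE_diff sE_cmult)
  have i2: "sE n m (\<lambda>A. complex_of_real (Gam A - gamma) * f A) = sE n m (\<lambda>A. Gam A * f A) - gamma * sE n m f"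
    by (simp only: of_real_diff left_diff_distrib sE_diff sE_cmult)
  have i3: "sE n m (\<lambda>A. \<i> * (of_real (ZZ A) * cis (s * ZZ A))) = \<i> * c / sg * (sE n m (\<lambda>A. YY p A * f A) - mu * sE n m f)"
  proof -
    have "\<i> * (of_real (ZZ A) * cis (s * ZZ A)) = \<i> * c / sg * (YY p A * f A - mu * f A)" for A
      unfolding ZZ using sg0 by (simp add: ZZ_def field_simps)
    then show ?thesis by (simp only: sE_cmult sE_diff)
  qed
  have st: "of_real t = of_real s / complex_of_real sg" by (simp add: t_def)
  have sgc: "complex_of_real sg \<noteq> 0" using sg0 by simp
  have eq: "sE n m (\<lambda>A. \<i> * (of_real (ZZ A) * cis (s * ZZ A))) + s *\<^sub>R phi s
    = \<i> * c / sg * (sE n m (\<lambda>A. complex_of_real (Xi A - mu) * f A) + R)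
      - (s / sg\<^sup>2) * c * sE n m (\<lambda>A. complex_of_real (Gam A - gamma) * f A)
      + (s * (s2 - gamma) / sg\<^sup>2) * c * sE n m f"
  proof -
    have "sE n m (\<lambda>A. YY p A * f A) = R + sE n m (\<lambda>A. Xi A * f A) + \<i> * t * sE n m (\<lambda>A. Gam A * f A)"
      by (simp add: R_def)
    moreover have "s2 = sg\<^sup>2" using s2_nonneg by (simp add: sg_def)
    ultimately show ?thesis
      using ode_algebra[OF sgc, of c R "sE n m (\<lambda>A. Xi A * f A)" s "sE n m (\<lambda>A. Gam A * f A)" mu "sE n m f" gamma]
      unfolding i3 phi i1 i2 scaleR_conv_of_real st by (simp only: of_real_mult of_real_divide of_real_diff of_real_power)
  qed
  have "norm (sE n m (\<lambda>A. \<i> * (of_real (ZZ A) * cis (s * ZZ A))) + s *\<^sub>R phi s) \<le> (cXi * real n powr (65 / 128) + t\<^sup>2 * c_third * real n powr (161 / 64)) / sg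
     + \<bar>s\<bar> / sg\<^sup>2 * (cGam * real n powr (193 / 128)) + \<bar>s\<bar> / sg\<^sup>2 * (cD * real n powr (193 / 128))"
    unfolding eq
  proof (intro order_trans[OF norm_triangle_ineq] order_trans[OF norm_triangle_ineq4] add_mono)
    have fb: "norm (sE n m (\<lambda>A. complex_of_real (g A) * f A)) \<le> sqrt (sE n m (\<lambda>A. (g A)\<^sup>2))" for g
    proof -
      have "norm (sE n m (\<lambda>A. complex_of_real (g A) * f A)) \<le> sE n m (\<lambda>A. \<bar>g A\<bar>)"
        using sE_norm[of n m "\<lambda>A. complex_of_real (g A) * f A"] by (simp add: norm_mult nc)
      then show ?thesis using sE_abs_le_sqrt[OF m_le_n, of g] by linarith
    qed
    have X: "norm (sE n m (\<lambda>A. complex_of_real (Xi A - mu) * f A)) \<le> cXi * real n powr (65 / 128)"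
    proof -
      \<comment> \<open>The mean of \<open>Xi\<close> on the slice is also \<open>mu\<close>, so
        centring only lowers the second moment.\<close>
      have "sE n m (\<lambda>A. (Xi A - mu)\<^sup>2) = sE n m (\<lambda>A. ((Xi A)\<^sup>2 - (2 * mu) * Xi A) + mu\<^sup>2)"
        by (intro sE_cong) (simp add: power2_eq_square algebra_simps)
      also have "\<dots> = sE n m (\<lambda>A. (Xi A)\<^sup>2) - (2 * mu) * mu + mu\<^sup>2"
        by (simp only: sE_add sE_diff sE_cmult sE_const[OF m_le_n] stein_mean[symmetric] mu_def)
      also have "\<dots> \<le> sE n m (\<lambda>A. (Xi A)\<^sup>2)" by (simp add: power2_eq_square)
      finally have "sqrt (sE n m (\<lambda>A. (Xi A - mu)\<^sup>2)) \<le> sqrt (sE n m (\<lambda>A. (Xi A)\<^sup>2))" by (rule real_sqrt_le_mono)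
      then show ?thesis using fb[of "\<lambda>A. Xi A - mu"] Xi_L2 by linarith
    qed
    have "norm (\<i> * c / sg * (sE n m (\<lambda>A. complex_of_real (Xi A - mu) * f A) + R))
       = norm (sE n m (\<lambda>A. complex_of_real (Xi A - mu) * f A) + R) / sg"
      using sg0 by (simp add: norm_mult norm_divide nc)
    also have "\<dots> \<le> (cXi * real n powr (65 / 128) + t\<^sup>2 * c_third * real n powr (161 / 64)) / sg"
      using sg0 X Rb by (intro divide_right_mono order_trans[OF norm_triangle_ineq] add_mono) auto
    finally show "norm (\<i> * c / sg * (sE n m (\<lambda>A. complex_of_real (Xi A - mu) * f A) + R))
      \<le> (cXi * real n powr (65 / 128) + t\<^sup>2 * c_third * real n powr (161 / 64)) / sg" .
    have G: "norm (sE n m (\<lambda>A. complex_of_real (Gam A - gamma) * f A)) \<le> cGam * real n powr (193 / 128)"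
      using fb[of "\<lambda>A. Gam A - gamma"] Gam_L2 by linarith
    have "norm (complex_of_real (s / sg\<^sup>2) * c * sE n m (\<lambda>A. complex_of_real (Gam A - gamma) * f A))
       = \<bar>s\<bar> / sg\<^sup>2 * norm (sE n m (\<lambda>A. complex_of_real (Gam A - gamma) * f A))"
      by (simp only: norm_mult norm_of_real nc abs_divide abs_power2 mult_1_right)
    also have "\<dots> \<le> \<bar>s\<bar> / sg\<^sup>2 * (cGam * real n powr (193 / 128))" by (intro mult_left_mono G) auto
    finally show "norm (complex_of_real (s / sg\<^sup>2) * c * sE n m (\<lambda>A. complex_of_real (Gam A - gamma) * f A))
      \<le> \<bar>s\<bar> / sg\<^sup>2 * (cGam * real n powr (193 / 128))" .
    have F: "norm (sE n m f) \<le> 1"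
      using sE_norm[of n m f] sE_const[OF m_le_n, of "1::real"] by (simp add: nc)
    have "norm (complex_of_real (s * (s2 - gamma) / sg\<^sup>2) * c * sE n m f) = \<bar>s\<bar> / sg\<^sup>2 * \<bar>s2 - gamma\<bar> * norm (sE n m f)"
      by (simp only: norm_mult norm_of_real nc abs_divide abs_power2 abs_mult mult_1_right) simp
    also have "\<dots> \<le> \<bar>s\<bar> / sg\<^sup>2 * (cD * real n powr (193 / 128)) * 1"
      using F s2_near_gamma' by (intro mult_mono mult_left_mono) auto
    finally show "norm (complex_of_real (s * (s2 - gamma) / sg\<^sup>2) * c * sE n m f) \<le> \<bar>s\<bar> / sg\<^sup>2 * (cD * real n powr (193 / 128))"
      by simp
  qed
  also have "\<dots> = cXi * real n powr (65 / 128) / sg + \<bar>s\<bar> * (cGam + cD) * real n powr (193 / 128) / sg\<^sup>2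
      + s\<^sup>2 * c_third * real n powr (161 / 64) / sg ^ 3"
    unfolding t_def by (simp add: add_divide_distrib power2_eq_square power3_eq_cube distrib_left distrib_right)
  finally show ?thesis .
qed

definition cP :: real where "cP = cXi / cL + (cGam + cD) / cL\<^sup>2 + c_third / cL ^ 3"

text \<open>With \<open>sg\<close> of order \<open>n\<close> the first two errors have exponent
  \<open>- 63/128\<close>. The Taylor remainder, with exponent \<open>161/64 - 3 = - 31/64\<close>,
  is the largest and determines the rate.\<close>

lemma phi_gaussian:
  assumes low: "cL * real n \<le> sg"
  shows "norm (phi s - of_real (exp (- s\<^sup>2 / 2))) \<le> \<bar>s\<bar> * (cP * (1 + \<bar>s\<bar>)\<^sup>2 * real n powr (- 31 / 64))"
proof (rule gaussian_ode[OF phi_derivative])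
  show "phi 0 = 1" by (simp add: phi_def sE_const[OF m_le_n])
  fix x :: real assume x: "\<bar>x\<bar> \<le> \<bar>s\<bar>"
  let ?N = "real n" and ?e = "real n powr (- 31 / 64)"
  have sg0: "0 < sg" using low consts_nonneg(5) n_ge_1 by (smt (verit) mult_pos_pos)
  have cLN: "0 < cL * ?N" using consts_nonneg(5) n_ge_1 by simp
  have b1: "cXi * ?N powr (65 / 128) / sg \<le> cXi / cL * ?e * 1"
  proof -
    have "cXi * ?N powr (65 / 128) / sg \<le> cXi * ?N powr (65 / 128) / (cL * ?N)"
      using low cLN consts_nonneg by (intro divide_left_mono) auto
    also have "\<dots> = cXi / cL * (?N powr (65 / 128) / ?N)" by simp
    also have "?N powr (65 / 128) / ?N = ?N powr (- 63 / 128)"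
      using n_pos powr_diff[of ?N "65 / 128" 1] by simp
    also have "cXi / cL * \<dots> \<le> cXi / cL * ?e"
      using consts_nonneg n_ge_1 by (intro mult_left_mono powr_mono) auto
    finally show ?thesis by simp
  qed
  have b2: "\<bar>x\<bar> * (cGam + cD) * ?N powr (193 / 128) / sg\<^sup>2 \<le> (cGam + cD) / cL\<^sup>2 * ?e * \<bar>s\<bar>"
  proof -
    have "\<bar>x\<bar> * (cGam + cD) * ?N powr (193 / 128) / sg\<^sup>2 \<le> \<bar>s\<bar> * (cGam + cD) * ?N powr (193 / 128) / (cL * ?N)\<^sup>2"
      using low cLN x consts_nonneg n_pos by (intro frac_le mult_right_mono power_mono) auto
    also have "\<dots> = \<bar>s\<bar> * (cGam + cD) / cL\<^sup>2 * (?N powr (193 / 128) / ?N\<^sup>2)" by (simp add: power_mult_distrib)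
    also have "?N powr (193 / 128) / ?N\<^sup>2 = ?N powr (- 63 / 128)"
      using n_pos powr_diff[of ?N "193 / 128" 2] by (simp add: powr_numeral)
    also have "\<bar>s\<bar> * (cGam + cD) / cL\<^sup>2 * \<dots> \<le> \<bar>s\<bar> * (cGam + cD) / cL\<^sup>2 * ?e"
      using consts_nonneg n_ge_1 by (intro mult_left_mono powr_mono divide_nonneg_nonneg) auto
    finally show ?thesis by (simp add: mult_ac)
  qed
  have b3: "x\<^sup>2 * c_third * ?N powr (161 / 64) / sg ^ 3 \<le> c_third / cL ^ 3 * ?e * s\<^sup>2"
  proof -
    have "x\<^sup>2 \<le> s\<^sup>2" using x by (simp add: abs_le_square_iff)
    then have "x\<^sup>2 * (c_third * ?N powr (161 / 64)) \<le> s\<^sup>2 * (c_third * ?N powr (161 / 64))"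
      using consts_nonneg by (intro mult_right_mono) auto
    moreover have "(cL * ?N) ^ 3 \<le> sg ^ 3" using low cLN by (intro power_mono) auto
    moreover have "0 < (cL * ?N) ^ 3" using cLN by (rule zero_less_power)
    moreover have "0 \<le> s\<^sup>2 * (c_third * ?N powr (161 / 64))" using consts_nonneg by auto
    ultimately have "x\<^sup>2 * c_third * ?N powr (161 / 64) / sg ^ 3 \<le> s\<^sup>2 * c_third * ?N powr (161 / 64) / (cL * ?N) ^ 3"
      unfolding mult.assoc by (intro frac_le)
    also have "\<dots> = s\<^sup>2 * c_third / cL ^ 3 * (?N powr (161 / 64) / ?N ^ 3)" by (simp add: power_mult_distrib)
    also have "?N powr (161 / 64) / ?N ^ 3 = ?e"
      using n_pos powr_diff[of ?N "161 / 64" 3] by (simp add: powr_numeral)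
    finally show ?thesis by (simp add: mult_ac)
  qed
  have s: "1 \<le> (1 + \<bar>s\<bar>)\<^sup>2" "\<bar>s\<bar> \<le> (1 + \<bar>s\<bar>)\<^sup>2" "s\<^sup>2 \<le> (1 + \<bar>s\<bar>)\<^sup>2"
    by (auto simp: power2_eq_square algebra_simps)
  have "norm (sE n m (\<lambda>A. \<i> * (of_real (ZZ A) * cis (x * ZZ A))) + x *\<^sub>R phi x)
     \<le> cXi / cL * ?e * 1 + (cGam + cD) / cL\<^sup>2 * ?e * \<bar>s\<bar> + c_third / cL ^ 3 * ?e * s\<^sup>2"
    using phi_ode[OF sg0, of x] b1 b2 b3 by linarith
  also have "\<dots> \<le> cXi / cL * ?e * (1 + \<bar>s\<bar>)\<^sup>2 + (cGam + cD) / cL\<^sup>2 * ?e * (1 + \<bar>s\<bar>)\<^sup>2 + c_third / cL ^ 3 * ?e * (1 + \<bar>s\<bar>)\<^sup>2"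
    using s consts_nonneg by (intro add_mono mult_left_mono mult_nonneg_nonneg divide_nonneg_nonneg) auto
  also have "\<dots> = cP * (1 + \<bar>s\<bar>)\<^sup>2 * ?e" unfolding cP_def by (simp add: distrib_left distrib_right mult_ac)
  finally show "norm (sE n m (\<lambda>A. \<i> * (of_real (ZZ A) * cis (x * ZZ A))) + x *\<^sub>R phi x) \<le> cP * (1 + \<bar>s\<bar>)\<^sup>2 * ?e" .
qed

end

section \<open>Decoupling\<close>

lemma bE_swap: "bE p I (\<lambda>A. bE p J (\<lambda>B. h A B)) = bE p J (\<lambda>B. bE p I (\<lambda>A. h A B))"
  by (simp add: bE_def scaleR_sum_right sum.swap[of _ "Pow J"] mult.commute)

lemma mon_cong: "A \<inter> T = A' \<inter> T \<Longrightarrow> mon s T A = mon s T A'"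
  unfolding mon_def by (intro prod.cong refl) (auto simp: ind_def)

lemma bE_cis_ind:
  assumes "finite U" "u \<in> U"
  shows "bE p U (\<lambda>A. cis (x * ind u A)) = of_real (1 - p) + of_real p * cis x"
proof -
  have "dep (\<lambda>A. cis (x * ind u A)) {u}" by (auto simp: dep_def ind_def)
  then have "bE p U (\<lambda>A. cis (x * ind u A)) = bE p {u} (\<lambda>A. cis (x * ind u A))"
    using bE_dep[OF assms(1), of "\<lambda>A. cis (x * ind u A)" "{u}" p] assms by (simp add: Int_absorb1)
  also have "\<dots> = of_real (1 - p) + of_real p * cis x"
    using bE_insert[of "{}" u p "\<lambda>A. cis (x * ind u A)"] by (simp add: ind_def scaleR_conv_of_real)
  finally show ?thesis .
qed

lemma norm_bernoulli_char: "(norm (of_real (1 - p) + of_real p * cis x))\<^sup>2 = 1 - 2 * (p * (1 - p)) * (1 - cos x)"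
proof -
  have "(norm (of_real (1 - p) + of_real p * cis x))\<^sup>2 = (1 - p + p * cos x)\<^sup>2 + (p * sin x)\<^sup>2"
    by (simp add: cmod_power2)
  also have "\<dots> = (1 - p)\<^sup>2 + 2 * (1 - p) * p * cos x + p\<^sup>2 * ((cos x)\<^sup>2 + (sin x)\<^sup>2)"
  proof -
    have "(1 - p + p * a)\<^sup>2 + (p * b)\<^sup>2 = (1 - p)\<^sup>2 + 2 * (1 - p) * p * a + p\<^sup>2 * (a\<^sup>2 + b\<^sup>2)" for a b
      by (simp add: power2_eq_square algebra_simps)
    then show ?thesis .
  qed
  also have "\<dots> = 1 - 2 * (p * (1 - p)) * (1 - cos x)"
    by (simp only: sin_cos_squared_add2) (simp add: power2_eq_square algebra_simps)
  finally show ?thesis .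
qed

text \<open>An affine phase factors over independent bits and the constant \<open>K\<close> does not
  affect the modulus. Squaring avoids the root in the modulus of a Bernoulli characteristic
  function.\<close>

lemma norm_bE_cis_affine:
  assumes "finite U"
  shows "(norm (bE p U (\<lambda>A. cis (K + (\<Sum>u\<in>U. ind u A * c u)))))\<^sup>2 = (\<Prod>u\<in>U. 1 - 2 * (p * (1 - p)) * (1 - cos (c u)))"
proof -
  have "cis (K + (\<Sum>u\<in>U. ind u A * c u)) = cis K * (\<Prod>u\<in>U. cis (c u * ind u A))" for A
  proof -
    have "cis (\<Sum>u\<in>W. ind u A * c u) = (\<Prod>u\<in>W. cis (c u * ind u A))" if "finite W" for W
      using that by (induction W rule: finite_induct) (simp_all add: cis_mult[symmetric] mult.commute)
    then show ?thesis using assms by (simp add: cis_mult[symmetric])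
  qed
  then have "bE p U (\<lambda>A. cis (K + (\<Sum>u\<in>U. ind u A * c u))) = cis K * bE p U (\<lambda>A. \<Prod>u\<in>U. cis (c u * ind u A))"
    by (simp add: bE_cmult)
  also have "bE p U (\<lambda>A. \<Prod>u\<in>U. cis (c u * ind u A)) = (\<Prod>u\<in>U. bE p U (\<lambda>A. cis (c u * ind u A)))"
    by (rule bE_indep_prod[OF assms assms, where B = "\<lambda>u. {u}"]) (auto simp: dep_def ind_def)
  also have "\<dots> = (\<Prod>u\<in>U. of_real (1 - p) + of_real p * cis (c u))"
    by (intro prod.cong refl bE_cis_ind[OF assms])
  finally have "norm (bE p U (\<lambda>A. cis (K + (\<Sum>u\<in>U. ind u A * c u)))) = (\<Prod>u\<in>U. norm (of_real (1 - p) + of_real p * cis (c u)))"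
    by (simp add: norm_mult prod_norm)
  then show ?thesis by (simp only: prod_power_distrib norm_bernoulli_char)
qed

text \<open>Two applications of the Cauchy-Schwarz inequality, first in the bits of \<open>V\<close> and then in the bits of
  \<open>U\<close>, leave only the interaction between the blocks \<open>U\<close> and \<open>V\<close>. In particular the twist
  by the cardinality disappears.\<close>

lemma decoupling:
  fixes \<kappa> :: "'t \<Rightarrow> real" and s t \<theta> p :: real
  assumes fin: "finite U" "finite V" "finite R" "finite J"
    and disj: "U \<inter> V = {}" "U \<inter> R = {}" "V \<inter> R = {}"
    and p: "0 \<le> p" "p \<le> 1"
    and T: "\<And>j. j \<in> J \<Longrightarrow> T j \<subseteq> U \<union> V \<union> R"
    and sep: "\<And>j u u'. j \<in> J \<Longrightarrow> T j \<inter> V \<noteq> {} \<Longrightarrow> u \<in> T j \<inter> U \<Longrightarrow> u' \<in> T j \<inter> U \<Longrightarrow> u = u'"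
  defines "F \<equiv> \<lambda>A. \<Sum>j\<in>J. \<kappa> j * mon s (T j) A"
  defines "c \<equiv> \<lambda>u B B' C. \<Sum>j\<in>{j \<in> J. u \<in> T j \<and> T j \<inter> V \<noteq> {}}. \<kappa> j * (mon s (T j - {u}) (B \<union> C) - mon s (T j - {u}) (B' \<union> C))"
  shows "(norm (bE p (U \<union> V \<union> R) (\<lambda>A. cis (t * F A) * cis (\<theta> * real (card A))))) ^ 4
    \<le> bE p R (\<lambda>C. bE p V (\<lambda>B. bE p V (\<lambda>B'. \<Prod>u\<in>U. 1 - 2 * (p * (1 - p)) * (1 - cos (t * c u B B' C)))))"
proof -
  define g where "g C A B = cis (t * F (C \<union> (A \<union> B))) * cis (\<theta> * real (card (C \<union> (A \<union> B))))" for A B C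
  \<comment> \<open>Subtracting the two copies kills every monomial that misses \<open>V\<close>. By
    \<open>sep\<close> the surviving ones contain at most one point of \<open>U\<close>, so the
    difference is affine in the bits of \<open>U\<close>.\<close>
  have aff: "F (C \<union> (A \<union> B)) - F (C \<union> (A \<union> B')) = (F (C \<union> B) - F (C \<union> B')) + (\<Sum>u\<in>U. ind u A * c u B B' C)"
    if sub: "A \<subseteq> U" "B \<subseteq> V" "B' \<subseteq> V" "C \<subseteq> R" for A B B' C
  proof -
    define d where "d j u = (if u \<in> T j \<and> T j \<inter> V \<noteq> {} then mon s (T j - {u}) (B \<union> C) - mon s (T j - {u}) (B' \<union> C) else 0)" for j u
    have one: "mon s (T j) (C \<union> (A \<union> B)) - mon s (T j) (C \<union> (A \<union> B'))
       = (mon s (T j) (C \<union> B) - mon s (T j) (C \<union> B')) + (\<Sum>u\<in>U. ind u A * d j u)" if j: "j \<in> J" for j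
    proof (cases "T j \<inter> V = {}")
      case True
      then have "mon s (T j) (C \<union> (A \<union> B)) = mon s (T j) (C \<union> (A \<union> B'))" "mon s (T j) (C \<union> B) = mon s (T j) (C \<union> B')"
        using sub by (auto intro!: mon_cong)
      then show ?thesis using True by (simp add: d_def)
    next
      case TV: False
      show ?thesis
      proof (cases "T j \<inter> U = {}")
        case True
        then have "mon s (T j) (C \<union> (A \<union> X)) = mon s (T j) (C \<union> X)" for X
          using sub by (auto intro!: mon_cong)
        moreover have "(\<Sum>u\<in>U. ind u A * d j u) = 0" using True by (intro sum.neutral) (auto simp: d_def)
        ultimately show ?thesis by simp
      next
        case False
        then obtain u where u: "u \<in> T j" "u \<in> U" by auto
        have uniq: "u' = u" if "u' \<in> T j" "u' \<in> U" for u' using sep[OF j TV] u that by auto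
        have fT: "finite (T j)" using T[OF j] fin finite_subset by blast
        have Tu: "(T j - {u}) \<inter> U = {}" using uniq by auto
        have ins: "mon s (T j) X = (ind u X - s) * mon s (T j - {u}) X" for X
          using fT u by (simp add: mon_def prod.remove)
        have uV: "u \<notin> V" "u \<notin> R" using u disj by auto
        have m1: "mon s (T j) (C \<union> (A \<union> X)) = (ind u A - s) * mon s (T j - {u}) (X \<union> C)" if "X \<subseteq> V" for X
        proof -
          have "ind u (C \<union> (A \<union> X)) = ind u A" using uV that sub by (auto simp: ind_def)
          moreover have "mon s (T j - {u}) (C \<union> (A \<union> X)) = mon s (T j - {u}) (X \<union> C)"
            using Tu sub by (intro mon_cong) auto
          ultimately show ?thesis by (simp add: ins)
        qed
        have m2: "mon s (T j) (C \<union> X) = - s * mon s (T j - {u}) (X \<union> C)" if "X \<subseteq> V" for X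
        proof -
          have "ind u (C \<union> X) = 0" using uV that sub by (auto simp: ind_def)
          then show ?thesis by (simp add: ins Un_commute)
        qed
        have "(\<Sum>u'\<in>U. ind u' A * d j u') = (\<Sum>u'\<in>U. if u' = u then ind u A * d j u else 0)"
          using uniq by (intro sum.cong) (auto simp: d_def)
        also have "\<dots> = ind u A * (mon s (T j - {u}) (B \<union> C) - mon s (T j - {u}) (B' \<union> C))"
          using u fin TV by (simp add: d_def)
        finally show ?thesis using sub by (simp add: m1 m2 algebra_simps)
      qed
    qed
    have "F (C \<union> (A \<union> B)) - F (C \<union> (A \<union> B')) = (\<Sum>j\<in>J. \<kappa> j * (mon s (T j) (C \<union> (A \<union> B)) - mon s (T j) (C \<union> (A \<union> B'))))"
      by (simp add: F_def sum_subtractf right_diff_distrib)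
    also have "\<dots> = (\<Sum>j\<in>J. \<kappa> j * ((mon s (T j) (C \<union> B) - mon s (T j) (C \<union> B')) + (\<Sum>u\<in>U. ind u A * d j u)))"
      using one by (intro sum.cong) auto
    also have "\<dots> = (F (C \<union> B) - F (C \<union> B')) + (\<Sum>j\<in>J. \<Sum>u\<in>U. ind u A * (\<kappa> j * d j u))"
      by (simp add: F_def sum_subtractf distrib_left right_diff_distrib sum.distrib sum_distrib_left mult_ac)
    also have "(\<Sum>j\<in>J. \<Sum>u\<in>U. ind u A * (\<kappa> j * d j u)) = (\<Sum>u\<in>U. ind u A * (\<Sum>j\<in>J. \<kappa> j * d j u))"
      by (subst sum.swap) (simp add: sum_distrib_left)
    also have "(\<Sum>u\<in>U. ind u A * (\<Sum>j\<in>J. \<kappa> j * d j u)) = (\<Sum>u\<in>U. ind u A * c u B B' C)"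
    proof (intro sum.cong refl arg_cong2[of _ _ _ _ "(*)"])
      fix u
      have "(\<Sum>j\<in>J. \<kappa> j * d j u) = (\<Sum>j\<in>J. if u \<in> T j \<and> T j \<inter> V \<noteq> {} then \<kappa> j * (mon s (T j - {u}) (B \<union> C) - mon s (T j - {u}) (B' \<union> C)) else 0)"
        by (intro sum.cong) (auto simp: d_def)
      also have "\<dots> = c u B B' C" unfolding c_def using fin(4) by (intro sum.inter_filter[symmetric])
      finally show "(\<Sum>j\<in>J. \<kappa> j * d j u) = c u B B' C" .
    qed
    finally show ?thesis .
  qed
  have GU: "(norm (bE p U (\<lambda>A. g C A B * cnj (g C A B'))))\<^sup>2 = (\<Prod>u\<in>U. 1 - 2 * (p * (1 - p)) * (1 - cos (t * c u B B' C)))"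
    if sub: "B \<subseteq> V" "B' \<subseteq> V" "C \<subseteq> R" for B B' C
  proof -
    \<comment> \<open>The part of the phase without bits of \<open>U\<close>. The size of
      \<open>A\<close> enters both copies alike and cancels, which removes the twist from the
      estimate.\<close>
    define K where "K = t * (F (C \<union> B) - F (C \<union> B')) + \<theta> * (real (card B) - real (card B'))"
    have "g C A B * cnj (g C A B') = cis (K + (\<Sum>u\<in>U. ind u A * (t * c u B B' C)))" if A: "A \<subseteq> U" for A
    proof -
      have cd: "real (card (C \<union> (A \<union> X))) = real (card C) + real (card A) + real (card X)" if X: "X \<subseteq> V" for X
      proof -
        have "finite C" "finite A" "finite X" "C \<inter> (A \<union> X) = {}" "A \<inter> X = {}"
          using sub(3) A X fin disj by (auto intro: finite_subset)
        then show ?thesis by (simp add: card_Un_disjoint)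
      qed
      have "g C A B * cnj (g C A B') = cis (t * (F (C \<union> (A \<union> B)) - F (C \<union> (A \<union> B'))) + \<theta> * (real (card (C \<union> (A \<union> B))) - real (card (C \<union> (A \<union> B')))))"
      proof -
        have "cis x * cnj (cis y) = cis (x - y)" for x y
          by (simp add: complex_eq_iff cos_diff sin_diff)
        then show ?thesis unfolding g_def cis_mult by (simp add: algebra_simps)
      qed
      also have "t * (F (C \<union> (A \<union> B)) - F (C \<union> (A \<union> B'))) + \<theta> * (real (card (C \<union> (A \<union> B))) - real (card (C \<union> (A \<union> B'))))
        = K + (\<Sum>u\<in>U. ind u A * (t * c u B B' C))"
        unfolding aff[OF A sub] K_def cd[OF sub(1)] cd[OF sub(2)]
        by (simp add: sum_distrib_left algebra_simps)
      finally show ?thesis .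
    qed
    then have "bE p U (\<lambda>A. g C A B * cnj (g C A B')) = bE p U (\<lambda>A. cis (K + (\<Sum>u\<in>U. ind u A * (t * c u B B' C))))"
      by (intro bE_cong)
    then show ?thesis using norm_bE_cis_affine[OF fin(1)] by simp
  qed
  have UV: "U \<union> V \<union> R = R \<union> (U \<union> V)" by auto
  define E where "E = bE p (U \<union> V \<union> R) (\<lambda>A. cis (t * F A) * cis (\<theta> * real (card A)))"
  have E: "E = bE p R (\<lambda>C. bE p U (\<lambda>A. bE p V (\<lambda>B. g C A B)))"
  proof -
    have "E = bE p R (\<lambda>C. bE p (U \<union> V) (\<lambda>X. cis (t * F (C \<union> X)) * cis (\<theta> * real (card (C \<union> X)))))"
      unfolding E_def UV using fin disj by (intro bE_Un) auto
    also have "\<dots> = bE p R (\<lambda>C. bE p U (\<lambda>A. bE p V (\<lambda>B. g C A B)))"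
      unfolding g_def using fin disj by (intro bE_cong bE_Un) auto
    finally show ?thesis .
  qed
  define H where "H = bE p R (\<lambda>C. bE p V (\<lambda>B. bE p V (\<lambda>B'. bE p U (\<lambda>A. g C A B * cnj (g C A B')))))"
  have E2: "(norm E)\<^sup>2 \<le> norm H"
  proof -
    have "(norm E)\<^sup>2 \<le> bE p R (\<lambda>C. (norm (bE p U (\<lambda>A. bE p V (\<lambda>B. g C A B))))\<^sup>2)"
      unfolding E by (intro bE_norm_square fin p)
    also have "\<dots> \<le> bE p R (\<lambda>C. bE p U (\<lambda>A. (norm (bE p V (\<lambda>B. g C A B)))\<^sup>2))"
      by (intro bE_mono p bE_norm_square fin)
    finally have 1: "(norm E)\<^sup>2 \<le> bE p R (\<lambda>C. bE p U (\<lambda>A. (norm (bE p V (\<lambda>B. g C A B)))\<^sup>2))" .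
    have of_real_bE: "complex_of_real (bE p I f) = bE p I (\<lambda>A. complex_of_real (f A))" for I :: "nat set" and f
      by (simp add: bE_def scaleR_conv_of_real)
    have cnj_bE: "cnj (bE p I f) = bE p I (\<lambda>A. cnj (f A))" for I :: "nat set" and f
      by (simp add: bE_def scaleR_conv_of_real cnj_sum)
    have sq: "complex_of_real ((norm (bE p V (\<lambda>B. g C A B)))\<^sup>2) = bE p V (\<lambda>B. bE p V (\<lambda>B'. g C A B * cnj (g C A B')))" for C A
      unfolding complex_norm_square cnj_bE by (simp add: bE_cmult bE_multc)
    have "complex_of_real (bE p R (\<lambda>C. bE p U (\<lambda>A. (norm (bE p V (\<lambda>B. g C A B)))\<^sup>2)))
       = bE p R (\<lambda>C. bE p U (\<lambda>A. bE p V (\<lambda>B. bE p V (\<lambda>B'. g C A B * cnj (g C A B')))))"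
      by (simp only: of_real_bE sq)
    also have "\<dots> = H" unfolding H_def
    proof (rule bE_cong)
      fix C
      have "bE p U (\<lambda>A. bE p V (\<lambda>B. bE p V (\<lambda>B'. g C A B * cnj (g C A B')))) = bE p V (\<lambda>B. bE p U (\<lambda>A. bE p V (\<lambda>B'. g C A B * cnj (g C A B'))))"
        by (rule bE_swap)
      also have "\<dots> = bE p V (\<lambda>B. bE p V (\<lambda>B'. bE p U (\<lambda>A. g C A B * cnj (g C A B'))))"
        by (intro bE_cong bE_swap)
      finally show "bE p U (\<lambda>A. bE p V (\<lambda>B. bE p V (\<lambda>B'. g C A B * cnj (g C A B')))) = bE p V (\<lambda>B. bE p V (\<lambda>B'. bE p U (\<lambda>A. g C A B * cnj (g C A B'))))" .
    qed
    finally have e: "complex_of_real (bE p R (\<lambda>C. bE p U (\<lambda>A. (norm (bE p V (\<lambda>B. g C A B)))\<^sup>2))) = H" .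
    have "r \<le> norm z" if "complex_of_real r = z" for r z
      using that norm_of_real[of r] abs_ge_self[of r] by auto
    from this[OF e] show ?thesis using 1 by linarith
  qed
  have "(norm H)\<^sup>2 \<le> bE p R (\<lambda>C. (norm (bE p V (\<lambda>B. bE p V (\<lambda>B'. bE p U (\<lambda>A. g C A B * cnj (g C A B'))))))\<^sup>2)"
    unfolding H_def by (intro bE_norm_square fin p)
  also have "\<dots> \<le> bE p R (\<lambda>C. bE p V (\<lambda>B. (norm (bE p V (\<lambda>B'. bE p U (\<lambda>A. g C A B * cnj (g C A B')))))\<^sup>2))"
    by (intro bE_mono p bE_norm_square fin)
  also have "\<dots> \<le> bE p R (\<lambda>C. bE p V (\<lambda>B. bE p V (\<lambda>B'. (norm (bE p U (\<lambda>A. g C A B * cnj (g C A B'))))\<^sup>2)))"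
    by (intro bE_mono p bE_norm_square fin)
  also have "\<dots> = bE p R (\<lambda>C. bE p V (\<lambda>B. bE p V (\<lambda>B'. \<Prod>u\<in>U. 1 - 2 * (p * (1 - p)) * (1 - cos (t * c u B B' C)))))"
    by (intro bE_cong GU)
  finally have H: "(norm H)\<^sup>2 \<le> bE p R (\<lambda>C. bE p V (\<lambda>B. bE p V (\<lambda>B'. \<Prod>u\<in>U. 1 - 2 * (p * (1 - p)) * (1 - cos (t * c u B B' C)))))" .
  have "(norm E) ^ 4 = ((norm E)\<^sup>2)\<^sup>2" by simp
  also have "\<dots> \<le> (norm H)\<^sup>2" using E2 by (intro power_mono) auto
  finally show ?thesis using H unfolding E_def by linarith
qed

section \<open>Medium frequencies\<close>

lemma card_UN_bound:
  assumes "finite V" "card V \<le> r" "\<And>v. v \<in> V \<Longrightarrow> card (S v) \<le> b"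
  shows "card (\<Union>v\<in>V. S v) \<le> r * b"
proof -
  have "card (\<Union>v\<in>V. S v) \<le> (\<Sum>v\<in>V. card (S v))" by (rule card_UN_le[OF assms(1)])
  also have "\<dots> \<le> (\<Sum>v\<in>V. b)" using assms by (intro sum_mono)
  also have "\<dots> \<le> r * b" using assms by simp
  finally show ?thesis .
qed

lemma one_minus_cos_ge:
  assumes "\<bar>x\<bar> \<le> (1::real)"
  shows "x\<^sup>2 / 4 \<le> 1 - cos x"
proof -
  obtain t where t: "cos x = (\<Sum>m<4. cos_coeff m * x ^ m) + (cos (t + 1 / 2 * real 4 * pi) / fact 4) * x ^ 4"
    using Maclaurin_cos_expansion[of x 4] by auto
  have "(\<Sum>m<4. cos_coeff m * x ^ m) = 1 - x\<^sup>2 / 2"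
  proof -
    have "{..<4::nat} = {0, 1, 2, 3}" by auto
    then show ?thesis by (simp add: cos_coeff_def)
  qed
  moreover have "(cos (t + 1 / 2 * real 4 * pi) / fact 4) * x ^ 4 \<le> 1 / fact 4 * x ^ 4"
    by (intro mult_right_mono divide_right_mono cos_le_one) auto
  moreover have "(fact 4 :: real) = 24" by (simp add: eval_nat_numeral)
  ultimately have "cos x \<le> 1 - x\<^sup>2 / 2 + x ^ 4 / 24" using t by simp
  moreover have "x ^ 4 \<le> x\<^sup>2"
  proof -
    have "x\<^sup>2 * x\<^sup>2 \<le> 1 * x\<^sup>2"
      using assms by (intro mult_right_mono) (auto simp: abs_square_le_1)
    then show ?thesis by (simp add: power4_eq_xxxx power2_eq_square mult.assoc)
  qed
  ultimately show ?thesis using zero_le_power2[of x] by linarith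
qed

context lam_progressions
begin

text \<open>The passage from flags to monomials used for \<open>PP\<close>, now for an arbitrary
  condition and function of the remaining points, as needed to recognise the decoupled
  coefficients.\<close>

lemma sum_base_flags:
  "(\<Sum>t\<in>{t \<in> flags. fb t = u \<and> P (fT t)}. cf t * h (fT t))
    = (\<Sum>a\<in>AP. \<Sum>S\<in>shapes. if u \<in> (\<lambda>j. e j a) ` S \<and> P ((\<lambda>j. e j a) ` S - {u})
    then p ^ (k - card S) / 2 * h ((\<lambda>j. e j a) ` S - {u}) else 0)"
proof -
  have "(\<Sum>t\<in>{t \<in> flags. fb t = u \<and> P (fT t)}. cf t * h (fT t)) = (\<Sum>t\<in>flags. if fb t = u \<and> P (fT t) then cf t * h (fT t) else 0)"
    by (subst sum.inter_filter) auto
  also have "\<dots> = (\<Sum>a\<in>AP. \<Sum>S\<in>shapes. \<Sum>i\<in>S. if e i a = u \<and> P ((\<lambda>j. e j a) ` (S - {i}))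
      then p ^ (k - card S) / 2 * h ((\<lambda>j. e j a) ` (S - {i})) else 0)"
    unfolding sum_flags by (simp only: fb_def fT_def cf_def prod.case)
  also have "\<dots> = (\<Sum>a\<in>AP. \<Sum>S\<in>shapes. if u \<in> (\<lambda>j. e j a) ` S \<and> P ((\<lambda>j. e j a) ` S - {u})
    then p ^ (k - card S) / 2 * h ((\<lambda>j. e j a) ` S - {u}) else 0)"
  proof (intro sum.cong refl)
    fix a S assume aS: "a \<in> AP" "S \<in> shapes"
    then have S: "S \<subseteq> {..<k}" "finite S" by (auto simp: shapes_def intro: finite_subset)
    have inj: "inj_on (\<lambda>j. e j a) S" using inj_on_subset[OF e_inj[OF aS(1)] S(1)] .
    let ?g = "\<lambda>i. if e i a = u \<and> P ((\<lambda>j. e j a) ` (S - {i}))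
      then p ^ (k - card S) / 2 * h ((\<lambda>j. e j a) ` (S - {i})) else 0"
    let ?r = "if u \<in> (\<lambda>j. e j a) ` S \<and> P ((\<lambda>j. e j a) ` S - {u})
      then p ^ (k - card S) / 2 * h ((\<lambda>j. e j a) ` S - {u}) else 0"
    show "(\<Sum>i\<in>S. ?g i) = ?r"
    proof (cases "u \<in> (\<lambda>j. e j a) ` S")
      case False
      then have "?g i = 0" if "i \<in> S" for i using that by auto
      then have "(\<Sum>i\<in>S. ?g i) = 0" by (intro sum.neutral) blast
      then show ?thesis using False by simp
    next
      case True
      then obtain i0 where i0: "i0 \<in> S" "e i0 a = u" by auto
      have im: "(\<lambda>j. e j a) ` (S - {i0}) = (\<lambda>j. e j a) ` S - {u}"
        using i0 inj by (auto simp: inj_on_def)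
      have "?g i = (if i = i0 then ?r else 0)" if "i \<in> S" for i
      proof (cases "i = i0")
        case True
        then show ?thesis using i0 im \<open>u \<in> _ ` S\<close> by auto
      next
        case False
        then have "e i a \<noteq> u" using i0 that inj by (auto simp: inj_on_def)
        then show ?thesis using False by simp
      qed
      then have "(\<Sum>i\<in>S. ?g i) = (\<Sum>i\<in>S. if i = i0 then ?r else 0)" by (intro sum.cong) blast+
      then show ?thesis using i0 S by simp
    qed
  qed
  finally show ?thesis .
qed

end

text \<open>The separation conditions say that a progression which meets both blocks meets each of them once.\<close>

locale two_blocks = lam_progressions n k AP e m lam for n k :: nat and AP :: "'a set" and e m lam +
  fixes U V :: "nat set"
  assumes UV_sub: "U \<subseteq> {..<n}" "V \<subseteq> {..<n}" and UV_disj: "U \<inter> V = {}"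
    and sepU: "\<And>a u u'. a \<in> AP \<Longrightarrow> pts a \<inter> V \<noteq> {} \<Longrightarrow> u \<in> pts a \<inter> U \<Longrightarrow> u' \<in> pts a \<inter> U \<Longrightarrow> u = u'"
    and sepV: "\<And>a v v'. a \<in> AP \<Longrightarrow> pts a \<inter> U \<noteq> {} \<Longrightarrow> v \<in> pts a \<inter> V \<Longrightarrow> v' \<in> pts a \<inter> V \<Longrightarrow> v = v'"
begin

definition RR :: "nat set" where "RR = {..<n} - U - V"

text \<open>The second copy of the bit at \<open>v\<close> is stored at \<open>v + n\<close>.\<close>

definition bits :: "nat set" where "bits = RR \<union> (V \<union> (\<lambda>v. v + n) ` V)"

definition zz :: "nat \<Rightarrow> nat set \<Rightarrow> real" where
  "zz i X = (if i \<in> V then ind i X - ind (i + n) X else ind i X - p)"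

definition bl :: "nat \<Rightarrow> nat set" where "bl i = (if i \<in> V then {i, i + n} else {i})"

lemma finite_UV: "finite U" "finite V" "finite RR" "finite bits"
  using UV_sub finite_subset by (auto simp: RR_def bits_def)

lemma bits_indep: "indep_family p bits ({..<n} - U) zz bl"
proof
  show "bE p bits (zz i) = 0" if "i \<in> {..<n} - U" for i
  proof (cases "i \<in> V")
    case True
    then have "i \<in> bits" "i + n \<in> bits" by (auto simp: bits_def)
    then show ?thesis using True finite_UV by (simp add: zz_def[abs_def] bE_diff bE_ind)
  next
    case False
    then have "i \<in> bits" using that by (auto simp: bits_def RR_def)
    then show ?thesis using False finite_UV by (simp add: zz_def[abs_def] bE_diff bE_ind)
  qed
  show "bl i \<inter> bl j = {}" if "i \<in> {..<n} - U" "j \<in> {..<n} - U" "i \<noteq> j" for i j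
    using that UV_sub by (auto simp: bl_def)
  show "\<bar>zz i A\<bar> \<le> 1" for i A by (auto simp: zz_def ind_def)
  show "dep (zz i) (bl i)" for i by (auto simp: zz_def dep_def bl_def ind_def)
qed (use finite_UV in auto)

interpretation Z: indep_family p bits "{..<n} - U" zz bl by (rule bits_indep)

text \<open>Independent draws of \<open>C\<close>, \<open>B\<close> and \<open>B'\<close> form a
  single draw over \<open>bits\<close>, with \<open>B'\<close> stored at the indices
  \<open>v + n\<close>, which lie outside \<open>{..<n}\<close>. The moment estimates for
  independent families then apply directly.\<close>

lemma nested_bE:
  "bE p RR (\<lambda>C. bE p V (\<lambda>B. bE p V (\<lambda>B'. h B B' C)))
    = bE p bits (\<lambda>X. h (X \<inter> V) {v \<in> V. v + n \<in> X} (X \<inter> RR))"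
proof -
  let ?s = "\<lambda>v. v + n"
  have d: "RR \<inter> (V \<union> ?s ` V) = {}" "V \<inter> ?s ` V = {}" "RR \<inter> V = {}" "RR \<inter> ?s ` V = {}"
    using UV_sub by (auto simp: RR_def)
  have "bE p bits (\<lambda>X. h (X \<inter> V) {v \<in> V. v + n \<in> X} (X \<inter> RR))
     = bE p RR (\<lambda>C. bE p (V \<union> ?s ` V) (\<lambda>Y. h ((C \<union> Y) \<inter> V) {v \<in> V. v + n \<in> C \<union> Y} ((C \<union> Y) \<inter> RR)))"
    unfolding bits_def using finite_UV d by (intro bE_Un) auto
  also have "\<dots> = bE p RR (\<lambda>C. bE p V (\<lambda>B. bE p (?s ` V) (\<lambda>B'. h ((C \<union> (B \<union> B')) \<inter> V) {v \<in> V. v + n \<in> C \<union> (B \<union> B')} ((C \<union> (B \<union> B')) \<inter> RR))))"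
    using finite_UV d by (intro bE_cong bE_Un) auto
  also have "\<dots> = bE p RR (\<lambda>C. bE p V (\<lambda>B. bE p V (\<lambda>B'. h ((C \<union> (B \<union> ?s ` B')) \<inter> V) {v \<in> V. v + n \<in> C \<union> (B \<union> ?s ` B')} ((C \<union> (B \<union> ?s ` B')) \<inter> RR))))"
    using finite_UV by (intro bE_cong bE_image) auto
  also have "\<dots> = bE p RR (\<lambda>C. bE p V (\<lambda>B. bE p V (\<lambda>B'. h B B' C)))"
  proof (intro bE_cong)
    fix C B B' assume s: "C \<subseteq> RR" "B \<subseteq> V" "B' \<subseteq> V"
    have ge: "x < n" if "x \<in> C \<or> x \<in> B \<or> x \<in> V" for x using that s UV_sub by (auto simp: RR_def)
    have no: "v + n \<notin> C" "v + n \<notin> B" "v + n \<notin> V" "v + n \<notin> RR" for v using ge[of "v + n"] by (auto simp: RR_def)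
    have "?s ` B' \<inter> V = {}" using no by auto
    then have "(C \<union> (B \<union> ?s ` B')) \<inter> V = B" using s d by blast
    moreover have "{v \<in> V. v + n \<in> C \<union> (B \<union> ?s ` B')} = B'"
      using s no by auto
    moreover have "?s ` B' \<inter> RR = {}" using no by auto
    then have "(C \<union> (B \<union> ?s ` B')) \<inter> RR = C" using s d by blast
    ultimately show "h ((C \<union> (B \<union> ?s ` B')) \<inter> V) {v \<in> V. v + n \<in> C \<union> (B \<union> ?s ` B')} ((C \<union> (B \<union> ?s ` B')) \<inter> RR) = h B B' C"
      by simp
  qed
  finally show ?thesis by simp
qed

definition FV :: "nat \<Rightarrow> ('a \<times> nat set \<times> nat) set" where
  "FV u = {t \<in> flags. fb t = u \<and> fT t \<inter> V \<noteq> {}}"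

definition cu :: "nat \<Rightarrow> nat set \<Rightarrow> real" where "cu u X = (\<Sum>t\<in>FV u. cf t * Z.zm (fT t) X)"

lemma FV_flags: "t \<in> FV u \<Longrightarrow> t \<in> flags \<and> fb t = u \<and> fT t \<inter> V \<noteq> {}" by (simp add: FV_def)

lemma finite_FV [simp]: "finite (FV u)" by (simp add: FV_def)

lemma FV_sub:
  assumes "t \<in> FV u" "u \<in> U"
  shows "fT t \<subseteq> {..<n} - U" "finite (fT t)" "\<exists>v. fT t \<inter> V = {v}"
proof -
  note t = FV_flags[OF assms(1)]
  have pt: "insert u (fT t) \<subseteq> pts (fst t)" using flag_pts[of t] t by auto
  have a: "fst t \<in> AP" using t fst_flags by auto
  have "w \<notin> U" if "w \<in> fT t" for w
  proof
    assume "w \<in> U"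
    then have "w = u" using sepU[OF a, of w u] pt that t assms by auto
    then show False using flag_notin[of t] t that by auto
  qed
  then show "fT t \<subseteq> {..<n} - U" using flag_less[of t] t by auto
  show "finite (fT t)" using t by auto
  obtain v where v: "v \<in> fT t" "v \<in> V" using t by auto
  have "v' = v" if "v' \<in> fT t \<inter> V" for v'
    using sepV[OF a, of v' v] pt that v assms by auto
  then show "\<exists>v. fT t \<inter> V = {v}" using v by blast
qed

text \<open>A surviving monomial meets \<open>V\<close> in exactly one point \<open>v\<close>. The
  difference between the two copies therefore affects one factor only and turns the centred bit at
  \<open>v\<close> into \<open>zz v\<close>.\<close>

lemma cu_eq:
  assumes u: "u \<in> U"
  shows "(\<Sum>x\<in>{x \<in> AP \<times> shapes. u \<in> (\<lambda>j. e j (fst x)) ` snd x \<and> (\<lambda>j. e j (fst x)) ` snd x \<inter> V \<noteq> {}}.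
      p ^ (k - card (snd x)) / 2 * (mon p ((\<lambda>j. e j (fst x)) ` snd x - {u}) ((X \<inter> V) \<union> (X \<inter> RR))
       - mon p ((\<lambda>j. e j (fst x)) ` snd x - {u}) ({v \<in> V. v + n \<in> X} \<union> (X \<inter> RR)))) = cu u X"
proof -
  define h where "h T = mon p T ((X \<inter> V) \<union> (X \<inter> RR)) - mon p T ({v \<in> V. v + n \<in> X} \<union> (X \<inter> RR))" for T
  have uV: "u \<notin> V" using u UV_disj by auto
  have "(\<Sum>x\<in>{x \<in> AP \<times> shapes. u \<in> (\<lambda>j. e j (fst x)) ` snd x \<and> (\<lambda>j. e j (fst x)) ` snd x \<inter> V \<noteq> {}}.
      p ^ (k - card (snd x)) / 2 * h ((\<lambda>j. e j (fst x)) ` snd x - {u}))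
    = (\<Sum>x\<in>AP \<times> shapes. if u \<in> (\<lambda>j. e j (fst x)) ` snd x \<and> (\<lambda>j. e j (fst x)) ` snd x \<inter> V \<noteq> {}
       then p ^ (k - card (snd x)) / 2 * h ((\<lambda>j. e j (fst x)) ` snd x - {u}) else 0)"
    using fin_AP by (intro sum.inter_filter) auto
  also have "\<dots> = (\<Sum>a\<in>AP. \<Sum>S\<in>shapes. if u \<in> (\<lambda>j. e j a) ` S \<and> ((\<lambda>j. e j a) ` S - {u}) \<inter> V \<noteq> {}
       then p ^ (k - card S) / 2 * h ((\<lambda>j. e j a) ` S - {u}) else 0)"
  proof -
    have iff: "(T - {u}) \<inter> V \<noteq> {} \<longleftrightarrow> T \<inter> V \<noteq> {}" for T using uV by auto
    show ?thesis unfolding iff by (simp only: sum.cartesian_product split_def)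
  qed
  also have "\<dots> = (\<Sum>t\<in>{t \<in> flags. fb t = u \<and> fT t \<inter> V \<noteq> {}}. cf t * h (fT t))"
    by (rule sum_base_flags[where u = u and P = "\<lambda>T. T \<inter> V \<noteq> {}" and h = h, symmetric])
  also have "\<dots> = cu u X"
    unfolding cu_def FV_def[symmetric]
  proof (intro sum.cong refl arg_cong2[of _ _ _ _ "(*)"])
    fix t assume t: "t \<in> FV u"
    note s = FV_sub[OF t u]
    obtain v where v: "fT t \<inter> V = {v}" using s(3) by blast
    then have vT: "v \<in> fT t" "v \<in> V" by auto
    have m: "mon p (fT t) Y = (ind v Y - p) * mon p (fT t - {v}) Y" for Y
      using s(2) vT by (simp add: mon_def prod.remove)
    have rest: "mon p (fT t - {v}) Y = (\<Prod>i\<in>fT t - {v}. zz i X)" if "Y \<inter> RR = X \<inter> RR" for Y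
      unfolding mon_def
    proof (intro prod.cong refl)
      fix i assume "i \<in> fT t - {v}"
      then have "i \<in> RR" "i \<notin> V" using v s(1) by (auto simp: RR_def)
      then show "ind i Y - p = zz i X" using that by (auto simp: zz_def ind_def)
    qed
    have "h (fT t) = (ind v ((X \<inter> V) \<union> (X \<inter> RR)) - ind v ({v \<in> V. v + n \<in> X} \<union> (X \<inter> RR))) * (\<Prod>i\<in>fT t - {v}. zz i X)"
    proof -
      have e1: "((X \<inter> V) \<union> (X \<inter> RR)) \<inter> RR = X \<inter> RR" "({v \<in> V. v + n \<in> X} \<union> (X \<inter> RR)) \<inter> RR = X \<inter> RR"
        by (auto simp: RR_def)
      show ?thesis unfolding h_def m rest[OF e1(1)] rest[OF e1(2)] by (simp add: algebra_simps)
    qed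
    also have "ind v ((X \<inter> V) \<union> (X \<inter> RR)) - ind v ({v \<in> V. v + n \<in> X} \<union> (X \<inter> RR)) = zz v X"
      using vT by (auto simp: zz_def ind_def RR_def)
    also have "zz v X * (\<Prod>i\<in>fT t - {v}. zz i X) = Z.zm (fT t) X"
      unfolding Z.zm_def using s(2) vT by (simp add: prod.remove)
    finally show "h (fT t) = Z.zm (fT t) X" .
  qed
  finally show ?thesis by (simp add: h_def)
qed

lemma decoupled:
  "(norm (bE p {..<n} (\<lambda>A. cis (t * YY p A) * cis (\<theta> * real (card A))))) ^ 4
    \<le> bE p bits (\<lambda>X. \<Prod>u\<in>U. 1 - 2 * (p * (1 - p)) * (1 - cos (t * cu u X)))"
proof -
  let ?T = "\<lambda>x. (\<lambda>j. e j (fst x)) ` snd x"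
  let ?\<kappa> = "\<lambda>x. p ^ (k - card (snd x)) / 2"
  have YY: "YY p A = (\<Sum>x\<in>AP \<times> shapes. ?\<kappa> x * mon p (?T x) A)" for A
    by (simp add: YY_def sum.cartesian_product split_def)
  have N: "{..<n} = U \<union> V \<union> RR" using UV_sub by (auto simp: RR_def)
  have Tp: "?T x \<subseteq> pts (fst x)" if "x \<in> AP \<times> shapes" for x
    using that by (auto simp: pts_def shapes_def)
  have "(norm (bE p (U \<union> V \<union> RR) (\<lambda>A. cis (t * (\<Sum>x\<in>AP \<times> shapes. ?\<kappa> x * mon p (?T x) A)) * cis (\<theta> * real (card A))))) ^ 4
    \<le> bE p RR (\<lambda>C. bE p V (\<lambda>B. bE p V (\<lambda>B'. \<Prod>u\<in>U. 1 - 2 * (p * (1 - p)) * (1 - cos (t *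
       (\<Sum>x\<in>{x \<in> AP \<times> shapes. u \<in> ?T x \<and> ?T x \<inter> V \<noteq> {}}. ?\<kappa> x * (mon p (?T x - {u}) (B \<union> C) - mon p (?T x - {u}) (B' \<union> C))))))))"
  proof (rule decoupling)
    fix x assume x: "x \<in> AP \<times> shapes"
    show "?T x \<subseteq> U \<union> V \<union> RR" using Tp[OF x] pts_less[of "fst x"] x unfolding N[symmetric] by (metis mem_Times_iff order_trans)
    fix u u' assume "?T x \<inter> V \<noteq> {}" "u \<in> ?T x \<inter> U" "u' \<in> ?T x \<inter> U"
    then show "u = u'" using Tp[OF x] x by (intro sepU[of "fst x" u u']) auto
  qed (use finite_UV fin_AP UV_disj in \<open>auto simp: RR_def\<close>)
  also have "\<dots> = bE p bits (\<lambda>X. \<Prod>u\<in>U. 1 - 2 * (p * (1 - p)) * (1 - cos (t * cu u X)))"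
    unfolding nested_bE by (intro bE_cong prod.cong refl) (simp only: cu_eq)
  finally show ?thesis unfolding YY N[symmetric] .
qed

lemma card_FV: "u \<in> U \<Longrightarrow> card (FV u) \<le> card V * KK"
proof -
  assume u: "u \<in> U"
  have "FV u \<subseteq> (\<Union>v\<in>V. {t \<in> flags. u \<in> pts (fst t) \<and> v \<in> pts (fst t)})"
    using flag_pts by (fastforce simp: FV_def)
  then have "card (FV u) \<le> card (\<Union>v\<in>V. {t \<in> flags. u \<in> pts (fst t) \<and> v \<in> pts (fst t)})"
    using finite_UV by (intro card_mono) auto
  also have "\<dots> \<le> card V * KK"
  proof (intro card_UN_bound)
    fix v assume "v \<in> V"
    then have "u \<noteq> v" using u UV_disj by auto
    then show "card {t \<in> flags. u \<in> pts (fst t) \<and> v \<in> pts (fst t)} \<le> KK" by (rule card_flags_two_points)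
  qed (use finite_UV in auto)
  finally show ?thesis .
qed

lemma cu_abs_le: "u \<in> U \<Longrightarrow> \<bar>cu u X\<bar> \<le> real (card V * KK)"
proof -
  assume u: "u \<in> U"
  have "\<bar>cu u X\<bar> \<le> (\<Sum>t\<in>FV u. \<bar>cf t * Z.zm (fT t) X\<bar>)" unfolding cu_def by (rule sum_abs)
  also have "\<dots> \<le> (\<Sum>t\<in>FV u. 1)"
  proof (rule sum_mono)
    fix t
    have "\<bar>cf t\<bar> * \<bar>Z.zm (fT t) X\<bar> \<le> 1 * 1" using cf_bounds[of t] Z.zm_le by (intro mult_mono) auto
    then show "\<bar>cf t * Z.zm (fT t) X\<bar> \<le> 1" by (simp add: abs_mult)
  qed
  also have "\<dots> \<le> real (card V * KK)" using card_FV[OF u] by (simp del: of_nat_mult)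
  finally show ?thesis .
qed

section \<open>Concentration of the decoupled quadratic form\<close>

definition JJ :: "(('a \<times> nat set \<times> nat) \<times> ('a \<times> nat set \<times> nat)) set" where
  "JJ = (SIGMA t:(\<Union>u\<in>U. FV u). FV (fb t))"

definition LL where "LL = {x \<in> JJ. fT (fst x) \<inter> fT (snd x) \<noteq> {}}"

definition pair_term where "pair_term x X = cf (fst x) * cf (snd x) * (Z.zm (fT (fst x)) X * Z.zm (fT (snd x)) X)"

text \<open>For small angles the product over \<open>U\<close> is bounded by the exponential of a
  negative multiple of \<open>t^2 * GG\<close>, so decay requires \<open>GG\<close> to be large with
  high probability.\<close>

definition GG :: "nat set \<Rightarrow> real" where "GG X = (\<Sum>u\<in>U. (cu u X)\<^sup>2)"

text \<open>This is also the mean of \<open>GG\<close>, because unlinked pairs have mean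
  zero.\<close>

definition gG :: real where "gG = bE p bits (\<lambda>X. \<Sum>x\<in>LL. pair_term x X)"

lemma JJ_mem: "x \<in> JJ \<Longrightarrow> \<exists>u\<in>U. fst x \<in> FV u \<and> snd x \<in> FV u \<and> fb (fst x) = u"
  by (auto simp: JJ_def FV_def)

lemma finite_JJ [simp]: "finite JJ" using finite_UV by (auto simp: JJ_def)

lemma GG_JJ: "GG X = (\<Sum>x\<in>JJ. pair_term x X)"
proof -
  have "GG X = (\<Sum>u\<in>U. \<Sum>t\<in>FV u. \<Sum>t'\<in>FV u. pair_term (t, t') X)"
    unfolding GG_def cu_def power2_eq_square sum_product pair_term_def by (simp add: mult_ac)
  also have "\<dots> = (\<Sum>u\<in>U. \<Sum>t\<in>FV u. \<Sum>t'\<in>FV (fb t). pair_term (t, t') X)"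
    by (intro sum.cong refl) (auto simp: FV_def)
  also have "\<dots> = (\<Sum>t\<in>(\<Union>u\<in>U. FV u). \<Sum>t'\<in>FV (fb t). pair_term (t, t') X)"
    using finite_UV by (intro sum.UNION_disjoint[symmetric]) (auto simp: FV_def)
  also have "\<dots> = (\<Sum>x\<in>JJ. pair_term x X)"
    unfolding JJ_def using finite_UV by (subst sum.Sigma) auto
  finally show ?thesis .
qed

lemma tt_abs_le: "\<bar>pair_term x X\<bar> \<le> 1"
proof -
  have "\<bar>cf (fst x)\<bar> * \<bar>cf (snd x)\<bar> * (\<bar>Z.zm (fT (fst x)) X\<bar> * \<bar>Z.zm (fT (snd x)) X\<bar>) \<le> 1 * 1 * (1 * 1)"
    using cf_bounds[of "fst x"] cf_bounds[of "snd x"] Z.zm_le by (intro mult_mono) auto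
  then show ?thesis by (simp add: pair_term_def abs_mult)
qed

lemma card_UFV: "card (\<Union>u\<in>U. FV u) \<le> card U * (card V * KK)"
  using finite_UV card_FV by (intro card_UN_bound) auto

lemma LL_card: "card LL \<le> card U * (card V * KK) * (k * KK)"
proof -
  have "LL \<subseteq> (SIGMA t:(\<Union>u\<in>U. FV u). {t' \<in> flags. fb t' = fb t \<and> fT t \<inter> fT t' \<noteq> {}})"
    by (auto simp: LL_def JJ_def FV_def)
  moreover have "finite (SIGMA t:(\<Union>u\<in>U. FV u). {t' \<in> flags. fb t' = fb t \<and> fT t \<inter> fT t' \<noteq> {}})"
    using finite_UV by auto
  ultimately have "card LL \<le> card (SIGMA t:(\<Union>u\<in>U. FV u). {t' \<in> flags. fb t' = fb t \<and> fT t \<inter> fT t' \<noteq> {}})"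
    by (rule card_mono[rotated])
  also have "\<dots> \<le> card U * (card V * KK) * (k * KK)"
    using finite_UV card_UFV by (intro card_Sigma_le) (auto simp: FV_def intro!: card_same_base_linked)
  finally show ?thesis .
qed

lemma card_U_point: "card {t \<in> (\<Union>u\<in>U. FV u). w \<in> fT t} \<le> card U * KK"
proof -
  have "{t \<in> (\<Union>u\<in>U. FV u). w \<in> fT t} \<subseteq> (\<Union>u\<in>U - {w}. {t \<in> flags. u \<in> pts (fst t) \<and> w \<in> pts (fst t)})"
    using flag_pts flag_notin by (fastforce simp: FV_def)
  then have "card {t \<in> (\<Union>u\<in>U. FV u). w \<in> fT t} \<le> card (\<Union>u\<in>U - {w}. {t \<in> flags. u \<in> pts (fst t) \<and> w \<in> pts (fst t)})"
    using finite_UV by (intro card_mono) auto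
  also have "\<dots> \<le> card U * KK"
    using finite_UV by (intro card_UN_bound card_flags_two_points) (auto intro: card_mono)
  finally show ?thesis .
qed

text \<open>With \<open>r = card U\<close> and \<open>v = card V\<close>, there are
  \<open>O(r * v)\<close> linked pairs, each overlapping \<open>O(r)\<close> others, and
  \<open>O(r * v^2)\<close> unlinked pairs with bounded correlation. Relative to a squared mean of
  order \<open>(r * v)^2\<close> the variance is \<open>O(1 / r + 1 / v)\<close>. The constants
  \<open>48\<close> and \<open>162\<close> are both replaced by their sum.\<close>

lemma GG_variance:
  "bE p bits (\<lambda>X. (GG X - gG)\<^sup>2) \<le> 210 * real (k ^ 4 * KK ^ 4) * ((real (card U))\<^sup>2 * real (card V) + real (card U) * (real (card V))\<^sup>2)"
proof -
  let ?E = "bE p bits" and ?r = "card U" and ?v = "card V"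
  let ?O = "JJ - LL"
  let ?s = "\<lambda>x. fT (fst x) \<union> fT (snd x)"
  have mem: "fst x \<in> flags" "snd x \<in> flags" "finite (?s x)" "?s x \<subseteq> {..<n} - U" "card (?s x) \<le> 3 * k" if xJ: "x \<in> JJ" for x
  proof -
    obtain u where u: "u \<in> U" "fst x \<in> FV u" "snd x \<in> FV u" using JJ_mem[OF xJ] by blast
    show f: "fst x \<in> flags" "snd x \<in> flags" using u FV_flags by blast+
    show "finite (?s x)" "?s x \<subseteq> {..<n} - U" using FV_sub[OF u(2,1)] FV_sub[OF u(3,1)] by auto
    have "card (?s x) \<le> card (fT (fst x)) + card (fT (snd x))" by (rule card_Un_le)
    then show "card (?s x) \<le> 3 * k" using card_fT_le[OF f(1)] card_fT_le[OF f(2)] by linarith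
  qed
  have VL: "?E (\<lambda>X. ((\<Sum>x\<in>LL. pair_term x X) - ?E (\<lambda>X. \<Sum>x\<in>LL. pair_term x X))\<^sup>2)
      \<le> 4 * 1\<^sup>2 * real (card LL) * real (3 * k * (2 * (?r * KK * (k * KK))))"
  proof (rule variance_sum_le[where B = "\<lambda>x. \<Union>i\<in>?s x. bl i"])
    fix x assume x: "x \<in> LL"
    then have xJ: "x \<in> JJ" by (simp add: LL_def)
    show "dep (pair_term x) (\<Union>i\<in>?s x. bl i)"
    proof -
      have "dep (\<lambda>X. Z.zm (fT (fst x)) X * Z.zm (fT (snd x)) X) (\<Union>i\<in>?s x. bl i)"
        unfolding UN_Un using mem(4)[OF xJ] by (intro dep_mult Z.dep_zm) auto
      then show ?thesis unfolding pair_term_def[abs_def] by (rule dep_comp)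
    qed
    show "\<bar>pair_term x X\<bar> \<le> 1" for X by (rule tt_abs_le)
    have "{x' \<in> LL. (\<Union>i\<in>?s x. bl i) \<inter> (\<Union>i\<in>?s x'. bl i) \<noteq> {}} \<subseteq> {x' \<in> LL. ?s x \<inter> ?s x' \<noteq> {}}"
    proof
      fix x' assume x': "x' \<in> {x' \<in> LL. (\<Union>i\<in>?s x. bl i) \<inter> (\<Union>i\<in>?s x'. bl i) \<noteq> {}}"
      then obtain i j where ij: "i \<in> ?s x" "j \<in> ?s x'" "bl i \<inter> bl j \<noteq> {}" by blast
      moreover have "x' \<in> JJ" using x' by (simp add: LL_def)
      ultimately have "i = j" using Z.b_disj[of i j] mem(4)[OF xJ] mem(4)[of x'] by blast
      then show "x' \<in> {x' \<in> LL. ?s x \<inter> ?s x' \<noteq> {}}" using ij x' by blast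
    qed
    moreover have "finite LL" by (simp add: LL_def)
    ultimately have "card {x' \<in> LL. (\<Union>i\<in>?s x. bl i) \<inter> (\<Union>i\<in>?s x'. bl i) \<noteq> {}} \<le> card {x' \<in> LL. ?s x \<inter> ?s x' \<noteq> {}}"
      by (intro card_mono) auto
    also have "\<dots> \<le> 3 * k * (2 * (?r * KK * (k * KK)))"
    proof (rule card_Collect_point_le)
      fix w
      let ?S1 = "{x \<in> LL. w \<in> fT (fst x)}" and ?S2 = "{x \<in> LL. w \<in> fT (snd x)}"
      have "card ?S1 \<le> card (SIGMA t:{t \<in> (\<Union>u\<in>U. FV u). w \<in> fT t}. {t' \<in> flags. fb t' = fb t \<and> fT t \<inter> fT t' \<noteq> {}})"
        using finite_UV by (intro card_mono) (auto simp: LL_def JJ_def FV_def)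
      also have "\<dots> \<le> ?r * KK * (k * KK)"
        using finite_UV card_U_point by (intro card_Sigma_le) (auto simp: FV_def intro!: card_same_base_linked)
      finally have c1: "card ?S1 \<le> ?r * KK * (k * KK)" .
      have "card ?S2 = card ((\<lambda>x. (snd x, fst x)) ` ?S2)" by (intro card_image[symmetric]) (auto simp: inj_on_def prod_eq_iff)
      also have "\<dots> \<le> card (SIGMA t:{t \<in> (\<Union>u\<in>U. FV u). w \<in> fT t}. {t' \<in> flags. fb t' = fb t \<and> fT t \<inter> fT t' \<noteq> {}})"
        using finite_UV by (intro card_mono) (auto simp: LL_def JJ_def FV_def)
      also have "\<dots> \<le> ?r * KK * (k * KK)"
        using finite_UV card_U_point by (intro card_Sigma_le) (auto simp: FV_def intro!: card_same_base_linked)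
      finally have c2: "card ?S2 \<le> ?r * KK * (k * KK)" .
      have "{x \<in> LL. w \<in> ?s x} = ?S1 \<union> ?S2" by auto
      then have "card {x \<in> LL. w \<in> ?s x} \<le> card ?S1 + card ?S2" by (simp only: card_Un_le)
      then show "card {x \<in> LL. w \<in> ?s x} \<le> 2 * (?r * KK * (k * KK))" using c1 c2 by linarith
    qed (use mem[OF xJ] in \<open>auto simp: LL_def\<close>)
    finally show "card {x' \<in> LL. (\<Union>i\<in>?s x. bl i) \<inter> (\<Union>i\<in>?s x'. bl i) \<noteq> {}} \<le> 3 * k * (2 * (?r * KK * (k * KK)))" .
  qed (use finite_UV in \<open>auto simp: LL_def\<close>)
  have VO: "?E (\<lambda>X. (\<Sum>x\<in>?O. pair_term x X)\<^sup>2) \<le> real (?r * (?v * KK) * (?v * KK)) * real (9 * k\<^sup>2 * KK * (9 * k\<^sup>2 * KK))"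
  proof -
    have "?E (\<lambda>X. (\<Sum>x\<in>?O. (cf (fst x) * cf (snd x)) * Z.zm (?s x) X)\<^sup>2) \<le> 1\<^sup>2 * real (card ?O) * real (9 * k\<^sup>2 * KK * (9 * k\<^sup>2 * KK))"
    proof (rule Z.square_sum_le[where W = "\<lambda>_. {}"])
      fix x assume x: "x \<in> ?O"
      then have xJ: "x \<in> JJ" by simp
      show "finite (?s x) \<and> ?s x \<subseteq> {..<n} - U" using mem[OF xJ] by simp
      show "\<bar>cf (fst x) * cf (snd x)\<bar> \<le> 1"
        using cf_bounds[of "fst x"] cf_bounds[of "snd x"] by (simp add: abs_mult mult_le_one)
      have "{x' \<in> ?O. ?s x' \<subseteq> ?s x \<union> {}} \<subseteq> (SIGMA t:{t \<in> flags. fT t \<subseteq> ?s x}. {t \<in> flags. fT t \<subseteq> ?s x})"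
      proof
        fix x' assume "x' \<in> {x' \<in> ?O. ?s x' \<subseteq> ?s x \<union> {}}"
        then show "x' \<in> (SIGMA t:{t \<in> flags. fT t \<subseteq> ?s x}. {t \<in> flags. fT t \<subseteq> ?s x})"
          using mem[of x'] by (cases x') auto
      qed
      then have "card {x' \<in> ?O. ?s x' \<subseteq> ?s x \<union> {}} \<le> card (SIGMA t:{t \<in> flags. fT t \<subseteq> ?s x}. {t \<in> flags. fT t \<subseteq> ?s x})"
        by (intro card_mono) auto
      also have "\<dots> \<le> 9 * k\<^sup>2 * KK * (9 * k\<^sup>2 * KK)"
        using card_within_3k[OF mem(3)[OF xJ] mem(5)[OF xJ]] by (intro card_Sigma_le) auto
      finally show "card {x' \<in> ?O. ?s x' \<subseteq> ?s x \<union> {}} \<le> 9 * k\<^sup>2 * KK * (9 * k\<^sup>2 * KK)" .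
    qed auto
    moreover have "(\<Sum>x\<in>?O. (cf (fst x) * cf (snd x)) * Z.zm (?s x) X) = (\<Sum>x\<in>?O. pair_term x X)" for X
    proof (intro sum.cong refl)
      fix x assume x: "x \<in> ?O"
      then have "fT (fst x) \<inter> fT (snd x) = {}" by (auto simp: LL_def)
      then have "Z.zm (?s x) X = Z.zm (fT (fst x)) X * Z.zm (fT (snd x)) X"
        unfolding Z.zm_def using mem(3)[of x] x by (intro prod.union_disjoint) auto
      then show "(cf (fst x) * cf (snd x)) * Z.zm (?s x) X = pair_term x X" by (simp add: pair_term_def)
    qed
    moreover have "card ?O \<le> ?r * (?v * KK) * (?v * KK)"
    proof -
      have "card ?O \<le> card JJ" by (intro card_mono) auto
      also have "\<dots> \<le> ?r * (?v * KK) * (?v * KK)"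
        unfolding JJ_def using finite_UV card_UFV card_FV by (intro card_Sigma_le) (auto simp: FV_def)
      finally show ?thesis .
    qed
    then have "real (card ?O) * real (9 * k\<^sup>2 * KK * (9 * k\<^sup>2 * KK)) \<le> real (?r * (?v * KK) * (?v * KK)) * real (9 * k\<^sup>2 * KK * (9 * k\<^sup>2 * KK))"
      by (intro mult_right_mono) (simp_all only: of_nat_le_iff of_nat_0_le_iff)
    ultimately show ?thesis by simp
  qed
  have split: "GG X = (\<Sum>x\<in>LL. pair_term x X) + (\<Sum>x\<in>?O. pair_term x X)" for X
  proof -
    have "LL \<subseteq> JJ" by (auto simp: LL_def)
    then show ?thesis unfolding GG_JJ by (simp add: sum.subset_diff[of LL JJ] add.commute)
  qed
  have "(GG X - gG)\<^sup>2 \<le> 2 * ((\<Sum>x\<in>LL. pair_term x X) - gG)\<^sup>2 + 2 * (\<Sum>x\<in>?O. pair_term x X)\<^sup>2" for X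
  proof -
    have "(a + b - g)\<^sup>2 \<le> 2 * (a - g)\<^sup>2 + 2 * b\<^sup>2" for a b g :: real
      using zero_le_power2[of "a - g - b"] by (simp add: power2_eq_square algebra_simps)
    then show ?thesis unfolding split .
  qed
  then have "?E (\<lambda>X. (GG X - gG)\<^sup>2) \<le> ?E (\<lambda>X. 2 * ((\<Sum>x\<in>LL. pair_term x X) - gG)\<^sup>2 + 2 * (\<Sum>x\<in>?O. pair_term x X)\<^sup>2)"
    by (intro bE_mono) auto
  also have "\<dots> = 2 * ?E (\<lambda>X. ((\<Sum>x\<in>LL. pair_term x X) - gG)\<^sup>2) + 2 * ?E (\<lambda>X. (\<Sum>x\<in>?O. pair_term x X)\<^sup>2)"
    by (simp only: bE_add bE_cmult)
  finally have 1: "?E (\<lambda>X. (GG X - gG)\<^sup>2) \<le> \<dots>" .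
  have 2: "?E (\<lambda>X. ((\<Sum>x\<in>LL. pair_term x X) - gG)\<^sup>2) \<le> real (24 * k ^ 3 * KK ^ 4 * (?r\<^sup>2 * ?v))"
  proof -
    have "?E (\<lambda>X. ((\<Sum>x\<in>LL. pair_term x X) - gG)\<^sup>2) \<le> real (4 * card LL * (3 * k * (2 * (?r * KK * (k * KK)))))"
      using VL unfolding gG_def by simp
    also have "\<dots> \<le> real (4 * (?r * (?v * KK) * (k * KK)) * (3 * k * (2 * (?r * KK * (k * KK)))))"
      unfolding of_nat_le_iff using LL_card by (intro mult_le_mono) auto
    also have "\<dots> = real (24 * k ^ 3 * KK ^ 4 * (?r\<^sup>2 * ?v))"
      by (simp add: power2_eq_square power3_eq_cube power4_eq_xxxx)
    finally show ?thesis .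
  qed
  have 3: "?E (\<lambda>X. (\<Sum>x\<in>?O. pair_term x X)\<^sup>2) \<le> real (81 * k ^ 4 * KK ^ 4 * (?r * ?v\<^sup>2))"
    using VO by (simp add: power2_eq_square power4_eq_xxxx mult_ac)
  have "real (24 * k ^ 3 * KK ^ 4 * (?r\<^sup>2 * ?v)) \<le> real (24 * k ^ 4 * KK ^ 4 * (?r\<^sup>2 * ?v))"
    unfolding of_nat_le_iff using k3 by (intro mult_le_mono power_increasing order_refl) auto
  then have "?E (\<lambda>X. (GG X - gG)\<^sup>2) \<le> 2 * real (24 * k ^ 4 * KK ^ 4 * (?r\<^sup>2 * ?v)) + 2 * real (81 * k ^ 4 * KK ^ 4 * (?r * ?v\<^sup>2))"
    using 1 2 3 by linarith
  also have "\<dots> \<le> 210 * real (k ^ 4 * KK ^ 4) * ((real ?r)\<^sup>2 * real ?v + real ?r * (real ?v)\<^sup>2)"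
    by (simp add: distrib_left mult_ac)
  finally show ?thesis .
qed

lemma bE_zz_square: "i \<in> {..<n} - U \<Longrightarrow> lam\<^sup>2 \<le> bE p bits (\<lambda>X. (zz i X)\<^sup>2)"
proof -
  assume i: "i \<in> {..<n} - U"
  have q: "lam\<^sup>2 \<le> p * (1 - p)" using lam_p lam_pos by (simp add: power2_eq_square mult_mono)
  show ?thesis
  proof (cases "i \<in> V")
    case True
    then have b: "i \<in> bits" "i + n \<in> bits" by (auto simp: bits_def)
    have "(\<lambda>X. (zz i X)\<^sup>2) = (\<lambda>X. ind i X + ind (i + n) X - 2 * (ind i X * ind (i + n) X))"
      using True by (auto simp: zz_def ind_def)
    moreover have "bE p bits (\<lambda>X. ind i X * ind (i + n) X) = bE p bits (ind i) * bE p bits (ind (i + n))"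
      using finite_UV n_pos by (intro bE_indep[where B = "{i}" and B' = "{i + n}"]) (auto simp: dep_def ind_def)
    ultimately have "bE p bits (\<lambda>X. (zz i X)\<^sup>2) = bE p bits (ind i) + bE p bits (ind (i + n)) - 2 * (bE p bits (ind i) * bE p bits (ind (i + n)))"
      by (simp only: bE_diff bE_add bE_cmult)
    also have "\<dots> = 2 * (p * (1 - p))" using b finite_UV by (simp add: bE_ind algebra_simps)
    finally show ?thesis using q zero_le_power2[of lam] by linarith
  next
    case False
    then have b: "i \<in> bits" using i by (auto simp: bits_def RR_def)
    have "(\<lambda>X. (zz i X)\<^sup>2) = (\<lambda>X. (1 - 2 * p) * ind i X + p\<^sup>2)"
      using False by (auto simp: zz_def ind_def power2_eq_square algebra_simps)
    then have "bE p bits (\<lambda>X. (zz i X)\<^sup>2) = (1 - 2 * p) * bE p bits (ind i) + p\<^sup>2"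
      using finite_UV by (simp only: bE_add bE_cmult bE_const)
    also have "\<dots> = p * (1 - p)" using b finite_UV by (simp add: bE_ind power2_eq_square algebra_simps)
    finally show ?thesis using q by simp
  qed
qed

text \<open>Linked pairs never have a negative mean, so it is enough to keep, for each
  \<open>u\<close> and \<open>v\<close> in the blocks, the pair formed twice by the full flag with
  \<open>u\<close> and \<open>v\<close> at its first two positions. The factor \<open>1/4\<close> is
  the square of its weight.\<close>

lemma gG_lower: "real (card U) * real (card V) * lam ^ (2 * k) / 4 \<le> gG"
proof -
  have uv: "u \<noteq> v" "u < n" "v < n" if "u \<in> U" "v \<in> V" for u v
    using that UV_disj UV_sub by auto
  have "\<forall>x\<in>U \<times> V. \<exists>a\<in>AP. e 0 a = fst x \<and> e 1 a = snd x"
    using uv k3 by (auto intro!: e_ex)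
  then obtain f where f: "\<And>x. x \<in> U \<times> V \<Longrightarrow> f x \<in> AP \<and> e 0 (f x) = fst x \<and> e 1 (f x) = snd x"
    by metis
  define g where "g x = (f x, {..<k}, 0 :: nat)" for x
  define S where "S = (\<lambda>x. (g x, g x)) ` (U \<times> V)"
  have gf: "g x \<in> flags" "g x \<in> FV (fst x)" "fst x \<in> U" "cf (g x) = 1 / 2" if x: "x \<in> U \<times> V" for x
  proof -
    show fl: "g x \<in> flags" using f[OF x] k3 by (auto simp: g_def flags_def)
    have "e 1 (f x) \<in> fT (g x)" unfolding g_def fT_def prod.case using k3 by (intro imageI) auto
    moreover have "fb (g x) = fst x" using f[OF x] by (simp add: g_def fb_def)
    ultimately show "g x \<in> FV (fst x)" using fl f[OF x] x by (auto simp: FV_def)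
    show "fst x \<in> U" using x by auto
    show "cf (g x) = 1 / 2" by (simp add: g_def cf_def)
  qed
  have inj: "inj_on (\<lambda>x. (g x, g x)) (U \<times> V)"
  proof (rule inj_onI)
    fix x y assume xy: "x \<in> U \<times> V" "y \<in> U \<times> V" "(g x, g x) = (g y, g y)"
    then have "f x = f y" by (simp add: g_def)
    then show "x = y" using f[OF xy(1)] f[OF xy(2)] by (auto simp: prod_eq_iff)
  qed
  have SL: "S \<subseteq> LL"
  proof
    fix y assume "y \<in> S"
    then obtain x where x: "y = (g x, g x)" "x \<in> U \<times> V" by (auto simp: S_def)
    have "fT (g x) \<noteq> {}" using fT_two[OF gf(1)[OF x(2)]] by auto
    moreover have "fb (g x) = fst x" using gf(2)[OF x(2)] by (simp add: FV_def)
    ultimately show "y \<in> LL" using gf(2,3)[OF x(2)] x(1) by (auto simp: LL_def JJ_def)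
  qed
  have pos: "0 \<le> bE p bits (pair_term x)" if x: "x \<in> LL" for x
  proof (cases "fT (fst x) = fT (snd x)")
    case True
    then have "0 \<le> pair_term x X" for X using cf_bounds(1) by (simp add: pair_term_def)
    then show ?thesis by (intro bE_nonneg) auto
  next
    case False
    have "x \<in> JJ" using x by (simp add: LL_def)
    then obtain u where u: "u \<in> U" "fst x \<in> FV u" "snd x \<in> FV u" using JJ_mem by blast
    note s1 = FV_sub[OF u(2,1)] and s2 = FV_sub[OF u(3,1)]
    consider w where "w \<in> fT (fst x)" "w \<notin> fT (snd x)" | w where "w \<in> fT (snd x)" "w \<notin> fT (fst x)" using False by blast
    then have "bE p bits (\<lambda>X. Z.zm (fT (fst x)) X * Z.zm (fT (snd x)) X) = 0"
    proof cases
      case 1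
      then have "bE p bits (\<lambda>X. Z.zm (fT (snd x)) X * Z.zm (fT (fst x)) X) = 0"
        using s1 s2 by (intro Z.mean_zm_zero[of _ w _ "fT (snd x)"] Z.dep_zm) auto
      then show ?thesis by (simp add: mult.commute)
    next
      case 2
      then show ?thesis using s1 s2 by (intro Z.mean_zm_zero[of _ w _ "fT (fst x)"] Z.dep_zm) auto
    qed
    then show ?thesis by (simp add: pair_term_def[abs_def] bE_cmult)
  qed
  have low: "lam ^ (2 * k) / 4 \<le> bE p bits (pair_term y)" if y: "y \<in> S" for y
  proof -
    obtain x where x: "y = (g x, g x)" "x \<in> U \<times> V" using y by (auto simp: S_def)
    note s = FV_sub[OF gf(2,3)[OF x(2)]]
    let ?T = "fT (g x)"
    have lam1: "lam\<^sup>2 \<le> 1" using lam_p p_less lam_pos by (intro power_le_one) auto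
    have "lam ^ (2 * k) = (lam\<^sup>2) ^ k" by (simp add: power_mult)
    also have "\<dots> \<le> (lam\<^sup>2) ^ card ?T"
      using lam1 card_fT_le[OF gf(1)[OF x(2)]] by (intro power_decreasing) auto
    also have "\<dots> = (\<Prod>i\<in>?T. lam\<^sup>2)" by simp
    also have "\<dots> \<le> (\<Prod>i\<in>?T. bE p bits (\<lambda>X. (zz i X)\<^sup>2))"
      using s(1) by (intro prod_mono conjI bE_zz_square) auto
    also have "\<dots> = bE p bits (\<lambda>X. \<Prod>i\<in>?T. (zz i X)\<^sup>2)"
    proof (rule bE_indep_prod[symmetric, where B = bl])
      show "dep (\<lambda>X. (zz i X)\<^sup>2) (bl i)" if "i \<in> ?T" for i
        using that s(1) by (intro dep_comp[OF Z.z_dep]) auto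
      show "bl i \<inter> bl j = {}" if "i \<in> ?T" "j \<in> ?T" "i \<noteq> j" for i j
        using that s(1) by (intro Z.b_disj) auto
    qed (use finite_UV s in auto)
    also have "\<dots> = bE p bits (\<lambda>X. Z.zm ?T X * Z.zm ?T X)"
      by (simp add: Z.zm_def prod.distrib power2_eq_square)
    finally have "1 / 4 * lam ^ (2 * k) \<le> 1 / 4 * bE p bits (\<lambda>X. Z.zm ?T X * Z.zm ?T X)" by simp
    also have "\<dots> = bE p bits (pair_term y)"
    proof -
      have "pair_term y = (\<lambda>X. 1 / 4 * (Z.zm ?T X * Z.zm ?T X))"
        unfolding pair_term_def x(1) fst_conv snd_conv gf(4)[OF x(2)] by auto
      then show ?thesis by (simp only: bE_cmult)
    qed
    finally show ?thesis by simp
  qed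
  have "real (card U) * real (card V) * lam ^ (2 * k) / 4 = (\<Sum>y\<in>S. lam ^ (2 * k) / 4)"
    using card_image[OF inj] by (simp add: S_def card_cartesian_product)
  also have "\<dots> \<le> (\<Sum>y\<in>S. bE p bits (pair_term y))" using low by (intro sum_mono)
  also have "\<dots> \<le> (\<Sum>y\<in>LL. bE p bits (pair_term y))"
    using SL pos by (intro sum_mono2) (auto simp: LL_def)
  also have "\<dots> = gG" by (simp add: gG_def bE_sum)
  finally show ?thesis .
qed

lemma dg_GG: "dg (2 * k) GG"
proof -
  have z: "dg 1 (zz i)" for i
  proof (cases "i \<in> V")
    case True
    then show ?thesis using dg_diff[OF dg_ind[of i 0] dg_ind[of "i + n" 0]] by (simp add: zz_def[abs_def])
  next
    case False
    then show ?thesis using dg_ind[of i p] by (simp add: zz_def[abs_def])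
  qed
  have "dg k (\<lambda>X. cf t * Z.zm (fT t) X)" if "t \<in> flags" for t
  proof (rule dg_scale)
    have "dg (card (fT t)) (\<lambda>X. \<Prod>i\<in>fT t. zz i X)" using that z by (intro dg_prod) auto
    then have "dg k (\<lambda>X. \<Prod>i\<in>fT t. zz i X)" using card_fT_le[OF that] by (rule dg_le)
    then show "dg k (Z.zm (fT t))" by (simp add: Z.zm_def[abs_def])
  qed
  then have "dg k (cu u)" for u
    unfolding cu_def[abs_def] using FV_flags by (intro dg_sum) blast
  then have "dg (k * 2) (\<lambda>X. (cu u X) ^ 2)" for u by (rule dg_power)
  then show ?thesis unfolding GG_def[abs_def] by (intro dg_sum) (simp add: mult.commute)
qed

text \<open>The hypothesis on \<open>t\<close> keeps all angles at most one, where
  \<open>1 - cos\<close> dominates a quarter of the square. If \<open>GG\<close> is at least half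
  its mean, the product is exponentially small; otherwise it is at most one, and that event is
  charged to the 128th central moment, which hypercontractivity bounds by the 64th power of the
  variance.\<close>

lemma block_product_bound:
  assumes ne: "U \<noteq> {}" "V \<noteq> {}" and t: "\<bar>t\<bar> * real (card V * KK) \<le> 1"
  shows "bE p bits (\<lambda>X. \<Prod>u\<in>U. 1 - 2 * (p * (1 - p)) * (1 - cos (t * cu u X)))
    \<le> exp (- (p * (1 - p)) * t\<^sup>2 / 4 * gG)
      + kap lam ^ (2 * k * 2 ^ 6 * (2 ^ 6 - 1)) * (bE p bits (\<lambda>X. (GG X - gG)\<^sup>2)) ^ (2 ^ 6) / (gG / 2) ^ (2 ^ 7)"
proof -
  let ?q = "p * (1 - p)" and ?K = "kap lam ^ (2 * k * 2 ^ 6 * (2 ^ 6 - 1))"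
  have q: "0 \<le> ?q" "?q \<le> 1 / 4"
  proof -
    show "?q \<le> 1 / 4" using zero_le_power2[of "p - 1/2"] by (simp add: power2_eq_square algebra_simps)
  qed (use p_pos p_less in auto)
  have cU: "real (card U) > 0" "real (card V) > 0" using ne finite_UV by (auto simp: card_gt_0_iff)
  have g0: "0 < gG"
    using gG_lower cU lam_pos by (intro less_le_trans[OF _ gG_lower]) auto
  have pt: "(\<Prod>u\<in>U. 1 - 2 * ?q * (1 - cos (t * cu u X))) \<le> exp (- ?q * t\<^sup>2 / 4 * gG) + ((GG X - gG) / (gG / 2)) ^ 128" for X
  proof -
    have "(\<Prod>u\<in>U. 1 - 2 * ?q * (1 - cos (t * cu u X))) \<le> (\<Prod>u\<in>U. exp (- (?q / 2) * (t * cu u X)\<^sup>2))"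
    proof (intro prod_mono conjI)
      fix u assume u: "u \<in> U"
      have "1 - cos (t * cu u X) \<le> 2" using cos_ge_minus_one[of "t * cu u X"] by linarith
      then have "2 * ?q * (1 - cos (t * cu u X)) \<le> 2 * (1/4) * 2" using q by (intro mult_mono) auto
      then show "0 \<le> 1 - 2 * ?q * (1 - cos (t * cu u X))" by simp
      have "\<bar>t * cu u X\<bar> \<le> \<bar>t\<bar> * real (card V * KK)"
        unfolding abs_mult by (intro mult_left_mono cu_abs_le u) auto
      then have "(t * cu u X)\<^sup>2 / 4 \<le> 1 - cos (t * cu u X)" using t by (intro one_minus_cos_ge) linarith
      then have "2 * ?q * ((t * cu u X)\<^sup>2 / 4) \<le> 2 * ?q * (1 - cos (t * cu u X))" using q by (intro mult_left_mono) auto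
      then have "1 - 2 * ?q * (1 - cos (t * cu u X)) \<le> 1 + (- (?q / 2) * (t * cu u X)\<^sup>2)" by simp
      also have "\<dots> \<le> exp (- (?q / 2) * (t * cu u X)\<^sup>2)" by (rule exp_ge_add_one_self)
      finally show "1 - 2 * ?q * (1 - cos (t * cu u X)) \<le> exp (- (?q / 2) * (t * cu u X)\<^sup>2)" .
    qed
    also have "\<dots> = exp (- (?q / 2) * t\<^sup>2 * GG X)"
    proof -
      have "(\<Sum>u\<in>U. - (?q / 2) * (t * cu u X)\<^sup>2) = - (?q / 2) * t\<^sup>2 * GG X"
        unfolding GG_def by (simp only: sum_distrib_left power_mult_distrib mult.assoc)
      then show ?thesis by (simp only: exp_sum[OF finite_UV(1), symmetric])
    qed
    also have "\<dots> \<le> exp (- ?q * t\<^sup>2 / 4 * gG) + ((GG X - gG) / (gG / 2)) ^ 128"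
    proof (cases "gG / 2 \<le> GG X")
      case True
      then have "?q / 2 * t\<^sup>2 * (gG / 2) \<le> ?q / 2 * t\<^sup>2 * GG X" using q by (intro mult_left_mono) auto
      then have "exp (- (?q / 2) * t\<^sup>2 * GG X) \<le> exp (- ?q * t\<^sup>2 / 4 * gG)" by simp
      moreover have "0 \<le> ((GG X - gG) / (gG / 2)) ^ 128" by (intro zero_le_even_power) simp
      ultimately show ?thesis by linarith
    next
      case False
      have "0 \<le> GG X" by (auto simp: GG_def intro: sum_nonneg)
      then have "exp (- (?q / 2) * t\<^sup>2 * GG X) \<le> 1" using q by simp
      moreover have a1: "1 \<le> \<bar>(GG X - gG) / (gG / 2)\<bar>" using False g0 by (simp add: abs_if field_simps)
      from a1 have p1: "1 ^ 128 \<le> \<bar>(GG X - gG) / (gG / 2)\<bar> ^ 128" by (intro power_mono) auto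
      have p2: "\<bar>x\<bar> ^ 128 = x ^ 128" for x :: real by (rule power_even_abs) simp
      moreover have "1 \<le> ((GG X - gG) / (gG / 2)) ^ 128" using p1 by (simp only: power_one p2)
      ultimately show ?thesis using exp_ge_zero[of "- ?q * t\<^sup>2 / 4 * gG"] by linarith
    qed
    finally show ?thesis .
  qed
  have "bE p bits (\<lambda>X. \<Prod>u\<in>U. 1 - 2 * ?q * (1 - cos (t * cu u X)))
      \<le> bE p bits (\<lambda>X. exp (- ?q * t\<^sup>2 / 4 * gG) + ((GG X - gG) / (gG / 2)) ^ 128)"
    by (intro bE_mono pt) auto
  also have "\<dots> = exp (- ?q * t\<^sup>2 / 4 * gG) + bE p bits (\<lambda>X. (GG X - gG) ^ 128) / (gG / 2) ^ 128"
    using finite_UV by (simp only: bE_add bE_const power_divide bE_divide)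
  also have "\<dots> \<le> exp (- ?q * t\<^sup>2 / 4 * gG) + ?K * (bE p bits (\<lambda>X. (GG X - gG)\<^sup>2)) ^ (2 ^ 6) / (gG / 2) ^ (2 ^ 7)"
  proof -
    have "bE p bits (\<lambda>X. (GG X - gG) ^ (2 ^ Suc 6)) \<le> ?K * (bE p bits (\<lambda>X. (GG X - gG)\<^sup>2)) ^ (2 ^ 6)"
      using p_pos p_less finite_UV
      by (intro hypercontractive_power dg_diff dg_GG dg_const kap_ge kap_square) auto
    moreover have "(2::nat) ^ Suc 6 = 128" "(2::nat) ^ 7 = 128" by simp_all
    ultimately have "bE p bits (\<lambda>X. (GG X - gG) ^ 128) \<le> ?K * (bE p bits (\<lambda>X. (GG X - gG)\<^sup>2)) ^ (2 ^ 6)" by (simp only:)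
    moreover have "(gG / 2) ^ (2 ^ 7) = (gG / 2) ^ 128" by simp
    moreover have "0 \<le> (gG / 2) ^ 128" using g0 by (intro zero_le_power) auto
    ultimately show ?thesis by (simp only:) (intro add_left_mono divide_right_mono)
  qed
  finally show ?thesis .
qed

end

section \<open>Large frequencies\<close>

text \<open>Two angles at distance \<open>\<bar>t\<bar> \<le> pi\<close> cannot both be close to
  multiples of \<open>2 * pi\<close>. The sum formula for cosines reduces this to an estimate for
  the angle \<open>t / 2\<close>.\<close>

lemma cos_pair_bound:
  assumes "\<bar>t\<bar> \<le> pi" "x - y = t \<or> y - x = t"
  shows "t\<^sup>2 / 16 \<le> (1 - cos x) + (1 - cos y)"
proof -
  have c: "cos ((x - y) / 2) = cos (t / 2)"
    using assms(2) cos_minus[of "t / 2"] by (metis minus_diff_eq minus_divide_left)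
  have c0: "0 \<le> cos (t / 2)" using assms(1) by (intro cos_ge_zero) auto
  have "cos x + cos y = 2 * cos ((x + y) / 2) * cos (t / 2)"
    unfolding c[symmetric] by (rule cos_plus_cos)
  also have "\<dots> \<le> 2 * 1 * cos (t / 2)"
    using c0 cos_le_one by (intro mult_right_mono mult_left_mono) auto
  finally have 1: "2 * (1 - cos (t / 2)) \<le> (1 - cos x) + (1 - cos y)" by simp
  define z where "z = t / 4"
  have z: "\<bar>z\<bar> \<le> 1" "t / 2 = 2 * z" "t = 4 * z" using assms(1) pi_less_4 by (auto simp: z_def)
  have "0 \<le> cos z" using z(1) pi_gt3 by (intro cos_ge_zero) auto
  then have "1 * (z\<^sup>2 / 4) \<le> (1 + cos z) * (1 - cos z)"
    using one_minus_cos_ge[OF z(1)] by (intro mult_mono) auto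
  moreover have "1 - cos (2 * z) = 2 * ((1 + cos z) * (1 - cos z))"
    using cos_double_cos[of z] by (simp add: power2_eq_square algebra_simps)
  ultimately have "z\<^sup>2 / 2 \<le> 1 - cos (t / 2)" unfolding z(2) by linarith
  moreover have "t\<^sup>2 / 16 = z\<^sup>2" unfolding z(3) by (simp add: power_mult_distrib)
  ultimately show ?thesis using 1 by argo
qed

text \<open>For \<open>u\<close> and \<open>v\<close> in the two blocks, \<open>al u v\<close> is the progression beginning with \<open>u, v\<close>, \<open>rh u v\<close> its reversal
  and \<open>wp u v\<close> its last point. No other progression through the two blocks contains \<open>wp u v\<close>, so that the bit
  there can be averaged out independently of everything else.\<close>

locale spread_blocks = two_blocks n k AP e m lam U V for n k :: nat and AP :: "'a set" and e m lam U V +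
  fixes al rh :: "nat \<Rightarrow> nat \<Rightarrow> 'a" and wp :: "nat \<Rightarrow> nat \<Rightarrow> nat"
  assumes al_AP: "\<And>u v. u \<in> U \<Longrightarrow> v \<in> V \<Longrightarrow> al u v \<in> AP \<and> rh u v \<in> AP \<and> al u v \<noteq> rh u v \<and> pts (rh u v) = pts (al u v)"
    and al_pts: "\<And>u v. u \<in> U \<Longrightarrow> v \<in> V \<Longrightarrow> u \<in> pts (al u v) \<and> v \<in> pts (al u v) \<and> wp u v \<in> pts (al u v) \<and> wp u v \<noteq> u \<and> wp u v \<noteq> v"
    and wp_only: "\<And>u v u' v' a. u \<in> U \<Longrightarrow> v \<in> V \<Longrightarrow> u' \<in> U \<Longrightarrow> v' \<in> V \<Longrightarrow> a \<in> AP \<Longrightarrow>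
      u' \<in> pts a \<Longrightarrow> v' \<in> pts a \<Longrightarrow> wp u v \<in> pts a \<Longrightarrow> u' = u \<and> v' = v \<and> a \<in> {al u v, rh u v}"
    and al_disj: "\<And>u u' v. u \<in> U \<Longrightarrow> u' \<in> U \<Longrightarrow> v \<in> V \<Longrightarrow> u \<noteq> u' \<Longrightarrow> pts (al u v) \<inter> pts (al u' v) \<subseteq> {v}"
begin

text \<open>The decoupled coefficient of \<open>XX\<close>. Raw bits are used, since the argument
  rests on exact unit jumps of this coefficient and not on its variance.\<close>

definition cx :: "nat \<Rightarrow> nat set \<Rightarrow> nat set \<Rightarrow> nat set \<Rightarrow> real" where
  "cx u B B' C = (\<Sum>a\<in>{a \<in> AP. u \<in> pts a \<and> pts a \<inter> V \<noteq> {}}. 1 / 2 * (mon 0 (pts a - {u}) (B \<union> C) - mon 0 (pts a - {u}) (B' \<union> C)))"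

lemma decoupled_XX:
  "(norm (bE p {..<n} (\<lambda>A. cis (t * XX A) * cis (\<theta> * real (card A))))) ^ 4
    \<le> bE p RR (\<lambda>C. bE p V (\<lambda>B. bE p V (\<lambda>B'. \<Prod>u\<in>U. 1 - 2 * (p * (1 - p)) * (1 - cos (t * cx u B B' C)))))"
proof -
  have XX: "XX A = (\<Sum>a\<in>AP. 1 / 2 * mon 0 (pts a) A)" for A by (simp add: XX_def sum_divide_distrib)
  have N: "{..<n} = U \<union> V \<union> RR" using UV_sub by (auto simp: RR_def)
  show ?thesis unfolding XX N cx_def
  proof (rule decoupling)
    fix a assume a: "a \<in> AP"
    show "pts a \<subseteq> U \<union> V \<union> RR" using pts_less[OF a] unfolding N .
    show "u = u'" if "pts a \<inter> V \<noteq> {}" "u \<in> pts a \<inter> U" "u' \<in> pts a \<inter> U" for u u'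
      using sepU[OF a] that by blast
  qed (use finite_UV fin_AP UV_disj in \<open>auto simp: RR_def\<close>)
qed

definition QQ :: "nat \<Rightarrow> nat \<Rightarrow> nat set" where "QQ u v = pts (al u v) - {u, v, wp u v}"

lemma al_sub: "u \<in> U \<Longrightarrow> v \<in> V \<Longrightarrow> pts (al u v) - {u, v} \<subseteq> RR"
proof
  fix x assume uv: "u \<in> U" "v \<in> V" and x: "x \<in> pts (al u v) - {u, v}"
  have a: "al u v \<in> AP" "u \<in> pts (al u v)" "v \<in> pts (al u v)" using al_AP al_pts uv by auto
  have "x \<notin> U" using sepU[OF a(1), of x u] a x uv by auto
  moreover have "x \<notin> V" using sepV[OF a(1), of x v] a x uv by auto
  moreover have "x < n" using pts_less[OF a(1)] x by auto
  ultimately show "x \<in> RR" by (simp add: RR_def)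
qed

text \<open>Among the progressions through \<open>u\<close> and \<open>V\<close>, the bit at
  \<open>wp u v\<close> occurs only in \<open>al u v\<close> and its reversal; their weights of one
  half add up to one. The jump takes place only if all other points \<open>QQ u v\<close> are
  present and the two copies differ at \<open>v\<close>.\<close>

lemma cx_step:
  assumes v: "v \<in> V" and B: "B \<subseteq> V" "B' \<subseteq> V"
    and C: "C \<subseteq> RR - (\<lambda>u. wp u v) ` U" and D: "D \<subseteq> (\<lambda>u. wp u v) ` U" and u: "u \<in> U"
  shows "cx u B B' (C \<union> D) = cx u B B' C + ind (wp u v) D * (ind v B - ind v B') * mon 0 (QQ u v) C"
proof -
  let ?M = "{a \<in> AP. u \<in> pts a \<and> pts a \<inter> V \<noteq> {}}"
  let ?P = "{al u v, rh u v}"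
  let ?f = "\<lambda>a C. mon 0 (pts a - {u}) (B \<union> C) - mon 0 (pts a - {u}) (B' \<union> C)"
  let ?d = "ind (wp u v) D * (ind v B - ind v B') * mon 0 (QQ u v) C"
  have aa: "al u v \<in> AP" "rh u v \<in> AP" "al u v \<noteq> rh u v" "pts (rh u v) = pts (al u v)"
    and ap: "u \<in> pts (al u v)" "v \<in> pts (al u v)" "wp u v \<in> pts (al u v)" "wp u v \<noteq> u" "wp u v \<noteq> v"
    using al_AP[OF u v] al_pts[OF u v] by auto
  have PM: "?P \<subseteq> ?M" using aa ap v by auto
  have uv: "u \<noteq> v" using u v UV_disj by auto
  have wR: "wp u' v \<in> RR" if "u' \<in> U" for u' using al_sub[OF that v] al_pts[OF that v] by auto
  have diff: "?f a (C \<union> D) - ?f a C = (if a \<in> ?P then ?d else 0)" if a: "a \<in> ?M" for a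
  proof (cases "pts a \<inter> D = {}")
    case True
    have "?f a (C \<union> D) = ?f a C" using True by (intro arg_cong2[of _ _ _ _ "(-)"] mon_cong) auto
    moreover have "?d = 0" if "a \<in> ?P"
    proof -
      have "wp u v \<in> pts a" using that aa ap by auto
      then have "wp u v \<notin> D" using True by auto
      then show ?thesis by (simp add: ind_def)
    qed
    ultimately show ?thesis by auto
  next
    case False
    then obtain u' where u': "u' \<in> U" "wp u' v \<in> pts a" "wp u' v \<in> D" using D by auto
    obtain v' where v': "v' \<in> pts a" "v' \<in> V" using a by auto
    have "u = u' \<and> v' = v \<and> a \<in> {al u' v, rh u' v}"
      using wp_only[OF u'(1) v u v'(2), of a] a v' u' by auto
    then have aP: "a \<in> ?P" and uu: "wp u v \<in> D" using u' by auto
    then have pa: "pts a = pts (al u v)" using aa by auto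
    have dec: "pts (al u v) - {u} = insert v (insert (wp u v) (QQ u v))" using ap uv by (auto simp: QQ_def)
    have fQ: "finite (QQ u v)" "v \<notin> insert (wp u v) (QQ u v)" "wp u v \<notin> QQ u v"
      using ap by (auto simp: QQ_def)
    have m: "mon 0 (pts a - {u}) Y = ind v Y * (ind (wp u v) Y * mon 0 (QQ u v) Y)" for Y
      unfolding pa dec mon_def using fQ by simp
    have QR: "QQ u v \<subseteq> RR" using al_sub[OF u v] by (auto simp: QQ_def)
    \<comment> \<open>Progressions through a common \<open>v\<close> with different \<open>u\<close>
      meet only in \<open>v\<close>, so the other averaged bits do not touch
      \<open>QQ u v\<close>.\<close>
    have QW: "QQ u v \<inter> D = {}"
    proof (rule ccontr)
      assume "QQ u v \<inter> D \<noteq> {}"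
      then obtain u2 where u2: "u2 \<in> U" "wp u2 v \<in> QQ u v" using D by auto
      then have "u2 \<noteq> u" by (auto simp: QQ_def)
      then show False using al_disj[OF u2(1) u v] al_pts[OF u2(1) v] u2(2) by (auto simp: QQ_def)
    qed
    have RV: "RR \<inter> V = {}" by (auto simp: RR_def)
    have "D \<subseteq> RR" using D wR by blast
    then have CD: "C \<inter> V = {}" "D \<inter> V = {}" using C RV by auto
    have wC: "wp u v \<notin> C" using C u by auto
    have wB: "wp u v \<notin> B" "wp u v \<notin> B'" using B wR[OF u] RV by auto
    have q: "mon 0 (QQ u v) (X \<union> (C \<union> D)) = mon 0 (QQ u v) C" if "X \<subseteq> V" for X
      using QR QW RV that by (intro mon_cong) auto
    have "?f a (C \<union> D) = ?d"
      unfolding m q[OF B(1)] q[OF B(2)] using CD v wB wC uu by (auto simp: ind_def)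
    moreover have "?f a C = 0" unfolding m using wB wC by (simp add: ind_def)
    ultimately show ?thesis using aP by simp
  qed
  have "cx u B B' (C \<union> D) - cx u B B' C = (\<Sum>a\<in>?M. 1 / 2 * (?f a (C \<union> D) - ?f a C))"
    unfolding cx_def by (simp only: sum_subtractf right_diff_distrib Un_assoc)
  also have "\<dots> = (\<Sum>a\<in>?M. if a \<in> ?P then 1 / 2 * ?d else 0)"
    using diff by (intro sum.cong refl) auto
  also have "\<dots> = (\<Sum>a\<in>?P. 1 / 2 * ?d)"
    using PM fin_AP by (simp add: sum.If_cases Int_absorb1 Int_def[symmetric] del: insert_iff)
  also have "\<dots> = ?d" using aa(3) by simp
  finally show ?thesis by simp
qed

text \<open>The guaranteed gain from averaging over one bit: \<open>2 * lam^2\<close> from the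
  variance factor, \<open>lam\<close> from the probability of each value of the bit, and
  \<open>t^2 / 16\<close> from the cosines.\<close>

definition eta :: "real \<Rightarrow> real" where "eta t = lam ^ 3 * t\<^sup>2 / 8"

lemma one_bit_bound:
  assumes t: "\<bar>t\<bar> \<le> pi" and d: "d = 1 \<or> d = -1"
  shows "(1 - p) * (1 - 2 * (p * (1 - p)) * (1 - cos (t * c))) + p * (1 - 2 * (p * (1 - p)) * (1 - cos (t * (c + d)))) \<le> 1 - eta t"
proof -
  let ?q = "p * (1 - p)" and ?a = "1 - cos (t * c)" and ?b = "1 - cos (t * (c + d))"
  have q: "lam\<^sup>2 \<le> ?q" using lam_p lam_pos by (simp add: power2_eq_square mult_mono)
  have ab: "0 \<le> ?a" "0 \<le> ?b" by auto
  have "t\<^sup>2 / 16 \<le> ?a + ?b"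
    using d by (intro cos_pair_bound[OF t]) (auto simp: algebra_simps)
  then have "lam * (t\<^sup>2 / 16) \<le> lam * ?a + lam * ?b" using lam_pos by (simp flip: distrib_left)
  also have "\<dots> \<le> (1 - p) * ?a + p * ?b" using lam_p ab by (intro add_mono mult_right_mono) auto
  finally have 1: "lam * (t\<^sup>2 / 16) \<le> (1 - p) * ?a + p * ?b" .
  have "eta t = 2 * lam\<^sup>2 * (lam * (t\<^sup>2 / 16))" by (simp add: eta_def power2_eq_square power3_eq_cube)
  also have "\<dots> \<le> 2 * ?q * ((1 - p) * ?a + p * ?b)"
    using q 1 lam_pos by (intro mult_mono) auto
  finally show ?thesis by (simp add: algebra_simps)
qed

text \<open>At some \<open>v\<close> the two copies differ. With this \<open>v\<close> fixed, the
  distinct bits at \<open>wp u v\<close> are averaged first and act on separate factors. The factor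
  of \<open>u\<close> gains \<open>eta t\<close> when all of \<open>QQ u v\<close> is present, which
  has probability at least \<open>lam ^ k\<close>; these events are independent because the sets
  \<open>QQ u v\<close> are disjoint for different \<open>u\<close>.\<close>

lemma inner_bound:
  assumes t: "\<bar>t\<bar> \<le> pi" and B: "B \<subseteq> V" "B' \<subseteq> V" "B \<noteq> B'"
  shows "bE p RR (\<lambda>C. \<Prod>u\<in>U. 1 - 2 * (p * (1 - p)) * (1 - cos (t * cx u B B' C))) \<le> (1 - eta t * lam ^ k) ^ card U"
proof -
  obtain v where v: "v \<in> V" "ind v B - ind v B' = 1 \<or> ind v B - ind v B' = -1"
  proof -
    obtain v where "v \<in> B \<and> v \<notin> B' \<or> v \<in> B' \<and> v \<notin> B" using B(3) by blast
    moreover from this have "v \<in> V" using B by auto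
    ultimately show ?thesis using that[of v] by (auto simp: ind_def)
  qed
  define d where "d = ind v B - ind v B'"
  define W where "W = (\<lambda>u. wp u v) ` U"
  define g where "g x = 1 - 2 * (p * (1 - p)) * (1 - cos (t * x))" for x
  have q: "0 \<le> p * (1 - p)" "p * (1 - p) \<le> 1 / 4"
  proof -
    show "p * (1 - p) \<le> 1 / 4" using zero_le_power2[of "p - 1/2"] by (simp add: power2_eq_square algebra_simps)
  qed (use p_pos p_less in auto)
  have g01: "0 \<le> g x" "g x \<le> 1" for x
  proof -
    have "1 - cos (t * x) \<le> 2" using cos_ge_minus_one[of "t * x"] by linarith
    then have "2 * (p * (1 - p)) * (1 - cos (t * x)) \<le> 2 * (1/4) * 2" using q by (intro mult_mono) auto
    then show "0 \<le> g x" by (simp add: g_def)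
    show "g x \<le> 1" using q by (simp add: g_def)
  qed
  have wR: "wp u v \<in> RR" if "u \<in> U" for u using al_sub[OF that v(1)] al_pts[OF that v(1)] by auto
  have winj: "wp u v \<noteq> wp u' v" if "u \<in> U" "u' \<in> U" "u \<noteq> u'" for u u'
    using al_disj[OF that(1,2) v(1) that(3)] al_pts[OF that(1) v(1)] al_pts[OF that(2) v(1)] by auto
  have WR: "W \<subseteq> RR" using wR by (auto simp: W_def)
  have fW: "finite W" "finite (RR - W)" using finite_UV by (auto simp: W_def)
  have eta01: "0 \<le> eta t" "eta t \<le> 1"
  proof -
    show "0 \<le> eta t" using lam_pos by (simp add: eta_def)
    have "lam \<le> 1/2" using lam_p by linarith
    then have "lam ^ 3 \<le> (1/2) ^ 3" using lam_pos by (intro power_mono) auto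
    moreover have "t\<^sup>2 \<le> 4\<^sup>2" using t pi_less_4 by (intro power2_le_iff_abs_le[THEN iffD2]) auto
    ultimately have "lam ^ 3 * t\<^sup>2 \<le> (1/2) ^ 3 * 4\<^sup>2" by (intro mult_mono) auto
    also have "\<dots> = (2::real)" by (simp add: power3_eq_cube power2_eq_square)
    finally show "eta t \<le> 1" by (simp add: eta_def)
  qed
  define Aq where "Aq u C = mon 0 (QQ u v) C" for u C
  have Aq01: "Aq u C = 0 \<or> Aq u C = 1" for u C
  proof (cases "QQ u v \<subseteq> C")
    case True
    then show ?thesis by (auto simp: Aq_def mon_def ind_def intro!: prod.neutral)
  next
    case False
    then obtain x where x: "x \<in> QQ u v" "x \<notin> C" by blast
    then have "ind x C - 0 = 0" by (simp add: ind_def)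
    moreover note x(1)
    moreover have "finite (QQ u v)" by (simp add: QQ_def)
    ultimately show ?thesis unfolding Aq_def mon_def using prod_zero[of "QQ u v" "\<lambda>i. ind i C - 0"] by blast
  qed
  have step: "bE p W (\<lambda>D. \<Prod>u\<in>U. g (cx u B B' (C \<union> D))) \<le> (\<Prod>u\<in>U. 1 - eta t * Aq u C)" if C: "C \<subseteq> RR - W" for C
  proof -
    have "bE p W (\<lambda>D. \<Prod>u\<in>U. g (cx u B B' (C \<union> D))) = bE p W (\<lambda>D. \<Prod>u\<in>U. g (cx u B B' C + ind (wp u v) D * d * Aq u C))"
      using C cx_step[OF v(1) B(1,2)] unfolding W_def Aq_def d_def
      by (intro bE_cong prod.cong refl arg_cong[of _ _ g]) auto
    also have "\<dots> = (\<Prod>u\<in>U. bE p W (\<lambda>D. g (cx u B B' C + ind (wp u v) D * d * Aq u C)))"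
      using winj finite_UV fW by (intro bE_indep_prod[where B = "\<lambda>u. {wp u v}"]) (auto simp: dep_def ind_def)
    also have "\<dots> \<le> (\<Prod>u\<in>U. 1 - eta t * Aq u C)"
    proof (intro prod_mono conjI)
      fix u assume u: "u \<in> U"
      show "0 \<le> bE p W (\<lambda>D. g (cx u B B' C + ind (wp u v) D * d * Aq u C))"
        using g01 by (intro bE_nonneg) auto
      have wW: "wp u v \<in> W" using u by (auto simp: W_def)
      have "bE p W (\<lambda>D. g (cx u B B' C + ind (wp u v) D * d * Aq u C)) = bE p {wp u v} (\<lambda>D. g (cx u B B' C + ind (wp u v) D * d * Aq u C))"
        using bE_dep[OF fW(1), of "\<lambda>D. g (cx u B B' C + ind (wp u v) D * d * Aq u C)" "{wp u v}" p] wW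
        by (simp add: dep_def ind_def Int_absorb1)
      also have "\<dots> = (1 - p) * g (cx u B B' C) + p * g (cx u B B' C + d * Aq u C)"
        using bE_insert[of "{}" "wp u v" p "\<lambda>D. g (cx u B B' C + ind (wp u v) D * d * Aq u C)"] by (simp add: ind_def)
      also have "\<dots> \<le> 1 - eta t * Aq u C"
      proof (cases "Aq u C = 1")
        case True
        then show ?thesis using one_bit_bound[OF t, of d "cx u B B' C"] v(2) by (simp add: g_def d_def)
      next
        case False
        then have "Aq u C = 0" using Aq01 by blast
        then show ?thesis using g01(2)[of "cx u B B' C"] by (simp flip: distrib_right)
      qed
      finally show "bE p W (\<lambda>D. g (cx u B B' C + ind (wp u v) D * d * Aq u C)) \<le> 1 - eta t * Aq u C" .
    qed
    finally show ?thesis .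
  qed
  have R: "RR = (RR - W) \<union> W" using WR by auto
  have "bE p RR (\<lambda>C. \<Prod>u\<in>U. g (cx u B B' C)) = bE p (RR - W) (\<lambda>C. bE p W (\<lambda>D. \<Prod>u\<in>U. g (cx u B B' (C \<union> D))))"
    by (subst R, rule bE_Un) (use fW in auto)
  also have "\<dots> \<le> bE p (RR - W) (\<lambda>C. \<Prod>u\<in>U. 1 - eta t * Aq u C)"
    using step by (intro bE_mono) auto
  also have "\<dots> = (\<Prod>u\<in>U. bE p (RR - W) (\<lambda>C. 1 - eta t * Aq u C))"
  proof (rule bE_indep_prod[where B = "\<lambda>u. QQ u v"])
    show "dep (\<lambda>C. 1 - eta t * Aq u C) (QQ u v)" for u
      unfolding dep_def Aq_def by (auto intro!: arg_cong2[of _ _ _ _ "(*)"] mon_cong)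
    show "QQ u v \<inter> QQ u' v = {}" if "u \<in> U" "u' \<in> U" "u \<noteq> u'" for u u'
      using al_disj[OF that(1,2) v(1) that(3)] by (auto simp: QQ_def)
  qed (use finite_UV fW in auto)
  also have "\<dots> \<le> (\<Prod>u\<in>U. 1 - eta t * lam ^ k)"
  proof (intro prod_mono conjI)
    fix u assume u: "u \<in> U"
    show "0 \<le> bE p (RR - W) (\<lambda>C. 1 - eta t * Aq u C)"
    proof (intro bE_nonneg)
      fix C show "0 \<le> 1 - eta t * Aq u C" using Aq01[of u C] eta01 by auto
    qed auto
    have Qsub: "QQ u v \<subseteq> RR - W"
    proof
      fix x assume x: "x \<in> QQ u v"
      then have "x \<in> RR" using al_sub[OF u v(1)] by (auto simp: QQ_def)
      moreover have "x \<notin> W"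
      proof
        assume "x \<in> W"
        then obtain u2 where u2: "u2 \<in> U" "x = wp u2 v" by (auto simp: W_def)
        then have "u2 \<noteq> u" using x by (auto simp: QQ_def)
        then show False using al_disj[OF u2(1) u v(1)] al_pts[OF u2(1) v(1)] u2(2) x by (auto simp: QQ_def)
      qed
      ultimately show "x \<in> RR - W" by simp
    qed
    have "bE p (RR - W) (Aq u) = (\<Prod>i\<in>QQ u v. bE p (RR - W) (ind i))"
    proof -
      have "Aq u = (\<lambda>C. \<Prod>i\<in>QQ u v. ind i C)" by (auto simp: Aq_def mon_def)
      then show ?thesis
        using fW by (simp only:) (intro bE_indep_prod[where B = "\<lambda>i. {i}"], auto simp: dep_def ind_def QQ_def)
    qed
    also have "\<dots> = p ^ card (QQ u v)" using Qsub fW by (simp add: bE_ind subset_iff)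
    finally have E: "bE p (RR - W) (Aq u) = p ^ card (QQ u v)" .
    have "card (QQ u v) \<le> k" using card_mono[OF finite_pts, of "QQ u v" "al u v"] card_pts_le[of "al u v"] by (auto simp: QQ_def)
    then have "lam ^ k \<le> lam ^ card (QQ u v)" using lam_pos lam_p p_less by (intro power_decreasing) auto
    also have "\<dots> \<le> p ^ card (QQ u v)" using lam_pos lam_p by (intro power_mono) auto
    finally have "eta t * lam ^ k \<le> eta t * bE p (RR - W) (Aq u)" unfolding E using eta01 by (intro mult_left_mono)
    then show "bE p (RR - W) (\<lambda>C. 1 - eta t * Aq u C) \<le> 1 - eta t * lam ^ k"
      using fW by (simp add: bE_diff bE_cmult)
  qed
  finally show ?thesis by (simp add: g_def)
qed

text \<open>The first term bounds the probability that the two copies of \<open>V\<close> coincide,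
  in which case there is no decay at all; the second is the bound for distinct copies.\<close>

lemma spread_char_bound:
  assumes t: "\<bar>t\<bar> \<le> pi"
  shows "(norm (bE p {..<n} (\<lambda>A. cis (t * XX A) * cis (\<theta> * real (card A))))) ^ 4
    \<le> (1 - lam) ^ card V + (1 - eta t * lam ^ k) ^ card U"
proof -
  let ?h = "\<lambda>B B' C. \<Prod>u\<in>U. 1 - 2 * (p * (1 - p)) * (1 - cos (t * cx u B B' C))"
  let ?x = "(1 - eta t * lam ^ k) ^ card U"
  have eta01: "0 \<le> eta t * lam ^ k" "eta t * lam ^ k \<le> 1"
  proof -
    show "0 \<le> eta t * lam ^ k" using lam_pos by (simp add: eta_def)
    have l: "lam \<le> 1/2" using lam_p by linarith
    then have "lam ^ 3 \<le> (1/2) ^ 3" using lam_pos by (intro power_mono) auto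
    moreover have "t\<^sup>2 \<le> 4\<^sup>2" using t pi_less_4 by (intro power2_le_iff_abs_le[THEN iffD2]) auto
    ultimately have "lam ^ 3 * t\<^sup>2 \<le> (1/2) ^ 3 * 4\<^sup>2" by (intro mult_mono) auto
    also have "\<dots> = (2::real)" by (simp add: power3_eq_cube power2_eq_square)
    finally have "eta t \<le> 1" by (simp add: eta_def)
    then show "eta t * lam ^ k \<le> 1" using l lam_pos by (intro mult_le_one power_le_one) auto
  qed
  have x: "0 \<le> ?x" using eta01 by (intro zero_le_power) auto
  have inner: "bE p RR (?h B B') \<le> (if B = B' then 1 else 0) + ?x" if "B \<subseteq> V" "B' \<subseteq> V" for B B'
  proof (cases "B = B'")
    case True
    then have "cx u B B' C = 0" for u C by (simp add: cx_def)
    then show ?thesis using True x finite_UV by simp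
  next
    case False
    then show ?thesis using inner_bound[OF t that False] by simp
  qed
  have "bE p RR (\<lambda>C. bE p V (\<lambda>B. bE p V (\<lambda>B'. ?h B B' C))) = bE p V (\<lambda>B. bE p RR (\<lambda>C. bE p V (\<lambda>B'. ?h B B' C)))"
    by (rule bE_swap)
  also have "\<dots> = bE p V (\<lambda>B. bE p V (\<lambda>B'. bE p RR (?h B B')))"
    by (intro bE_cong bE_swap)
  also have "\<dots> \<le> bE p V (\<lambda>B. bE p V (\<lambda>B'. (if B = B' then 1 else 0) + ?x))"
    using inner by (intro bE_mono) auto
  also have "\<dots> = bE p V (\<lambda>B. bE p V (\<lambda>B'. if B = B' then 1 else 0)) + ?x"
    using finite_UV by (simp only: bE_add bE_const)
  also have "bE p V (\<lambda>B. bE p V (\<lambda>B'. if B = B' then 1 else 0 :: real)) \<le> (1 - lam) ^ card V"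
  proof (rule bE_le_const)
    fix B assume B: "B \<subseteq> V"
    have "bE p V (\<lambda>B'. if B = B' then 1 else 0 :: real) = (\<Sum>A\<in>Pow V. if B = A then wt p V A else 0)"
      unfolding bE_def by (intro sum.cong) auto
    also have "\<dots> = wt p V B" using B finite_UV by simp
    also have "\<dots> \<le> (1 - lam) ^ card V" using lam_p by (intro wt_le_power) auto
    finally show "bE p V (\<lambda>B'. if B = B' then 1 else 0 :: real) \<le> (1 - lam) ^ card V" .
  qed (use finite_UV in auto)
  finally show ?thesis using decoupled_XX[of t \<theta>] by linarith
qed

end

section \<open>Progressions modulo n\<close>

lemma dvd_small_int:
  fixes n x :: int
  assumes "n dvd x" "\<bar>x\<bar> < n"
  shows "x = 0"
  using assms dvd_imp_le_int[of x n] by fastforce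

lemma abs_mult_le_int:
  fixes a b x y :: int
  assumes "\<bar>a\<bar> \<le> x" "\<bar>b\<bar> \<le> y"
  shows "\<bar>a * b\<bar> \<le> x * y"
  using assms by (simp add: abs_mult mult_mono')

definition cyc_AP :: "nat \<Rightarrow> (nat \<times> nat) set" where "cyc_AP n = {..<n} \<times> {1..<n}"

definition cyc_pt :: "nat \<Rightarrow> nat \<Rightarrow> nat \<times> nat \<Rightarrow> nat" where
  "cyc_pt n j x = (fst x + j * snd x) mod n"

lemma cyc_pt_cong: "int n dvd int (cyc_pt n j x) - (int (fst x) + int j * int (snd x))"
  by (simp add: cyc_pt_def zmod_int mod_eq_dvd_iff[symmetric])

lemma cyc_pt_eqI:
  assumes "int n dvd int (cyc_pt n i x) - int (cyc_pt n j y)" "0 < n"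
  shows "cyc_pt n i x = cyc_pt n j y"
proof -
  have "cyc_pt n i x < n" "cyc_pt n j y < n" using assms(2) by (auto simp: cyc_pt_def)
  then have "int (cyc_pt n i x) - int (cyc_pt n j y) = 0" using assms(1) by (intro dvd_small_int[of "int n"]) auto
  then show ?thesis by simp
qed

text \<open>All incidence questions for the blocks reduce to this congruence: its two sides are small integers,
  so it is an equality, which is then settled by comparing sizes.\<close>

lemma cyc_collinear:
  "int n dvd (int j - int i) * (int (cyc_pt n l x) - int (cyc_pt n i x)) - (int l - int i) * (int (cyc_pt n j x) - int (cyc_pt n i x))"
proof -
  define f where "f j = int (cyc_pt n j x) - (int (fst x) + int j * int (snd x))" for j
  have "int n dvd (int j - int i) * (f l - f i) - (int l - int i) * (f j - f i)"
    unfolding f_def by (intro dvd_diff dvd_mult cyc_pt_cong)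
  moreover have "(int j - int i) * (f l - f i) - (int l - int i) * (f j - f i) = (int j - int i) * (int (cyc_pt n l x) - int (cyc_pt n i x)) - (int l - int i) * (int (cyc_pt n j x) - int (cyc_pt n i x))"
    by (simp add: f_def algebra_simps)
  ultimately show ?thesis by simp
qed

locale coprime_modulus =
  fixes n k :: nat
  assumes n_pos: "0 < n" and k3: "3 \<le> k" and gcd_fact: "gcd n (fact (k - 1)) = 1"
begin

text \<open>Differences of positions have absolute value at most \<open>k - 1\<close> and so divide
  the factorial: they are units modulo \<open>n\<close>.\<close>

lemma coprime_diff:
  assumes "i < k" "j < k" "i \<noteq> j"
  shows "coprime (int n) (int i - int j)"
proof -
  have c: "coprime n (fact (k - 1))" using gcd_fact by (simp add: coprime_iff_gcd_eq_1)
  have *: "coprime (int n) (int i - int j)" if "j < i" "i < k" for i j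
  proof -
    have "(i - j) dvd fact (k - 1)" using that by (intro dvd_fact) auto
    then have "coprime n (i - j)" using coprime_divisors[OF dvd_refl _ c] by simp
    then have "coprime (int n) (int (i - j))" by simp
    then show ?thesis using that by (simp add: of_nat_diff)
  qed
  show ?thesis
  proof (cases "j < i")
    case False
    then have "coprime (int n) (int j - int i)" using assms by (intro *) auto
    then show ?thesis using coprime_minus_right_iff[of "int n" "int j - int i"] by simp
  qed (use * assms in auto)
qed

lemma odd_n: "odd n"
proof
  assume "even n"
  moreover have "(2::nat) dvd fact (k - 1)" using k3 by (intro dvd_fact) auto
  ultimately have "2 dvd gcd n (fact (k - 1))" by (rule gcd_greatest)
  then show False unfolding gcd_fact by simp
qed

lemma cyc_det:
  assumes "x \<in> cyc_AP n" "y \<in> cyc_AP n" "i < k" "j < k" "i \<noteq> j"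
    and "cyc_pt n i x = cyc_pt n i y" "cyc_pt n j x = cyc_pt n j y"
  shows "x = y"
proof -
  define f where "f x j = int (cyc_pt n j x) - (int (fst x) + int j * int (snd x))" for x j
  have f: "int n dvd f x j" for x j unfolding f_def by (rule cyc_pt_cong)
  have "int n dvd (f y i - f y j) - (f x i - f x j)" using f by (intro dvd_diff)
  moreover have "(f y i - f y j) - (f x i - f x j) = (int i - int j) * (int (snd x) - int (snd y))"
    using assms by (simp add: f_def algebra_simps)
  ultimately have "int n dvd int (snd x) - int (snd y)"
    using coprime_dvd_mult_right_iff[OF coprime_diff[OF assms(3-5)]] by simp
  then have d: "int (snd x) - int (snd y) = 0"
    using assms(1,2) by (intro dvd_small_int) (auto simp: cyc_AP_def)
  have "int n dvd f y i - f x i" using f by (intro dvd_diff)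
  moreover have "f y i - f x i = int (fst x) - int (fst y)"
    using assms d by (simp add: f_def)
  ultimately have "int (fst x) - int (fst y) = 0"
    using assms(1,2) by (intro dvd_small_int) (auto simp: cyc_AP_def)
  then show ?thesis using d by (simp add: prod_eq_iff)
qed

lemma cyc_ne:
  assumes "x \<in> cyc_AP n" "i < k" "j < k" "i \<noteq> j"
  shows "cyc_pt n i x \<noteq> cyc_pt n j x"
proof
  assume eq: "cyc_pt n i x = cyc_pt n j x"
  define f where "f j = int (cyc_pt n j x) - (int (fst x) + int j * int (snd x))" for j
  have f: "int n dvd f j" for j unfolding f_def by (rule cyc_pt_cong)
  have "int n dvd f j - f i" using f by (intro dvd_diff)
  moreover have "f j - f i = (int i - int j) * int (snd x)"
    using eq by (simp add: f_def algebra_simps)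
  ultimately have "int n dvd int (snd x)"
    using coprime_dvd_mult_right_iff[OF coprime_diff[OF assms(2-4)]] by simp
  then have "int (snd x) = 0" using assms(1) by (intro dvd_small_int) (auto simp: cyc_AP_def)
  then show False using assms(1) by (auto simp: cyc_AP_def)
qed

text \<open>Injectivity follows because differences of positions are units; both sides have
  \<open>n * (n - 1)\<close> elements, which gives surjectivity.\<close>

sublocale progressions n k "cyc_AP n" "cyc_pt n"
proof
  fix i j assume ij: "i < k" "j < k" "i \<noteq> j"
  let ?T = "{(w, w'). w < n \<and> w' < n \<and> w \<noteq> w'}"
  let ?f = "\<lambda>a. (cyc_pt n i a, cyc_pt n j a)"
  have inj: "inj_on ?f (cyc_AP n)" using cyc_det ij by (intro inj_onI) auto
  have T: "?T = Sigma {..<n} (\<lambda>w. {..<n} - {w})" by auto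
  have cT: "card ?T = n * (n - 1)" unfolding T by (subst card_SigmaI) auto
  have fT: "finite ?T" unfolding T by auto
  have "card (?f ` cyc_AP n) = n * (n - 1)" using card_image[OF inj] by (simp add: cyc_AP_def)
  moreover have "?f ` cyc_AP n \<subseteq> ?T" using cyc_ne ij n_pos by (auto simp: cyc_pt_def)
  ultimately have "?f ` cyc_AP n = ?T" using card_subset_eq[OF fT] cT by simp
  then show "bij_betw ?f (cyc_AP n) ?T" using inj by (simp add: bij_betw_def)
qed (use k3 in \<open>auto simp: cyc_AP_def\<close>)

section \<open>The count as a sum over all nonzero differences\<close>

definition cprod :: "nat set \<Rightarrow> nat \<Rightarrow> nat \<Rightarrow> real" where
  "cprod A a d = (\<Prod>i<k. indicator A ((a + i * d) mod n))"

text \<open>Starting at the last point and stepping by \<open>n - d\<close> traverses the same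
  progression backwards, and the shift of the starting point is a bijection.\<close>

lemma sum_cprod_reverse:
  assumes "d < n"
  shows "(\<Sum>a<n. cprod A a (n - d)) = (\<Sum>a<n. cprod A a d)"
proof -
  let ?s = "\<lambda>a. (a + (k - 1) * d) mod n"
  have inj: "inj_on ?s {..<n}"
  proof (rule inj_onI)
    fix a b assume ab: "a \<in> {..<n}" "b \<in> {..<n}" and "?s a = ?s b"
    then have "int n dvd int (a + (k - 1) * d) - int (b + (k - 1) * d)"
      by (metis mod_eq_dvd_iff zmod_int)
    then have "int n dvd int a - int b" by simp
    then have "int a - int b = 0" using ab by (intro dvd_small_int) auto
    then show "a = b" by simp
  qed
  have bij: "bij_betw ?s {..<n} {..<n}"
    unfolding bij_betw_def using inj n_pos by (intro conjI endo_inj_surj) auto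
  have pt: "(?s a + i * (n - d)) mod n = (a + (k - Suc i) * d) mod n" if "i < k" for a i
  proof -
    have "(k - 1) * d + i * (n - d) = (k - Suc i) * d + i * n"
    proof -
      obtain c where c: "k = Suc i + c" using less_imp_Suc_add[OF \<open>i < k\<close>] by auto
      obtain n' where "n = d + n'" using assms less_imp_add_positive by blast
      then show ?thesis using c by (simp add: algebra_simps)
    qed
    then have "(a + (k - 1) * d + i * (n - d)) mod n = (a + (k - Suc i) * d + i * n) mod n"
      by (simp add: add.assoc)
    then show ?thesis by (simp add: mod_add_left_eq)
  qed
  have "(\<Sum>a<n. cprod A a (n - d)) = (\<Sum>a<n. cprod A (?s a) (n - d))"
    using sum.reindex_bij_betw[OF bij, of "\<lambda>a. cprod A a (n - d)"] by simp
  moreover have "cprod A (?s a) (n - d) = cprod A a d" for a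
  proof -
    have "cprod A (?s a) (n - d) = (\<Prod>i<k. indicator A ((a + (k - Suc i) * d) mod n))"
      unfolding cprod_def by (intro prod.cong refl) (simp only: pt lessThan_iff)
    then show ?thesis unfolding cprod_def
      using prod.nat_diff_reindex[of "\<lambda>i. indicator A ((a + i * d) mod n) :: real" k] by simp
  qed
  ultimately show ?thesis by simp
qed

text \<open>As \<open>n = 2 * h + 1\<close> is odd, the differences \<open>h + 1\<close> to
  \<open>2 * h\<close> are the reversals of \<open>1\<close> to \<open>h\<close>. Every progression
  is thus counted twice in the full sum, which accounts for the factor one half in
  \<open>XX\<close>.\<close>

lemma kAP_eq_XX: "kAP k n A = XX A"
proof -
  have mon: "mon 0 (pts x) A = cprod A (fst x) (snd x)" if x: "x \<in> cyc_AP n" for x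
  proof -
    have "mon 0 (pts x) A = (\<Prod>i<k. ind (cyc_pt n i x) A)"
      unfolding mon_def pts_def using prod.reindex[OF e_inj[OF x], of "\<lambda>i. ind i A - 0"] by simp
    then show ?thesis by (simp add: cprod_def cyc_pt_def ind_def indicator_def of_bool_def)
  qed
  obtain h where h: "n = 2 * h + 1" using odd_n by (auto elim: oddE)
  define S where "S d = (\<Sum>a<n. cprod A a d)" for d
  have "XX A = (\<Sum>x\<in>cyc_AP n. cprod A (fst x) (snd x)) / 2"
    unfolding XX_def using mon by simp
  moreover have "(\<Sum>x\<in>cyc_AP n. cprod A (fst x) (snd x)) = (\<Sum>a<n. \<Sum>d\<in>{1..<n}. cprod A a d)"
    unfolding cyc_AP_def by (simp add: sum.cartesian_product split_beta)
  moreover have "(\<Sum>a<n. \<Sum>d\<in>{1..<n}. cprod A a d) = (\<Sum>d\<in>{1..<n}. S d)"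
    unfolding S_def by (rule sum.swap)
  moreover have "(\<Sum>d\<in>{1..<n}. S d) = (\<Sum>d\<in>{1..h}. S d) + (\<Sum>d\<in>{h+1..2*h}. S d)"
  proof -
    have "{1..<n} = {1..h} \<union> {h+1..2*h}" using h by auto
    then show ?thesis by (simp add: sum.union_disjoint)
  qed
  moreover have "(\<Sum>d\<in>{h+1..2*h}. S d) = (\<Sum>d\<in>{1..h}. S d)"
  proof (rule sum.reindex_bij_witness[of _ "\<lambda>d. n - d" "\<lambda>d. n - d"])
    fix d assume d: "d \<in> {h+1..2*h}"
    then have "S (n - (n - d)) = S (n - d)" unfolding S_def using h by (intro sum_cprod_reverse) auto
    then show "S (n - d) = S d" using d h by simp
  qed (use h in auto)
  moreover have "kAP k n A = (\<Sum>d\<in>{1..h}. S d)"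
  proof -
    have "n div 2 = h" using h by simp
    then have "kAP k n A = (\<Sum>a<n. \<Sum>d\<in>{1..h}. cprod A a d)" by (simp add: kAP_def cprod_def)
    then show ?thesis unfolding S_def by (simp only: sum.swap[of _ "{1..h}" "{..<n}"])
  qed
  ultimately show ?thesis by simp
qed

end

text \<open>Three scales: the extent \<open>r1 + B * r2\<close> of the blocks, their distance
  \<open>N\<close>, and the modulus \<open>n\<close>, each at least \<open>8 * k^2\<close> times the
  preceding one. The margin covers the coefficients, built from differences of positions, that occur
  in collinearity relations.\<close>

locale separated_blocks = coprime_modulus n k for n k :: nat +
  fixes N B r1 r2 :: nat
  assumes B_pos: "0 < B" and r_pos: "0 < r1" "0 < r2"
    and N_small: "8 * k\<^sup>2 * N \<le> n" and blocks_small: "8 * k\<^sup>2 * (r1 + B * r2) \<le> N"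
begin

definition Ub :: "nat set" where "Ub = {..<r1}"

definition Vb :: "nat set" where "Vb = (\<lambda>b. N + B * b) ` {..<r2}"

lemma card_Ub: "card Ub = r1" by (simp add: Ub_def)

lemma card_Vb: "card Vb = r2"
  using B_pos unfolding Vb_def by (subst card_image) (auto simp: inj_on_def)

text \<open>The nonlinear products are named and compared once, so that later size comparisons are
  linear arithmetic.\<close>

lemma small_int:
  obtains K M S where "K = int k" "M = int N" "S = int (r1 + B * r2)" "3 \<le> K" "8 * (K * K * M) \<le> int n"
    "8 * (K * K * S) \<le> M" "0 < S" "8 * (K * S) \<le> M" "8 * S \<le> M" "8 * (K * M) \<le> int n" "8 * M \<le> int n" "0 < M"
    "K * S \<le> K * K * S" "K * M \<le> K * K * M" "S \<le> K * S" "M \<le> K * M"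
proof -
  define K M S where "K = int k" and "M = int N" and "S = int (r1 + B * r2)"
  have K: "3 \<le> K" using k3 by (simp add: K_def)
  have a: "8 * (K * K * M) \<le> int n"
    using N_small of_nat_mono[OF N_small, where 'a = int] by (simp add: K_def M_def power2_eq_square mult.assoc)
  have b: "8 * (K * K * S) \<le> M"
    using of_nat_mono[OF blocks_small, where 'a = int] by (simp add: K_def M_def S_def power2_eq_square mult.assoc)
  have S: "0 < S" using r_pos unfolding S_def of_nat_0_less_iff by simp
  have "0 < K * K * S" using K S by simp
  then have M: "0 < M" using b by linarith
  have c: "S \<le> K * S" "M \<le> K * M" using K S M by auto
  have "K * S \<le> K * (K * S)" "K * M \<le> K * (K * M)" using c K by (intro mult_left_mono; simp)+
  then have d: "K * S \<le> K * K * S" "K * M \<le> K * K * M" by (simp_all add: mult.assoc)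
  have e: "8 * (K * S) \<le> M" "8 * S \<le> M" "8 * (K * M) \<le> int n" "8 * M \<le> int n"
    using a b c d by linarith+
  show thesis by (rule that[OF K_def M_def S_def K a b S e M d c])
qed

lemma Ub_mem: "u \<in> Ub \<Longrightarrow> 0 \<le> int u \<and> int u < int r1" by (simp add: Ub_def)

lemma Vb_mem: "v \<in> Vb \<Longrightarrow> \<exists>b. b < r2 \<and> v = N + B * b" by (auto simp: Vb_def)

lemma Vb_bounds: "v \<in> Vb \<Longrightarrow> int N \<le> int v \<and> int v \<le> int N + int (B * r2)"
proof -
  assume "v \<in> Vb"
  then obtain b where b: "b < r2" "v = N + B * b" using Vb_mem by blast
  then have "B * b \<le> B * r2" by (intro mult_left_mono) auto
  then have "int (B * b) \<le> int (B * r2)" by (rule of_nat_mono)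
  then show ?thesis unfolding b(2) of_nat_add by simp
qed

lemma UVb_sub: "Ub \<subseteq> {..<n}" "Vb \<subseteq> {..<n}" "Ub \<inter> Vb = {}"
proof -
  obtain K M S where s: "K = int k" "M = int N" "S = int (r1 + B * r2)" "8 * S \<le> M" "8 * M \<le> int n" "0 < S" "0 < M"
    by (rule small_int) blast
  have u: "int u < M \<and> u < n" if "u \<in> Ub" for u
  proof -
    have "int r1 \<le> S" unfolding s(3) by simp
    then have "int u < S" using Ub_mem[OF that] by linarith
    then show ?thesis using s by linarith
  qed
  have v: "M \<le> int v \<and> v < n" if "v \<in> Vb" for v
  proof -
    have "int (B * r2) \<le> S" unfolding s(3) by simp
    then have "M \<le> int v" "int v \<le> M + S" using Vb_bounds[OF that] s(2) by linarith+
    then show ?thesis using s by linarith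
  qed
  show "Ub \<subseteq> {..<n}" "Vb \<subseteq> {..<n}" using u v by auto
  show "Ub \<inter> Vb = {}" using u v by fastforce
qed

text \<open>Collinearity gives \<open>(j - i) * x = (l - i) * y\<close> with \<open>x\<close> the
  long and \<open>y\<close> the short difference. The left side has size at least about
  \<open>N\<close> when \<open>i \<noteq> j\<close>, the right side at most \<open>k\<close> times
  the extent of the blocks. One statement covers both roles of the blocks.\<close>

lemma blocks_sep:
  assumes a: "a \<in> cyc_AP n" and l: "l < k" and i: "i < k" and j: "j < k"
    and far: "int N - int r1 \<le> \<bar>int (cyc_pt n l a) - int (cyc_pt n i a)\<bar>"
      "\<bar>int (cyc_pt n l a) - int (cyc_pt n i a)\<bar> \<le> int N + int (B * r2)"
    and near: "\<bar>int (cyc_pt n j a) - int (cyc_pt n i a)\<bar> \<le> int (r1 + B * r2)"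
  shows "i = j"
proof (rule ccontr)
  assume ij: "i \<noteq> j"
  obtain K M S where s: "K = int k" "M = int N" "S = int (r1 + B * r2)" "8 * S \<le> M" "8 * M \<le> int n" "0 < S" "0 < M"
    "8 * (K * S) \<le> M" "8 * (K * M) \<le> int n" "3 \<le> K" "K * S \<le> K * K * S" "S \<le> K * S" "M \<le> K * M"
    by (rule small_int) blast
  define x where "x = int (cyc_pt n l a) - int (cyc_pt n i a)"
  define y where "y = int (cyc_pt n j a) - int (cyc_pt n i a)"
  have rS: "int r1 \<le> S" "int (B * r2) \<le> S" unfolding s(3) by simp_all
  have x: "M - S \<le> \<bar>x\<bar>" "\<bar>x\<bar> \<le> M + S" using far rS s(2) unfolding x_def by linarith+
  have y: "\<bar>y\<bar> \<le> S" using near s(3) unfolding y_def by linarith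
  have ji: "\<bar>int j - int i\<bar> \<le> K" "\<bar>int l - int i\<bar> \<le> K" using i j l s(1) by auto
  have 1: "\<bar>(int j - int i) * x\<bar> \<le> K * (M + S)" by (intro abs_mult_le_int ji x)
  have 2: "\<bar>(int l - int i) * y\<bar> \<le> K * S" by (intro abs_mult_le_int ji y)
  have "int n dvd (int j - int i) * x - (int l - int i) * y" unfolding x_def y_def by (rule cyc_collinear)
  moreover have "\<bar>(int j - int i) * x - (int l - int i) * y\<bar> < int n"
    using 1 2 s unfolding distrib_left by linarith
  ultimately have eq: "(int j - int i) * x - (int l - int i) * y = 0" by (rule dvd_small_int)
  have "1 * \<bar>x\<bar> \<le> \<bar>int j - int i\<bar> * \<bar>x\<bar>" using ij by (intro mult_right_mono) auto
  then have "\<bar>x\<bar> \<le> \<bar>(int j - int i) * x\<bar>" by (simp add: abs_mult)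
  then show False using eq 2 x s by linarith
qed

lemma blocks_sepU:
  assumes a: "a \<in> cyc_AP n" "pts a \<inter> Vb \<noteq> {}" "u \<in> pts a \<inter> Ub" "u' \<in> pts a \<inter> Ub"
  shows "u = u'"
proof -
  obtain l where l: "l < k" "cyc_pt n l a \<in> Vb" using a(2) by (auto simp: pts_def)
  obtain i where i: "i < k" "u = cyc_pt n i a" using a(3) by (auto simp: pts_def)
  obtain j where j: "j < k" "u' = cyc_pt n j a" using a(4) by (auto simp: pts_def)
  have "u \<in> Ub" "u' \<in> Ub" using a by auto
  note b = Ub_mem[OF this(1)] Ub_mem[OF this(2)] Vb_bounds[OF l(2)]
  obtain K M S where s: "K = int k" "M = int N" "S = int (r1 + B * r2)" "8 * S \<le> M" "8 * M \<le> int n" "0 < S" "0 < M"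
    by (rule small_int) blast
  have s': "int r1 \<le> S" "0 \<le> int (B * r2)" "S = int r1 + int (B * r2)" unfolding s(3) by simp_all
  have "i = j" using b s s'
    by (intro blocks_sep[OF a(1) l(1) i(1) j(1)]) (unfold i(2)[symmetric] j(2)[symmetric], linarith+)
  then show ?thesis using i j by simp
qed

lemma blocks_sepV:
  assumes a: "a \<in> cyc_AP n" "pts a \<inter> Ub \<noteq> {}" "v \<in> pts a \<inter> Vb" "v' \<in> pts a \<inter> Vb"
  shows "v = v'"
proof -
  obtain l where l: "l < k" "cyc_pt n l a \<in> Ub" using a(2) by (auto simp: pts_def)
  obtain i where i: "i < k" "v = cyc_pt n i a" using a(3) by (auto simp: pts_def)
  obtain j where j: "j < k" "v' = cyc_pt n j a" using a(4) by (auto simp: pts_def)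
  have "v \<in> Vb" "v' \<in> Vb" using a by auto
  note b = Vb_bounds[OF this(1)] Vb_bounds[OF this(2)] Ub_mem[OF l(2)]
  obtain K M S where s: "K = int k" "M = int N" "S = int (r1 + B * r2)" "8 * S \<le> M" "8 * M \<le> int n" "0 < S" "0 < M"
    by (rule small_int) blast
  have s': "int r1 \<le> S" "0 \<le> int (B * r2)" "S = int r1 + int (B * r2)" unfolding s(3) by simp_all
  have "i = j" using b s s'
    by (intro blocks_sep[OF a(1) l(1) i(1) j(1)]) (unfold i(2)[symmetric] j(2)[symmetric], linarith+)
  then show ?thesis using i j by simp
qed

definition alb :: "nat \<Rightarrow> nat \<Rightarrow> nat \<times> nat" where
  "alb u v = (SOME a. a \<in> cyc_AP n \<and> cyc_pt n 0 a = u \<and> cyc_pt n 1 a = v)"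

definition rhb :: "nat \<Rightarrow> nat \<Rightarrow> nat \<times> nat" where
  "rhb u v = (SOME a. a \<in> cyc_AP n \<and> cyc_pt n (k - 1) a = u \<and> cyc_pt n (k - 2) a = v)"

definition wpb :: "nat \<Rightarrow> nat \<Rightarrow> nat" where "wpb u v = cyc_pt n (k - 1) (alb u v)"

lemma UVb_ne: "u \<in> Ub \<Longrightarrow> v \<in> Vb \<Longrightarrow> u < n \<and> v < n \<and> u \<noteq> v"
  using UVb_sub by auto

lemma alb:
  assumes "u \<in> Ub" "v \<in> Vb"
  shows "alb u v \<in> cyc_AP n" "cyc_pt n 0 (alb u v) = u" "cyc_pt n 1 (alb u v) = v"
proof -
  have "\<exists>a\<in>cyc_AP n. cyc_pt n 0 a = u \<and> cyc_pt n 1 a = v"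
    using UVb_ne[OF assms] k3 by (intro e_ex) auto
  then have "\<exists>a. a \<in> cyc_AP n \<and> cyc_pt n 0 a = u \<and> cyc_pt n 1 a = v" by blast
  from someI_ex[OF this]
  show "alb u v \<in> cyc_AP n" "cyc_pt n 0 (alb u v) = u" "cyc_pt n 1 (alb u v) = v" by (auto simp: alb_def)
qed

lemma rhb:
  assumes "u \<in> Ub" "v \<in> Vb"
  shows "rhb u v \<in> cyc_AP n" "cyc_pt n (k - 1) (rhb u v) = u" "cyc_pt n (k - 2) (rhb u v) = v"
proof -
  have "\<exists>a\<in>cyc_AP n. cyc_pt n (k - 1) a = u \<and> cyc_pt n (k - 2) a = v"
    using UVb_ne[OF assms] k3 by (intro e_ex) auto
  then have "\<exists>a. a \<in> cyc_AP n \<and> cyc_pt n (k - 1) a = u \<and> cyc_pt n (k - 2) a = v" by blast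
  from someI_ex[OF this]
  show "rhb u v \<in> cyc_AP n" "cyc_pt n (k - 1) (rhb u v) = u" "cyc_pt n (k - 2) (rhb u v) = v" by (auto simp: rhb_def)
qed

lemma alb_point:
  assumes "u \<in> Ub" "v \<in> Vb"
  shows "int n dvd int (cyc_pt n j (alb u v)) - (int u + int j * (int v - int u))"
  using cyc_collinear[of n 1 0 j "alb u v"] alb[OF assms] by (simp add: algebra_simps)

text \<open>Both progressions are pinned down by \<open>u\<close> and \<open>v\<close> at matching
  ends, so the collinearity congruence gives the same residue for mirrored positions.\<close>

lemma rhb_point:
  assumes uv: "u \<in> Ub" "v \<in> Vb" and j: "j < k"
  shows "cyc_pt n (k - 1 - j) (rhb u v) = cyc_pt n j (alb u v)"
proof -
  define c where "c = int (cyc_pt n (k - 1 - j) (rhb u v))"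
  have "int n dvd (int (k - 2) - int (k - 1)) * (c - int u) - (int (k - 1 - j) - int (k - 1)) * (int v - int u)"
    using cyc_collinear[of n "k - 2" "k - 1" "k - 1 - j" "rhb u v"] rhb[OF uv] by (simp add: c_def)
  moreover have "int (k - 2) - int (k - 1) = -1" "int (k - 1 - j) - int (k - 1) = - int j" using k3 j by auto
  ultimately have "int n dvd - (c - int u) + int j * (int v - int u)" by simp
  then have "int n dvd - (- (c - int u) + int j * (int v - int u))" by (simp only: dvd_minus_iff)
  then have "int n dvd - (- (c - int u) + int j * (int v - int u)) - (int (cyc_pt n j (alb u v)) - (int u + int j * (int v - int u)))"
    by (rule dvd_diff[OF _ alb_point[OF uv, of j]])
  then have "int n dvd c - int (cyc_pt n j (alb u v))" by (simp add: algebra_simps)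
  then show ?thesis unfolding c_def using n_pos by (intro cyc_pt_eqI)
qed

lemma rhb_pts:
  assumes uv: "u \<in> Ub" "v \<in> Vb"
  shows "pts (rhb u v) = pts (alb u v)"
proof
  show "pts (rhb u v) \<subseteq> pts (alb u v)"
  proof
    fix x assume "x \<in> pts (rhb u v)"
    then obtain j where j: "j < k" "x = cyc_pt n j (rhb u v)" by (auto simp: pts_def)
    have "k - 1 - (k - 1 - j) = j" "k - 1 - j < k" using j k3 by auto
    then have "x = cyc_pt n (k - 1 - j) (alb u v)" using rhb_point[OF uv, of "k - 1 - j"] j by simp
    then show "x \<in> pts (alb u v)" using \<open>k - 1 - j < k\<close> by (auto simp: pts_def)
  qed
  show "pts (alb u v) \<subseteq> pts (rhb u v)"
  proof
    fix x assume "x \<in> pts (alb u v)"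
    then obtain j where j: "j < k" "x = cyc_pt n j (alb u v)" by (auto simp: pts_def)
    then have "x = cyc_pt n (k - 1 - j) (rhb u v)" "k - 1 - j < k" using rhb_point[OF uv j(1)] k3 by auto
    then show "x \<in> pts (rhb u v)" by (auto simp: pts_def)
  qed
qed

text \<open>The collinearity relation of \<open>u'\<close>, \<open>v'\<close> and the last point
  \<open>wpb u v\<close> is compared scale by scale. The multiple of \<open>N\<close> must vanish,
  which forces \<open>u'\<close> and the last point to opposite ends with \<open>v'\<close> next to
  \<open>u'\<close>; the remaining small-scale equation forces \<open>u' = u\<close> and
  \<open>v' = v\<close>.\<close>

lemma wpb_only:
  assumes B: "r1 \<le> B" and uv: "u \<in> Ub" "v \<in> Vb" "u' \<in> Ub" "v' \<in> Vb" and a: "a \<in> cyc_AP n"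
    and mem: "u' \<in> pts a" "v' \<in> pts a" "wpb u v \<in> pts a"
  shows "u' = u \<and> v' = v \<and> a \<in> {alb u v, rhb u v}"
proof -
  obtain K M S where s: "K = int k" "M = int N" "S = int (r1 + B * r2)" "3 \<le> K" "8 * (K * K * M) \<le> int n"
    "8 * (K * K * S) \<le> M" "0 < S" "8 * (K * S) \<le> M" "8 * S \<le> M" "8 * (K * M) \<le> int n" "8 * M \<le> int n" "0 < M"
    "K * S \<le> K * K * S" "K * M \<le> K * K * M" "S \<le> K * S" "M \<le> K * M"
    by (rule small_int) blast
  obtain i where i: "i < k" "u' = cyc_pt n i a" using mem(1) by (auto simp: pts_def)
  obtain j where j: "j < k" "v' = cyc_pt n j a" using mem(2) by (auto simp: pts_def)
  obtain l where l: "l < k" "wpb u v = cyc_pt n l a" using mem(3) by (auto simp: pts_def)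
  obtain b where b: "b < r2" "v = N + B * b" using Vb_mem[OF uv(2)] by blast
  obtain b' where b': "b' < r2" "v' = N + B * b'" using Vb_mem[OF uv(4)] by blast
  define x where "x = int B * int b"
  define x' where "x' = int B * int b'"
  have vx: "int v = M + x" "int v' = M + x'" using b b' s(2) by (simp_all add: x_def x'_def)
  have rS: "int r1 \<le> S" "int (B * r2) \<le> S" unfolding s(3) by simp_all
  have bnd: "0 \<le> int u" "int u < S" "0 \<le> int u'" "int u' < S" "0 \<le> x" "x \<le> S" "0 \<le> x'" "x' \<le> S"
    using Ub_mem[OF uv(1)] Ub_mem[OF uv(3)] Vb_bounds[OF uv(2)] Vb_bounds[OF uv(4)] vx rS s(2)
    by (auto simp: x_def x'_def)
  have ne: "i \<noteq> j" using UVb_ne[OF uv(3,4)] i j by auto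
  define ji where "ji = int j - int i"
  define li where "li = int l - int i"
  have jl: "\<bar>ji\<bar> \<le> K" "\<bar>li\<bar> \<le> K - 1" "\<bar>li\<bar> \<le> K" "ji \<noteq> 0" using i j l s(1) ne by (auto simp: ji_def li_def)
  \<comment> \<open>Modulo \<open>n\<close>, \<open>wpb u v - u'\<close> is
    \<open>(K - 1) * M + P\<close>: this separates the distance scale from the block scale.\<close>
  define P where "P = (K - 1) * x - (K - 2) * int u - int u'"
  have kk: "int (k - 1) = K - 1" using k3 s(1) by auto
  have "int n dvd ji * (int (wpb u v) - int u') - li * (int v' - int u')"
    unfolding ji_def li_def l(2) i(2) j(2) by (rule cyc_collinear)
  moreover have w: "int n dvd int (wpb u v) - (int u + (K - 1) * (int v - int u))"
    using alb_point[OF uv(1,2), of "k - 1"] kk by (simp add: wpb_def)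
  ultimately have "int n dvd (ji * (int (wpb u v) - int u') - li * (int v' - int u')) - ji * (int (wpb u v) - (int u + (K - 1) * (int v - int u)))"
    by (rule dvd_diff[OF _ dvd_mult])
  moreover have "(ji * (int (wpb u v) - int u') - li * (int v' - int u')) - ji * (int (wpb u v) - (int u + (K - 1) * (int v - int u)))
      = ((ji * (K - 1) - li) * M) + (ji * P - li * (x' - int u'))"
    by (simp add: P_def vx algebra_simps)
  ultimately have dv: "int n dvd (ji * (K - 1) - li) * M + (ji * P - li * (x' - int u'))" by simp
  have P1: "(K - 1) * x \<le> K * S" "0 \<le> (K - 1) * x" using bnd s by (auto intro!: mult_mono)
  have P2: "(K - 2) * int u \<le> (K - 2) * S" "0 \<le> (K - 2) * int u" using bnd s by (auto intro!: mult_mono)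
  have "\<bar>P\<bar> \<le> K * S" using P1 P2 bnd s(7) unfolding P_def left_diff_distrib by linarith
  then have Pa: "\<bar>ji * P\<bar> \<le> K * (K * S)" by (intro abs_mult_le_int jl)
  have Pb: "\<bar>li * (x' - int u')\<bar> \<le> K * S" using bnd by (intro abs_mult_le_int jl) auto
  have KKe: "K * (K * S) = K * K * S" "K * (K * M) = K * K * M" by simp_all
  have "\<bar>ji * (K - 1)\<bar> \<le> K * (K - 1)" using s(4) by (intro abs_mult_le_int jl) auto
  then have cb: "\<bar>ji * (K - 1) - li\<bar> \<le> K * K" using jl(3) by (simp add: right_diff_distrib)
  have cM: "\<bar>(ji * (K - 1) - li) * M\<bar> \<le> K * K * M" using s(12) by (intro abs_mult_le_int cb) auto
  have sm: "\<bar>ji * P - li * (x' - int u')\<bar> < M" using Pa Pb s KKe by linarith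
  have "\<bar>(ji * (K - 1) - li) * M + (ji * P - li * (x' - int u'))\<bar> < int n"
    using cM sm s by linarith
  from dvd_small_int[OF dv this] have eq: "(ji * (K - 1) - li) * M + (ji * P - li * (x' - int u')) = 0" .
  have z: "ji * (K - 1) - li = 0"
  proof (rule ccontr)
    assume "ji * (K - 1) - li \<noteq> 0"
    then have "1 \<le> \<bar>ji * (K - 1) - li\<bar>" by linarith
    then have "1 * M \<le> \<bar>ji * (K - 1) - li\<bar> * M" using s(12) by (intro mult_right_mono) auto
    then have "M \<le> \<bar>(ji * (K - 1) - li) * M\<bar>" using s(12) by (simp add: abs_mult)
    then show False using eq sm by linarith
  qed
  \<comment> \<open>Positions lie below \<open>k\<close>, so \<open>li\<close> is at most
    \<open>K - 1\<close> in absolute value, while it equals \<open>ji * (K - 1)\<close>.\<close>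
  have ji1: "\<bar>ji\<bar> = 1"
  proof (rule ccontr)
    assume "\<bar>ji\<bar> \<noteq> 1"
    then have "2 \<le> \<bar>ji\<bar>" using jl(4) by linarith
    then have "2 * (K - 1) \<le> \<bar>ji\<bar> * (K - 1)" using s(4) by (intro mult_right_mono) auto
    also have "\<dots> = \<bar>ji * (K - 1)\<bar>" using s(4) by (simp add: abs_mult)
    also have "ji * (K - 1) = li" using z by simp
    finally have "2 * (K - 1) \<le> \<bar>li\<bar>" .
    from order.trans[OF this jl(2)] show False using s(4) by simp
  qed
  have "ji * (P - (K - 1) * (x' - int u')) = ji * P - (ji * (K - 1)) * (x' - int u')" by (simp add: algebra_simps)
  also have "\<dots> = 0" using eq z by simp
  finally have "P - (K - 1) * (x' - int u') = 0" using jl(4) by simp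
  then have key: "(K - 1) * (x - x') = (K - 2) * (int u - int u')" by (simp add: P_def algebra_simps)
  \<comment> \<open>Distinct points of the second block differ by at least \<open>B\<close>, hence
    by at least \<open>r1\<close>, whereas \<open>u\<close> and \<open>u'\<close> differ by less
    than \<open>r1\<close>; with the coefficients \<open>K - 1\<close> and \<open>K - 2\<close> the
    equation \<open>key\<close> is then impossible.\<close>
  have xx: "x = x'"
  proof (rule ccontr)
    assume n: "x \<noteq> x'"
    then have "b \<noteq> b'" by (auto simp: x_def x'_def)
    then have "1 \<le> \<bar>int b - int b'\<bar>" by auto
    then have "int B * 1 \<le> int B * \<bar>int b - int b'\<bar>" by (intro mult_left_mono) auto
    also have "\<dots> = \<bar>int B * (int b - int b')\<bar>" by (simp add: abs_mult)
    also have "int B * (int b - int b') = x - x'" by (simp add: x_def x'_def algebra_simps)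
    finally have "int r1 \<le> \<bar>x - x'\<bar>" using B by simp
    then have "(K - 1) * int r1 \<le> (K - 1) * \<bar>x - x'\<bar>" using s(4) by (intro mult_left_mono) auto
    also have "\<dots> = \<bar>(K - 2) * (int u - int u')\<bar>" using key[symmetric] s(4) by (simp add: abs_mult)
    also have "\<dots> \<le> (K - 2) * int r1"
      using Ub_mem[OF uv(1)] Ub_mem[OF uv(3)] s(4) by (intro abs_mult_le_int) auto
    finally have "int r1 \<le> 0" by (simp add: left_diff_distrib)
    then show False using r_pos by simp
  qed
  then have "(K - 2) * (int u - int u') = 0" using key by simp
  then have uu: "u = u'" using s(4) by simp
  have vv: "v = v'" using vx xx by simp
  have "i = 0 \<and> j = 1 \<or> i = k - 1 \<and> j = k - 2"
  proof (cases "ji = 1")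
    case True
    then have "li = K - 1" using z by simp
    then have "i = 0" using l i s(1) by (auto simp: li_def)
    then show ?thesis using True by (simp add: ji_def)
  next
    case False
    then have m: "ji = -1" using ji1 by linarith
    then have "li = - (K - 1)" using z by simp
    then have "i = k - 1" using l i s(1) by (auto simp: li_def)
    then show ?thesis using m k3 by (auto simp: ji_def)
  qed
  moreover have "a = alb u v" if "i = 0" "j = 1"
    using that alb[OF uv(1,2)] a i j k3 uu vv by (intro cyc_det[of a _ 0 1]) auto
  moreover have "a = rhb u v" if "i = k - 1" "j = k - 2"
    using that rhb[OF uv(1,2)] a i j k3 uu vv by (intro cyc_det[of a _ "k - 1" "k - 2"]) auto
  ultimately show ?thesis using uu vv by blast
qed

text \<open>A common point at positions \<open>j\<close> and \<open>j'\<close> gives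
  \<open>(j - j') * v\<close> plus a small term equal to zero. As \<open>v\<close> is at least
  \<open>N\<close>, the positions agree, and then \<open>(1 - j) * (u - u') = 0\<close> leaves only
  \<open>j = 1\<close>, the point \<open>v\<close>.\<close>

lemma alb_disj:
  assumes uv: "u \<in> Ub" "u' \<in> Ub" "v \<in> Vb" and ne: "u \<noteq> u'"
  shows "pts (alb u v) \<inter> pts (alb u' v) \<subseteq> {v}"
proof
  fix y assume "y \<in> pts (alb u v) \<inter> pts (alb u' v)"
  then obtain j j' where j: "j < k" "y = cyc_pt n j (alb u v)" and j': "j' < k" "y = cyc_pt n j' (alb u' v)"
    by (auto simp: pts_def)
  obtain K M S where s: "K = int k" "M = int N" "S = int (r1 + B * r2)" "3 \<le> K" "8 * (K * K * M) \<le> int n"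
    "8 * (K * K * S) \<le> M" "0 < S" "8 * (K * S) \<le> M" "8 * S \<le> M" "8 * (K * M) \<le> int n" "8 * M \<le> int n" "0 < M"
    "K * S \<le> K * K * S" "K * M \<le> K * K * M" "S \<le> K * S" "M \<le> K * M"
    by (rule small_int) blast
  have rS: "int r1 \<le> S" "int (B * r2) \<le> S" unfolding s(3) by simp_all
  have bnd: "\<bar>int u\<bar> \<le> S" "\<bar>int u'\<bar> \<le> S" "M \<le> int v" "\<bar>int v\<bar> \<le> M + S"
    using Ub_mem[OF uv(1)] Ub_mem[OF uv(2)] Vb_bounds[OF uv(3)] rS s(2) by auto
  define d where "d = int j - int j'"
  have "int n dvd (int y - (int u' + int j' * (int v - int u'))) - (int y - (int u + int j * (int v - int u)))"
    using dvd_diff[OF alb_point[OF uv(2,3), of j'] alb_point[OF uv(1,3), of j]] unfolding j(2)[symmetric] j'(2)[symmetric] .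
  then have dv: "int n dvd d * int v + ((1 - int j) * int u - (1 - int j') * int u')"
    by (simp add: d_def algebra_simps)
  have d: "\<bar>d\<bar> \<le> K" using j j' s(1) by (auto simp: d_def)
  have 1: "\<bar>d * int v\<bar> \<le> K * (M + S)" by (intro abs_mult_le_int d bnd)
  have 2: "\<bar>(1 - int j) * int u\<bar> \<le> K * S" using j s(1,4) by (intro abs_mult_le_int bnd) auto
  have 3: "\<bar>(1 - int j') * int u'\<bar> \<le> K * S" using j' s(1,4) by (intro abs_mult_le_int bnd) auto
  have "\<bar>d * int v + ((1 - int j) * int u - (1 - int j') * int u')\<bar> < int n"
    using 1 2 3 s unfolding distrib_left by linarith
  from dvd_small_int[OF dv this] have eq: "d * int v + ((1 - int j) * int u - (1 - int j') * int u') = 0" .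
  have d0: "d = 0"
  proof (rule ccontr)
    assume "d \<noteq> 0"
    then have "1 \<le> \<bar>d\<bar>" by linarith
    then have "1 * int v \<le> \<bar>d\<bar> * int v" by (intro mult_right_mono) auto
    then have "int v \<le> \<bar>d * int v\<bar>" by (simp add: abs_mult)
    then show False using eq 2 3 bnd s by linarith
  qed
  then have "j = j'" by (simp add: d_def)
  then have "(1 - int j) * (int u - int u') = 0" using eq d0 by (simp add: algebra_simps)
  then have "j = 1" using ne by simp
  then show "y \<in> {v}" using j alb[OF uv(1,3)] by simp
qed

end

locale cyclic_blocks = separated_blocks n k N B r1 r2 for n k N B r1 r2 :: nat +
  fixes m :: nat and lam :: real
  assumes mlam: "0 < m" "m < n" "0 < lam" "lam \<le> real m / real n" "real m / real n \<le> 1 - lam"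
begin

sublocale two_blocks n k "cyc_AP n" "cyc_pt n" m lam Ub Vb
proof
  show "u = u'" if "a \<in> cyc_AP n" "pts a \<inter> Vb \<noteq> {}" "u \<in> pts a \<inter> Ub" "u' \<in> pts a \<inter> Ub" for a u u'
    using blocks_sepU that by blast
  show "v = v'" if "a \<in> cyc_AP n" "pts a \<inter> Ub \<noteq> {}" "v \<in> pts a \<inter> Vb" "v' \<in> pts a \<inter> Vb" for a v v'
    using blocks_sepV that by blast
qed (use mlam UVb_sub in auto)

lemma spread:
  assumes "r1 \<le> B"
  shows "spread_blocks n k (cyc_AP n) (cyc_pt n) m lam Ub Vb alb rhb wpb"
proof
  fix u v assume uv: "u \<in> Ub" "v \<in> Vb"
  have inj: "cyc_pt n i (alb u v) \<noteq> cyc_pt n j (alb u v)" if "i < k" "j < k" "i \<noteq> j" for i j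
    using cyc_ne[OF alb(1)[OF uv] that] .
  have "alb u v \<noteq> rhb u v"
  proof
    assume eq: "alb u v = rhb u v"
    have "cyc_pt n (k - 1) (alb u v) = u" unfolding eq by (rule rhb[OF uv])
    then show False using inj[of "k - 1" 0] k3 alb[OF uv] by auto
  qed
  then show "alb u v \<in> cyc_AP n \<and> rhb u v \<in> cyc_AP n \<and> alb u v \<noteq> rhb u v \<and> pts (rhb u v) = pts (alb u v)"
    using alb[OF uv] rhb[OF uv] rhb_pts[OF uv] by simp
  have P: "cyc_pt n j (alb u v) \<in> pts (alb u v)" if "j < k" for j using that by (auto simp: pts_def)
  show "u \<in> pts (alb u v) \<and> v \<in> pts (alb u v) \<and> wpb u v \<in> pts (alb u v) \<and> wpb u v \<noteq> u \<and> wpb u v \<noteq> v"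
    using P[of 0] P[of 1] P[of "k - 1"] inj[of "k - 1" 0] inj[of "k - 1" 1] k3 alb[OF uv] by (auto simp: wpb_def)
qed (use wpb_only[OF assms] alb_disj in auto)

end

section \<open>The characteristic function away from the origin\<close>

lemma power4_le_imp_le:
  fixes x D :: real
  assumes "x ^ 4 \<le> D ^ 4" "0 \<le> D"
  shows "x \<le> D"
proof (rule ccontr)
  assume "\<not> x \<le> D"
  then have "D ^ 4 < x ^ 4" using assms(2) by (intro power_strict_mono) auto
  then show False using assms(1) by simp
qed

context cyclic_blocks
begin

lemma kAP_char_le:
  assumes "\<And>\<theta>. norm (bE p {..<n} (\<lambda>A. cis (t * kAP k n A) * cis (\<theta> * real (card A)))) ^ 4 \<le> D ^ 4" "0 \<le> D"
  shows "norm (sE n m (\<lambda>A. cis (t * kAP k n A))) \<le> (real n + 1) * D"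
proof (rule sE_le_twisted_bE)
  fix \<theta>
  have "norm (bE p {..<n} (\<lambda>A. cis (t * kAP k n A) * cis (\<theta> * real (card A)))) \<le> D"
    by (rule power4_le_imp_le[OF assms])
  then show "norm (bE (real m / real n) {..<n} (\<lambda>A. cis (t * kAP k n A) * cis (\<theta> * real (card A)))) \<le> D"
    by (simp only: p_def)
qed (use m_pos m_less in auto)

lemma large_char_bound:
  assumes t: "\<bar>t\<bar> \<le> pi" and B: "r1 \<le> B" and D: "0 \<le> D"
    and le: "(1 - lam) ^ r2 + (1 - lam ^ 3 * t\<^sup>2 / 8 * lam ^ k) ^ r1 \<le> D ^ 4"
  shows "norm (sE n m (\<lambda>A. cis (t * kAP k n A))) \<le> (real n + 1) * D"
proof (rule kAP_char_le[OF _ D])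
  interpret spread_blocks n k "cyc_AP n" "cyc_pt n" m lam Ub Vb alb rhb wpb by (rule spread[OF B])
  fix \<theta>
  show "norm (bE p {..<n} (\<lambda>A. cis (t * kAP k n A) * cis (\<theta> * real (card A)))) ^ 4 \<le> D ^ 4"
    unfolding kAP_eq_XX using order.trans[OF spread_char_bound[OF t, of \<theta>, unfolded eta_def card_Ub card_Vb] le] .
qed

text \<open>The decay is proved for \<open>YY\<close>, whose centred monomials make the second
  moments computable. The number \<open>64 / lam ^ (4 * k)\<close> comes from the square of half the
  lower bound for \<open>gG\<close>.\<close>

lemma mid_char_bound:
  assumes t: "\<bar>t\<bar> * real (r2 * (2 ^ k * k ^ 3)) \<le> 1" and D: "0 \<le> D"
    and le: "exp (- (lam ^ (2 * k + 2) / 16 * (t\<^sup>2 * (real r1 * real r2))))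
      + kap lam ^ (2 * k * 2 ^ 6 * (2 ^ 6 - 1)) * (210 * real (k ^ 4 * (2 ^ k * k ^ 3) ^ 4) * (64 / lam ^ (4 * k)) * (1 / real r1 + 1 / real r2)) ^ 64 \<le> D ^ 4"
  shows "norm (sE n m (\<lambda>A. cis (t * kAP k n A))) \<le> (real n + 1) * D"
proof -
  have ne: "Ub \<noteq> {}" "Vb \<noteq> {}" using r_pos by (auto simp: Ub_def Vb_def)
  have pair_term: "\<bar>t\<bar> * real (card Vb * KK) \<le> 1" using t by (simp add: card_Vb KK_def)
  define g where "g = real r1 * real r2 * lam ^ (2 * k) / 4"
  have g: "0 < g" using r_pos lam_pos by (simp add: g_def)
  have gG: "g \<le> gG" using gG_lower by (simp add: g_def card_Ub card_Vb)
  define V where "V = bE p bits (\<lambda>X. (GG X - gG)\<^sup>2)"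
  define c where "c = 210 * real (k ^ 4 * KK ^ 4)"
  have V0: "0 \<le> V" using p_bounds by (auto simp: V_def intro!: bE_nonneg)
  have V: "V \<le> c * ((real r1)\<^sup>2 * real r2 + real r1 * (real r2)\<^sup>2)"
    using GG_variance unfolding V_def c_def card_Ub card_Vb .
  have c0: "0 \<le> c" by (simp add: c_def)
  have q: "lam\<^sup>2 \<le> p * (1 - p)"
    unfolding power2_eq_square using lam_p lam_pos by (intro mult_mono) auto
  have e: "exp (- (p * (1 - p)) * t\<^sup>2 / 4 * gG) \<le> exp (- (lam ^ (2 * k + 2) / 16 * (t\<^sup>2 * (real r1 * real r2))))"
  proof -
    have "lam\<^sup>2 * (t\<^sup>2 / 4 * g) \<le> (p * (1 - p)) * (t\<^sup>2 / 4 * gG)"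
      using q g gG lam_pos by (intro mult_mono mult_nonneg_nonneg) auto
    moreover have "lam\<^sup>2 * (t\<^sup>2 / 4 * g) = lam ^ (2 * k + 2) / 16 * (t\<^sup>2 * (real r1 * real r2))"
      by (simp add: g_def power_add power2_eq_square)
    moreover have "- (p * (1 - p)) * t\<^sup>2 / 4 * gG = - ((p * (1 - p)) * (t\<^sup>2 / 4 * gG))" by simp
    ultimately show ?thesis by (simp only: exp_le_cancel_iff neg_le_iff_le)
  qed
  have "V / (g / 2)\<^sup>2 \<le> c * ((real r1)\<^sup>2 * real r2 + real r1 * (real r2)\<^sup>2) / (g / 2)\<^sup>2"
    using V by (intro divide_right_mono) auto
  moreover have "c * ((real r1)\<^sup>2 * real r2 + real r1 * (real r2)\<^sup>2) / (g / 2)\<^sup>2 = c * (64 / lam ^ (4 * k)) * (1 / real r1 + 1 / real r2)"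
  proof -
    define l where "l = lam ^ (2 * k)"
    have l: "0 < l" "lam ^ (4 * k) = l\<^sup>2" using lam_pos by (simp_all add: l_def power_mult[symmetric])
    have "0 < real r1" "0 < real r2" using r_pos by auto
    then show ?thesis unfolding g_def l(2) l_def[symmetric] using l(1)
      by (simp add: field_simps power2_eq_square)
  qed
  ultimately have W: "V / (g / 2)\<^sup>2 \<le> c * (64 / lam ^ (4 * k)) * (1 / real r1 + 1 / real r2)" by linarith
  have h: "V ^ (2 ^ 6) / (gG / 2) ^ (2 ^ 7) \<le> (c * (64 / lam ^ (4 * k)) * (1 / real r1 + 1 / real r2)) ^ 64"
  proof -
    have "V ^ (2 ^ 6) / (gG / 2) ^ (2 ^ 7) \<le> V ^ 64 / (g / 2) ^ 128"
      using g gG V0 by (auto intro!: divide_left_mono power_mono mult_pos_pos)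
    moreover have "V ^ 64 / (g / 2) ^ 128 = (V / (g / 2)\<^sup>2) ^ 64"
      using power_mult[of "g / 2" 2 64] by (simp add: power_divide)
    moreover have "(V / (g / 2)\<^sup>2) ^ 64 \<le> (c * (64 / lam ^ (4 * k)) * (1 / real r1 + 1 / real r2)) ^ 64"
      using W V0 by (intro power_mono) auto
    ultimately show ?thesis by linarith
  qed
  define Kc where "Kc = kap lam ^ (2 * k * 2 ^ 6 * (2 ^ 6 - 1))"
  have Kc: "0 \<le> Kc" using kap_ge by (simp add: Kc_def)
  have "bE p bits (\<lambda>X. \<Prod>u\<in>Ub. 1 - 2 * (p * (1 - p)) * (1 - cos (t * cu u X)))
      \<le> exp (- (p * (1 - p)) * t\<^sup>2 / 4 * gG) + Kc * (V ^ (2 ^ 6) / (gG / 2) ^ (2 ^ 7))"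
    using block_product_bound[OF ne pair_term] unfolding V_def Kc_def by (simp only: times_divide_eq_right)
  moreover have "Kc * (V ^ (2 ^ 6) / (gG / 2) ^ (2 ^ 7)) \<le> Kc * (c * (64 / lam ^ (4 * k)) * (1 / real r1 + 1 / real r2)) ^ 64"
    by (rule mult_left_mono[OF h Kc])
  ultimately have bnd: "bE p bits (\<lambda>X. \<Prod>u\<in>Ub. 1 - 2 * (p * (1 - p)) * (1 - cos (t * cu u X))) \<le> D ^ 4"
    using e le unfolding c_def KK_def Kc_def by linarith
  have "norm (sE n m (\<lambda>A. cis (t * YY p A))) \<le> (real n + 1) * D"
  proof (rule sE_le_twisted_bE)
    fix \<theta>
    have "norm (bE p {..<n} (\<lambda>A. cis (t * YY p A) * cis (\<theta> * real (card A)))) \<le> D"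
      by (rule power4_le_imp_le[OF order.trans[OF decoupled bnd] D])
    then show "norm (bE (real m / real n) {..<n} (\<lambda>A. cis (t * YY p A) * cis (\<theta> * real (card A)))) \<le> D"
      by (simp only: p_def)
  qed (use m_pos m_less in auto)
  \<comment> \<open>On the slice the count and \<open>YY\<close> differ by a constant, which is only
    a phase; under independent bits this would fail, so the exchange is made here, on the
    slice.\<close>
  moreover obtain s where s: "\<And>A. A \<in> slc n m \<Longrightarrow> XX A = YY p A + s"
    using XX_eq_YY[of m p] n_pos m_less p_def by (auto simp: less_imp_le)
  have "sE n m (\<lambda>A. cis (t * kAP k n A)) = sE n m (\<lambda>A. cis (t * s) * cis (t * YY p A))"
    by (intro sE_cong) (simp add: kAP_eq_XX s cis_mult algebra_simps)
  then have "norm (sE n m (\<lambda>A. cis (t * kAP k n A))) = norm (sE n m (\<lambda>A. cis (t * YY p A)))"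
    by (simp add: sE_cmult norm_mult)
  ultimately show ?thesis by simp
qed

end

lemma power_le_exp:
  assumes "0 \<le> x" "x \<le> 1"
  shows "(1 - x) ^ r \<le> exp (- (x * real r))"
proof -
  have "(1 - x) ^ r \<le> (exp (- x)) ^ r" using assms exp_ge_add_one_self[of "- x"] by (intro power_mono) auto
  then show ?thesis by (simp add: exp_of_nat_mult[symmetric] mult.commute)
qed

text \<open>The exponents are of orders \<open>x powr (3/10)\<close> and, from
  \<open>- 4/10 + 1/2\<close>, \<open>x powr (1/10)\<close>, so both exponentials beat any power.
  The last clause lets the blocks fit. The target \<open>-12\<close> is four times
  \<open>-3\<close>, as decoupling bounds a fourth power.\<close>

lemma large_eventually:
  fixes lam c K :: real
  assumes "0 < lam" "0 < c" "0 < K"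
  shows "\<forall>\<^sub>F x in at_top. exp (- (lam * (x powr (3/10) - 1))) + exp (- (c * x powr (-4/10) * (x powr (1/2) - 1))) \<le> x powr (-12)
    \<and> K * (x powr (1/2) + x powr (8/10)) \<le> x / K - 1"
proof (intro eventually_conj)
  show "\<forall>\<^sub>F x in at_top. exp (- (lam * (x powr (3/10) - 1))) + exp (- (c * x powr (-4/10) * (x powr (1/2) - 1))) \<le> x powr (-12)"
    using assms by real_asymp
  show "\<forall>\<^sub>F x in at_top. K * (x powr (1/2) + x powr (8/10)) \<le> x / K - 1"
    using assms by real_asymp
qed

text \<open>The exponential has an exponent of order \<open>x powr (5/1000)\<close>, the margin
  between \<open>99/100\<close> and \<open>985/1000\<close>. The other term is at most a constant
  times the 64th power of \<open>x powr (-2/10)\<close>, that is \<open>x powr (-128/10)\<close>,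
  just below the target; the 32nd power would not reach it.\<close>

lemma mid_eventually:
  fixes c K L M :: real
  assumes "0 < c" "0 < K" "0 < L" "0 < M"
  shows "\<forall>\<^sub>F x in at_top. exp (- (c * (x powr (-985/1000) * (x powr (99/100) - 1)))) + L * (M * (2 * x powr (-99/100) + 2 * K * x powr (-2/10))) ^ 64 \<le> x powr (-12)
    \<and> K * (x powr (99/100) + x powr (985/1000)) \<le> x / K - 1 \<and> 2 * K * x powr (-2/10) \<le> 1 \<and> 2 \<le> x powr (99/100)"
proof (intro eventually_conj)
  have "\<forall>\<^sub>F x in at_top. exp (- (c * (x powr (-985/1000) * (x powr (99/100) - 1)))) \<le> x powr (-12) / 2"
    using assms by real_asymp
  moreover have "\<forall>\<^sub>F x in at_top. L * (M * (2 * x powr (-99/100) + 2 * K * x powr (-2/10))) ^ 64 \<le> x powr (-12) / 2"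
  proof -
    \<comment> \<open>The high power is first dominated by a single monomial; only that monomial is
      passed to the asymptotic estimate.\<close>
    define Q where "Q = L * (M * (2 + 2 * K)) ^ 64"
    have Q: "0 < Q" using assms by (simp add: Q_def)
    have "\<forall>\<^sub>F x in at_top. Q * x powr (-128/10) \<le> x powr (-12) / 2" using Q by real_asymp
    moreover have "\<forall>\<^sub>F x in at_top. (1::real) \<le> x" by (rule eventually_ge_at_top)
    ultimately show ?thesis
    proof eventually_elim
      case (elim x)
      have "x powr (-99/100) \<le> x powr (-2/10)" using elim by (intro powr_mono) auto
      then have "2 * x powr (-99/100) + 2 * K * x powr (-2/10) \<le> (2 + 2 * K) * x powr (-2/10)"
        by (simp add: algebra_simps)
      then have "M * (2 * x powr (-99/100) + 2 * K * x powr (-2/10)) \<le> M * ((2 + 2 * K) * x powr (-2/10))"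
        using assms by (intro mult_left_mono) auto
      then have "(M * (2 * x powr (-99/100) + 2 * K * x powr (-2/10))) ^ 64 \<le> (M * ((2 + 2 * K) * x powr (-2/10))) ^ 64"
        using assms by (intro power_mono) auto
      then have "L * (M * (2 * x powr (-99/100) + 2 * K * x powr (-2/10))) ^ 64 \<le> L * (M * ((2 + 2 * K) * x powr (-2/10))) ^ 64"
        using assms by (intro mult_left_mono) auto
      moreover have "(x powr (-2/10)) ^ 64 = x powr (-128/10)" using elim by (simp add: powr_power)
      then have "L * (M * ((2 + 2 * K) * x powr (-2/10))) ^ 64 = Q * x powr (-128/10)"
        unfolding Q_def power_mult_distrib by (simp only: mult.assoc)
      ultimately show ?case using elim by linarith
    qed
  qed
  ultimately show "\<forall>\<^sub>F x in at_top. exp (- (c * (x powr (-985/1000) * (x powr (99/100) - 1)))) + L * (M * (2 * x powr (-99/100) + 2 * K * x powr (-2/10))) ^ 64 \<le> x powr (-12)"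
    by eventually_elim linarith
  show "\<forall>\<^sub>F x in at_top. K * (x powr (99/100) + x powr (985/1000)) \<le> x / K - 1" using assms by real_asymp
  show "\<forall>\<^sub>F x in at_top. 2 * K * x powr (-2/10) \<le> 1" using assms by real_asymp
  show "\<forall>\<^sub>F x::real in at_top. 2 \<le> x powr (99/100)" by real_asymp
qed

text \<open>For \<open>|t| \<ge> n^(-1/5)\<close> the blocks have \<open>n^(1/2)\<close> and \<open>n^(3/10)\<close> points, the latter with spacing \<open>n^(1/2)\<close>.
  For smaller \<open>t\<close> they are intervals of lengths \<open>n^(99/100)\<close> and order \<open>1 / |t|\<close>.\<close>

lemma minor_arcs:
  fixes k :: nat and lam :: real
  assumes k3: "3 \<le> k" and lam: "0 < lam"
  shows "\<exists>n0. \<forall>n m t. n0 \<le> real n \<longrightarrow> gcd n (fact (k - 1)) = 1 \<longrightarrow> 0 < m \<longrightarrow> m < n \<longrightarrow>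
    lam \<le> real m / real n \<longrightarrow> real m / real n \<le> 1 - lam \<longrightarrow>
    real n powr (-985/1000) \<le> \<bar>t\<bar> \<longrightarrow> \<bar>t\<bar> \<le> pi \<longrightarrow>
    norm (sE n m (\<lambda>A. cis (t * kAP k n A))) \<le> (real n + 1) * real n powr (-3)"
proof -
  \<comment> \<open>The value of \<open>KK\<close> written out, as no progression is fixed yet. It
    is also at least \<open>8 * k^2\<close>, so the same constant makes the blocks fit.\<close>
  define K where "K = real (2 ^ k * k ^ 3)"
  define Kn where "Kn = 2 ^ k * k ^ 3"
  have KKn: "K = real Kn" by (simp add: K_def Kn_def)
  have "(2::nat) ^ 3 \<le> 2 ^ k" using k3 by (intro power_increasing) auto
  then have "2 ^ 3 * k ^ 2 \<le> (2 ^ k) * k ^ 3" using k3 by (intro mult_mono power_increasing) auto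
  then have K8: "8 * k\<^sup>2 \<le> Kn" by (simp add: Kn_def)
  have K: "0 < K" using k3 by (simp add: K_def)
  define c1 where "c1 = lam ^ 3 / 8 * lam ^ k"
  define c2 where "c2 = lam ^ (2 * k + 2) / 16 / (2 * K)"
  define L where "L = kap lam ^ (2 * k * 2 ^ 6 * (2 ^ 6 - 1))"
  define M where "M = 210 * real (k ^ 4 * (2 ^ k * k ^ 3) ^ 4) * (64 / lam ^ (4 * k))"
  have c: "0 < c1" "0 < c2" "0 < L" "0 < M"
  proof -
    have "0 < kap lam" using lam by (simp add: kap_def pos_add_strict)
    then show "0 < L" unfolding L_def by (rule zero_less_power)
    show "0 < c1" "0 < c2" "0 < M" using lam K k3 by (simp_all add: c1_def c2_def M_def)
  qed
  from large_eventually[OF lam c(1) K] obtain n1 where n1: "\<And>x. n1 \<le> x \<Longrightarrow>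
      exp (- (lam * (x powr (3/10) - 1))) + exp (- (c1 * x powr (-4/10) * (x powr (1/2) - 1))) \<le> x powr (-12)
      \<and> K * (x powr (1/2) + x powr (8/10)) \<le> x / K - 1"
    unfolding eventually_at_top_linorder by blast
  from mid_eventually[OF c(2) K c(3) c(4)] obtain n2 where n2: "\<And>x. n2 \<le> x \<Longrightarrow>
      exp (- (c2 * (x powr (-985/1000) * (x powr (99/100) - 1)))) + L * (M * (2 * x powr (-99/100) + 2 * K * x powr (-2/10))) ^ 64 \<le> x powr (-12)
      \<and> K * (x powr (99/100) + x powr (985/1000)) \<le> x / K - 1 \<and> 2 * K * x powr (-2/10) \<le> 1 \<and> 2 \<le> x powr (99/100)"
    unfolding eventually_at_top_linorder by blast
  show ?thesis
  proof (intro exI[of _ "max (max n1 n2) 1"] allI impI)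
    fix n m :: nat and t :: real
    assume n: "max (max n1 n2) 1 \<le> real n" and g: "gcd n (fact (k - 1)) = 1" and m: "0 < m" "m < n"
      and l: "lam \<le> real m / real n" "real m / real n \<le> 1 - lam" and t: "real n powr (-985/1000) \<le> \<bar>t\<bar>" "\<bar>t\<bar> \<le> pi"
    define x where "x = real n"
    have x: "n1 \<le> x" "n2 \<le> x" "1 \<le> x" using n by (auto simp: x_def)
    note big1 = n1[OF x(1)] and big2 = n2[OF x(2)]
    define D where "D = x powr (-3)"
    have D: "0 \<le> D" "D ^ 4 = x powr (-12)" using x by (simp_all add: D_def powr_power)
    define N where "N = n div (8 * k\<^sup>2)"
    have N: "8 * k\<^sup>2 * N \<le> n" by (simp add: N_def)
    have Nbig: "8 * k\<^sup>2 * s \<le> N" if "K * real s \<le> x / K - 1" for s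
    proof -
      have k8: "real (8 * k\<^sup>2) \<le> K" using K8 unfolding KKn by (rule of_nat_mono)
      have k0: "0 < real (8 * k\<^sup>2)" using k3 by simp
      have "real (8 * k\<^sup>2) * real s \<le> K * real s" using k8 by (intro mult_right_mono) auto
      moreover have "x / K \<le> x / real (8 * k\<^sup>2)" using k8 k0 K x by (intro divide_left_mono) auto
      moreover have "x / real (8 * k\<^sup>2) < real N + 1"
      proof -
        have "n < (N + 1) * (8 * k\<^sup>2)" unfolding N_def using k3 dividend_less_div_times[of "8 * k\<^sup>2" n] by simp
        then have "x < real ((N + 1) * (8 * k\<^sup>2))" unfolding x_def by (rule of_nat_less_iff[THEN iffD2])
        then show ?thesis using k0 by (simp only: of_nat_mult pos_divide_less_eq of_nat_add of_nat_1)
      qed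
      ultimately have "real (8 * k\<^sup>2) * real s < real N" using that by linarith
      then have "real (8 * k\<^sup>2 * s) < real N" by (simp only: of_nat_mult)
      then show ?thesis by (simp only: of_nat_less_iff less_imp_le)
    qed
    have fl: "real (nat \<lfloor>y\<rfloor>) \<le> y \<and> y - 1 \<le> real (nat \<lfloor>y\<rfloor>) \<and> 0 < nat \<lfloor>y\<rfloor>" if "1 \<le> y" for y :: real
      using that by linarith
    have gcdn: "0 < n" using m by simp
    show "norm (sE n m (\<lambda>A. cis (t * kAP k n A))) \<le> (real n + 1) * real n powr (-3)"
    proof (cases "x powr (-2/10) \<le> \<bar>t\<bar>")
      case True
      define r1 where "r1 = nat \<lfloor>x powr (1/2)\<rfloor>"
      define r2 where "r2 = nat \<lfloor>x powr (3/10)\<rfloor>"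
      have "1 \<le> x powr (1/2)" "1 \<le> x powr (3/10)" using x by (auto intro!: ge_one_powr_ge_zero)
      note f1 = fl[OF this(1), folded r1_def] and f2 = fl[OF this(2), folded r2_def]
      have "real r1 * real r2 \<le> x powr (1/2) * x powr (3/10)" using f1 f2 by (intro mult_mono) auto
      also have "\<dots> = x powr (8/10)" by (simp add: powr_add[symmetric])
      finally have "real (r1 + r1 * r2) \<le> x powr (1/2) + x powr (8/10)" using f1 by simp
      then have "K * real (r1 + r1 * r2) \<le> K * (x powr (1/2) + x powr (8/10))" using K by (intro mult_left_mono) auto
      then have S: "8 * k\<^sup>2 * (r1 + r1 * r2) \<le> N" using big1 by (intro Nbig) linarith
      \<comment> \<open>The spacing of the second block is the length \<open>r1\<close> of the
        first, so that last points determine the pair of blocks' elements.\<close>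
      interpret cyclic_blocks n k N r1 r1 r2 m lam
        using f1 f2 k3 g gcdn N S m lam l by unfold_locales auto
      have lam1: "lam \<le> 1 / 2" using l by linarith
      have "(1 - lam) ^ r2 \<le> exp (- (lam * real r2))" using lam lam1 by (intro power_le_exp) auto
      moreover have "exp (- (lam * real r2)) \<le> exp (- (lam * (x powr (3/10) - 1)))" using f2 lam by simp
      moreover have "(1 - lam ^ 3 * t\<^sup>2 / 8 * lam ^ k) ^ r1 \<le> exp (- (c1 * x powr (-4/10) * (x powr (1/2) - 1)))"
      proof -
        define y where "y = c1 * t\<^sup>2"
        have y0: "0 \<le> y" using c by (simp add: y_def)
        have y1: "y \<le> 1"
        proof -
          have "lam ^ 3 \<le> (1/2) ^ 3" using lam lam1 by (intro power_mono) auto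
          moreover have "lam ^ k \<le> 1" using lam lam1 by (intro power_le_one) auto
          moreover have "t\<^sup>2 \<le> 4\<^sup>2" using t pi_less_4 by (intro power2_le_iff_abs_le[THEN iffD2]) auto
          ultimately have "lam ^ 3 / 8 * lam ^ k * t\<^sup>2 \<le> (1/2) ^ 3 / 8 * 1 * 4\<^sup>2"
            using lam by (intro mult_mono) auto
          also have "\<dots> \<le> (1::real)" by (simp add: power2_eq_square power3_eq_cube)
          finally show ?thesis by (simp only: y_def c1_def)
        qed
        have "(x powr (-2/10))\<^sup>2 \<le> \<bar>t\<bar>\<^sup>2" using True by (intro power_mono) auto
        then have "x powr (-4/10) \<le> t\<^sup>2" using x by (simp add: powr_power)
        then have "c1 * x powr (-4/10) * (x powr (1/2) - 1) \<le> y * real r1"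
          unfolding y_def using c f1 \<open>1 \<le> x powr (1/2)\<close> by (intro mult_mono) auto
        then have "exp (- (y * real r1)) \<le> exp (- (c1 * x powr (-4/10) * (x powr (1/2) - 1)))" by simp
        moreover have "(1 - y) ^ r1 \<le> exp (- (y * real r1))" using y0 y1 by (rule power_le_exp)
        moreover have "lam ^ 3 * t\<^sup>2 / 8 * lam ^ k = y" by (simp add: y_def c1_def)
        ultimately show ?thesis by (simp only:)
      qed
      ultimately have "(1 - lam) ^ r2 + (1 - lam ^ 3 * t\<^sup>2 / 8 * lam ^ k) ^ r1 \<le> D ^ 4"
        using big1 unfolding D(2) by linarith
      from large_char_bound[OF t(2) order_refl D(1) this] show ?thesis by (simp add: D_def x_def)
    next
      case False
      have t0: "0 < \<bar>t\<bar>" using t(1) x by (intro less_le_trans[OF _ t(1)]) (auto simp: x_def)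
      \<comment> \<open>Up to rounding, the largest size of the second block for which
        \<open>\<bar>t\<bar> * card V * KK\<close> is at most one, the range of small
        angles.\<close>
      define y where "y = 1 / (K * \<bar>t\<bar>)"
      define r1 where "r1 = nat \<lfloor>x powr (99/100)\<rfloor>"
      define r2 where "r2 = nat \<lfloor>y\<rfloor>"
      have "K * \<bar>t\<bar> \<le> K * x powr (-2/10)" using False K by (intro mult_left_mono) auto
      then have Kt: "2 * (K * \<bar>t\<bar>) \<le> 2 * K * x powr (-2/10)" by simp
      have Kt1: "2 * (K * \<bar>t\<bar>) \<le> 1" using Kt big2 by linarith
      have Kt0: "0 < K * \<bar>t\<bar>" using K t0 by simp
      have y2: "2 \<le> y" using Kt1 Kt0 by (simp add: y_def field_simps)
      have f1: "real r1 \<le> x powr (99/100) \<and> x powr (99/100) - 1 \<le> real r1 \<and> 0 < r1" unfolding r1_def using big2 by (intro fl) linarith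
      have f2: "real r2 \<le> y \<and> y - 1 \<le> real r2 \<and> 0 < r2" unfolding r2_def using y2 by (intro fl) linarith
      have yx: "y \<le> x powr (985/1000)"
      proof -
        have "1 \<le> K" using K unfolding KKn by simp
        then have "1 * x powr (-985/1000) \<le> K * \<bar>t\<bar>" using t(1) by (intro mult_mono) (auto simp: x_def)
        then have "y \<le> 1 / x powr (-985/1000)" unfolding y_def using x Kt0 by (intro divide_left_mono) auto
        also have "\<dots> = x powr (985/1000)" by (simp add: powr_minus_divide)
        finally show ?thesis .
      qed
      have "real (r1 + 1 * r2) \<le> x powr (99/100) + x powr (985/1000)" using f1 f2 yx by simp
      then have "K * real (r1 + 1 * r2) \<le> K * (x powr (99/100) + x powr (985/1000))" using K by (intro mult_left_mono) auto
      then have S: "8 * k\<^sup>2 * (r1 + 1 * r2) \<le> N" using big2 by (intro Nbig) linarith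
      interpret cyclic_blocks n k N 1 r1 r2 m lam
        using f1 f2 k3 g gcdn N S m lam l by unfold_locales auto
      have tr: "\<bar>t\<bar> * real (r2 * (2 ^ k * k ^ 3)) \<le> 1"
      proof -
        have "\<bar>t\<bar> * real (r2 * (2 ^ k * k ^ 3)) = (K * \<bar>t\<bar>) * real r2" by (simp add: K_def)
        also have "\<dots> \<le> (K * \<bar>t\<bar>) * y" using f2 Kt0 by (intro mult_left_mono) auto
        also have "\<dots> = 1" using K t0 unfolding y_def by simp
        finally show ?thesis .
      qed
      have yr: "y / 2 \<le> real r2" using f2 y2 by linarith
      have e1: "c2 * (x powr (-985/1000) * (x powr (99/100) - 1)) \<le> lam ^ (2 * k + 2) / 16 * (t\<^sup>2 * (real r1 * real r2))"
      proof -
        have "x powr (-985/1000) * (x powr (99/100) - 1) \<le> \<bar>t\<bar> * real r1"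
          using t(1) f1 big2 by (intro mult_mono) (auto simp: x_def)
        moreover have "\<bar>t\<bar> * real r1 / (2 * K) \<le> t\<^sup>2 * (real r1 * real r2)"
        proof -
          have "t\<^sup>2 * real r1 * (y / 2) \<le> t\<^sup>2 * real r1 * real r2" using yr by (intro mult_left_mono) auto
          moreover have "t\<^sup>2 * real r1 * (y / 2) = \<bar>t\<bar> * real r1 / (2 * K)"
          proof -
            have "t\<^sup>2 = \<bar>t\<bar> * \<bar>t\<bar>" by (simp add: power2_eq_square)
            then show ?thesis unfolding y_def using K t0 by (simp add: field_simps)
          qed
          ultimately show ?thesis by (simp only: mult.assoc)
        qed
        ultimately have "x powr (-985/1000) * (x powr (99/100) - 1) / (2 * K) \<le> t\<^sup>2 * (real r1 * real r2)"
          using K divide_right_mono[of "x powr (-985/1000) * (x powr (99/100) - 1)" "\<bar>t\<bar> * real r1" "2 * K"] by linarith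
        then have "lam ^ (2 * k + 2) / 16 * (x powr (-985/1000) * (x powr (99/100) - 1) / (2 * K)) \<le> lam ^ (2 * k + 2) / 16 * (t\<^sup>2 * (real r1 * real r2))"
          using lam by (intro mult_left_mono) auto
        then show ?thesis by (simp add: c2_def)
      qed
      have r: "1 / real r1 + 1 / real r2 \<le> 2 * x powr (-99/100) + 2 * K * x powr (-2/10)"
      proof -
        have x99: "0 < x powr (99/100)" using x by simp
        have "x powr (99/100) / 2 \<le> real r1" using f1 big2 by linarith
        then have "1 / real r1 \<le> 1 / (x powr (99/100) / 2)" using x99 f1 by (intro divide_left_mono) auto
        also have "\<dots> = 2 * x powr (-99/100)" by (simp add: powr_minus_divide)
        finally have a: "1 / real r1 \<le> 2 * x powr (-99/100)" .
        have "1 / real r2 \<le> 1 / (y / 2)" using yr y2 f2 by (intro divide_left_mono) auto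
        also have "\<dots> = 2 * (K * \<bar>t\<bar>)" by (simp add: y_def)
        finally show ?thesis using a Kt by linarith
      qed
      have "M * (1 / real r1 + 1 / real r2) \<le> M * (2 * x powr (-99/100) + 2 * K * x powr (-2/10))"
        using r c by (intro mult_left_mono) auto
      then have "(M * (1 / real r1 + 1 / real r2)) ^ 64 \<le> (M * (2 * x powr (-99/100) + 2 * K * x powr (-2/10))) ^ 64"
        using c by (intro power_mono) auto
      then have "L * (M * (1 / real r1 + 1 / real r2)) ^ 64 \<le> L * (M * (2 * x powr (-99/100) + 2 * K * x powr (-2/10))) ^ 64"
        using c by (intro mult_left_mono) auto
      moreover have "exp (- (lam ^ (2 * k + 2) / 16 * (t\<^sup>2 * (real r1 * real r2)))) \<le> exp (- (c2 * (x powr (-985/1000) * (x powr (99/100) - 1))))"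
        using e1 by (simp only: exp_le_cancel_iff neg_le_iff_le)
      ultimately have "exp (- (lam ^ (2 * k + 2) / 16 * (t\<^sup>2 * (real r1 * real r2)))) + L * (M * (1 / real r1 + 1 / real r2)) ^ 64 \<le> D ^ 4"
        using big2 unfolding D(2) by linarith
      from mid_char_bound[OF tr D(1) this[unfolded L_def M_def]] show ?thesis by (simp add: D_def x_def)
    qed
  qed
qed

section \<open>From characteristic functions to local limits\<close>

text \<open>The antiderivative of a nontrivial character takes equal values at the two ends of a
  full period.\<close>

lemma integral_cis_period:
  fixes l :: int
  assumes "0 < \<sigma>"
  shows "(\<integral>s. indicator {-(pi*\<sigma>)..pi*\<sigma>} s *\<^sub>R cis (s * (of_int l / \<sigma>)) \<partial>lborel) = (if l = 0 then of_real (2 * pi * \<sigma>) else 0)"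
proof (cases "l = 0")
  case True
  have "(\<integral>s. indicator {-(pi*\<sigma>)..pi*\<sigma>} s *\<^sub>R (1::complex) \<partial>lborel) = of_real (pi * \<sigma>) - of_real (- (pi * \<sigma>))"
    using assms by (intro integral_FTC_atLeastAtMost) (auto intro!: derivative_eq_intros simp: has_vector_derivative_def scaleR_conv_of_real)
  then show ?thesis using True by simp
next
  case False
  define c where "c = of_int l / \<sigma>"
  have c: "c \<noteq> 0" "pi * \<sigma> * c = pi * of_int l" using False assms by (simp_all add: c_def)
  define F where "F s = cis (s * c) / (\<i> * of_real c)" for s :: real
  have der: "(F has_vector_derivative cis (x * c)) (at x within S)" for x S
  proof -
    have "((\<lambda>z. exp (\<i> * (z * of_real c)) / (\<i> * of_real c)) has_field_derivative exp (\<i> * (of_real x * of_real c))) (at (of_real x))"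
      using c by (auto intro!: derivative_eq_intros simp: mult_ac)
    from has_vector_derivative_real_field[OF this]
    have "((\<lambda>s. exp (\<i> * (of_real s * of_real c)) / (\<i> * of_real c)) has_vector_derivative exp (\<i> * (of_real x * of_real c))) (at x within S)" .
    then show ?thesis unfolding F_def cis_conv_exp of_real_mult .
  qed
  have "(\<integral>s. indicator {-(pi*\<sigma>)..pi*\<sigma>} s *\<^sub>R cis (s * c) \<partial>lborel) = F (pi * \<sigma>) - F (- (pi * \<sigma>))"
    using assms by (intro integral_FTC_atLeastAtMost der continuous_intros) auto
  moreover have "cis (pi * of_int l) = cis (- (pi * of_int l))"
  proof -
    have "cis (2 * pi * of_int l) = 1" by (rule cis_multiple_2pi) simp
    then have "cis (- (pi * of_int l)) * cis (2 * pi * of_int l) = cis (- (pi * of_int l))" by simp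
    then show ?thesis by (simp add: cis_mult algebra_simps)
  qed
  then have "F (pi * \<sigma>) = F (- (pi * \<sigma>))" unfolding F_def mult_minus_left c(2) by simp
  ultimately show ?thesis using False by (simp add: c_def)
qed

lemma integrable_indicator_cis:
  "integrable lborel (\<lambda>s. indicator {a..b::real} s *\<^sub>R cis (s * c))"
proof -
  have "continuous_on {a..b} (\<lambda>s. cis (s * c))" by (intro continuous_intros)
  from borel_integrable_atLeastAtMost'[OF this] show ?thesis unfolding set_integrable_def .
qed

definition fchar :: "real pmf \<Rightarrow> real \<Rightarrow> real \<Rightarrow> real \<Rightarrow> complex" where
  "fchar X \<mu> \<sigma> s = (\<Sum>x\<in>set_pmf X. pmf X x *\<^sub>R cis (s * ((x - \<mu>) / \<sigma>)))"

text \<open>For an integer variable divided by \<open>\<sigma>\<close>, a full frequency period has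
  length \<open>2 * pi * \<sigma>\<close>, and integration against one character isolates one
  atom.\<close>

lemma lattice_inversion:
  assumes fin: "finite (set_pmf X)" and int: "set_pmf X \<subseteq> range of_int" and \<sigma>: "0 < \<sigma>"
  shows "integrable lborel (\<lambda>s. indicator {-(pi*\<sigma>)..pi*\<sigma>} s *\<^sub>R (cis (- (s * ((of_int j - \<mu>) / \<sigma>))) * fchar X \<mu> \<sigma> s))"
    and "(\<integral>s. indicator {-(pi*\<sigma>)..pi*\<sigma>} s *\<^sub>R (cis (- (s * ((of_int j - \<mu>) / \<sigma>))) * fchar X \<mu> \<sigma> s) \<partial>lborel)
      = of_real (2 * pi * (\<sigma> * pmf X (of_int j)))"
proof -
  let ?I = "\<lambda>s. indicator {-(pi*\<sigma>)..pi*\<sigma>} s :: real"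
  have eq: "?I s *\<^sub>R (cis (- (s * ((of_int j - \<mu>) / \<sigma>))) * fchar X \<mu> \<sigma> s)
      = (\<Sum>x\<in>set_pmf X. pmf X x *\<^sub>R (?I s *\<^sub>R cis (s * ((x - of_int j) / \<sigma>))))" for s
  proof -
    have cc: "cis (- (s * ((of_int j - \<mu>) / \<sigma>))) * cis (s * ((x - \<mu>) / \<sigma>)) = cis (s * ((x - of_int j) / \<sigma>))" for x
      by (simp add: cis_mult algebra_simps diff_divide_distrib)
    show ?thesis unfolding fchar_def sum_distrib_left scaleR_sum_right
      by (intro sum.cong refl) (simp only: mult_scaleR_right cc scaleR_left_commute)
  qed
  show "integrable lborel (\<lambda>s. ?I s *\<^sub>R (cis (- (s * ((of_int j - \<mu>) / \<sigma>))) * fchar X \<mu> \<sigma> s))"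
    unfolding eq by (intro Bochner_Integration.integrable_sum integrable_scaleR_right integrable_indicator_cis)
  have tm: "(\<integral>s. ?I s *\<^sub>R cis (s * ((x - of_int j) / \<sigma>)) \<partial>lborel) = (if x = of_int j then of_real (2 * pi * \<sigma>) else 0)"
    if "x \<in> set_pmf X" for x
  proof -
    obtain i :: int where i: "x = of_int i" using \<open>x \<in> set_pmf X\<close> int by auto
    show ?thesis using integral_cis_period[OF \<sigma>, of "i - j"] by (simp add: i)
  qed
  have "(\<integral>s. ?I s *\<^sub>R (cis (- (s * ((of_int j - \<mu>) / \<sigma>))) * fchar X \<mu> \<sigma> s) \<partial>lborel)
      = (\<Sum>x\<in>set_pmf X. pmf X x *\<^sub>R (\<integral>s. ?I s *\<^sub>R cis (s * ((x - of_int j) / \<sigma>)) \<partial>lborel))"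
    unfolding eq Bochner_Integration.integral_sum[OF integrable_scaleR_right[OF integrable_indicator_cis]]
    by (intro sum.cong refl integral_scaleR_right integrable_indicator_cis)
  also have "\<dots> = (\<Sum>x\<in>set_pmf X. if x = of_int j then pmf X x *\<^sub>R complex_of_real (2 * pi * \<sigma>) else 0)"
  proof (intro sum.cong refl)
    fix x assume x: "x \<in> set_pmf X"
    show "pmf X x *\<^sub>R (\<integral>s. ?I s *\<^sub>R cis (s * ((x - of_int j) / \<sigma>)) \<partial>lborel) = (if x = of_int j then pmf X x *\<^sub>R complex_of_real (2 * pi * \<sigma>) else 0)"
      unfolding tm[OF x] by simp
  qed
  also have "\<dots> = of_real (2 * pi * (\<sigma> * pmf X (of_int j)))"
    using fin by (auto simp: scaleR_conv_of_real set_pmf_iff)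
  finally show "(\<integral>s. ?I s *\<^sub>R (cis (- (s * ((of_int j - \<mu>) / \<sigma>))) * fchar X \<mu> \<sigma> s) \<partial>lborel) = of_real (2 * pi * (\<sigma> * pmf X (of_int j)))" .
qed

lemma exp_eq_density: "exp (- (s::real)\<^sup>2 / 2) = sqrt (2 * pi) * std_normal_density s"
  by (simp add: std_normal_density_def)

text \<open>Fourier inversion for the normal law; it reduces to the known characteristic function
  because the Gaussian is its own transform up to a factor.\<close>

lemma gaussian_inversion:
  shows "integrable lborel (\<lambda>s. cis (- (s * z)) * of_real (exp (- s\<^sup>2 / 2)))"
    and "(\<integral>s. cis (- (s * z)) * of_real (exp (- s\<^sup>2 / 2)) \<partial>lborel) = of_real (2 * pi * std_normal_density z)"
proof -
  have eq: "cis (- (s * z)) * of_real (exp (- s\<^sup>2 / 2)) = of_real (sqrt (2 * pi)) * (std_normal_density s *\<^sub>R iexp (- z * s))" for s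
    unfolding exp_eq_density cis_conv_exp by (simp add: scaleR_conv_of_real mult_ac)
  have "integrable lborel (\<lambda>s. std_normal_density s)" using integrable_std_normal_moment[of 0] by simp
  then have i: "integrable lborel (\<lambda>s. std_normal_density s *\<^sub>R iexp (- z * s))"
    by (rule Bochner_Integration.integrable_bound) (auto simp: norm_mult normal_density_nonneg)
  show "integrable lborel (\<lambda>s. cis (- (s * z)) * of_real (exp (- s\<^sup>2 / 2)))"
    unfolding eq by (intro integrable_mult_right i)
  have "char std_normal_distribution (- z) = (\<integral>s. std_normal_density s *\<^sub>R iexp (- z * s) \<partial>lborel)"
    unfolding char_def by (subst integral_density) (auto simp: normal_density_nonneg)
  then have "(\<integral>s. std_normal_density s *\<^sub>R iexp (- z * s) \<partial>lborel) = of_real (exp (- z\<^sup>2 / 2))"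
    by (simp add: char_std_normal_distribution)
  then have "(\<integral>s. cis (- (s * z)) * of_real (exp (- s\<^sup>2 / 2)) \<partial>lborel) = of_real (sqrt (2 * pi) * exp (- z\<^sup>2 / 2))"
    unfolding eq integral_mult_right_zero by simp
  moreover have "sqrt (2 * pi) * exp (- z\<^sup>2 / 2) = 2 * pi * std_normal_density z"
    unfolding exp_eq_density mult.assoc[symmetric] by simp
  ultimately show "(\<integral>s. cis (- (s * z)) * of_real (exp (- s\<^sup>2 / 2)) \<partial>lborel) = of_real (2 * pi * std_normal_density z)" by (simp only:)
qed

text \<open>With the cutoff \<open>T = n^(1/50)\<close>, the twentieth moment bounds the Gaussian tail by \<open>O(n^(-2/5))\<close>.\<close>

definition gmom :: real where "gmom = (\<integral>s. std_normal_density s * s ^ 20 \<partial>lborel)"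

lemma gmom_nonneg: "0 \<le> gmom"
  unfolding gmom_def by (intro integral_nonneg_AE) (auto simp: normal_density_nonneg)

text \<open>The two inversion integrals are subtracted and the integrand is dominated by
  \<open>w\<close>: by \<open>d\<close> for frequencies up to \<open>T\<close>, by \<open>d'\<close>
  on the rest of the period, and by the Gaussian itself wherever it is not compared. Some factors
  are enlarged to \<open>pi\<close> to obtain a simple bound.\<close>

lemma local_limit_bound:
  assumes fin: "finite (set_pmf X)" and int: "set_pmf X \<subseteq> range of_int" and \<sigma>: "0 < \<sigma>"
    and T: "0 < T" "T \<le> pi * \<sigma>" and d: "0 \<le> d" "0 \<le> d'"
    and major: "\<And>s. \<bar>s\<bar> \<le> T \<Longrightarrow> norm (fchar X \<mu> \<sigma> s - of_real (exp (- s\<^sup>2 / 2))) \<le> d"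
    and minor: "\<And>s. T \<le> \<bar>s\<bar> \<Longrightarrow> \<bar>s\<bar> \<le> pi * \<sigma> \<Longrightarrow> norm (fchar X \<mu> \<sigma> s) \<le> d'"
  shows "\<bar>\<sigma> * pmf X (of_int j) - std_normal_density ((of_int j - \<mu>) / \<sigma>)\<bar> \<le> T * d + pi * \<sigma> * d' + gmom / T ^ 20"
proof -
  let ?I = "\<lambda>s. indicator {-(pi*\<sigma>)..pi*\<sigma>} s :: real"
  define z where "z = (of_int j - \<mu>) / \<sigma>"
  define f where "f s = ?I s *\<^sub>R (cis (- (s * z)) * fchar X \<mu> \<sigma> s) - cis (- (s * z)) * of_real (exp (- s\<^sup>2 / 2))" for s
  define w where "w s = indicator {-T..T} s * d + ?I s * d' + sqrt (2 * pi) / T ^ 20 * (std_normal_density s * s ^ 20)" for s :: real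
  note L = lattice_inversion[OF fin int \<sigma>, of j \<mu>, folded z_def]
  note G = gaussian_inversion[of z]
  have fi: "integrable lborel f" unfolding f_def by (intro Bochner_Integration.integrable_diff L(1) G(1))
  have fe: "integral\<^sup>L lborel f = of_real (2 * pi * (\<sigma> * pmf X (of_int j) - std_normal_density z))"
    unfolding f_def by (subst Bochner_Integration.integral_diff[OF L(1) G(1)]) (simp only: L(2) G(2) of_real_diff right_diff_distrib)
  have i1: "integrable lborel (\<lambda>s. indicator {-T..T} s * d)" "integrable lborel (\<lambda>s. ?I s * d')"
    by (auto intro!: integrable_mult_left integrable_real_indicator simp: emeasure_lborel_Icc_eq)
  have i2: "integrable lborel (\<lambda>s. sqrt (2 * pi) / T ^ 20 * (std_normal_density s * s ^ 20))"
    by (intro integrable_mult_right integrable_std_normal_moment)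
  have wi: "integrable lborel w" unfolding w_def by (intro Bochner_Integration.integrable_add i1 i2)
  have we: "integral\<^sup>L lborel w = 2 * T * d + 2 * pi * \<sigma> * d' + sqrt (2 * pi) / T ^ 20 * gmom"
  proof -
    have "integral\<^sup>L lborel w = (\<integral>s. indicator {-T..T} s * d \<partial>lborel) + (\<integral>s. ?I s * d' \<partial>lborel) + (\<integral>s. sqrt (2 * pi) / T ^ 20 * (std_normal_density s * s ^ 20) \<partial>lborel)"
      unfolding w_def using i1 i2 by (simp only: Bochner_Integration.integral_add Bochner_Integration.integrable_add)
    then show ?thesis using T \<sigma> by (simp add: gmom_def)
  qed
  have pt: "norm (f s) \<le> w s" for s
  proof -
    have fs: "f s = cis (- (s * z)) * (?I s *\<^sub>R fchar X \<mu> \<sigma> s - of_real (exp (- s\<^sup>2 / 2)))"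
      by (simp add: f_def algebra_simps)
    have nf: "norm (f s) = norm (?I s *\<^sub>R fchar X \<mu> \<sigma> s - of_real (exp (- s\<^sup>2 / 2)))"
      unfolding fs norm_mult by simp
    have w3: "sqrt (2 * pi) / T ^ 20 * (std_normal_density s * s ^ 20) = exp (- s\<^sup>2 / 2) * (s / T) ^ 20"
      unfolding exp_eq_density by (simp add: power_divide)
    have w30: "0 \<le> exp (- s\<^sup>2 / 2) * (s / T) ^ 20" by simp
    show ?thesis
    proof (cases "\<bar>s\<bar> \<le> T")
      case True
      then have "s \<in> {-T..T}" "s \<in> {-(pi*\<sigma>)..pi*\<sigma>}" using T by auto
      then have ind: "indicator {-T..T} s = (1::real)" "?I s = 1" by simp_all
      show ?thesis unfolding nf w_def w3 ind scaleR_one mult_1_left using major[OF True] d w30 by linarith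
    next
      case False
      have "1 \<le> \<bar>s / T\<bar>" using False T by simp
      then have "1 \<le> \<bar>s / T\<bar> ^ 20" by (rule one_le_power)
      then have "1 \<le> (s / T) ^ 20" by (simp only: power_even_abs even_numeral)
      \<comment> \<open>Beyond \<open>T\<close> the factor \<open>(s / T) ^ 20\<close> is at least
        one, so the Gaussian tail is bounded by a moment.\<close>
      then have e: "exp (- s\<^sup>2 / 2) \<le> exp (- s\<^sup>2 / 2) * (s / T) ^ 20" by simp
      have ne: "norm (complex_of_real (exp (- s\<^sup>2 / 2))) = exp (- s\<^sup>2 / 2)" by (simp only: norm_of_real abs_exp_cancel)
      have ns: "s \<notin> {-T..T}" using False by auto
      show ?thesis
      proof (cases "\<bar>s\<bar> \<le> pi * \<sigma>")
        case True
        then have "s \<in> {-(pi*\<sigma>)..pi*\<sigma>}" by auto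
        moreover have "norm (fchar X \<mu> \<sigma> s - of_real (exp (- s\<^sup>2 / 2))) \<le> d' + exp (- s\<^sup>2 / 2)"
          using norm_triangle_ineq4[of "fchar X \<mu> \<sigma> s" "of_real (exp (- s\<^sup>2 / 2))"] minor[of s] True False ne by linarith
        moreover have "?I s = 1" "indicator {-T..T} s = (0::real)" using calculation(1) ns by simp_all
        ultimately show ?thesis unfolding nf w_def w3 using e by (simp only: scaleR_one mult_1_left mult_zero_left)
      next
        case f: False
        then have "s \<notin> {-(pi*\<sigma>)..pi*\<sigma>}" by auto
        then have "?I s = 0" "indicator {-T..T} s = (0::real)" using ns by simp_all
        then show ?thesis unfolding nf w_def w3 using e ne by (simp only: scaleR_zero_left mult_zero_left diff_0 norm_minus_cancel)
      qed
    qed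
  qed
  have "norm (integral\<^sup>L lborel f) \<le> integral\<^sup>L lborel w"
    using Bochner_Integration.integral_norm_bound_integral[OF fi wi] pt by blast
  then have "2 * pi * \<bar>\<sigma> * pmf X (of_int j) - std_normal_density z\<bar> \<le> 2 * T * d + 2 * pi * \<sigma> * d' + sqrt (2 * pi) / T ^ 20 * gmom"
    unfolding fe we norm_of_real by (simp add: abs_mult)
  moreover have "sqrt (2 * pi) / T ^ 20 * gmom \<le> 2 * pi * (gmom / T ^ 20)"
  proof -
    have "2 * pi \<le> (2 * pi)\<^sup>2" using pi_gt3 by (intro self_le_power) auto
    then have "sqrt (2 * pi) \<le> 2 * pi" using pi_gt3 by (intro real_le_lsqrt) auto
    then have "sqrt (2 * pi) * (gmom / T ^ 20) \<le> 2 * pi * (gmom / T ^ 20)"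
      using gmom_nonneg T by (intro mult_right_mono divide_nonneg_nonneg) auto
    then show ?thesis by simp
  qed
  moreover have "2 * T * d \<le> 2 * pi * (T * d)" using pi_gt3 T d mult_right_mono[of 1 pi "T * d"] by simp
  moreover have "2 * pi * \<sigma> * d' \<le> 2 * pi * (pi * \<sigma> * d')"
    using pi_gt3 \<sigma> d mult_right_mono[of 1 pi "\<sigma> * d'"] mult_left_mono[of "\<sigma> * d'" "pi * (\<sigma> * d')" "2 * pi"] by (simp add: mult_ac)
  ultimately have "2 * pi * \<bar>\<sigma> * pmf X (of_int j) - std_normal_density z\<bar> \<le> 2 * pi * (T * d + pi * \<sigma> * d' + gmom / T ^ 20)"
    by (simp only: distrib_left)
  then show ?thesis unfolding z_def[symmetric] using pi_gt_zero by (simp only: mult_le_cancel_left_pos mult_pos_pos zero_less_numeral)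
qed

text \<open>Comparison with the Cauchy density through the quadratic Taylor bound for
  \<open>exp\<close> at \<open>z^2 / 2\<close>; sums of the latter over a lattice are accessible via
  \<open>arctan\<close>.\<close>

lemma std_normal_density_decay:
  "std_normal_density z \<le> 2 / (1 + z\<^sup>2)" "std_normal_density z * z\<^sup>2 \<le> 8 / (1 + z\<^sup>2)"
proof -
  define u where "u = z\<^sup>2 / 2"
  have u: "0 \<le> u" "z\<^sup>2 = 2 * u" by (simp_all add: u_def)
  have c: "1 / sqrt (2 * pi) \<le> 1"
  proof -
    have "1 \<le> sqrt (2 * pi)" using pi_gt3 by simp
    then show ?thesis by simp
  qed
  have N: "std_normal_density z \<le> exp (- u)"
    using mult_right_mono[OF c, of "exp (- u)"] by (simp add: std_normal_density_def u_def)
  have e: "1 + u + u\<^sup>2 / 2 \<le> exp u" by (rule exp_lower_Taylor_quadratic[OF u(1)])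
  have pu: "0 < 1 + u + u\<^sup>2 / 2" using u by (simp add: add_pos_nonneg)
  have E: "exp (- u) \<le> 1 / (1 + u + u\<^sup>2 / 2)"
    using e pu by (simp add: exp_minus field_simps)
  have p2: "0 < 1 + 2 * u" using u by simp
  have "1 / (1 + u + u\<^sup>2 / 2) \<le> 2 / (1 + 2 * u)" using pu p2 u by (simp add: field_simps)
  then show "std_normal_density z \<le> 2 / (1 + z\<^sup>2)" using N E unfolding u(2) by linarith
  have "1 / (1 + u + u\<^sup>2 / 2) * (2 * u) \<le> 8 / (1 + 2 * u)"
    using pu p2 u by (simp add: field_simps power2_eq_square)
  moreover have "std_normal_density z * (2 * u) \<le> 1 / (1 + u + u\<^sup>2 / 2) * (2 * u)"
    using N E u by (intro mult_right_mono) auto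
  ultimately show "std_normal_density z * z\<^sup>2 \<le> 8 / (1 + z\<^sup>2)" unfolding u(2) by linarith
qed

text \<open>The sum is compared with the telescoping increments of \<open>arctan\<close>.\<close>

lemma cauchy_lattice_sum:
  fixes F :: "int set" and \<mu> \<sigma> :: real
  assumes F: "finite F" and \<sigma>: "0 < \<sigma>"
  shows "(\<Sum>j\<in>F. 1 / (1 + ((of_int j - \<mu>) / \<sigma>)\<^sup>2) / \<sigma>) \<le> 4 * (2 + 2 / \<sigma>\<^sup>2)"
proof -
  define z where "z j = (of_int j - \<mu>) / \<sigma>" for j :: int
  define a where "a j = arctan (z j)" for j :: int
  define c where "c = 2 + 2 / \<sigma>\<^sup>2"
  have c: "0 < c" using \<sigma> by (simp add: c_def add_pos_pos)
  have zd: "z j - z (j - 1) = 1 / \<sigma>" for j by (simp add: z_def diff_divide_distrib[symmetric])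
  have ltz: "z (j - 1) < z j" for j
  proof -
    have "0 < 1 / \<sigma>" using \<sigma> by simp
    then show ?thesis using zd[of j] by linarith
  qed
  have step: "1 / (1 + (z j)\<^sup>2) / \<sigma> \<le> c * (a j - a (j - 1))" for j
  proof -
    \<comment> \<open>The increment of \<open>arctan\<close> is the Cauchy weight at an intermediate
      point less than one lattice step \<open>1 / \<sigma>\<close> away; the factor \<open>c\<close>
      pays for replacing that point by \<open>z j\<close>.\<close>
    obtain y where y: "z (j - 1) < y" "y < z j" "arctan (z j) - arctan (z (j - 1)) = (z j - z (j - 1)) * inverse (1 + y\<^sup>2)"
      using MVT2[OF ltz, of j arctan "\<lambda>x. inverse (1 + x\<^sup>2)"] DERIV_arctan by blast
    have "\<bar>y - z j\<bar> \<le> 1 / \<sigma>" using y zd[of j] by linarith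
    then have "(y - z j)\<^sup>2 \<le> (1 / \<sigma>)\<^sup>2" using \<sigma> by (intro power2_le_iff_abs_le[THEN iffD2]) auto
    moreover have "y\<^sup>2 \<le> 2 * (z j)\<^sup>2 + 2 * (y - z j)\<^sup>2"
    proof -
      have "0 \<le> (y - 2 * z j)\<^sup>2" by simp
      then show ?thesis by (simp add: power2_eq_square algebra_simps)
    qed
    ultimately have "y\<^sup>2 \<le> 2 * (z j)\<^sup>2 + 2 / \<sigma>\<^sup>2" by (simp add: power_divide)
    moreover have "0 \<le> 2 / \<sigma>\<^sup>2 * (z j)\<^sup>2" by simp
    ultimately have yc: "1 + y\<^sup>2 \<le> c * (1 + (z j)\<^sup>2)" unfolding c_def distrib_left distrib_right by linarith
    have p: "0 < 1 + y\<^sup>2" "0 < 1 + (z j)\<^sup>2" by (simp_all add: add_pos_nonneg)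
    have "1 / (1 + (z j)\<^sup>2) \<le> c * (1 / (1 + y\<^sup>2))" using yc p by (simp add: field_simps)
    then have "1 / (1 + (z j)\<^sup>2) / \<sigma> \<le> c * (1 / (1 + y\<^sup>2)) / \<sigma>" using \<sigma> by (intro divide_right_mono) auto
    moreover have "c * (1 / (1 + y\<^sup>2)) / \<sigma> = c * (a j - a (j - 1))"
      unfolding a_def y(3) zd by (simp add: inverse_eq_divide)
    ultimately show ?thesis by linarith
  qed
  have mono: "0 \<le> a j - a (j - 1)" for j
    unfolding a_def using ltz[of j] by (simp add: arctan_le_iff less_imp_le)
  have tele: "(\<Sum>j\<in>{l..<l + int r}. a j - a (j - 1)) = a (l + int r - 1) - a (l - 1)" for l r
  proof (induction r)
    case (Suc r)
    have "{l..<l + int (Suc r)} = insert (l + int r) {l..<l + int r}" by auto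
    then show ?case using Suc by simp
  qed simp
  obtain L where L: "\<And>j. j \<in> F \<Longrightarrow> \<bar>j\<bar> \<le> int L"
  proof -
    have "finite ((\<lambda>j. nat \<bar>j\<bar>) ` F)" using F by simp
    then obtain L where "\<forall>x\<in>(\<lambda>j. nat \<bar>j\<bar>) ` F. x \<le> L" using finite_nat_set_iff_bounded_le by blast
    then show thesis by (intro that[of L]) auto
  qed
  have sub: "F \<subseteq> {- int L..<- int L + int (2 * L + 1)}"
  proof
    fix j assume "j \<in> F"
    from L[OF this] show "j \<in> {- int L..<- int L + int (2 * L + 1)}" by auto
  qed
  have "(\<Sum>j\<in>F. 1 / (1 + (z j)\<^sup>2) / \<sigma>) \<le> (\<Sum>j\<in>F. c * (a j - a (j - 1)))" by (intro sum_mono step)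
  also have "\<dots> \<le> (\<Sum>j\<in>{- int L..<- int L + int (2 * L + 1)}. c * (a j - a (j - 1)))"
    using sub mono c by (intro sum_mono2) auto
  also have "\<dots> = c * (a (- int L + int (2 * L + 1) - 1) - a (- int L - 1))"
    unfolding sum_distrib_left[symmetric] tele ..
  also have "\<dots> \<le> c * 4"
  proof -
    have "a i - a j \<le> 4" for i j
      unfolding a_def using arctan_ubound[of "z i"] arctan_lbound[of "z j"] pi_less_4 by linarith
    then show ?thesis using c by (intro mult_left_mono) auto
  qed
  finally show ?thesis by (simp add: z_def c_def mult.commute)
qed

section \<open>From a uniform bound to total variation\<close>

lemma sum_pmf_int_le_1:
  assumes "finite (F :: int set)"
  shows "(\<Sum>j\<in>F. pmf X (of_int j :: real)) \<le> 1"
proof -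
  have "(\<Sum>j\<in>F. pmf X (of_int j :: real)) = sum (pmf X) (of_int ` F)"
    by (subst sum.reindex) (auto simp: inj_on_def)
  also have "\<dots> = measure (measure_pmf X) (of_int ` F)" using assms by (simp add: measure_measure_pmf_finite)
  finally show ?thesis by simp
qed

lemma pmf_tail_le:
  fixes X :: "real pmf"
  assumes F: "finite (F :: int set)" and fin: "finite (set_pmf X)" and a: "0 < a"
    and far: "\<And>j. j \<in> F \<Longrightarrow> a \<le> \<bar>of_int j - measure_pmf.expectation X (\<lambda>x. x)\<bar>"
  shows "(\<Sum>j\<in>F. pmf X (of_int j)) \<le> measure_pmf.variance X (\<lambda>x. x) / a\<^sup>2"
proof -
  let ?\<mu> = "measure_pmf.expectation X (\<lambda>x. x)"
  have "(\<Sum>j\<in>F. pmf X (of_int j)) = sum (pmf X) (of_int ` F)"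
    by (subst sum.reindex) (auto simp: inj_on_def)
  also have "\<dots> = measure (measure_pmf X) (of_int ` F)" using F by (simp add: measure_measure_pmf_finite)
  also have "\<dots> \<le> measure (measure_pmf X) {x \<in> space X. a \<le> \<bar>x - ?\<mu>\<bar>}"
    using far by (intro measure_pmf.finite_measure_mono) auto
  also have "\<dots> \<le> measure_pmf.variance X (\<lambda>x. x) / a\<^sup>2"
    using a fin by (intro measure_pmf.Chebyshev_inequality) (auto intro: integrable_measure_pmf_finite)
  finally show ?thesis .
qed

text \<open>Both conclusions in one predicate, monotone in the bound. Summability is included
  because the infinite sum of a family that is not summable is \<open>0\<close> by
  convention.\<close>

definition llt_error_le :: "real pmf \<Rightarrow> real \<Rightarrow> bool" where
  "llt_error_le X B \<longleftrightarrow> (let \<mu> = measure_pmf.expectation X (\<lambda>x. x); \<sigma> = sqrt (measure_pmf.variance X (\<lambda>x. x))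
      in (\<forall>j::int. \<bar>\<sigma> * pmf X (of_int j) - std_normal_density ((of_int j - \<mu>) / \<sigma>)\<bar> \<le> B)
       \<and> (\<lambda>j::int. \<bar>pmf X (of_int j) - std_normal_density ((of_int j - \<mu>) / \<sigma>) / \<sigma>\<bar>) summable_on UNIV
       \<and> (\<Sum>\<^sub>\<infinity>j::int. \<bar>pmf X (of_int j) - std_normal_density ((of_int j - \<mu>) / \<sigma>) / \<sigma>\<bar>) \<le> B)"

lemma llt_error_leI:
  assumes mu: "\<mu> = measure_pmf.expectation X (\<lambda>x. x)" and sig: "\<sigma> = sqrt (measure_pmf.variance X (\<lambda>x. x))"
    and sup: "\<And>j::int. \<bar>\<sigma> * pmf X (of_int j) - std_normal_density ((of_int j - \<mu>) / \<sigma>)\<bar> \<le> B"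
    and fin: "\<And>F. finite F \<Longrightarrow> (\<Sum>j\<in>F. \<bar>pmf X (of_int j) - std_normal_density ((of_int j - \<mu>) / \<sigma>) / \<sigma>\<bar>) \<le> B"
  shows "llt_error_le X B"
proof -
  define g where "g j = \<bar>pmf X (of_int j) - std_normal_density ((of_int j - \<mu>) / \<sigma>) / \<sigma>\<bar>" for j :: int
  have g: "sum g F \<le> B" if "finite F" for F using fin[OF that] by (simp add: g_def)
  have s: "g summable_on UNIV"
    by (rule nonneg_bdd_above_summable_on) (use g in \<open>auto simp: g_def intro!: bdd_aboveI2[of _ _ B]\<close>)
  have "infsum g UNIV \<le> B" by (rule infsum_le_finite_sums[OF s]) (use g in auto)
  with s sup show ?thesis unfolding llt_error_le_def Let_def mu[symmetric] sig[folded mu, symmetric] g_def by simp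
qed

lemma llt_error_le_mono: "llt_error_le X B \<Longrightarrow> B \<le> B' \<Longrightarrow> llt_error_le X B'"
  unfolding llt_error_le_def Let_def by (meson order.trans)

text \<open>This covers \<open>\<sigma> = 0\<close> as well, where division by zero removes the density from the sum.\<close>

lemma llt_error_finite:
  fixes X :: "real pmf"
  shows "\<exists>B. llt_error_le X B"
proof -
  define \<mu> where "\<mu> = measure_pmf.expectation X (\<lambda>x. x)"
  define \<sigma> where "\<sigma> = sqrt (measure_pmf.variance X (\<lambda>x. x))"
  define z where "z j = (of_int j - \<mu>) / \<sigma>" for j :: int
  have s0: "0 \<le> \<sigma>" unfolding \<sigma>_def by (intro real_sqrt_ge_zero integral_nonneg_AE) auto
  have N: "0 \<le> std_normal_density y" "std_normal_density y \<le> 2" for y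
  proof -
    have "2 / (1 + y\<^sup>2) \<le> 2 / 1" by (intro divide_left_mono) (auto simp: add_pos_nonneg)
    then show "std_normal_density y \<le> 2" using std_normal_density_decay(1)[of y] by simp
  qed (simp add: normal_density_nonneg)
  define R where "R = 8 * (2 + 2 / \<sigma>\<^sup>2)"
  define B where "B = \<sigma> + 3 + R"
  have q: "0 \<le> R" by (simp add: R_def)
  have "llt_error_le X B"
  proof (rule llt_error_leI[OF \<mu>_def \<sigma>_def])
    fix j :: int
    have "\<sigma> * pmf X (of_int j) \<le> \<sigma> * 1" using s0 by (intro mult_left_mono pmf_le_1)
    moreover have "0 \<le> \<sigma> * pmf X (of_int j)" using s0 by simp
    ultimately show "\<bar>\<sigma> * pmf X (of_int j) - std_normal_density ((of_int j - \<mu>) / \<sigma>)\<bar> \<le> B"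
      using N[of "(of_int j - \<mu>) / \<sigma>"] q unfolding B_def by linarith
  next
    fix F :: "int set" assume F: "finite F"
    have "(\<Sum>j\<in>F. \<bar>pmf X (of_int j) - std_normal_density (z j) / \<sigma>\<bar>) \<le> (\<Sum>j\<in>F. pmf X (of_int j) + 2 * (1 / (1 + (z j)\<^sup>2) / \<sigma>))"
    proof (intro sum_mono)
      fix j
      have "std_normal_density (z j) / \<sigma> \<le> 2 / (1 + (z j)\<^sup>2) / \<sigma>" using s0 by (intro divide_right_mono std_normal_density_decay)
      moreover have "0 \<le> std_normal_density (z j) / \<sigma>" using s0 N by simp
      moreover have "0 \<le> pmf X (of_int j)" by simp
      moreover have "2 / (1 + (z j)\<^sup>2) / \<sigma> = 2 * (1 / (1 + (z j)\<^sup>2) / \<sigma>)" by simp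
      ultimately show "\<bar>pmf X (of_int j) - std_normal_density (z j) / \<sigma>\<bar> \<le> pmf X (of_int j) + 2 * (1 / (1 + (z j)\<^sup>2) / \<sigma>)" by linarith
    qed
    also have "\<dots> = (\<Sum>j\<in>F. pmf X (of_int j)) + 2 * (\<Sum>j\<in>F. 1 / (1 + (z j)\<^sup>2) / \<sigma>)"
      by (simp add: sum.distrib sum_distrib_left)
    also have "\<dots> \<le> 1 + 2 * (4 * (2 + 2 / \<sigma>\<^sup>2))"
    proof (intro add_mono mult_left_mono sum_pmf_int_le_1 F)
      show "(\<Sum>j\<in>F. 1 / (1 + (z j)\<^sup>2) / \<sigma>) \<le> 4 * (2 + 2 / \<sigma>\<^sup>2)"
        using cauchy_lattice_sum[OF F, of \<sigma> \<mu>] s0 by (cases "\<sigma> = 0") (auto simp: z_def)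
    qed auto
    also have "\<dots> \<le> B" using s0 by (simp add: B_def R_def)
    finally show "(\<Sum>j\<in>F. \<bar>pmf X (of_int j) - std_normal_density ((of_int j - \<mu>) / \<sigma>) / \<sigma>\<bar>) \<le> B" by (simp add: z_def)
  qed
  then show ?thesis ..
qed

text \<open>Within \<open>M\<close> standard deviations there are at most
  \<open>2 * M * \<sigma> + 1\<close>, hence at most \<open>3 * M * \<sigma>\<close>, lattice
  points, each contributing \<open>h / \<sigma>\<close>. Outside, Chebyshev gives
  \<open>1 / M^2\<close> for the variable, and the decay of the normal density gives
  \<open>8 * 16 / M^2\<close>.\<close>

lemma llt_error_from_sup:
  fixes X :: "real pmf"
  assumes fin: "finite (set_pmf X)"
    and mu: "\<mu> = measure_pmf.expectation X (\<lambda>x. x)" and sig: "\<sigma> = sqrt (measure_pmf.variance X (\<lambda>x. x))"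
    and s1: "1 \<le> \<sigma>" and M: "1 \<le> M"
    and sup: "\<And>j::int. \<bar>\<sigma> * pmf X (of_int j) - std_normal_density ((of_int j - \<mu>) / \<sigma>)\<bar> \<le> h"
  shows "llt_error_le X (3 * M * h + 129 / M\<^sup>2)"
proof (rule llt_error_leI[OF mu sig])
  have s0: "0 < \<sigma>" using s1 by simp
  have h0: "0 \<le> h" using sup[of 0] abs_ge_zero order.trans by blast
  have M0: "0 < M" using M by simp
  define z where "z j = (of_int j - \<mu>) / \<sigma>" for j :: int
  have Mh: "1 * h \<le> M * h" using M h0 by (intro mult_right_mono) auto
  show "\<bar>\<sigma> * pmf X (of_int j) - std_normal_density ((of_int j - \<mu>) / \<sigma>)\<bar> \<le> 3 * M * h + 129 / M\<^sup>2" for j :: int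
  proof -
    have "0 \<le> 129 / M\<^sup>2" by simp
    then show ?thesis using sup[of j] Mh h0 by linarith
  qed
  fix F :: "int set" assume F: "finite F"
  define Fc where "Fc = {j \<in> F. \<bar>z j\<bar> \<le> M}"
  define Fo where "Fo = {j \<in> F. M < \<bar>z j\<bar>}"
  have FF: "F = Fc \<union> Fo" "Fc \<inter> Fo = {}" "finite Fc" "finite Fo" using F by (auto simp: Fc_def Fo_def)
  define g where "g j = \<bar>pmf X (of_int j) - std_normal_density (z j) / \<sigma>\<bar>" for j :: int
  have "sum g Fc \<le> 3 * M * h"
  proof -
    have "g j \<le> h / \<sigma>" for j
    proof -
      have "g j = \<bar>\<sigma> * pmf X (of_int j) - std_normal_density (z j)\<bar> / \<sigma>"
      proof -
        have "pmf X (of_int j) - std_normal_density (z j) / \<sigma> = (\<sigma> * pmf X (of_int j) - std_normal_density (z j)) / \<sigma>"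
          using s0 by (simp add: diff_divide_distrib)
        then show ?thesis unfolding g_def using s0 by (simp add: abs_divide)
      qed
      then show ?thesis using sup[of j] s0 by (auto simp: z_def intro!: divide_right_mono)
    qed
    then have "sum g Fc \<le> real (card Fc) * (h / \<sigma>)" using sum_bounded_above[of Fc g "h / \<sigma>"] by simp
    moreover have "real (card Fc) \<le> 3 * M * \<sigma>"
    proof -
      have "Fc \<subseteq> {\<lceil>\<mu> - M * \<sigma>\<rceil>..\<lfloor>\<mu> + M * \<sigma>\<rfloor>}"
      proof
        fix j assume "j \<in> Fc"
        then have "\<bar>z j\<bar> \<le> M" by (simp add: Fc_def)
        then have "\<bar>of_int j - \<mu>\<bar> \<le> M * \<sigma>" using s0 by (simp add: z_def abs_divide pos_divide_le_eq)
        then have "\<mu> - M * \<sigma> \<le> of_int j" "of_int j \<le> \<mu> + M * \<sigma>" by linarith+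
        then show "j \<in> {\<lceil>\<mu> - M * \<sigma>\<rceil>..\<lfloor>\<mu> + M * \<sigma>\<rfloor>}" by (simp add: ceiling_le_iff le_floor_iff)
      qed
      then have "card Fc \<le> card {\<lceil>\<mu> - M * \<sigma>\<rceil>..\<lfloor>\<mu> + M * \<sigma>\<rfloor>}" by (intro card_mono) auto
      then have cc: "real (card Fc) \<le> real (nat (\<lfloor>\<mu> + M * \<sigma>\<rfloor> + 1 - \<lceil>\<mu> - M * \<sigma>\<rceil>))" by simp
      have "1 * 1 \<le> M * \<sigma>" using M s1 by (intro mult_mono) auto
      then show ?thesis using cc by linarith
    qed
    then have "real (card Fc) * (h / \<sigma>) \<le> 3 * M * \<sigma> * (h / \<sigma>)" using h0 s0 by (intro mult_right_mono) auto
    then have "real (card Fc) * (h / \<sigma>) \<le> 3 * M * h" using s0 by simp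
    ultimately show ?thesis by linarith
  qed
  moreover have "sum g Fo \<le> 129 / M\<^sup>2"
  proof -
    have "(\<Sum>j\<in>Fo. pmf X (of_int j)) \<le> measure_pmf.variance X (\<lambda>x. x) / (M * \<sigma>)\<^sup>2"
    proof (rule pmf_tail_le[OF FF(4) fin])
      fix j assume "j \<in> Fo"
      then have "M < \<bar>z j\<bar>" by (simp add: Fo_def)
      then have "M * \<sigma> \<le> \<bar>of_int j - \<mu>\<bar>" using s0 by (simp add: z_def abs_divide pos_less_divide_eq)
      then show "M * \<sigma> \<le> \<bar>of_int j - measure_pmf.expectation X (\<lambda>x. x)\<bar>" by (simp add: mu)
    qed (use M0 s0 in simp)
    moreover have "measure_pmf.variance X (\<lambda>x. x) / (M * \<sigma>)\<^sup>2 = 1 / M\<^sup>2"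
    proof -
      have "measure_pmf.variance X (\<lambda>x. x) = \<sigma>\<^sup>2"
        unfolding sig by (subst real_sqrt_pow2) (auto intro: integral_nonneg_AE)
      then show ?thesis using s0 M0 by (simp add: power_mult_distrib)
    qed
    moreover have "(\<Sum>j\<in>Fo. std_normal_density (z j) / \<sigma>) \<le> 8 / M\<^sup>2 * 16"
    proof -
      have "(\<Sum>j\<in>Fo. std_normal_density (z j) / \<sigma>) \<le> (\<Sum>j\<in>Fo. 8 / M\<^sup>2 * (1 / (1 + (z j)\<^sup>2) / \<sigma>))"
      proof (intro sum_mono)
        fix j assume "j \<in> Fo"
        then have "M < \<bar>z j\<bar>" by (simp add: Fo_def)
        then have "M\<^sup>2 \<le> \<bar>z j\<bar>\<^sup>2" using M0 by (intro power_mono) auto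
        then have "std_normal_density (z j) * M\<^sup>2 \<le> std_normal_density (z j) * (z j)\<^sup>2"
          by (intro mult_left_mono) (auto simp: normal_density_nonneg)
        then have "std_normal_density (z j) * M\<^sup>2 \<le> 8 / (1 + (z j)\<^sup>2)" using std_normal_density_decay(2)[of "z j"] by linarith
        then have "std_normal_density (z j) \<le> 8 / (1 + (z j)\<^sup>2) / M\<^sup>2" using M0 by (simp only: pos_le_divide_eq zero_less_power)
        then have "std_normal_density (z j) / \<sigma> \<le> 8 / (1 + (z j)\<^sup>2) / M\<^sup>2 / \<sigma>" using s0 by (intro divide_right_mono) auto
        then show "std_normal_density (z j) / \<sigma> \<le> 8 / M\<^sup>2 * (1 / (1 + (z j)\<^sup>2) / \<sigma>)" by (simp add: mult_ac)
      qed
      also have "\<dots> = 8 / M\<^sup>2 * (\<Sum>j\<in>Fo. 1 / (1 + (z j)\<^sup>2) / \<sigma>)" by (simp only: sum_distrib_left)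
      also have "\<dots> \<le> 8 / M\<^sup>2 * 16"
      proof (intro mult_left_mono)
        have "1\<^sup>2 \<le> \<sigma>\<^sup>2" using s1 by (intro power_mono) auto
        then have "2 / \<sigma>\<^sup>2 \<le> 2 / 1" by (intro divide_left_mono) auto
        then have "4 * (2 + 2 / \<sigma>\<^sup>2) \<le> 4 * (2 + 2 / 1)" by (intro mult_left_mono add_left_mono) auto
        then have "4 * (2 + 2 / \<sigma>\<^sup>2) \<le> 16" by simp
        from order.trans[OF cauchy_lattice_sum[OF FF(4) s0, of \<mu>] this]
        show "(\<Sum>j\<in>Fo. 1 / (1 + (z j)\<^sup>2) / \<sigma>) \<le> 16" unfolding z_def .
      qed simp
      finally show ?thesis .
    qed
    moreover have "sum g Fo \<le> (\<Sum>j\<in>Fo. pmf X (of_int j)) + (\<Sum>j\<in>Fo. std_normal_density (z j) / \<sigma>)"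
    proof -
      have "g j \<le> pmf X (of_int j) + std_normal_density (z j) / \<sigma>" for j
      proof -
        have "0 \<le> std_normal_density (z j) / \<sigma>" using s0 by (simp add: normal_density_nonneg)
        moreover have "0 \<le> pmf X (of_int j)" by simp
        ultimately show ?thesis unfolding g_def by linarith
      qed
      then show ?thesis unfolding sum.distrib[symmetric] by (intro sum_mono)
    qed
    ultimately show ?thesis by simp
  qed
  moreover have "sum g F = sum g Fc + sum g Fo" unfolding FF(1) using FF by (intro sum.union_disjoint) auto
  ultimately show "(\<Sum>j\<in>F. \<bar>pmf X (of_int j) - std_normal_density ((of_int j - \<mu>) / \<sigma>) / \<sigma>\<bar>) \<le> 3 * M * h + 129 / M\<^sup>2"
    by (simp add: g_def z_def)
qed

section \<open>The local limit theorem\<close>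

lemma uniform_subset_slc: "uniform_subset n m = pmf_of_set (slc n m)"
  by (simp add: uniform_subset_def slc_def)

lemma kAP_Ints: "kAP k n A \<in> \<int>"
  unfolding kAP_def by (intro Ints_sum Ints_prod) (auto simp: indicator_def)

lemma slc_ne: "m \<le> n \<Longrightarrow> slc n m \<noteq> {}"
  using card_slc[of n m] by (metis binomial_eq_0_iff card.empty not_less)

lemma expectation_kAP:
  fixes f :: "real \<Rightarrow> 'b::{banach, second_countable_topology}"
  assumes "m \<le> n"
  shows "measure_pmf.expectation (map_pmf (kAP k n) (uniform_subset n m)) f = sE n m (\<lambda>A. f (kAP k n A))"
proof -
  have "measure_pmf.expectation (map_pmf (kAP k n) (uniform_subset n m)) f = measure_pmf.expectation (pmf_of_set (slc n m)) (\<lambda>A. f (kAP k n A))"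
    by (simp add: uniform_subset_slc)
  also have "\<dots> = (\<Sum>A\<in>slc n m. pmf (pmf_of_set (slc n m)) A *\<^sub>R f (kAP k n A))"
    using slc_ne[OF assms] by (intro integral_measure_pmf) (auto simp: set_pmf_of_set)
  also have "\<dots> = (\<Sum>A\<in>slc n m. (1 / real (card (slc n m))) *\<^sub>R f (kAP k n A))"
    using slc_ne[OF assms] by (intro sum.cong refl) (auto simp: pmf_of_set)
  finally show ?thesis by (simp add: sE_def scaleR_sum_right)
qed

lemma kAP_pmf_support:
  assumes "m \<le> n"
  shows "finite (set_pmf (map_pmf (kAP k n) (uniform_subset n m)))"
    and "set_pmf (map_pmf (kAP k n) (uniform_subset n m)) \<subseteq> range of_int"
  using slc_ne[OF assms] kAP_Ints by (auto simp: uniform_subset_slc set_pmf_of_set Ints_def)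

locale cyclic_slice = coprime_modulus n k for n k :: nat +
  fixes m :: nat and lam :: real
  assumes mlam: "0 < m" "m < n" "0 < lam" "lam \<le> real m / real n" "real m / real n \<le> 1 - lam"
begin

sublocale lam_progressions n k "cyc_AP n" "cyc_pt n" m lam
  by unfold_locales (use mlam in auto)

abbreviation XP :: "real pmf" where "XP \<equiv> map_pmf (kAP k n) (uniform_subset n m)"

lemma kAP_YY: "\<exists>c. \<forall>A\<in>slc n m. kAP k n A = YY p A + c"
  using XX_eq_YY[OF n_pos m_le_n, of p] by (simp add: kAP_eq_XX p_def)

definition mX :: real where "mX = measure_pmf.expectation XP (\<lambda>x. x)"

lemma kAP_centred: "A \<in> slc n m \<Longrightarrow> kAP k n A - mX = YY p A - mu"
proof -
  assume A: "A \<in> slc n m"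
  obtain c where c: "\<And>A. A \<in> slc n m \<Longrightarrow> kAP k n A = YY p A + c" using kAP_YY by blast
  have "mX = sE n m (\<lambda>A. YY p A + c)" unfolding mX_def expectation_kAP[OF m_le_n] by (intro sE_cong c)
  also have "\<dots> = mu + c" by (simp add: sE_add sE_const[OF m_le_n] mu_def)
  finally show ?thesis using c[OF A] by simp
qed

lemma variance_kAP: "sqrt (measure_pmf.variance XP (\<lambda>x. x)) = sg"
proof -
  have "measure_pmf.variance XP (\<lambda>x. x) = sE n m (\<lambda>A. (kAP k n A - mX)\<^sup>2)"
    unfolding mX_def[symmetric] by (rule expectation_kAP[OF m_le_n])
  also have "\<dots> = s2" unfolding s2_def by (intro sE_cong) (simp add: kAP_centred)
  finally show ?thesis by (simp add: sg_def)
qed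

lemma fchar_expectation: "fchar XP mX sg s = sE n m (\<lambda>A. cis (s * ((kAP k n A - mX) / sg)))"
proof -
  have "fchar XP mX sg s = measure_pmf.expectation XP (\<lambda>x. cis (s * ((x - mX) / sg)))"
    unfolding fchar_def by (rule integral_measure_pmf[symmetric, OF kAP_pmf_support(1)[OF m_le_n]]) auto
  then show ?thesis by (simp only: expectation_kAP[OF m_le_n])
qed

lemma fchar_phi: "fchar XP mX sg s = phi s"
  unfolding fchar_expectation phi_def ZZ_def by (intro sE_cong) (simp add: kAP_centred)

lemma norm_fchar: "norm (fchar XP mX sg s) = norm (sE n m (\<lambda>A. cis ((s / sg) * kAP k n A)))"
proof -
  have "fchar XP mX sg s = sE n m (\<lambda>A. cis (- (s * mX / sg)) * cis ((s / sg) * kAP k n A))"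
    unfolding fchar_expectation by (intro sE_cong) (simp add: cis_mult algebra_simps diff_divide_distrib)
  then show ?thesis by (simp add: sE_cmult norm_mult)
qed

lemma cP_nonneg: "0 \<le> cP"
  using consts_nonneg by (simp add: cP_def)

text \<open>The cutoff is \<open>T = n powr (20/1000)\<close> and the window is
  \<open>M = n powr (13/100)\<close>. The powers of \<open>T\<close> in the error near the origin
  add up to \<open>T ^ 4\<close>, that is \<open>n powr (8/100)\<close>; and \<open>T ^ 20\<close>
  is \<open>n powr (4/10)\<close>.\<close>

lemma llt_bound:
  assumes low: "cL * real n \<le> sg" and x1: "1 \<le> cL * real n"
    and minor: "\<And>t. real n powr (-985/1000) \<le> \<bar>t\<bar> \<Longrightarrow> \<bar>t\<bar> \<le> pi \<Longrightarrow>
      norm (sE n m (\<lambda>A. cis (t * kAP k n A))) \<le> (real n + 1) * real n powr (-3)"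
    and T1: "cS * real n powr (15/1000) \<le> real n powr (20/1000)" and T2: "real n powr (20/1000) \<le> cL * real n"
  shows "llt_error_le XP (3 * real n powr (13/100) * (4 * cP * real n powr (8/100 - 31/64) + pi * cS * 2 * real n powr (-1) + gmom * real n powr (-4/10))
    + 129 * real n powr (-26/100))"
proof -
  define x where "x = real n"
  have x: "1 \<le> x" using n_ge_1 by (simp add: x_def)
  have s1: "1 \<le> sg" and s0: "0 < sg" using low x1 by linarith+
  define T where "T = x powr (20/1000)"
  have T: "1 \<le> T" "0 < T" using x by (auto simp: T_def intro!: ge_one_powr_ge_zero)
  define d where "d = T * (cP * (1 + T)\<^sup>2 * x powr (- 31 / 64))"
  define d' where "d' = (x + 1) * x powr (-3)"
  have d0: "0 \<le> d" "0 \<le> d'" using T cP_nonneg x by (auto simp: d_def d'_def)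
  define h where "h = T * d + pi * sg * d' + gmom / T ^ 20"
  define h' where "h' = 4 * cP * x powr (8/100 - 31/64) + pi * cS * 2 * x powr (-1) + gmom * x powr (-4/10)"
  define M where "M = x powr (13/100)"
  have M: "1 \<le> M" using x by (auto simp: M_def intro!: ge_one_powr_ge_zero)
  have sup: "\<bar>sg * pmf XP (of_int j) - std_normal_density ((of_int j - mX) / sg)\<bar> \<le> h" for j
    unfolding h_def
  proof (rule local_limit_bound[OF kAP_pmf_support[OF m_le_n] s0 T(2) _ d0])
    have "1 * sg \<le> pi * sg" using s0 pi_gt3 by (intro mult_right_mono) auto
    then show "T \<le> pi * sg" using T2 low by (simp add: T_def x_def)
    fix s :: real
    show "norm (fchar XP mX sg s - of_real (exp (- s\<^sup>2 / 2))) \<le> d" if s: "\<bar>s\<bar> \<le> T"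
    proof -
      have "norm (fchar XP mX sg s - of_real (exp (- s\<^sup>2 / 2))) \<le> \<bar>s\<bar> * (cP * (1 + \<bar>s\<bar>)\<^sup>2 * x powr (- 31 / 64))"
        unfolding fchar_phi x_def by (rule phi_gaussian[OF low])
      also have "\<dots> \<le> d" unfolding d_def using s T cP_nonneg by (intro mult_mono power_mono) auto
      finally show ?thesis .
    qed
    show "norm (fchar XP mX sg s) \<le> d'" if s: "T \<le> \<bar>s\<bar>" "\<bar>s\<bar> \<le> pi * sg"
      unfolding norm_fchar d'_def x_def
    proof (rule minor)
      show "\<bar>s / sg\<bar> \<le> pi" using s s0 by (simp add: abs_divide pos_divide_le_eq)
      \<comment> \<open>A normalised frequency \<open>s\<close> is \<open>s / sg\<close> on the
        original scale. As \<open>sg\<close> is at most \<open>cS * n\<close>, frequencies from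
        \<open>T\<close> on fall into the range of \<open>minor\<close>; the gap between
        \<open>15/1000\<close> and \<open>20/1000\<close> absorbs \<open>cS\<close>.\<close>
      have "x powr (-985/1000) * sg \<le> x powr (-985/1000) * (cS * x)"
        using sg_upper by (intro mult_left_mono) (auto simp: x_def)
      also have "\<dots> = cS * (x powr (-985/1000) * x powr 1)" using x by simp
      also have "\<dots> = cS * x powr (15/1000)" by (simp only: powr_add[symmetric]) simp
      also have "\<dots> \<le> T" using T1 by (simp only: T_def x_def)
      also note s(1)
      finally show "real n powr (-985/1000) \<le> \<bar>s / sg\<bar>" using s0 by (simp add: abs_divide pos_le_divide_eq x_def)
    qed
  qed
  have hh: "h \<le> h'"
  proof -
    have "T * d \<le> 4 * cP * x powr (8/100 - 31/64)"
    proof -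
      have "(1 + T)\<^sup>2 \<le> (2 * T)\<^sup>2" using T by (intro power_mono) auto
      then have "T * (T * (cP * (1 + T)\<^sup>2 * x powr (- 31 / 64))) \<le> T * (T * (cP * (2 * T)\<^sup>2 * x powr (- 31 / 64)))"
        using T cP_nonneg by (intro mult_left_mono mult_right_mono) auto
      also have "\<dots> = 4 * cP * (T ^ 4 * x powr (- 31 / 64))" by (simp add: power2_eq_square power4_eq_xxxx)
      also have "T ^ 4 * x powr (- 31 / 64) = x powr (8/100 - 31/64)"
        using x by (simp add: T_def powr_power powr_add[symmetric])
      finally show ?thesis by (simp only: d_def)
    qed
    moreover have "pi * sg * d' \<le> pi * cS * 2 * x powr (-1)"
    proof -
      have "sg * d' \<le> (cS * x) * (2 * x * x powr (-3))"
        unfolding d'_def using sg_upper x s0 consts_nonneg by (intro mult_mono) (auto simp: x_def)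
      also have "\<dots> = cS * 2 * (x powr 1 * x powr 1 * x powr (-3))" using x by simp
      also have "\<dots> = cS * 2 * x powr (-1)" by (simp only: powr_add[symmetric]) simp
      finally have "pi * (sg * d') \<le> pi * (cS * 2 * x powr (-1))" by (intro mult_left_mono) auto
      then show ?thesis by (simp only: mult.assoc)
    qed
    moreover have "gmom / T ^ 20 = gmom * x powr (-4/10)"
      using x by (simp add: T_def powr_power powr_minus_divide)
    ultimately show ?thesis unfolding h_def h'_def by linarith
  qed
  have "llt_error_le XP (3 * M * h + 129 / M\<^sup>2)"
    by (rule llt_error_from_sup[OF kAP_pmf_support(1)[OF m_le_n] mX_def variance_kAP[symmetric] s1 M sup])
  moreover have "3 * M * h \<le> 3 * M * h'" using hh M by (intro mult_left_mono) auto
  moreover have "129 / M\<^sup>2 = 129 * x powr (-26/100)"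
    using x by (simp add: M_def powr_power powr_minus_divide)
  ultimately show ?thesis unfolding h'_def M_def x_def[symmetric] by (elim llt_error_le_mono) linarith
qed

end

text \<open>After multiplication by \<open>x powr (13/100)\<close> the three exponents are about
  \<open>-0.274\<close>, \<open>-0.87\<close> and \<open>-0.27\<close>. Together with
  \<open>-0.26\<close> all lie below \<open>-1/4\<close>, so the constants are eventually
  absorbed.\<close>

lemma llt_rate_eventually:
  fixes P S L D g K :: real
  assumes "0 < P" "0 < S" "0 < L" "0 < D" "0 < g" "0 < G"
  shows "\<forall>\<^sub>F x in at_top. K \<le> x \<and> D * x powr (193/128) \<le> g / 16 * x\<^sup>2 \<and> 1 \<le> L * x
    \<and> S * x powr (15/1000) \<le> x powr (20/1000) \<and> x powr (20/1000) \<le> L * x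
    \<and> 3 * x powr (13/100) * (4 * P * x powr (8/100 - 31/64) + pi * S * 2 * x powr (-1) + G * x powr (-4/10))
      + 129 * x powr (-26/100) \<le> x powr (-1/4)"
proof (intro eventually_conj)
  show "\<forall>\<^sub>F x in at_top. K \<le> x" by (rule eventually_ge_at_top)
  show "\<forall>\<^sub>F x in at_top. D * x powr (193/128) \<le> g / 16 * x\<^sup>2" using assms by real_asymp
  show "\<forall>\<^sub>F x in at_top. 1 \<le> L * x" using assms by real_asymp
  show "\<forall>\<^sub>F x in at_top. S * x powr (15/1000) \<le> x powr (20/1000)" using assms by real_asymp
  show "\<forall>\<^sub>F x in at_top. x powr (20/1000) \<le> L * x" using assms by real_asymp
  show "\<forall>\<^sub>F x in at_top. 3 * x powr (13/100) * (4 * P * x powr (8/100 - 31/64) + pi * S * 2 * x powr (-1) + G * x powr (-4/10))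
      + 129 * x powr (-26/100) \<le> x powr (-1/4)" using assms by real_asymp
qed

lemma kAP_llt_large:
  fixes k :: nat and lam :: real
  assumes k3: "3 \<le> k" and lam: "0 < lam"
  shows "\<exists>n0::nat. \<forall>n m. n0 \<le> n \<longrightarrow> cyclic_slice n k m lam \<longrightarrow>
    llt_error_le (map_pmf (kAP k n) (uniform_subset n m)) (real n powr (-1/4))"
proof (cases "\<exists>n m. cyclic_slice n k m lam")
  case False
  then show ?thesis by blast
next
  case True
  then obtain n' m' where I: "cyclic_slice n' k m' lam" by blast
  \<comment> \<open>The constants are defined where \<open>n\<close> and \<open>m\<close> are fixed,
    but depend only on \<open>k\<close> and \<open>lam\<close>. Any single instance supplies them,
    and without an instance the claim is vacuous.\<close>
  interpret I: cyclic_slice n' k m' lam by (rule I)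
  let ?K = "4 * real k + 4 * real (I.KK\<^sup>2 * k\<^sup>2) / I.g_low"
  \<comment> \<open>One is added wherever only nonnegativity is known, because the asymptotic
    estimate asks for positive constants.\<close>
  have pos: "0 < I.cP + 1" "0 < I.cS + 1" "0 < I.cL" "0 < I.cD + 1" "0 < I.g_low" "0 < gmom + 1"
    using I.cP_nonneg I.consts_nonneg I.g_low_pos gmom_nonneg by auto
  from llt_rate_eventually[OF pos, of ?K] obtain x0 where x0: "\<And>x. x0 \<le> x \<Longrightarrow> ?K \<le> x \<and> (I.cD + 1) * x powr (193/128) \<le> I.g_low / 16 * x\<^sup>2 \<and> 1 \<le> I.cL * x
    \<and> (I.cS + 1) * x powr (15/1000) \<le> x powr (20/1000) \<and> x powr (20/1000) \<le> I.cL * x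
    \<and> 3 * x powr (13/100) * (4 * (I.cP + 1) * x powr (8/100 - 31/64) + pi * (I.cS + 1) * 2 * x powr (-1) + (gmom + 1) * x powr (-4/10))
      + 129 * x powr (-26/100) \<le> x powr (-1/4)"
    unfolding eventually_at_top_linorder by blast
  from minor_arcs[OF k3 lam] obtain n1 where n1: "\<And>n m t. n1 \<le> real n \<Longrightarrow> gcd n (fact (k - 1)) = 1 \<Longrightarrow> 0 < m \<Longrightarrow> m < n \<Longrightarrow>
    lam \<le> real m / real n \<Longrightarrow> real m / real n \<le> 1 - lam \<Longrightarrow>
    real n powr (-985/1000) \<le> \<bar>t\<bar> \<Longrightarrow> \<bar>t\<bar> \<le> pi \<Longrightarrow>
    norm (sE n m (\<lambda>A. cis (t * kAP k n A))) \<le> (real n + 1) * real n powr (-3)" by blast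
  show ?thesis
  proof (intro exI[of _ "nat \<lceil>max x0 n1\<rceil>"] allI impI)
    fix n m assume n: "nat \<lceil>max x0 n1\<rceil> \<le> n" and c: "cyclic_slice n k m lam"
    interpret cyclic_slice n k m lam by (rule c)
    have nx: "x0 \<le> real n" "n1 \<le> real n" using n by linarith+
    note X = x0[OF nx(1)]
    let ?x = "real n"
    have p: "0 \<le> ?x powr y" for y by simp
    have "cD * ?x powr (193/128) \<le> (cD + 1) * ?x powr (193/128)" using p by (intro mult_right_mono) auto
    then have low: "cL * ?x \<le> sg" using X by (intro sg_lower) (auto simp: mult.commute)
    have "cS * ?x powr (15/1000) \<le> (cS + 1) * ?x powr (15/1000)" using p by (intro mult_right_mono) auto
    then have T1: "cS * ?x powr (15/1000) \<le> ?x powr (20/1000)" using X by linarith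
    have T2: "?x powr (20/1000) \<le> cL * ?x" "1 \<le> cL * ?x" using X by auto
    have minor: "norm (sE n m (\<lambda>A. cis (t * kAP k n A))) \<le> (?x + 1) * ?x powr (-3)"
      if "?x powr (-985/1000) \<le> \<bar>t\<bar>" "\<bar>t\<bar> \<le> pi" for t
      using n1[OF nx(2) gcd_fact mlam(1,2,4,5) that] .
    have "3 * ?x powr (13/100) * (4 * cP * ?x powr (8/100 - 31/64) + pi * cS * 2 * ?x powr (-1) + gmom * ?x powr (-4/10))
      \<le> 3 * ?x powr (13/100) * (4 * (cP + 1) * ?x powr (8/100 - 31/64) + pi * (cS + 1) * 2 * ?x powr (-1) + (gmom + 1) * ?x powr (-4/10))"
      using p cP_nonneg consts_nonneg by (intro mult_left_mono add_mono mult_right_mono) auto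
    then show "llt_error_le (map_pmf (kAP k n) (uniform_subset n m)) (?x powr (-1/4))"
      using X by (intro llt_error_le_mono[OF llt_bound[OF low T2(2) minor T1 T2(1)]]) auto
  qed
qed

lemma kAP_llt:
  fixes k :: nat and lam :: real
  assumes k3: "3 \<le> k" and lam: "0 < lam"
  shows "\<exists>C. \<forall>n m. cyclic_slice n k m lam \<longrightarrow>
    llt_error_le (map_pmf (kAP k n) (uniform_subset n m)) (C * real n powr (-1/4))"
proof -
  from kAP_llt_large[OF assms] obtain n0 where n0: "\<And>n m. n0 \<le> n \<Longrightarrow> cyclic_slice n k m lam \<Longrightarrow>
    llt_error_le (map_pmf (kAP k n) (uniform_subset n m)) (real n powr (-1/4))" by blast
  define b where "b n m = (SOME B. llt_error_le (map_pmf (kAP k n) (uniform_subset n m)) B)" for n m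
  have b: "llt_error_le (map_pmf (kAP k n) (uniform_subset n m)) (b n m)" for n m
    unfolding b_def by (rule someI_ex[OF llt_error_finite])
  \<comment> \<open>The finitely many pairs with \<open>n < n0\<close> each have some bound;
    multiplied by \<open>n powr (1/4)\<close> and added, these bounds become part of the
    constant.\<close>
  define C where "C = 1 + (\<Sum>n<n0. \<Sum>m<n. \<bar>b n m\<bar> * real n powr (1/4))"
  have nonneg: "0 \<le> (\<Sum>m<n. \<bar>b n m\<bar> * real n powr (1/4))" for n by (intro sum_nonneg) auto
  have C1: "1 \<le> C" unfolding C_def using nonneg by (simp add: sum_nonneg)
  show ?thesis
  proof (intro exI[of _ C] allI impI)
    fix n m assume c: "cyclic_slice n k m lam"
    interpret cyclic_slice n k m lam by (rule c)
    show "llt_error_le (map_pmf (kAP k n) (uniform_subset n m)) (C * real n powr (-1/4))"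
    proof (cases "n0 \<le> n")
      case True
      have "1 * real n powr (-1/4) \<le> C * real n powr (-1/4)" using C1 by (intro mult_right_mono) auto
      then show ?thesis using llt_error_le_mono[OF n0[OF True c]] by simp
    next
      case False
      have "\<bar>b n m\<bar> * real n powr (1/4) \<le> (\<Sum>m<n. \<bar>b n m\<bar> * real n powr (1/4))"
        using m_less by (intro member_le_sum) auto
      also have "\<dots> \<le> (\<Sum>n<n0. \<Sum>m<n. \<bar>b n m\<bar> * real n powr (1/4))"
        using False nonneg by (intro member_le_sum) auto
      finally have "\<bar>b n m\<bar> * real n powr (1/4) \<le> C" by (simp add: C_def)
      then have "\<bar>b n m\<bar> * real n powr (1/4) * real n powr (-1/4) \<le> C * real n powr (-1/4)"
        by (intro mult_right_mono) auto
      moreover have "real n powr (1/4) * real n powr (-1/4) = 1"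
        using n_pos by (simp only: powr_add[symmetric]) simp
      ultimately have "\<bar>b n m\<bar> \<le> C * real n powr (-1/4)" by (simp only: mult.assoc mult_1_right)
      then show ?thesis by (intro llt_error_le_mono[OF b]) linarith
    qed
  qed
qed

theorem theorem1p6:
  fixes k :: nat and lam eps :: real
  assumes "k \<ge> 3" "0 < lam" "lam < 1/2" "eps > 0"
  shows "\<exists>C. \<forall>n m :: nat. n \<ge> 1 \<longrightarrow> gcd n (fact (k - 1)) = 1 \<longrightarrow>
            lam < real m / real n \<longrightarrow> real m / real n < 1 - lam \<longrightarrow>
     (let X = map_pmf (kAP k n) (uniform_subset n m);
          \<mu> = measure_pmf.expectation X (\<lambda>x. x);
          \<sigma> = sqrt (measure_pmf.variance X (\<lambda>x. x))
      in (\<forall>j::int. \<bar>\<sigma> * pmf X (of_int j) - std_normal_density ((of_int j - \<mu>) / \<sigma>)\<bar>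
                     \<le> C * real n powr (eps - 1/4))
       \<and> (\<lambda>j::int. \<bar>pmf X (of_int j) - std_normal_density ((of_int j - \<mu>) / \<sigma>) / \<sigma>\<bar>) summable_on UNIV
       \<and> (\<Sum>\<^sub>\<infinity>j::int. \<bar>pmf X (of_int j) - std_normal_density ((of_int j - \<mu>) / \<sigma>) / \<sigma>\<bar>)
                     \<le> C * real n powr (eps - 1/4))"
proof -
  from kAP_llt[OF assms(1,2)] obtain C where C: "\<And>n m. cyclic_slice n k m lam \<Longrightarrow>
    llt_error_le (map_pmf (kAP k n) (uniform_subset n m)) (C * real n powr (-1/4))" by blast
  have "llt_error_le (map_pmf (kAP k n) (uniform_subset n m)) (\<bar>C\<bar> * real n powr (eps - 1/4))"
    if n: "n \<ge> 1" and g: "gcd n (fact (k - 1)) = 1" and l: "lam < real m / real n" "real m / real n < 1 - lam" for n m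
  proof -
    have "0 < real m / real n" "real m / real n < 1" using l assms by linarith+
    then have "0 < m" "m < n" using n by (auto simp: divide_less_eq_1 intro: gr0I)
    then have "cyclic_slice n k m lam" using assms n g l by unfold_locales auto
    then have "llt_error_le (map_pmf (kAP k n) (uniform_subset n m)) (C * real n powr (-1/4))" by (rule C)
    \<comment> \<open>The absolute value provides a nonnegative constant, so that enlarging the
      power of \<open>n \<ge> 1\<close> can only weaken the bound.\<close>
    moreover have "C * real n powr (-1/4) \<le> \<bar>C\<bar> * real n powr (eps - 1/4)"
      using n assms by (intro mult_mono powr_mono) auto
    ultimately show ?thesis by (rule llt_error_le_mono)
  qed
  then show ?thesis unfolding llt_error_le_def Let_def by blast
qed

end
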